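(* Compact quantum groups having identical fusion rules have isomorphic centers: if $G_1$ and $G_2$ are compact quantum groups with identical fusion rules, then the discrete groups $Z(G_1)=\widehat{G_1}/\widetilde\Sigma_{G_1}$ and $Z(G_2)=\widehat{G_2}/\widetilde\Sigma_{G_2}$ are isomorphic.
   Context: A compact quantum group $G=(A,\Phi)$ is a unital $C^*$-algebra $A$ with a coassociative unital $*$-homomorphism $\Phi:A\to A\otimes A$ (minimal tensor product) such that $(A\otimes 1)\Phi(A)$ and $(1\otimes A)\Phi(A)$ have dense linear span in $A\otimes A$. A finite-dimensional representation is a unitary $u=((u_{ij}))\in M_n(A)$ with $\Phi(u_{ij})=\sum_k u_{ik}\otimes u_{kj}$. $\widehat G$ is the set of equivalence classes of irreducible representations of $G$; for $a,b\in\widehat G$, $\bar b$ is the conjugate class and $a\times b\subseteq\widehat G$ is the set of classes of irreducible subrepresentations of $u^a\otimes u^b$ ($u^a\in a$, $u^b\in b$); for subsets $X,Y$, $X\times Y=\bigcup_{a\in X,b\in Y}a\times b$. $G_1,G_2$ have identical fusion rules if there is a bijection $p:\widehat{G_1}\to\widehat{G_2}$ preserving the decomposition of tensor products of irreducibles into irreducibles; in particular $p(v\times s)=p(v)\times p(s)$ for all $v,s\in\widehat{G_1}$. A subobject $\Sigma\subseteq\widehat G$ is a subset containing the trivial class and closed under $\times$ and conjugation. Given $\Sigma$, write $a\sim b$ iff $(a\times\bar b)\cap\Sigma\neq\varnothing$; this is an equivalence relation whose classes are called $\Sigma$-cosets. $\Sigma$ is a central subobject if the $\Sigma$-cosets form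 a group under the setwise product (with identity $\Sigma$); this group is denoted $\widehat G/\Sigma$. The center subobject $\widetilde\Sigma_G$ is the intersection of all central subobjects of $\widehat G$ (it is itself a central subobject), and the center of $G$ is identified with the discrete group $Z(G)=\widehat G/\widetilde\Sigma_G$. *)

theory Defs
  imports
    "HOL-Analysis.Elementary_Topology"
    "HOL-Algebra.Group"
    "Jordan_Normal_Form.Schur_Decomposition"
begin

section \<open>Unital C*-algebras and the minimal tensor product\<close>

text \<open>The class \<open>real_normed_algebra_1\<close> forces \<open>norm 1 = 1\<close>, so the zero algebra is excluded.\<close>

class cstar_algebra = real_normed_algebra_1 + banach +
  fixes scaleC :: "complex \<Rightarrow> 'a \<Rightarrow> 'a"
    and star :: "'a \<Rightarrow> 'a"
  assumes scaleC_add_right: "scaleC c (x + y) = scaleC c x + scaleC c y"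
    and scaleC_add_left: "scaleC (c + d) x = scaleC c x + scaleC d x"
    and scaleC_scaleC: "scaleC c (scaleC d x) = scaleC (c * d) x"
    and scaleC_of_real: "scaleC (of_real r) x = scaleR r x"
    and scaleC_mult_left: "scaleC c x * y = scaleC c (x * y)"
    and scaleC_mult_right: "x * scaleC c y = scaleC c (x * y)"
    and norm_scaleC: "norm (scaleC c x) = cmod c * norm x"
    and star_star: "star (star x) = x"
    and star_add: "star (x + y) = star x + star y"
    and star_scaleC: "star (scaleC c x) = scaleC (cnj c) (star x)"
    and star_mult: "star (x * y) = star y * star x"
    and cstar_identity: "norm (star x * x) = (norm x)\<^sup>2"

definition unital_star_hom :: "('a::cstar_algebra \<Rightarrow> 'b::cstar_algebra) \<Rightarrow> bool" where
  "unital_star_hom f \<longleftrightarrow>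
     (\<forall>x y. f (x + y) = f x + f y) \<and> (\<forall>c x. f (scaleC c x) = scaleC c (f x)) \<and>
     (\<forall>x y. f (x * y) = f x * f y) \<and> (\<forall>x. f (star x) = star (f x)) \<and> f 1 = 1"

definition state :: "('a::cstar_algebra \<Rightarrow> complex) \<Rightarrow> bool" where
  "state \<phi> \<longleftrightarrow>
     (\<forall>x y. \<phi> (x + y) = \<phi> x + \<phi> y) \<and> (\<forall>c x. \<phi> (scaleC c x) = c * \<phi> x) \<and>
     (\<forall>x. \<phi> (star x * x) \<in> \<real> \<and> 0 \<le> Re (\<phi> (star x * x))) \<and> \<phi> 1 = 1"

text \<open>
  A list \<open>[(a\<^sub>1, b\<^sub>1), \<dots>, (a\<^sub>n, b\<^sub>n)]\<close> stands for the element
  \<open>a\<^sub>1 \<otimes> b\<^sub>1 + \<dots> + a\<^sub>n \<otimes> b\<^sub>n\<close> of the algebraic tensor product. Different lists may represent the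
  same element; the quantities below only depend on the element represented.
\<close>

definition alg_mult :: "('a::times \<times> 'b::times) list \<Rightarrow> ('a \<times> 'b) list \<Rightarrow> ('a \<times> 'b) list" where
  "alg_mult x y = map (\<lambda>((a, b), (c, d)). (a * c, b * d)) (List.product x y)"

definition alg_star :: "('a::cstar_algebra \<times> 'b::cstar_algebra) list \<Rightarrow> ('a \<times> 'b) list" where
  "alg_star x = map (\<lambda>(a, b). (star a, star b)) x"

definition product_state :: "('a \<Rightarrow> complex) \<Rightarrow> ('b \<Rightarrow> complex) \<Rightarrow> ('a \<times> 'b) list \<Rightarrow> complex" where
  "product_state \<phi> \<psi> x = (\<Sum>(a, b)\<leftarrow>x. \<phi> a * \<psi> b)"

text \<open>
  The spatial (minimal) C*-norm of \<open>x\<close> in the algebraic tensor product: the supremum, over all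
  states \<open>\<phi>\<close>, \<open>\<psi>\<close>, of the operator norm of \<open>(\<pi>\<^sub>\<phi> \<otimes> \<pi>\<^sub>\<psi>) x\<close>, where \<open>\<pi>\<^sub>\<phi>\<close>, \<open>\<pi>\<^sub>\<psi>\<close> are the GNS
  representations. The vectors \<open>y \<cdot> (\<xi>\<^sub>\<phi> \<otimes> \<xi>\<^sub>\<psi>)\<close> with \<open>y\<close> in the algebraic tensor product are dense
  in the tensor product of the two GNS spaces, and such a vector has squared norm
  \<open>(\<phi> \<otimes> \<psi>) (y* y)\<close>.
\<close>

definition min_norm :: "('a::cstar_algebra \<times> 'b::cstar_algebra) list \<Rightarrow> real" where
  "min_norm x = Sup {sqrt (Re (product_state \<phi> \<psi> (alg_mult (alg_star (alg_mult x y)) (alg_mult x y)))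
                          / Re (product_state \<phi> \<psi> (alg_mult (alg_star y) y))) | \<phi> \<psi> y.
     state \<phi> \<and> state \<psi> \<and> product_state \<phi> \<psi> (alg_mult (alg_star y) y) \<noteq> 0}"

text \<open>
  \<open>is_min_tensor t\<close>: the C*-algebra \<open>'c\<close>, with the elementary tensors \<open>t a b\<close>, is the minimal
  tensor product of \<open>'a\<close> and \<open>'b\<close>, i.e. the completion of the algebraic tensor product in the
  minimal norm (unique up to isomorphism). The real span used here is also the complex span,
  because the set of elementary tensors is closed under complex multiples.
\<close>

definition is_min_tensor :: "('a::cstar_algebra \<Rightarrow> 'b::cstar_algebra \<Rightarrow> 'c::cstar_algebra) \<Rightarrow> bool" where
  "is_min_tensor t \<longleftrightarrow>
     (\<forall>a a' b. t (a + a') b = t a b + t a' b) \<and> (\<forall>a b b'. t a (b + b') = t a b + t a b') \<and>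
     (\<forall>c a b. t (scaleC c a) b = scaleC c (t a b)) \<and> (\<forall>c a b. t a (scaleC c b) = scaleC c (t a b)) \<and>
     (\<forall>a b a' b'. t a b * t a' b' = t (a * a') (b * b')) \<and>
     (\<forall>a b. star (t a b) = t (star a) (star b)) \<and>
     (\<forall>x. norm (\<Sum>(a, b)\<leftarrow>x. t a b) = min_norm x) \<and>
     closure (span {t a b | a b. True}) = UNIV"

section \<open>Compact quantum groups\<close>

text \<open>
  \<open>'a\<close> is the algebra \<open>A\<close>, \<open>'b\<close> is \<open>A \<otimes> A\<close> and \<open>'c\<close> is the triple tensor product, seen both as
  \<open>(A \<otimes> A) \<otimes> A\<close> (through \<open>tensor_l\<close>) and as \<open>A \<otimes> (A \<otimes> A)\<close> (through \<open>tensor_r\<close>).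
\<close>

record ('a, 'b, 'c) quantum_group =
  tensor :: "'a \<Rightarrow> 'a \<Rightarrow> 'b"
  tensor_l :: "'b \<Rightarrow> 'a \<Rightarrow> 'c"
  tensor_r :: "'a \<Rightarrow> 'b \<Rightarrow> 'c"
  comult :: "'a \<Rightarrow> 'b"

text \<open>
  In the definition of coassociativity, \<open>F\<close> and \<open>H\<close> are \<open>\<Phi> \<otimes> id\<close> and \<open>id \<otimes> \<Phi>\<close>: a *-homomorphism of
  C*-algebras is continuous, hence determined by its values on elementary tensors.
\<close>

definition coassociative ::
    "('a::cstar_algebra, 'b::cstar_algebra, 'c::cstar_algebra) quantum_group \<Rightarrow> bool" where
  "coassociative G \<longleftrightarrow>
     (\<exists>F H. unital_star_hom F \<and> (\<forall>a b. F (tensor G a b) = tensor_l G (comult G a) b) \<and>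
            unital_star_hom H \<and> (\<forall>a b. H (tensor G a b) = tensor_r G a (comult G b)) \<and>
            (\<forall>a. F (comult G a) = H (comult G a)))"

text \<open>As above, the real spans in the density conditions are complex subspaces.\<close>

definition compact_quantum_group ::
    "('a::cstar_algebra, 'b::cstar_algebra, 'c::cstar_algebra) quantum_group \<Rightarrow> bool" where
  "compact_quantum_group G \<longleftrightarrow>
     is_min_tensor (tensor G) \<and> is_min_tensor (tensor_l G) \<and> is_min_tensor (tensor_r G) \<and>
     (\<forall>a b c. tensor_l G (tensor G a b) c = tensor_r G a (tensor G b c)) \<and>
     unital_star_hom (comult G) \<and> coassociative G \<and>
     closure (span {tensor G a 1 * comult G b | a b. True}) = UNIV \<and>
     closure (span {tensor G 1 a * comult G b | a b. True}) = UNIV"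

section \<open>Finite-dimensional representations\<close>

definition star_transpose :: "'a::cstar_algebra mat \<Rightarrow> 'a mat" where
  "star_transpose u = transpose_mat (map_mat star u)"

definition is_rep :: "('a::cstar_algebra, 'b::cstar_algebra, 'c::cstar_algebra) quantum_group \<Rightarrow> 'a mat \<Rightarrow> bool" where
  "is_rep G u \<longleftrightarrow>
     (\<exists>n>0. u \<in> carrier_mat n n \<and> star_transpose u * u = 1\<^sub>m n \<and> u * star_transpose u = 1\<^sub>m n \<and>
        (\<forall>i<n. \<forall>j<n. comult G (u $$ (i, j)) = (\<Sum>k<n. tensor G (u $$ (i, k)) (u $$ (k, j)))))"

definition scalar_mat :: "complex mat \<Rightarrow> 'a::cstar_algebra mat" where
  "scalar_mat T = map_mat (\<lambda>c. scaleC c 1) T"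

definition Mor :: "'a::cstar_algebra mat \<Rightarrow> 'a mat \<Rightarrow> complex mat set" where
  "Mor u v = {T \<in> carrier_mat (dim_row v) (dim_row u). scalar_mat T * u = v * scalar_mat T}"

definition rep_equiv :: "'a::cstar_algebra mat \<Rightarrow> 'a mat \<Rightarrow> bool" where
  "rep_equiv u v \<longleftrightarrow> (\<exists>T \<in> Mor u v. invertible_mat T)"

text \<open>\<open>v\<close> is, up to unitary equivalence, the restriction of \<open>u\<close> to the range of an isometry \<open>T\<close>.\<close>

definition subrep :: "'a::cstar_algebra mat \<Rightarrow> 'a mat \<Rightarrow> bool" where
  "subrep v u \<longleftrightarrow> (\<exists>T \<in> Mor v u. mat_adjoint T * T = 1\<^sub>m (dim_row v))"

text \<open>Representations have positive dimension, so only subrepresentations of full dimension are left.\<close>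

definition irreducible_rep :: "('a::cstar_algebra, 'b::cstar_algebra, 'c::cstar_algebra) quantum_group \<Rightarrow> 'a mat \<Rightarrow> bool" where
  "irreducible_rep G u \<longleftrightarrow>
     is_rep G u \<and> (\<forall>v. is_rep G v \<and> subrep v u \<longrightarrow> dim_row v = dim_row u)"

definition conj_rep :: "'a::cstar_algebra mat \<Rightarrow> 'a mat" where
  "conj_rep u = map_mat star u"

text \<open>The tensor product \<open>(u\<^sub>i\<^sub>j v\<^sub>k\<^sub>l)\<close>, with the pair \<open>(i, k)\<close> encoded as \<open>i * dim v + k\<close>.\<close>

definition tensor_rep :: "'a::cstar_algebra mat \<Rightarrow> 'a mat \<Rightarrow> 'a mat" where
  "tensor_rep u v = (let m = dim_row v in
     mat (dim_row u * m) (dim_row u * m)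
       (\<lambda>(r, s). u $$ (r div m, s div m) * v $$ (r mod m, s mod m)))"

section \<open>The dual and its fusion rules\<close>

definition dual :: "('a::cstar_algebra, 'b::cstar_algebra, 'c::cstar_algebra) quantum_group \<Rightarrow> 'a mat set set" where
  "dual G = {u. irreducible_rep G u} //
     {(u, v). irreducible_rep G u \<and> irreducible_rep G v \<and> rep_equiv u v}"

definition trivial_class :: "('a::cstar_algebra, 'b::cstar_algebra, 'c::cstar_algebra) quantum_group \<Rightarrow> 'a mat set" where
  "trivial_class G = {v. irreducible_rep G v \<and> rep_equiv (1\<^sub>m 1) v}"

text \<open>
  The matrix \<open>conj_rep u\<close> need not be unitary; the conjugate class consists of the (unitary)
  irreducible representations that are equivalent to it.
\<close>

definition conj_class ::
    "('a::cstar_algebra, 'b::cstar_algebra, 'c::cstar_algebra) quantum_group \<Rightarrow> 'a mat set \<Rightarrow> 'a mat set" where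
  "conj_class G b = {v. irreducible_rep G v \<and> (\<exists>u\<in>b. rep_equiv (conj_rep u) v)}"

definition fusion :: "('a::cstar_algebra, 'b::cstar_algebra, 'c::cstar_algebra) quantum_group \<Rightarrow>
    'a mat set \<Rightarrow> 'a mat set \<Rightarrow> 'a mat set set" where
  "fusion G a b = {c \<in> dual G. \<exists>u\<in>a. \<exists>v\<in>b. \<exists>w\<in>c. subrep w (tensor_rep u v)}"

definition fusion_set :: "('a::cstar_algebra, 'b::cstar_algebra, 'c::cstar_algebra) quantum_group \<Rightarrow>
    'a mat set set \<Rightarrow> 'a mat set set \<Rightarrow> 'a mat set set" where
  "fusion_set G X Y = (\<Union>a\<in>X. \<Union>b\<in>Y. fusion G a b)"

text \<open>
  The tensor product of \<open>a\<close> and \<open>b\<close> is equivalent to the direct sum of irreducible representations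
  \<open>ws\<close> whose classes, listed with multiplicity, are \<open>cs\<close>.
\<close>

definition tensor_decomposition ::
    "('a::cstar_algebra, 'b::cstar_algebra, 'c::cstar_algebra) quantum_group \<Rightarrow>
     'a mat set \<Rightarrow> 'a mat set \<Rightarrow> 'a mat set list \<Rightarrow> bool" where
  "tensor_decomposition G a b cs \<longleftrightarrow>
     set cs \<subseteq> dual G \<and>
     (\<exists>u\<in>a. \<exists>v\<in>b. \<exists>ws. list_all2 (\<in>) ws cs \<and> rep_equiv (tensor_rep u v) (diag_block_mat ws))"

definition identical_fusion_rules ::
    "('a1::cstar_algebra, 'b1::cstar_algebra, 'c1::cstar_algebra) quantum_group \<Rightarrow>
     ('a2::cstar_algebra, 'b2::cstar_algebra, 'c2::cstar_algebra) quantum_group \<Rightarrow> bool" where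
  "identical_fusion_rules G1 G2 \<longleftrightarrow>
     (\<exists>p. bij_betw p (dual G1) (dual G2) \<and>
        (\<forall>a \<in> dual G1. \<forall>b \<in> dual G1. \<forall>cs \<in> lists (dual G1).
           tensor_decomposition G1 a b cs \<longleftrightarrow> tensor_decomposition G2 (p a) (p b) (map p cs)))"

section \<open>Central subobjects and the center\<close>

definition subobject :: "('a::cstar_algebra, 'b::cstar_algebra, 'c::cstar_algebra) quantum_group \<Rightarrow>
    'a mat set set \<Rightarrow> bool" where
  "subobject G S \<longleftrightarrow>
     S \<subseteq> dual G \<and> trivial_class G \<in> S \<and>
     (\<forall>a\<in>S. \<forall>b\<in>S. fusion G a b \<subseteq> S) \<and> (\<forall>a\<in>S. conj_class G a \<in> S)"

definition coset_rel :: "('a::cstar_algebra, 'b::cstar_algebra, 'c::cstar_algebra) quantum_group \<Rightarrow>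
    'a mat set set \<Rightarrow> ('a mat set \<times> 'a mat set) set" where
  "coset_rel G S = {(a, b). a \<in> dual G \<and> b \<in> dual G \<and> fusion G a (conj_class G b) \<inter> S \<noteq> {}}"

definition coset_group :: "('a::cstar_algebra, 'b::cstar_algebra, 'c::cstar_algebra) quantum_group \<Rightarrow>
    'a mat set set \<Rightarrow> 'a mat set set monoid" where
  "coset_group G S =
     \<lparr>carrier = dual G // coset_rel G S, monoid.mult = fusion_set G, one = S\<rparr>"

definition central_subobject :: "('a::cstar_algebra, 'b::cstar_algebra, 'c::cstar_algebra) quantum_group \<Rightarrow>
    'a mat set set \<Rightarrow> bool" where
  "central_subobject G S \<longleftrightarrow> subobject G S \<and> group (coset_group G S)"

definition center_subobject :: "('a::cstar_algebra, 'b::cstar_algebra, 'c::cstar_algebra) quantum_group \<Rightarrow>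
    'a mat set set" where
  "center_subobject G = \<Inter>{S. central_subobject G S}"

definition center :: "('a::cstar_algebra, 'b::cstar_algebra, 'c::cstar_algebra) quantum_group \<Rightarrow>
    'a mat set set monoid" where
  "center G = coset_group G (center_subobject G)"

end

theory Submission
  imports Defs
    "HOL-Computational_Algebra.Formal_Power_Series"
    "HOL-Analysis.Elementary_Metric_Spaces"
    "HOL-Analysis.Function_Topology"
    "Jordan_Normal_Form.Spectral_Radius"
begin

text \<open>
  The center of \<open>G\<close> is built from the set of irreducible classes, the fusion product of classes,
  the trivial class and conjugation, so it is enough that a bijection \<open>p\<close> preserving tensor
  decompositions respects these. By complete reducibility and Schur's lemma, \<open>c\<close> lies in the
  fusion product of \<open>a\<close> and \<open>b\<close> iff it occurs in some decomposition of \<open>a \<otimes> b\<close>; the trivial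
  class is the only unit of the fusion product; and \<open>b\<close> is the conjugate of \<open>a\<close> iff the trivial
  class lies in the fusion product of \<open>a\<close> and \<open>b\<close>. The last point needs that the conjugate of an
  irreducible unitary representation \<open>u\<close> is equivalent to a unitary one. Averaging with
  the Haar state of the quantum group, resp. of its flip, gives positive definite matrices \<open>F\<close> and
  \<open>E\<close> with \<open>b* F b = F\<close> and \<open>b E b* = E\<close> for \<open>b = conj_rep u\<close>, which suffices.
\<close>

text \<open>Two obstacles shape the proof. The Haar state need not be faithful on \<open>A\<close>,
  so the definiteness of an averaged form is a genuine claim; it is obtained by moving matrix
  entries across \<open>h\<close> with the help of both density conditions. And \<open>A\<close> is
  noncommutative, so a square matrix over \<open>A\<close> with a left inverse need not be
  invertible: the form \<open>F\<close> only turns \<open>conj_rep u\<close> into an isometry, and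
  it is \<open>E\<close>, the form of the adjoint of \<open>u\<close> over the flipped group, that
  supplies a right inverse. The analytic half serves the slice maps id \<otimes> \<psi>, through
  which invariance of a state is expressed. They must be bounded for the minimal norm. Since that
  norm is a supremum over states, this rests on norming states, and these come from Hahn-Banach
  together with positivity of \<open>star x * x\<close>. Positivity is measured by a norm bound and
  exploited through square roots given by a power series.\<close>

section \<open>Scalars, involution and norm in a C*-algebra\<close>

lemma scaleC_zero_left [simp]: "scaleC 0 (x::'a::cstar_algebra) = 0"
  using scaleC_add_left[of 0 0 x] by simp

lemma scaleC_zero_right [simp]: "scaleC c (0::'a::cstar_algebra) = 0"
  using scaleC_add_right[of c 0 "0::'a"] by simp

lemma scaleC_one [simp]: "scaleC 1 (x::'a::cstar_algebra) = x"
  using scaleC_of_real[of 1 x] by simp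

lemma scaleC_minus_left [simp]: "scaleC (- c) (x::'a::cstar_algebra) = - scaleC c x"
  using scaleC_add_left[of c "-c" x] by (simp add: eq_neg_iff_add_eq_0 add.commute)

lemma scaleC_minus_right [simp]: "scaleC c (- x::'a::cstar_algebra) = - scaleC c x"
  using scaleC_add_right[of c x "-x"] by (simp add: eq_neg_iff_add_eq_0 add.commute)

lemma scaleC_diff_right: "scaleC c (x - y::'a::cstar_algebra) = scaleC c x - scaleC c y"
  using scaleC_add_right[of c x "-y"] by simp

lemma scaleC_diff_left: "scaleC (c - d) (x::'a::cstar_algebra) = scaleC c x - scaleC d x"
  using scaleC_add_left[of c "-d" x] by simp

lemma scaleC_sum_right: "scaleC c (\<Sum>i\<in>I. f i::'a::cstar_algebra) = (\<Sum>i\<in>I. scaleC c (f i))"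
  by (induct I rule: infinite_finite_induct) (auto simp: scaleC_add_right)

lemma scaleC_sum_left: "scaleC (\<Sum>i\<in>I. f i) (x::'a::cstar_algebra) = (\<Sum>i\<in>I. scaleC (f i) x)"
  by (induct I rule: infinite_finite_induct) (auto simp: scaleC_add_left)

lemma scaleR_scaleC: "scaleR r (x::'a::cstar_algebra) = scaleC (of_real r) x"
  by (simp add: scaleC_of_real)

lemma bounded_linear_scaleC: "bounded_linear (scaleC c :: 'a::cstar_algebra \<Rightarrow> 'a)"
  by (rule bounded_linear_intro[of _ "cmod c"])
    (auto simp: scaleC_add_right scaleR_scaleC scaleC_scaleC mult.commute norm_scaleC)

lemma star_zero [simp]: "star (0::'a::cstar_algebra) = 0"
  using star_add[of 0 "0::'a"] by simp

lemma star_one [simp]: "star (1::'a::cstar_algebra) = 1"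
  by (metis mult.left_neutral star_mult star_star)

lemma star_minus [simp]: "star (- x::'a::cstar_algebra) = - star x"
  using star_add[of x "-x"] by (simp add: eq_neg_iff_add_eq_0 add.commute)

lemma star_diff: "star (x - y::'a::cstar_algebra) = star x - star y"
  using star_add[of x "-y"] by simp

lemma star_scaleR [simp]: "star (scaleR r (x::'a::cstar_algebra)) = scaleR r (star x)"
  by (simp add: scaleR_scaleC star_scaleC)

lemma star_of_real [simp]: "star (of_real r :: 'a::cstar_algebra) = of_real r"
  by (simp add: of_real_def)

lemma star_sum: "star (\<Sum>i\<in>I. f i::'a::cstar_algebra) = (\<Sum>i\<in>I. star (f i))"
  by (induct I rule: infinite_finite_induct) (auto simp: star_add)

lemma norm_star [simp]: "norm (star (x::'a::cstar_algebra)) = norm x"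
proof -
  have le: "norm y \<le> norm (star y)" for y :: 'a
  proof (cases "y = 0")
    case False
    have "norm y * norm y \<le> norm (star y) * norm y"
      using norm_mult_ineq[of "star y" y] by (simp add: cstar_identity power2_eq_square)
    then show ?thesis using False by simp
  qed simp
  show ?thesis using le[of x] le[of "star x"] by (simp add: star_star)
qed

lemma bounded_linear_star: "bounded_linear (star :: 'a::cstar_algebra \<Rightarrow> 'a)"
  by (rule bounded_linear_intro[of _ 1]) (auto simp: star_add)

lemma norm_square_selfadjoint: "star x = x \<Longrightarrow> norm (x * x::'a::cstar_algebra) = (norm x)\<^sup>2"
  using cstar_identity[of x] by simp

section \<open>Positive elements and states\<close>

text \<open>The binomial series of \<open>sqrt (1 - t)\<close> converges absolutely also for \<open>norm t = 1\<close>.\<close>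

lemma sqrt_one_minus:
  fixes t :: "'a::cstar_algebra"
  assumes t: "norm t \<le> 1"
  obtains s where "s * s = 1 - t" "norm (1 - s) \<le> 1" "\<forall>y. y * t = t * y \<longrightarrow> y * s = s * y"
    "star t = t \<Longrightarrow> star s = s"
proof -
  define a :: "nat \<Rightarrow> real" where "a k = (1/2 gchoose k) * (-1)^k" for k
  have a0: "a 0 = 1" by (simp add: a_def)
  have a_poch: "a k = pochhammer (-(1/2)) k / fact k" for k
    by (simp add: a_def gbinomial_pochhammer power_mult_distrib[symmetric])
  have a_neg: "a (Suc k) \<le> 0" for k
  proof -
    have "pochhammer (1/2::real) k \<ge> 0" by (rule pochhammer_nonneg) simp
    then show ?thesis by (simp add: a_poch pochhammer_rec divide_le_0_iff)
  qed
  \<comment> \<open>The partial sums of the coefficients of (1 - t)^(1/2) are the coefficients of (1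
    - t)^(-1/2), hence nonnegative. As every coefficient after \<open>a 0 = 1\<close> is
    nonpositive, the remaining ones sum to at most 1 in absolute value.\<close>
  have psum: "(\<Sum>k\<le>n. a k) \<ge> 0" for n
  proof -
    have "(\<Sum>k\<le>n. a k) = (-1)^n * ((1/2 - 1) gchoose n)"
      unfolding a_def by (rule gbinomial_sum_lower_neg)
    also have "\<dots> = pochhammer (1/2) n / fact n"
      by (simp add: gbinomial_pochhammer power_mult_distrib[symmetric])
    finally show ?thesis by (simp add: pochhammer_nonneg)
  qed
  have abs_sum: "(\<Sum>k<n. \<bar>a (Suc k)\<bar>) \<le> 1" for n
  proof -
    have "(\<Sum>k<n. \<bar>a (Suc k)\<bar>) = - (\<Sum>k<n. a (Suc k))"
      using a_neg by (simp add: sum_negf[symmetric] abs_of_nonpos)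
    also have "(\<Sum>k<n. a (Suc k)) = (\<Sum>k\<le>n. a k) - 1"
      by (simp add: lessThan_Suc_atMost[symmetric] sum.lessThan_Suc_shift a0 del: sum.lessThan_Suc)
    finally show ?thesis using psum[of n] by simp
  qed
  have summ': "summable (\<lambda>k. \<bar>a (Suc k)\<bar>)"
    by (rule summableI_nonneg_bounded[of _ 1]) (use abs_sum in auto)
  have summ: "summable (\<lambda>k. \<bar>a k\<bar>)" using summ' summable_Suc_iff by blast
  have le1: "norm (t ^ k) \<le> 1" for k
    using norm_power_ineq[of t k] power_le_one[OF norm_ge_zero t, of k] by linarith
  have nb: "norm (a k *\<^sub>R t ^ k) \<le> \<bar>a k\<bar>" for k
    using le1[of k] by (simp add: mult_left_le)
  define f where "f k = a k *\<^sub>R t ^ k" for k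
  have sf: "summable (\<lambda>k. norm (f k))"
    by (rule summable_comparison_test'[OF summ]) (use nb in \<open>simp add: f_def\<close>)
  have sf1: "summable f" using sf by (rule summable_norm_cancel)
  define s where "s = suminf f"
  have fs: "f sums s" using sf1 by (simp add: s_def summable_sums)
  \<comment> \<open>Vandermonde convolution with 1/2 + 1/2 = 1: the square of the series is the
    binomial series of exponent 1, that is 1 - t.\<close>
  have coef: "(\<Sum>i\<le>k. a i * a (k - i)) = (if k = 0 then 1 else if k = 1 then -1 else 0)" for k
  proof -
    have "(\<Sum>i\<le>k. a i * a (k - i)) = (\<Sum>i\<le>k. ((1/2 gchoose i) * (1/2 gchoose (k - i))) * (-1)^k)"
      unfolding a_def
      by (rule sum.cong) (auto simp: power_add[symmetric])
    also have "\<dots> = ((1/2 + 1/2) gchoose k) * (-1)^k"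
      by (simp only: sum_distrib_right[symmetric] gbinomial_Vandermonde atLeast0AtMost[symmetric])
    also have "(1/2 + 1/2 :: real) gchoose k = of_nat (1 choose k)"
      by (simp add: binomial_gbinomial)
    finally show ?thesis by (cases k) (auto simp: binomial_eq_0)
  qed
  have cp: "(\<Sum>i\<le>k. f i * f (k - i)) = (if k = 0 then 1 else if k = 1 then - t else 0)" for k
  proof -
    have "(\<Sum>i\<le>k. f i * f (k - i)) = (\<Sum>i\<le>k. (a i * a (k - i)) *\<^sub>R t ^ k)"
      unfolding f_def by (rule sum.cong) (auto simp: power_add[symmetric])
    also have "\<dots> = (\<Sum>i\<le>k. a i * a (k - i)) *\<^sub>R t ^ k" by (simp add: scaleR_sum_left)
    finally show ?thesis by (simp add: coef)
  qed
  have "(\<lambda>k. \<Sum>i\<le>k. f i * f (k - i)) sums (s * s)"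
    unfolding s_def by (rule Cauchy_product_sums[OF sf sf])
  moreover have "(\<lambda>k. if k = 0 then 1 else if k = 1 then - t else 0) sums (1 - t)"
    using sums_finite[of "{0,1}" "\<lambda>k. if k = 0 then 1 else if k = 1 then - t else 0"] by simp
  ultimately have ss: "s * s = 1 - t" using sums_unique2 by (simp add: cp)
  have "(\<lambda>k. f (Suc k)) sums (s - f 0)" using fs by (simp add: sums_Suc_iff)
  then have "norm (s - f 0) \<le> 1"
  proof -
    assume *: "(\<lambda>k. f (Suc k)) sums (s - f 0)"
    show ?thesis
    proof (rule Lim_bounded[OF tendsto_norm[OF *[unfolded sums_def]], of 0], intro allI impI)
      fix n :: nat
      have "norm (\<Sum>k<n. f (Suc k)) \<le> (\<Sum>k<n. \<bar>a (Suc k)\<bar>)"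
        unfolding f_def by (rule sum_norm_le) (rule nb)
      then show "norm (\<Sum>k<n. f (Suc k)) \<le> 1" using abs_sum[of n] by linarith
    qed
  qed
  then have n1: "norm (1 - s) \<le> 1" by (simp add: f_def a0 norm_minus_commute)
  have comm: "y * s = s * y" if "y * t = t * y" for y
  proof -
    have "y * t ^ k = t ^ k * y" for k
      by (induct k) (simp_all add: mult.assoc[symmetric] that, metis mult.assoc that)
    then have "y * f k = f k * y" for k by (simp add: f_def)
    then show ?thesis using sums_mult[OF fs, of y] sums_mult2[OF fs, of y] sums_unique2 by simp
  qed
  have st: "star s = s" if "star t = t"
  proof -
    have "star (t ^ k) = t ^ k" for k
      by (induct k) (simp_all add: star_mult that power_commutes)
    then have "star (f k) = f k" for k by (simp add: f_def)
    then show ?thesis using bounded_linear.sums[OF bounded_linear_star fs] fs sums_unique2 by simp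
  qed
  show ?thesis using that ss n1 comm st by blast
qed

text \<open>For self-adjoint \<open>x\<close> the bound says that the spectrum lies in the interval
  [0, 2r]. In this form closure under sums is the triangle inequality, while positivity of
  \<open>star x * x\<close> becomes the hard statement.\<close>

definition positive :: "'a::cstar_algebra \<Rightarrow> bool" where
  "positive x \<longleftrightarrow> star x = x \<and> (\<exists>r\<ge>0. norm (of_real r - x) \<le> r)"

lemma positive_star: "positive x \<Longrightarrow> star x = x" by (simp add: positive_def)

lemma positive_zero: "positive 0" unfolding positive_def by auto

lemma positive_diff_of_norm_le:
  "star x = x \<Longrightarrow> norm x \<le> r \<Longrightarrow> positive (of_real r - x)"
  unfolding positive_def using norm_ge_zero[of x]
  by (auto simp: star_diff intro!: exI[of _ r] simp del: norm_ge_zero)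

lemma positive_add:
  assumes "positive x" "positive y" shows "positive (x + y)"
proof -
  obtain r r' where r: "r \<ge> 0" "norm (of_real r - x) \<le> r" "r' \<ge> 0" "norm (of_real r' - y) \<le> r'"
    using assms unfolding positive_def by blast
  have "norm (of_real (r + r') - (x + y)) = norm ((of_real r - x) + (of_real r' - y))"
    by (simp add: algebra_simps)
  also have "\<dots> \<le> r + r'" using r by (intro norm_triangle_mono)
  finally have "norm (of_real (r + r') - (x + y)) \<le> r + r'" .
  then show ?thesis using assms r unfolding positive_def
    by (auto simp: star_add intro!: exI[of _ "r + r'"])
qed

lemma positive_scaleR:
  assumes "positive x" "c \<ge> 0" shows "positive (c *\<^sub>R x)"
proof -
  obtain r where r: "r \<ge> 0" "norm (of_real r - x) \<le> r"
    using assms unfolding positive_def by blast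
  have "of_real (c * r) - c *\<^sub>R x = c *\<^sub>R (of_real r - x)"
    by (simp add: of_real_def scaleR_right_diff_distrib)
  then have "norm (of_real (c * r) - c *\<^sub>R x) \<le> c * r"
    using r assms(2) by (simp add: mult_left_mono)
  then show ?thesis using assms r unfolding positive_def
    by (auto intro!: exI[of _ "c * r"])
qed

lemma positive_of_real_imp: assumes "positive (of_real l :: 'a::cstar_algebra)" shows "l \<ge> 0"
proof -
  obtain r where "r \<ge> 0" "norm (of_real r - of_real l :: 'a) \<le> r"
    using assms unfolding positive_def by blast
  moreover have "norm (of_real r - of_real l :: 'a) = \<bar>r - l\<bar>"
    by (metis norm_of_real of_real_diff)
  ultimately show ?thesis by linarith
qed

text \<open>Write x as r (1 - t) with norm t at most 1 and use the binomial root of 1 - t. The root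
  commutes with everything that commutes with x, which is what later allows roots of commuting
  elements to be multiplied freely.\<close>

lemma positive_sqrt:
  assumes "positive x"
  obtains s where "positive s" "s * s = x" "\<forall>y. y * x = x * y \<longrightarrow> y * s = s * y"
proof -
  obtain r where r: "r \<ge> 0" "norm (of_real r - x) \<le> r" and sx: "star x = x"
    using assms unfolding positive_def by blast
  show ?thesis
  proof (cases "r = 0")
    case True
    then show ?thesis using r that[of 0] by (simp add: positive_zero)
  next
    case False
    then have r0: "r > 0" using r by simp
    define t where "t = (1/r) *\<^sub>R (of_real r - x)"
    have "norm t \<le> 1" using r0 r by (simp add: t_def)
    then obtain s where s: "s * s = 1 - t" "norm (1 - s) \<le> 1" "\<forall>y. y * t = t * y \<longrightarrow> y * s = s * y"
      "star t = t \<Longrightarrow> star s = s" using sqrt_one_minus by blast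
    have xt: "x = r *\<^sub>R (1 - t)" using r0
      by (simp add: t_def of_real_def scaleR_right_diff_distrib)
    have "star t = t" by (simp add: t_def star_diff sx)
    then have ss: "star s = s" using s by blast
    define q where "q = sqrt r *\<^sub>R s"
    have "of_real (sqrt r) - q = sqrt r *\<^sub>R (1 - s)"
      by (simp add: q_def of_real_def scaleR_right_diff_distrib)
    then have "norm (of_real (sqrt r) - q) \<le> sqrt r"
      using s(2) r0 by (simp add: mult_left_le)
    then have "positive q" unfolding positive_def using r0 ss
      by (auto simp: q_def intro!: exI[of _ "sqrt r"])
    moreover have "q * q = x" using s(1) xt r0 by (simp add: q_def)
    moreover have "y * q = q * y" if "y * x = x * y" for y
    proof -
      have "y * t = t * y" by (simp add: t_def algebra_simps that of_real_def)
      then show ?thesis using s(3) by (simp add: q_def)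
    qed
    ultimately show ?thesis using that by blast
  qed
qed

text \<open>With \<open>z = s + i r\<close> one has \<open>star z * z = s\<^sup>2 + r\<^sup>2\<close>, and \<open>s\<close> is the real part of \<open>z\<close>.\<close>

lemma norm_le_of_sum_squares:
  fixes s r :: "'a::cstar_algebra"
  assumes "star s = s" "star r = r" "s * r = r * s" "s * s + r * r = of_real l"
  shows "(norm s)\<^sup>2 \<le> \<bar>l\<bar>"
proof -
  define z where "z = s + scaleC \<i> r"
  have sz: "star z = s - scaleC \<i> r" by (simp add: z_def star_add star_scaleC assms)
  have "star z * z = s * s + r * r + scaleC \<i> (s * r - r * s)"
    unfolding sz unfolding z_def
    by (simp add: algebra_simps scaleC_mult_left scaleC_mult_right scaleC_scaleC scaleC_diff_right)
  also have "\<dots> = of_real l" by (simp add: assms)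
  finally have "(norm z)\<^sup>2 = \<bar>l\<bar>" using cstar_identity[of z] by simp
  moreover have "2 *\<^sub>R s = z + star z" unfolding sz by (simp add: z_def scaleR_2)
  then have "2 * norm s \<le> 2 * norm z"
    using norm_triangle_ineq[of z "star z"] by (metis norm_scaleR abs_numeral mult_2 norm_star)
  ultimately show ?thesis by (metis norm_ge_zero power_mono mult_le_cancel_left_pos zero_less_numeral)
qed

text \<open>With r the square of norm s, the element r - s s has a root p that commutes with s. The
  squares of s and p add up to r, so \<open>norm_le_of_sum_squares\<close> bounds p, and this is the
  required bound on r - s s.\<close>

lemma positive_square:
  fixes s :: "'a::cstar_algebra"
  assumes "star s = s" shows "positive (s * s)"
proof (cases "s = 0")
  case False
  define r where "r = (norm s)\<^sup>2"
  have r0: "r > 0" using False by (simp add: r_def)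
  define t where "t = (1/r) *\<^sub>R (s * s)"
  have "norm t \<le> 1" using r0 norm_square_selfadjoint[OF assms] by (simp add: t_def r_def)
  then obtain q where q: "q * q = 1 - t" "\<forall>y. y * t = t * y \<longrightarrow> y * q = q * y"
    "star t = t \<Longrightarrow> star q = q" using sqrt_one_minus by blast
  have sq: "star q = q" using q(3) by (simp add: t_def star_mult assms)
  have sq_comm: "s * q = q * s" by (rule q(2)[rule_format]) (simp add: t_def mult.assoc)
  have rt: "r *\<^sub>R (1 - t) = of_real r - s * s" using r0
    by (simp add: t_def of_real_def scaleR_right_diff_distrib)
  define p where "p = sqrt r *\<^sub>R q"
  have pp: "p * p = of_real r - s * s" using q(1) rt r0 by (simp add: p_def)
  have "(norm p)\<^sup>2 \<le> \<bar>r\<bar>"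
    by (rule norm_le_of_sum_squares[of _ s]) (simp_all add: pp assms, simp_all add: p_def sq sq_comm)
  then have "norm (of_real r - s * s) \<le> r"
    using pp norm_square_selfadjoint[of p] r0 by (simp add: p_def sq)
  then show ?thesis unfolding positive_def using r0 assms by (auto simp: star_mult intro!: exI[of _ r])
qed (simp add: positive_zero)

text \<open>The roots of b and of l - b commute and their squares add up to l, so the root of b has
  squared norm at most l; that squared norm is norm b.\<close>

lemma norm_le_of_positive:
  fixes b :: "'a::cstar_algebra"
  assumes b: "positive b" and lb: "positive (of_real l - b)"
  shows "norm b \<le> l"
proof -
  \<comment> \<open>l is the sum of the two given positive elements, and a scalar is positive only
    if it is a nonnegative number.\<close>
  have l0: "l \<ge> 0" using positive_add[OF b lb] positive_of_real_imp by force
  obtain s where s: "positive s" "s * s = b" "\<forall>y. y * b = b * y \<longrightarrow> y * s = s * y"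
    using positive_sqrt[OF b] by blast
  obtain r where r: "positive r" "r * r = of_real l - b"
    "\<forall>y. y * (of_real l - b) = (of_real l - b) * y \<longrightarrow> y * r = r * y"
    using positive_sqrt[OF lb] by blast
  have "b * s = s * b" unfolding s(2)[symmetric] by (simp add: mult.assoc)
  then have "s * (of_real l - b) = (of_real l - b) * s" by (simp add: algebra_simps of_real_def)
  then have "s * r = r * s" by (rule r(3)[rule_format])
  then have "(norm s)\<^sup>2 \<le> \<bar>l\<bar>"
    using norm_le_of_sum_squares[OF positive_star[OF s(1)] positive_star[OF r(1)]] s(2) r(2) by simp
  then show ?thesis using s(2) l0 norm_square_selfadjoint[OF positive_star[OF s(1)]] by simp
qed

text \<open>Neumann series; telescoping t^k - t^(k+1) yields both one-sided identities.\<close>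

lemma invertible_one_minus:
  fixes t :: "'a::{real_normed_algebra_1,banach}"
  assumes "norm t < 1"
  obtains n where "n * (1 - t) = 1" "(1 - t) * n = 1"
proof -
  have "summable (\<lambda>k. norm (t ^ k))"
    by (rule summable_comparison_test'[of "\<lambda>k. norm t ^ k"])
      (use assms in \<open>auto simp: norm_power_ineq summable_geometric\<close>)
  then have s: "(\<lambda>k. t ^ k) sums suminf (\<lambda>k. t ^ k)"
    by (simp add: summable_norm_cancel summable_sums)
  have "(\<lambda>k. t ^ k) \<longlonglongrightarrow> 0"
    by (rule summable_LIMSEQ_zero[OF sums_summable[OF s]])
  then have "(\<lambda>k. t ^ k - t ^ Suc k) sums (t ^ 0 - 0)" by (rule telescope_sums')
  moreover have "(\<lambda>k. t ^ k - t ^ Suc k) = (\<lambda>k. t ^ k * (1 - t))"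
    "(\<lambda>k. t ^ k - t ^ Suc k) = (\<lambda>k. (1 - t) * t ^ k)"
    by (auto simp: algebra_simps power_commutes)
  ultimately have "(\<lambda>k. t ^ k * (1 - t)) sums 1" "(\<lambda>k. (1 - t) * t ^ k) sums 1" by simp_all
  then show ?thesis using that sums_mult[OF s, of "1 - t"] sums_mult2[OF s, of "1 - t"] sums_unique2
    by blast
qed

text \<open>l + z is r + l times 1 - t, where norm t is at most r / (r + l) < 1.\<close>

lemma positive_plus_invertible:
  fixes z :: "'a::cstar_algebra"
  assumes "positive z" "l > 0"
  obtains n where "n * (of_real l + z) = 1" "(of_real l + z) * n = 1"
proof -
  obtain r where r: "r \<ge> 0" "norm (of_real r - z) \<le> r"
    using assms unfolding positive_def by blast
  define t where "t = (1/(r + l)) *\<^sub>R (of_real r - z)"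
  have "norm t < 1" using r assms(2) by (simp add: t_def)
  then obtain n where n: "n * (1 - t) = 1" "(1 - t) * n = 1" using invertible_one_minus by blast
  have z: "of_real l + z = (r + l) *\<^sub>R (1 - t)" using r assms(2)
    by (simp add: t_def of_real_def scaleR_right_diff_distrib scaleR_add_left)
  define k where "k = r + l"
  have k: "k \<noteq> 0" using r(1) assms(2) by (simp add: k_def)
  have z: "of_real l + z = k *\<^sub>R (1 - t)" using z by (simp only: k_def)
  show ?thesis
  proof (rule that)
    have "inverse k *\<^sub>R n * (of_real l + z) = n * (1 - t)" unfolding z using k by simp
    then show "inverse k *\<^sub>R n * (of_real l + z) = 1" unfolding n(1) .
    have "(of_real l + z) * (inverse k *\<^sub>R n) = (1 - t) * n" unfolding z using k by simp
    then show "(of_real l + z) * (inverse k *\<^sub>R n) = 1" unfolding n(2) .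
  qed
qed

text \<open>
  \<open>y * star y\<close> is then positive, so by Jacobson's identity \<open>l - p\<^sup>2 = l + star y * y\<close> is
  invertible for every \<open>l > 0\<close>; taking \<open>l = (norm p)\<^sup>2\<close> gives \<open>p\<^sup>2 \<le> l - e\<close> for some \<open>e > 0\<close>.
\<close>

lemma star_mult_eq_neg_square_imp:
  fixes y p :: "'a::cstar_algebra"
  assumes yy: "star y * y = - (p * p)" and p: "star p = p"
  shows "p = 0"
proof (rule ccontr)
  assume "p \<noteq> 0"
  define l where "l = (norm p)\<^sup>2"
  have l0: "l > 0" using \<open>p \<noteq> 0\<close> by (simp add: l_def)
  have npp: "norm (p * p) = l" using norm_square_selfadjoint[OF p] by (simp add: l_def)
  \<comment> \<open>Twice the real part of y and, up to sign, twice its imaginary part. Half of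
    \<open>h * h + k * k\<close> is \<open>y * star y + star y * y\<close>, so
    \<open>y * star y\<close> is a sum of squares.\<close>
  define h where "h = y + star y"
  define k where "k = scaleC \<i> (y - star y)"
  have hk: "star h = h" "star k = k"
    by (simp_all add: h_def k_def star_add star_star add.commute star_scaleC star_diff scaleC_diff_right)
  have "h * h + k * k = 2 *\<^sub>R (y * star y + star y * y)"
    by (simp add: h_def k_def algebra_simps scaleC_mult_left scaleC_mult_right scaleC_scaleC scaleR_2 scaleC_diff_right)
  then have "2 *\<^sub>R (y * star y) = h * h + k * k + 2 *\<^sub>R (p * p)"
    by (simp add: yy scaleR_right_diff_distrib)
  then have "y * star y = (1/2) *\<^sub>R (h * h + k * k + 2 *\<^sub>R (p * p))"
    by (metis scaleR_scaleR scaleR_one nonzero_divide_eq_eq zero_neq_numeral)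
  then have "positive (y * star y)"
    by (simp add: positive_scaleR positive_add positive_square hk p)
  then obtain m where m: "m * (of_real l + y * star y) = 1" "(of_real l + y * star y) * m = 1"
    using positive_plus_invertible l0 by blast
  define g where "g = of_real l - p * p"
  \<comment> \<open>Jacobson's formula for the inverse of \<open>l + star y * y\<close> in terms of
    the inverse m of \<open>l + y * star y\<close>.\<close>
  define v where "v = (1/l) *\<^sub>R (1 - star y * m * y)"
  have g': "g = of_real l + star y * y" by (simp add: g_def yy)
  have comm_l: "of_real l * x = l *\<^sub>R x" "x * of_real l = l *\<^sub>R x" for x :: 'a
    by (simp_all add: of_real_def)
  have "star y * m * y * g = star y * (m * (of_real l + y * star y)) * y"
    by (simp add: g' algebra_simps comm_l)
  then have "star y * m * y * g = star y * y" by (simp add: m)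
  then have "(1 - star y * m * y) * g = of_real l" by (simp add: left_diff_distrib g')
  then have vg: "v * g = 1" using l0 by (simp add: v_def of_real_def)
  have "g * (star y * m * y) = star y * ((of_real l + y * star y) * m) * y"
    by (simp add: g' algebra_simps comm_l)
  then have "g * (star y * m * y) = star y * y" by (simp add: m)
  then have "g * (1 - star y * m * y) = of_real l" by (simp add: right_diff_distrib g')
  then have gv: "g * v = 1" using l0 by (simp add: v_def of_real_def)
  have sg: "star g = g" by (simp add: g_def star_diff star_mult p)
  have sv: "star v = v"
    by (metis sg vg gv mult.assoc mult.left_neutral mult.right_neutral star_mult star_one)
  have "positive g" unfolding g_def
    by (rule positive_diff_of_norm_le) (simp_all add: star_mult p npp)
  then obtain r where r: "positive r" "r * r = g" "\<forall>y. y * g = g * y \<longrightarrow> y * r = r * y"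
    using positive_sqrt by blast
  note sr = positive_star[OF r(1)]
  have vr: "v * r = r * v" by (rule r(3)[rule_format]) (simp add: vg gv)
  \<comment> \<open>A square root of the inverse of g, since r and v commute.\<close>
  define w where "w = r * v"
  have sw: "star w = w" by (simp add: w_def star_mult sv sr vr)
  have wr: "w * w * r * r = 1"
    by (metis w_def vr gv mult.assoc mult.right_neutral r(2) vg)
  \<comment> \<open>This size makes the norm of e w w at most 1, so 1 - e w w has a root q. Then q r
    squares to g - e, that is to l - e - p p, which is therefore positive.\<close>
  define e where "e = 1 / ((norm w)\<^sup>2 + 1)"
  have e0: "e > 0" by (simp add: e_def add_nonneg_pos)
  have "norm (e *\<^sub>R (w * w)) \<le> 1"
    using norm_square_selfadjoint[OF sw] by (simp add: e_def divide_le_eq_1 add_nonneg_pos)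
  then obtain q where q: "q * q = 1 - e *\<^sub>R (w * w)" "\<forall>y. y * (e *\<^sub>R (w * w)) = e *\<^sub>R (w * w) * y \<longrightarrow> y * q = q * y"
    "star (e *\<^sub>R (w * w)) = e *\<^sub>R (w * w) \<Longrightarrow> star q = q" using sqrt_one_minus by blast
  have sq: "star q = q" using q(3) by (simp add: star_mult sw)
  have "r * (w * w) = w * w * r" by (metis w_def vr mult.assoc)
  then have rq: "r * q = q * r" by (intro q(2)[rule_format]) simp
  have "(q * r) * (q * r) = q * q * (r * r)" by (metis rq mult.assoc)
  also have "\<dots> = r * r - e *\<^sub>R (w * w * (r * r))" by (simp add: q left_diff_distrib)
  also have "\<dots> = of_real (l - e) - p * p" using wr
    by (simp add: r(2) g_def of_real_def scaleR_left_diff_distrib mult.assoc)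
  finally have "positive (of_real (l - e) - p * p)"
    using positive_square[of "q * r"] by (simp add: star_mult sq sr rq)
  then have "norm (p * p) \<le> l - e" using norm_le_of_positive[OF positive_square[OF p]] by blast
  then show False using npp e0 by simp
qed

text \<open>Let c be \<open>star x * x\<close>, d its absolute value and e = d - c, twice the
  negative part of c, so that c e = - d e. With r the root of d, the element y = x e satisfies
  \<open>star y * y = - (e r)(e r)\<close>, and \<open>star_mult_eq_neg_square_imp\<close> gives e r
  = 0. Then d e = 0, hence e e = 0 and c = d.\<close>

theorem positive_star_mult: "positive (star x * x :: 'a::cstar_algebra)"
proof -
  define c where "c = star x * x"
  have sc: "star c = c" by (simp add: c_def star_mult star_star)
  obtain d where d: "positive d" "d * d = c * c" "\<forall>y. y * (c * c) = c * c * y \<longrightarrow> y * d = d * y"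
    using positive_sqrt[OF positive_square[OF sc]] by blast
  have cd: "c * d = d * c" by (rule d(3)[rule_format]) (simp add: mult.assoc)
  obtain r where r: "positive r" "r * r = d" "\<forall>y. y * d = d * y \<longrightarrow> y * r = r * y"
    using positive_sqrt[OF d(1)] by blast
  define e where "e = d - c"
  have se: "star e = e" by (simp add: e_def star_diff sc positive_star[OF d(1)])
  have "e * d = d * e" by (simp add: e_def algebra_simps cd)
  then have er: "e * r = r * e" by (rule r(3)[rule_format])
  have ce: "c * e = - (d * e)" by (simp add: e_def right_diff_distrib cd d(2))
  have "star (x * e) * (x * e) = e * (c * e)"
    by (simp add: star_mult se c_def mult.assoc)
  also have "e * (c * e) = - ((e * r) * (r * e))" by (simp add: ce r(2)[symmetric] mult.assoc)
  also have "r * e = e * r" by (rule er[symmetric])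
  finally have "e * r = 0"
    by (rule star_mult_eq_neg_square_imp) (simp add: star_mult se positive_star[OF r(1)] er)
  moreover have "d * e = r * (e * r)" by (simp add: r(2)[symmetric] er mult.assoc)
  ultimately have "d * e = 0" by simp
  moreover have "e * e = d * e - c * e" by (simp add: e_def left_diff_distrib)
  ultimately have "e * e = 0" by (simp add: ce)
  then have "e = 0" using norm_square_selfadjoint[OF se] by simp
  then show ?thesis using d(1) by (simp add: e_def c_def)
qed

section \<open>The Hahn-Banach theorem and norming states\<close>

definition sublinear :: "('a::real_vector \<Rightarrow> real) \<Rightarrow> bool" where
  "sublinear p \<longleftrightarrow> (\<forall>x y. p (x + y) \<le> p x + p y) \<and> (\<forall>t x. t \<ge> 0 \<longrightarrow> p (t *\<^sub>R x) = t * p x)"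

lemma sublinear_zero: assumes "sublinear p" shows "p 0 = 0"
proof -
  have "\<forall>t x. t \<ge> 0 \<longrightarrow> p (t *\<^sub>R x) = t * p x" using assms by (simp add: sublinear_def)
  from this[rule_format, of 0 0] show ?thesis by simp
qed

lemma sublinear_lower: assumes "sublinear p" shows "- p (- x) \<le> p x"
proof -
  have "p 0 = 0" by (rule sublinear_zero[OF assms])
  moreover have "p (x + (- x)) \<le> p x + p (- x)" using assms unfolding sublinear_def by blast
  ultimately show ?thesis by simp
qed

text \<open>The sublinear functional \<open>q\<close> below satisfies \<open>q \<le> p\<close> and \<open>q (- x\<^sub>0) \<le> - p x\<^sub>0\<close>.\<close>

lemma sublinear_modify:
  fixes x0 :: "'a::real_vector"
  assumes p: "sublinear p"
  defines "q \<equiv> \<lambda>x. INF t\<in>{0..}. p (x + t *\<^sub>R x0) - t * p x0"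
  shows "sublinear q" "\<And>x t. t \<ge> 0 \<Longrightarrow> q x \<le> p (x + t *\<^sub>R x0) - t * p x0"
proof -
  have padd: "p (x + y) \<le> p x + p y" for x y using p by (simp add: sublinear_def)
  have psc: "t \<ge> 0 \<Longrightarrow> p (t *\<^sub>R x) = t * p x" for t x using p by (simp add: sublinear_def)
  have bdd: "bdd_below ((\<lambda>t. p (x + t *\<^sub>R x0) - t * p x0) ` {0..})" for x
  proof (rule bdd_belowI[of _ "- p (- x)"], clarsimp)
    fix t :: real assume "0 \<le> t"
    then show "- p (- x) \<le> p (x + t *\<^sub>R x0) - t * p x0"
      using padd[of "x + t *\<^sub>R x0" "- x"] psc[of t x0] by simp
  qed
  show le: "q x \<le> p (x + t *\<^sub>R x0) - t * p x0" if "t \<ge> 0" for x t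
    unfolding q_def by (rule cINF_lower[OF bdd]) (use that in simp)
  have ge: "m \<le> q x" if "\<And>t. t \<ge> 0 \<Longrightarrow> m \<le> p (x + t *\<^sub>R x0) - t * p x0" for m x
    unfolding q_def by (rule cINF_greatest) (use that in auto)
  show "sublinear q" unfolding sublinear_def
  proof (intro conjI allI impI)
    fix x y
    have "q (x + y) - q y \<le> q x"
    proof (rule ge)
      fix t :: real assume t: "t \<ge> 0"
      have "q (x + y) - (p (x + t *\<^sub>R x0) - t * p x0) \<le> q y"
      proof (rule ge)
        fix s :: real assume s: "s \<ge> 0"
        have "q (x + y) \<le> p ((x + y) + (t + s) *\<^sub>R x0) - (t + s) * p x0" using s t by (intro le) simp
        also have "(x + y) + (t + s) *\<^sub>R x0 = (x + t *\<^sub>R x0) + (y + s *\<^sub>R x0)" by (simp add: algebra_simps)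
        finally show "q (x + y) - (p (x + t *\<^sub>R x0) - t * p x0) \<le> p (y + s *\<^sub>R x0) - s * p x0"
          using padd[of "x + t *\<^sub>R x0" "y + s *\<^sub>R x0"] by (simp add: algebra_simps)
      qed
      then show "q (x + y) - q y \<le> p (x + t *\<^sub>R x0) - t * p x0" by simp
    qed
    then show "q (x + y) \<le> q x + q y" by simp
  next
    have half: "q (c *\<^sub>R x) \<le> c * q x" if c: "c > 0" for c x
    proof -
      have "q (c *\<^sub>R x) / c \<le> q x"
      proof (rule ge)
        fix t :: real assume t: "t \<ge> 0"
        have "q (c *\<^sub>R x) \<le> p (c *\<^sub>R x + (c * t) *\<^sub>R x0) - (c * t) * p x0" using t c by (intro le) simp
        also have "c *\<^sub>R x + (c * t) *\<^sub>R x0 = c *\<^sub>R (x + t *\<^sub>R x0)" by (simp add: algebra_simps)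
        finally show "q (c *\<^sub>R x) / c \<le> p (x + t *\<^sub>R x0) - t * p x0"
          unfolding psc[OF less_imp_le[OF c]] using c by (simp add: field_simps)
      qed
      then show ?thesis using c by (simp add: field_simps)
    qed
    have q0: "q 0 = 0"
    proof (rule antisym)
      have "p 0 = 0" using psc[of 0 0] by simp
      then show "q 0 \<le> 0" using le[of 0 0] by simp
      show "0 \<le> q 0" by (rule ge) (use psc in simp)
    qed
    fix c :: real and x assume "c \<ge> 0"
    show "q (c *\<^sub>R x) = c * q x"
    proof (cases "c = 0")
      case False
      then have c: "c > 0" using \<open>c \<ge> 0\<close> by simp
      have "c * q ((1/c) *\<^sub>R (c *\<^sub>R x)) \<le> c * ((1/c) * q (c *\<^sub>R x))"
        using half[of "1/c" "c *\<^sub>R x"] c by (intro mult_left_mono) auto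
      then show ?thesis using half[OF c, of x] c by simp
    qed (simp add: q0)
  qed
qed

text \<open>A minimal sublinear functional is linear.\<close>

theorem hahn_banach_sublinear:
  fixes p :: "'a::real_vector \<Rightarrow> real"
  assumes p: "sublinear p"
  obtains f where "linear f" "\<And>x. f x \<le> p x" "f x0 = p x0"
proof -
  \<comment> \<open>Lowering p at x0 before Zorn's lemma is applied forces f (- x0) \<le> - p x0,
    and so equality at x0, for every linear functional f below p1.\<close>
  define p1 where "p1 = (\<lambda>x. INF t\<in>{0..}. p (x + t *\<^sub>R x0) - t * p x0)"
  have p1: "sublinear p1" "\<And>x t. t \<ge> 0 \<Longrightarrow> p1 x \<le> p (x + t *\<^sub>R x0) - t * p x0"
    unfolding p1_def using sublinear_modify[OF p] by auto
  define S where "S = {q. sublinear q \<and> (\<forall>x. q x \<le> p1 x)}"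
  \<comment> \<open>The order is reversed, so that the maximal element given by Zorn's lemma is a
    minimal sublinear functional.\<close>
  define R where "R = relation_of (\<lambda>q q'. \<forall>x. q' x \<le> (q x::real)) S"
  have po: "partial_order_on S R"
    unfolding R_def
    by (rule partial_order_on_relation_ofI) (auto intro: order_trans intro!: antisym simp: fun_eq_iff)
  have "\<exists>m\<in>S. \<forall>q\<in>S. (\<forall>x. q x \<le> m x) \<longrightarrow> q = m"
  proof (rule predicate_Zorn[OF po[unfolded R_def]])
    fix C assume C: "C \<in> Chains (relation_of (\<lambda>q q'. \<forall>x. q' x \<le> q x) S)"
    then have CS: "C \<subseteq> S" by (auto simp: Chains_def relation_of_def)
    have tot: "(\<forall>x. q x \<le> q' x) \<or> (\<forall>x. q' x \<le> q x)" if "q \<in> C" "q' \<in> C" for q q'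
      using C that by (auto simp: Chains_def relation_of_def)
    show "\<exists>u\<in>S. \<forall>q\<in>C. \<forall>x. u x \<le> q x"
    proof (cases "C = {}")
      case True
      then show ?thesis using p1 by (auto simp: S_def)
    next
      case False
      \<comment> \<open>The pointwise infimum bounds the chain. For subadditivity two members are
        compared and the smaller one serves both summands.\<close>
      define u where "u x = (INF q\<in>C. q x)" for x
      have bdd: "bdd_below ((\<lambda>q. q x) ` C)" for x
      proof (rule bdd_belowI[of _ "- p1 (- x)"], clarsimp)
        fix q assume "q \<in> C"
        then have "sublinear q" "q (- x) \<le> p1 (- x)" using CS by (auto simp: S_def)
        then show "- p1 (- x) \<le> q x" using sublinear_lower[of q x] by linarith
      qed
      have le: "u x \<le> q x" if "q \<in> C" for q x unfolding u_def by (rule cINF_lower[OF bdd that])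
      have ge: "m \<le> u x" if "\<And>q. q \<in> C \<Longrightarrow> m \<le> q x" for m x
        unfolding u_def by (rule cINF_greatest) (use that False in auto)
      have sub: "sublinear q" if "q \<in> C" for q using that CS by (auto simp: S_def)
      have "sublinear u" unfolding sublinear_def
      proof (intro conjI allI impI)
        fix x y
        have "u (x + y) - u y \<le> u x"
        proof (rule ge)
          fix q assume q: "q \<in> C"
          have "u (x + y) - q x \<le> u y"
          proof (rule ge)
            fix q' assume q': "q' \<in> C"
            have add: "q (x + y) \<le> q x + q y" "q' (x + y) \<le> q' x + q' y"
              using sub q q' by (auto simp: sublinear_def)
            from tot[OF q q'] show "u (x + y) - q x \<le> q' y"
            proof
              assume "\<forall>x. q x \<le> q' x"
              then show ?thesis using add le[OF q, of "x + y"] by (smt (verit))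
            next
              assume "\<forall>x. q' x \<le> q x"
              then show ?thesis using add le[OF q', of "x + y"] by (smt (verit))
            qed
          qed
          then show "u (x + y) - u y \<le> q x" by simp
        qed
        then show "u (x + y) \<le> u x + u y" by simp
      next
        fix c :: real and x assume c: "c \<ge> 0"
        have qc: "q (c *\<^sub>R x) = c * q x" if "q \<in> C" for q
          using sub[OF that] c by (simp add: sublinear_def)
        show "u (c *\<^sub>R x) = c * u x"
        proof (rule antisym)
          show "u (c *\<^sub>R x) \<le> c * u x"
          proof (cases "c = 0")
            case True
            obtain q where "q \<in> C" using False by blast
            then show ?thesis using le[of q "c *\<^sub>R x"] qc[of q] True by simp
          next
            case False
            then have c: "c > 0" using \<open>c \<ge> 0\<close> by simp
            have "u (c *\<^sub>R x) / c \<le> u x"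
            proof (rule ge)
              fix q assume "q \<in> C"
              then show "u (c *\<^sub>R x) / c \<le> q x" using le[of q "c *\<^sub>R x"] qc[of q] c by (simp add: field_simps)
            qed
            then show ?thesis using c by (simp add: field_simps)
          qed
          show "c * u x \<le> u (c *\<^sub>R x)"
            by (rule ge) (simp add: qc le c mult_left_mono)
        qed
      qed
      moreover have "u x \<le> p1 x" for x
      proof -
        obtain q where "q \<in> C" using False by blast
        moreover from this have "q x \<le> p1 x" using CS by (auto simp: S_def)
        ultimately show ?thesis using le[of q x] by linarith
      qed
      ultimately show ?thesis using le by (auto simp: S_def intro!: bexI[of _ u])
    qed
  qed
  then obtain f where f: "sublinear f" "\<And>x. f x \<le> p1 x"
    and fmin: "\<And>q. sublinear q \<Longrightarrow> (\<And>x. q x \<le> p1 x) \<Longrightarrow> (\<And>x. q x \<le> f x) \<Longrightarrow> q = f"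
    unfolding S_def by blast
  have fp: "f x \<le> p x" for x using f(2)[of x] p1(2)[of 0 x] by simp
  have f0: "f 0 = 0" by (rule sublinear_zero[OF f(1)])
  have add: "f (x + y) = f x + f y" for x y
  proof -
    \<comment> \<open>Lowering f at y gives a sublinear functional below f, hence f itself by
      minimality; its bound for t = 1 is the missing half of additivity.\<close>
    define g where "g = (\<lambda>x. INF t\<in>{0..}. f (x + t *\<^sub>R y) - t * f y)"
    have g: "sublinear g" "\<And>x t. t \<ge> 0 \<Longrightarrow> g x \<le> f (x + t *\<^sub>R y) - t * f y"
      unfolding g_def using sublinear_modify[OF f(1)] by auto
    have "g z \<le> f z" for z using g(2)[of 0 z] by simp
    moreover from this have "g z \<le> p1 z" for z using f(2) order_trans by blast
    ultimately have "g = f" using fmin g(1) by blast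
    then have "f x \<le> f (x + y) - f y" using g(2)[of 1 x] by simp
    moreover have "f (x + y) \<le> f x + f y" using f(1) by (simp add: sublinear_def)
    ultimately show ?thesis by simp
  qed
  have neg: "f (- x) = - f x" for x using add[of x "- x"] f0 by simp
  have lin: "linear f"
  proof (rule linearI)
    fix c :: real and x
    have sc: "t \<ge> 0 \<Longrightarrow> f (t *\<^sub>R x) = t * f x" for t using f(1) by (simp add: sublinear_def)
    show "f (c *\<^sub>R x) = c *\<^sub>R f x"
      using sc[of c] sc[of "-c"] neg[of "c *\<^sub>R x"] by (cases "c \<ge> 0") auto
  qed (rule add)
  have "p 0 = 0" by (rule sublinear_zero[OF p])
  then have "f (- x0) \<le> - p x0" using f(2)[of "- x0"] p1(2)[of 1 "- x0"] by simp
  then have "f x0 = p x0" using fp[of x0] neg[of x0] by simp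
  then show ?thesis using that lin fp by blast
qed

text \<open>\<open>P x\<close> is the infimum of the l that dominate the real part of x, the gauge
  of the order unit 1. A real functional below P is automatically positive, normalised and zero on
  skew elements, so it is the real part of a state; Hahn-Banach provides one that attains
  \<open>P (star a * a)\<close>. By \<open>norm_le_of_positive\<close> this value is at least the
  norm of \<open>star a * a\<close>.\<close>

theorem norming_state:
  fixes a :: "'a::cstar_algebra"
  obtains \<phi> where "state \<phi>" "Re (\<phi> (star a * a)) \<ge> (norm a)\<^sup>2"
proof -
  define S where "S x = {l. positive (of_real l - (1/2) *\<^sub>R (x + star x))}" for x :: 'a
  define P where "P x = Inf (S x)" for x
  have hsa: "star ((1/2) *\<^sub>R (x + star x)) = (1/2) *\<^sub>R (x + star x)" for x :: 'a
    by (simp add: star_add star_star add.commute)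
  have hn: "norm ((1/2) *\<^sub>R (x + star x)) \<le> norm x" for x :: 'a
    using norm_triangle_ineq[of x "star x"] by simp
  have ne: "norm x \<in> S x" for x
    unfolding S_def by (simp only: mem_Collect_eq) (rule positive_diff_of_norm_le[OF hsa hn])
  have lower: "- norm x \<le> l" if "l \<in> S x" for x l
  proof -
    have "positive (of_real (norm x) - (- ((1/2) *\<^sub>R (x + star x))))"
      by (rule positive_diff_of_norm_le) (use hsa[of x] hn[of x] in \<open>simp_all only: star_minus norm_minus_cancel\<close>)
    from positive_add[OF that[unfolded S_def mem_Collect_eq] this]
    have "positive (of_real (l + norm x) :: 'a)" by simp
    from positive_of_real_imp[OF this] show ?thesis by simp
  qed
  have bdd: "bdd_below (S x)" for x by (rule bdd_belowI[of _ "- norm x"]) (rule lower)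
  have Ple: "P x \<le> l" if "l \<in> S x" for x l unfolding P_def by (rule cInf_lower[OF that bdd])
  have Pge: "m \<le> P x" if "\<And>l. l \<in> S x \<Longrightarrow> m \<le> l" for x m
    unfolding P_def by (rule cInf_greatest) (use ne that in blast)+
  have "sublinear P" unfolding sublinear_def
  proof (intro conjI allI impI)
    fix x y
    have "P (x + y) - P y \<le> P x"
    proof (rule Pge)
      fix l assume l: "l \<in> S x"
      have "P (x + y) - l \<le> P y"
      proof (rule Pge)
        fix m assume m: "m \<in> S y"
        have "of_real (l + m) - (1/2) *\<^sub>R ((x + y) + star (x + y))
          = (of_real l - (1/2) *\<^sub>R (x + star x)) + (of_real m - (1/2) *\<^sub>R (y + star y))"
          by (simp add: star_add algebra_simps)
        then have "l + m \<in> S (x + y)"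
          using positive_add[OF l[unfolded S_def mem_Collect_eq] m[unfolded S_def mem_Collect_eq]]
          by (simp only: S_def mem_Collect_eq)
        then show "P (x + y) - l \<le> m" using Ple by force
      qed
      then show "P (x + y) - P y \<le> l" by simp
    qed
    then show "P (x + y) \<le> P x + P y" by simp
  next
    have half: "P (c *\<^sub>R x) \<le> c * P x" if c: "c > 0" for c x
    proof -
      have "P (c *\<^sub>R x) / c \<le> P x"
      proof (rule Pge)
        fix l assume l: "l \<in> S x"
        have "of_real (c * l) - (1/2) *\<^sub>R (c *\<^sub>R x + star (c *\<^sub>R x)) = c *\<^sub>R (of_real l - (1/2) *\<^sub>R (x + star x))"
          by (simp add: of_real_def algebra_simps)
        then have "c * l \<in> S (c *\<^sub>R x)"
          using positive_scaleR[OF l[unfolded S_def mem_Collect_eq] less_imp_le[OF c]]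
          by (simp only: S_def mem_Collect_eq)
        then show "P (c *\<^sub>R x) / c \<le> l" using Ple[of "c * l"] c by (simp add: field_simps)
      qed
      then show ?thesis using c by (simp add: field_simps)
    qed
    have P0: "P 0 = 0"
    proof (rule antisym)
      show "P 0 \<le> 0" using Ple[OF ne[of 0]] by simp
      show "0 \<le> P 0" by (rule Pge) (use lower[of _ 0] in simp)
    qed
    fix c :: real and x assume "c \<ge> 0"
    show "P (c *\<^sub>R x) = c * P x"
    proof (cases "c = 0")
      case False
      then have c: "c > 0" using \<open>c \<ge> 0\<close> by simp
      have "c * P ((1/c) *\<^sub>R (c *\<^sub>R x)) \<le> c * ((1/c) * P (c *\<^sub>R x))"
        using half[of "1/c" "c *\<^sub>R x"] c by (intro mult_left_mono) auto
      then show ?thesis using half[OF c, of x] c by simp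
    qed (simp add: P0)
  qed
  then obtain f where f: "linear f" "\<And>x. f x \<le> P x" "f (star a * a) = P (star a * a)"
    using hahn_banach_sublinear by blast
  note fl = linear_add[OF f(1)] linear_scale[OF f(1)] linear_neg[OF f(1)]
  have half: "(1/2) *\<^sub>R (x + x) = x" for x :: 'a by (simp add: scaleR_2[symmetric])
  have two: "(1/2) *\<^sub>R (2::'a) = 1" using half[of 1] by (simp only: one_add_one)
  have f1: "f 1 = 1"
  proof (rule antisym)
    show "f 1 \<le> 1" using f(2)[of 1] Ple[of 1 1] by (simp add: S_def two positive_zero)
    have "f (- 1) \<le> - 1" using f(2)[of "- 1"] Ple[of "- 1" "- 1"]
      by (simp add: S_def two positive_zero)
    then show "1 \<le> f 1" by (simp add: fl)
  qed
  \<comment> \<open>The real part of a skew element is 0, so the gauge is at most 0 at both z and -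
    z.\<close>
  have skew: "f z = 0" if "star z = - z" for z
  proof -
    have "z + star z = 0" "- z + star (- z) = 0" by (simp_all add: that)
    then have "0 \<in> S z" "0 \<in> S (- z)"
      by (simp_all only: S_def mem_Collect_eq scaleR_zero_right of_real_0 diff_0_right positive_zero)
    then have "f z \<le> 0" "f (- z) \<le> 0" using f(2) Ple order_trans by blast+
    then show ?thesis by (simp add: fl)
  qed
  have fpos: "0 \<le> f (star x * x)" for x
  proof -
    have "0 \<in> S (- (star x * x))"
      using half[of "- (star x * x)"] by (simp add: S_def star_mult star_star positive_star_mult)
    then have "f (- (star x * x)) \<le> 0" using f(2) Ple order_trans by blast
    then show ?thesis by (simp add: fl)
  qed
  \<comment> \<open>The complex linear functional with real part f: complex linearity forces its
    imaginary part at x to be minus the value of f at ix.\<close>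
  define \<phi> where "\<phi> x = Complex (f x) (- f (scaleC \<i> x))" for x
  have cl: "\<phi> (scaleC c x) = c * \<phi> x" for c x
  proof -
    have e: "scaleC c x = Re c *\<^sub>R x + Im c *\<^sub>R scaleC \<i> x"
      "scaleC \<i> (scaleC c x) = Re c *\<^sub>R scaleC \<i> x - Im c *\<^sub>R x"
      unfolding scaleR_scaleC scaleC_scaleC scaleC_add_left[symmetric] scaleC_diff_left[symmetric]
      by (rule arg_cong[of _ _ "\<lambda>c. scaleC c x"], simp add: complex_eq_iff)+
    show ?thesis unfolding \<phi>_def e(2) unfolding e(1) using linear_diff[OF f(1)] by (simp add: fl complex_eq_iff)
  qed
  have im0: "f (scaleC \<i> (star x * x)) = 0" for x
    by (rule skew) (simp add: star_scaleC star_mult star_star)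
  have "state \<phi>" unfolding state_def
  proof (intro conjI allI)
    show "\<phi> (x + y) = \<phi> x + \<phi> y" for x y
      by (simp add: \<phi>_def fl scaleC_add_right complex_eq_iff)
    show "\<phi> (star x * x) \<in> \<real>" "0 \<le> Re (\<phi> (star x * x))" for x
      by (simp_all add: \<phi>_def im0 fpos complex_is_Real_iff)
    have "f (scaleC \<i> 1) = 0" by (rule skew) (simp add: star_scaleC)
    then show "\<phi> 1 = 1" by (simp add: \<phi>_def f1 complex_eq_iff)
  qed (rule cl)
  moreover have "(norm a)\<^sup>2 \<le> P (star a * a)"
  proof (rule Pge)
    fix l assume "l \<in> S (star a * a)"
    then have "positive (of_real l - star a * a)"
      by (simp add: S_def star_mult star_star half)
    then show "(norm a)\<^sup>2 \<le> l"
      using norm_le_of_positive[OF positive_star_mult] cstar_identity by metis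
  qed
  ultimately show ?thesis using that[of \<phi>] f(3) by (simp add: \<phi>_def)
qed

section \<open>States and homomorphisms\<close>

lemma cnj_mult_self: "cnj z * z = (of_real (cmod z))\<^sup>2" "z * cnj z = (of_real (cmod z))\<^sup>2"
  using complex_norm_square[of z] by (simp_all add: mult.commute)

lemma state_add: "state \<phi> \<Longrightarrow> \<phi> (x + y) = \<phi> x + \<phi> y" by (simp add: state_def)
lemma state_scaleC: "state \<phi> \<Longrightarrow> \<phi> (scaleC c x) = c * \<phi> x" by (simp add: state_def)
lemma state_one: "state \<phi> \<Longrightarrow> \<phi> 1 = 1" by (simp add: state_def)
lemma state_zero: "state \<phi> \<Longrightarrow> \<phi> 0 = 0" using state_add[of \<phi> 0 0] by simp
lemma state_scaleR: "state \<phi> \<Longrightarrow> \<phi> (scaleR r x) = r *\<^sub>R \<phi> x"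
  by (simp add: scaleR_scaleC state_scaleC scaleR_conv_of_real)
lemma state_scaleR': "state \<phi> \<Longrightarrow> \<phi> (scaleR r x) = of_real r * \<phi> x"
  by (simp add: scaleR_scaleC state_scaleC)
lemma state_minus: "state \<phi> \<Longrightarrow> \<phi> (- x) = - \<phi> x"
  using state_scaleR[of \<phi> "-1" x] by simp
lemma state_diff: "state \<phi> \<Longrightarrow> \<phi> (x - y) = \<phi> x - \<phi> y"
  using state_add[of \<phi> x "- y"] by (simp add: state_minus)
lemma state_nonneg: "state \<phi> \<Longrightarrow> 0 \<le> Re (\<phi> (star x * x))" by (simp add: state_def)
lemma state_real: "state \<phi> \<Longrightarrow> Im (\<phi> (star x * x)) = 0" by (simp add: state_def complex_is_Real_iff)
lemma state_sum: "state \<phi> \<Longrightarrow> \<phi> (\<Sum>i\<in>I. f i) = (\<Sum>i\<in>I. \<phi> (f i))"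
  by (induct I rule: infinite_finite_induct) (auto simp: state_zero state_add)

text \<open>Reality of \<phi> on \<open>star y * y\<close> for y = x + 1 compares the imaginary
  parts, and for y = ix + 1 the real parts.\<close>

lemma state_star: assumes "state \<phi>" shows "\<phi> (star x) = cnj (\<phi> x)"
proof -
  note s = state_add[OF assms] state_scaleC[OF assms] state_one[OF assms] state_minus[OF assms]
  have "Im (\<phi> (star x)) + Im (\<phi> x) = 0"
    using state_real[OF assms, of "x + 1"] state_real[OF assms, of x]
    by (simp add: star_add algebra_simps s)
  moreover have "star (scaleC \<i> x + 1) * (scaleC \<i> x + 1)
      = star x * x + (1 - scaleC \<i> (star x) + scaleC \<i> x)"
    by (simp add: star_add star_scaleC algebra_simps scaleC_mult_left scaleC_mult_right scaleC_scaleC scaleC_diff_right)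
  then have "Re (\<phi> x) - Re (\<phi> (star x)) = 0"
    using state_real[OF assms, of "scaleC \<i> x + 1"] state_real[OF assms, of x]
    by (simp add: s state_diff[OF assms])
  ultimately show ?thesis by (simp add: complex_eq_iff)
qed

text \<open>The gap between the squared norm of x and \<open>star x * x\<close> is positive, hence
  the square of a self-adjoint element, where a state is nonnegative.\<close>

lemma state_star_mult_le: assumes "state \<phi>" shows "Re (\<phi> (star x * x)) \<le> (norm x)\<^sup>2"
proof -
  have sx: "star (star x * x) = star x * x" by (simp add: star_mult star_star)
  have "positive (of_real ((norm x)\<^sup>2) - star x * x)"
    by (rule positive_diff_of_norm_le) (simp_all only: sx cstar_identity order_refl)
  then obtain s where s: "positive s" "s * s = of_real ((norm x)\<^sup>2) - star x * x"
    using positive_sqrt by metis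
  have "0 \<le> Re (\<phi> (s * s))" using state_nonneg[OF assms, of s] positive_star[OF s(1)] by simp
  also have "\<phi> (s * s) = (norm x)\<^sup>2 - \<phi> (star x * x)"
    unfolding s(2) by (simp add: state_diff[OF assms] of_real_def state_scaleR[OF assms] state_one[OF assms])
  finally show ?thesis by simp
qed

text \<open>The variance of x about c = \<open>\<phi> x\<close> is nonnegative, which is the
  Cauchy-Schwarz inequality against 1.\<close>

lemma state_norm_le: assumes "state \<phi>" shows "norm (\<phi> x) \<le> norm x"
proof -
  define c where "c = \<phi> x"
  have "\<phi> (star (x - scaleC c 1) * (x - scaleC c 1))
      = \<phi> (star x * x) - c * \<phi> (star x) - cnj c * \<phi> x + cnj c * c"
    by (simp add: star_diff star_scaleC algebra_simps scaleC_mult_left scaleC_mult_right scaleC_scaleC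
        state_add[OF assms] state_diff[OF assms] state_scaleC[OF assms] state_one[OF assms])
  also have "\<dots> = \<phi> (star x * x) - of_real ((norm c)\<^sup>2)"
    by (simp add: state_star[OF assms] c_def[symmetric] cnj_mult_self)
  finally have "Re (\<phi> (star (x - scaleC c 1) * (x - scaleC c 1))) = Re (\<phi> (star x * x)) - (norm c)\<^sup>2"
    by simp
  then have "(norm c)\<^sup>2 \<le> Re (\<phi> (star x * x))"
    using state_nonneg[OF assms, of "x - scaleC c 1"] by linarith
  also have "\<dots> \<le> (norm x)\<^sup>2" by (rule state_star_mult_le[OF assms])
  finally show ?thesis unfolding c_def by (rule power2_le_imp_le) simp
qed

lemma bounded_linear_state: assumes "state \<phi>" shows "bounded_linear \<phi>"
  by (rule bounded_linear_intro[of _ 1])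
    (auto simp: state_add[OF assms] state_scaleR[OF assms] state_norm_le[OF assms])

text \<open>The degenerate case of Cauchy-Schwarz: if y is a null vector, adding multiples of y to x
  changes \<open>\<phi> (star x * x)\<close> linearly, and nonnegativity forces the slope to
  vanish.\<close>

lemma state_star_mult_zero:
  assumes "state \<phi>" and 0: "\<phi> (star y * y) = 0" shows "\<phi> (star x * y) = 0" "\<phi> (star y * x) = 0"
proof -
  define w where "w = \<phi> (star x * y)"
  have w': "\<phi> (star y * x) = cnj w"
    unfolding w_def state_star[OF assms(1), symmetric] by (simp add: star_mult star_star)
  have *: "0 \<le> Re (\<phi> (star x * x)) - 2 * t * (norm w)\<^sup>2" for t
  proof -
    define c where "c = - of_real t * cnj w"
    have "\<phi> (star (x + scaleC c y) * (x + scaleC c y)) = \<phi> (star x * x) + c * w + cnj c * cnj w"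
      by (simp add: star_add star_scaleC algebra_simps scaleC_mult_left scaleC_mult_right scaleC_scaleC
          state_add[OF assms(1)] state_scaleC[OF assms(1)] 0 w_def[symmetric] w')
    also have "\<dots> = \<phi> (star x * x) - of_real (2 * t * (norm w)\<^sup>2)"
      by (simp add: c_def mult.assoc cnj_mult_self)
    finally have "Re (\<phi> (star (x + scaleC c y) * (x + scaleC c y))) = Re (\<phi> (star x * x)) - 2 * t * (norm w)\<^sup>2"
      by simp
    then show ?thesis using state_nonneg[OF assms(1), of "x + scaleC c y"] by linarith
  qed
  have "norm w = 0"
  proof (rule ccontr)
    assume "norm w \<noteq> 0"
    then show False
      using *[of "(Re (\<phi> (star x * x)) + 1) / (2 * (norm w)\<^sup>2)"] by simp
  qed
  then show "\<phi> (star x * y) = 0" "\<phi> (star y * x) = 0" using w' by (auto simp: w_def)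
qed

lemma state_comp_hom:
  assumes "state \<phi>" "unital_star_hom F" shows "state (\<lambda>x. \<phi> (F x))"
proof -
  have "F (star x * x) = star (F x) * F x" for x using assms(2) by (simp add: unital_star_hom_def)
  then show ?thesis using assms by (simp add: state_def unital_star_hom_def)
qed

text \<open>A norming state of F x pulls back along F to a state, whose value at
  \<open>star x * x\<close> is at most the squared norm of x.\<close>

lemma unital_star_hom_norm_le:
  assumes "unital_star_hom F" shows "norm (F x) \<le> norm x"
proof -
  obtain \<phi> where \<phi>: "state \<phi>" "Re (\<phi> (star (F x) * F x)) \<ge> (norm (F x))\<^sup>2" using norming_state .
  have eq: "star (F x) * F x = F (star x * x)" using assms by (simp add: unital_star_hom_def)
  have "(norm (F x))\<^sup>2 \<le> Re (\<phi> (F (star x * x)))" using \<phi>(2) by (simp only: eq)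
  also have "\<dots> \<le> (norm x)\<^sup>2" by (rule state_star_mult_le[OF state_comp_hom[OF \<phi>(1) assms]])
  finally show ?thesis by (rule power2_le_imp_le) simp
qed

lemma unital_star_hom_scaleR: "unital_star_hom F \<Longrightarrow> F (scaleR r x) = scaleR r (F x)"
  by (simp add: unital_star_hom_def scaleR_scaleC)

lemma bounded_linear_hom: assumes "unital_star_hom F" shows "bounded_linear F"
  by (rule bounded_linear_intro[of _ 1])
    (use assms in \<open>auto simp: unital_star_hom_norm_le unital_star_hom_scaleR unital_star_hom_def\<close>)

lemma unital_star_hom_sum: "unital_star_hom F \<Longrightarrow> F (\<Sum>i\<in>I. f i) = (\<Sum>i\<in>I. F (f i))"
  by (metis bounded_linear_hom bounded_linear.linear linear_sum)

text \<open>If \<open>\<phi> (star y * y)\<close> is nonzero, compressing by y and dividing by this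
  number gives another state, which vanishes at d; otherwise y is a null vector of \<phi>.\<close>

lemma state_conjugate_eq_zero:
  assumes d: "\<And>\<phi>. state \<phi> \<Longrightarrow> \<phi> d = 0" and \<phi>: "state \<phi>"
  shows "\<phi> (star y * d * y) = 0"
proof (cases "\<phi> (star y * y) = 0")
  case True
  then show ?thesis using state_star_mult_zero(1)[OF \<phi> True, of "star (star y * d)"] by (simp add: star_star)
next
  case False
  define r where "r = Re (\<phi> (star y * y))"
  have r: "\<phi> (star y * y) = of_real r" using state_real[OF \<phi>] by (simp add: r_def complex_eq_iff)
  have r0: "r > 0" using False state_nonneg[OF \<phi>, of y] by (simp add: r r_def[symmetric])
  have "\<phi> (star y * (star x * x) * y) = \<phi> (star (x * y) * (x * y))" for x
    by (simp add: star_mult mult.assoc)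
  then have "state (\<lambda>x. \<phi> (star y * x * y) / of_real r)"
    unfolding state_def using r0 state_nonneg[OF \<phi>] state_real[OF \<phi>]
    by (simp add: distrib_left distrib_right state_add[OF \<phi>] add_divide_distrib state_scaleC[OF \<phi>]
        scaleC_mult_left scaleC_mult_right complex_is_Real_iff r)
  from d[OF this] show ?thesis using r0 by simp
qed

text \<open>By polarisation of the previous lemma, \<open>\<phi> (star d * d) = 0\<close>.\<close>

theorem states_separate:
  fixes a b :: "'a::cstar_algebra"
  assumes ab: "\<And>\<phi>. state \<phi> \<Longrightarrow> \<phi> a = \<phi> b" shows "a = b"
proof -
  define d where "d = a - b"
  have d: "\<phi> d = 0" if "state \<phi>" for \<phi> using ab[OF that] state_diff[OF that] by (simp add: d_def)
  obtain \<phi> where \<phi>: "state \<phi>" "Re (\<phi> (star d * d)) \<ge> (norm d)\<^sup>2" using norming_state .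
  have z: "\<phi> (star y * d * y) = 0" for y by (rule state_conjugate_eq_zero[OF _ \<phi>(1)]) (rule d)
  have e: "star (d + scaleC c 1) * d * (d + scaleC c 1)
      = star d * d * d + scaleC c (star d * d) + scaleC (cnj c) (d * d) + scaleC (cnj c * c) d" for c
    by (simp add: star_add star_scaleC algebra_simps scaleC_mult_left scaleC_mult_right scaleC_scaleC scaleC_add_right)
  have "\<phi> (star d * d * d) + c * \<phi> (star d * d) + cnj c * \<phi> (d * d) = 0" for c
    using z[of "d + scaleC c 1"] unfolding e
    by (simp add: state_add[OF \<phi>(1)] state_scaleC[OF \<phi>(1)] d[OF \<phi>(1)])
  \<comment> \<open>The values 0, 1 and i of c make the coefficients of 1, c and the conjugate of c
    vanish separately.\<close>
  from this[of 0] this[of 1] this[of \<i>] have "\<phi> (star d * d) = 0" by (simp add: complex_eq_iff)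
  then show ?thesis using \<phi>(2) by (simp add: d_def)
qed

section \<open>The minimal tensor product\<close>

definition psd :: "nat \<Rightarrow> (nat \<Rightarrow> nat \<Rightarrow> complex) \<Rightarrow> bool" where
  "psd n Q \<longleftrightarrow> (\<forall>i j. Q j i = cnj (Q i j)) \<and> (\<forall>c. 0 \<le> Re (\<Sum>i<n. \<Sum>j<n. cnj (c i) * c j * Q i j))"

text \<open>Schur's product theorem, by induction along Schur complements of \<open>Q\<close>.\<close>

lemma schur_product_aux:
  assumes "\<epsilon> > 0" "psd n P" "\<And>i j. Q j i = cnj (Q i j)"
    and "\<And>c. \<epsilon> * (\<Sum>i<n. (norm (c i))\<^sup>2) \<le> Re (\<Sum>i<n. \<Sum>j<n. cnj (c i) * c j * Q i j)"
  shows "0 \<le> Re (\<Sum>i<n. \<Sum>j<n. P i j * Q i j)"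
  using assms(2-)
proof (induct n arbitrary: Q)
  case 0
  show ?case by simp
next
  case (Suc n)
  note herm = Suc.prems(2)
  have split: "(\<Sum>i<Suc n. \<Sum>j<Suc n. f i j) = (\<Sum>i<n. \<Sum>j<n. f i j) + (\<Sum>i<n. f i n) + (\<Sum>j<n. f n j) + f n n"
    for f :: "nat \<Rightarrow> nat \<Rightarrow> complex" by (simp add: sum.distrib)
  define d where "d = Re (Q n n)"
  have "Im (Q n n) = 0" using herm[of n n] by (simp add: complex_eq_iff)
  then have Qnn: "Q n n = of_real d" by (simp add: d_def complex_eq_iff)
  \<comment> \<open>The coercivity bound at the last unit vector: the pivot is at least \<epsilon>,
    so it can be divided by. This is why the induction runs over strictly positive forms.\<close>
  have "\<epsilon> \<le> d" using Suc.prems(3)[of "\<lambda>i. if i = n then 1 else 0"]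
    by (simp add: d_def sum.delta if_distrib[of "\<lambda>x. _ * x"] if_distrib[of "\<lambda>x. x * _"] if_distrib[of cnj] if_distrib[of norm] if_distrib[of "\<lambda>x. x\<^sup>2"] cong: if_cong)
  then have d0: "d > 0" using assms(1) by linarith
  define Q' where "Q' i j = Q i j - Q i n * Q n j / of_real d" for i j
  have "psd n P" unfolding psd_def
  proof (intro conjI allI)
    show "P j i = cnj (P i j)" for i j using Suc.prems(1) unfolding psd_def by blast
    fix c :: "nat \<Rightarrow> complex"
    have "0 \<le> Re (\<Sum>i<Suc n. \<Sum>j<Suc n. cnj ((c(n := 0)) i) * (c(n := 0)) j * P i j)"
      using Suc.prems(1) unfolding psd_def by blast
    then show "0 \<le> Re (\<Sum>i<n. \<Sum>j<n. cnj (c i) * c j * P i j)" unfolding split by simp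
  qed
  moreover have "Q' j i = cnj (Q' i j)" for i j
    unfolding Q'_def by (simp add: herm[symmetric])
  moreover have "\<epsilon> * (\<Sum>i<n. (norm (c i))\<^sup>2) \<le> Re (\<Sum>i<n. \<Sum>j<n. cnj (c i) * c j * Q' i j)" for c
  proof -
    define w where "w = (\<Sum>j<n. c j * Q n j)"
    have cw: "(\<Sum>i<n. cnj (c i) * Q i n) = cnj w" unfolding w_def by (simp add: herm[symmetric])
    \<comment> \<open>The last coordinate that minimises the form of Q when the others are given by
      c; the minimum is the form of the Schur complement Q', which thus inherits the bound.\<close>
    define v where "v = - w / of_real d"
    define c' where "c' = c(n := v)"
    have c': "c' n = v" "\<And>i. i < n \<Longrightarrow> c' i = c i" by (auto simp: c'_def)
    have "\<epsilon> * (\<Sum>i<n. (norm (c i))\<^sup>2) \<le> \<epsilon> * (\<Sum>i<Suc n. (norm (c' i))\<^sup>2)"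
      using assms(1) by (simp add: c'_def)
    also have "\<dots> \<le> Re (\<Sum>i<Suc n. \<Sum>j<Suc n. cnj (c' i) * c' j * Q i j)" by (rule Suc.prems(3))
    also have "(\<Sum>i<Suc n. \<Sum>j<Suc n. cnj (c' i) * c' j * Q i j)
        = (\<Sum>i<n. \<Sum>j<n. cnj (c i) * c j * Q i j) + (\<Sum>i<n. cnj (c i) * Q i n) * v + cnj v * w + cnj v * v * of_real d"
      unfolding split w_def sum_distrib_left sum_distrib_right
      by (intro arg_cong2[of _ _ _ _ "(+)"] sum.cong refl) (simp_all add: c' Qnn mult_ac)
    also have "\<dots> = (\<Sum>i<n. \<Sum>j<n. cnj (c i) * c j * Q i j) - cnj w * w / of_real d"
      unfolding cw using d0 by (simp add: v_def)
    also have "cnj w * w = (\<Sum>i<n. \<Sum>j<n. cnj (c i) * c j * (Q i n * Q n j))"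
      unfolding cw[symmetric] unfolding w_def sum_product by (intro sum.cong refl) (simp add: mult_ac)
    also have "(\<Sum>i<n. \<Sum>j<n. cnj (c i) * c j * Q i j) - \<dots> / of_real d = (\<Sum>i<n. \<Sum>j<n. cnj (c i) * c j * Q' i j)"
      unfolding Q'_def sum_divide_distrib sum_subtractf[symmetric]
      by (intro sum.cong refl) (simp add: algebra_simps)
    finally show ?thesis .
  qed
  ultimately have IH: "0 \<le> Re (\<Sum>i<n. \<Sum>j<n. P i j * Q' i j)" by (rule Suc.hyps)
  have Q'n: "Q' i n = 0" "Q' n j = 0" for i j using d0 by (simp_all add: Q'_def Qnn)
  \<comment> \<open>Q is its Schur complement plus a rank one form. Against P the latter contributes
    the form of P at the vector \<open>Q n i\<close>, divided by the pivot.\<close>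
  have "(\<Sum>i<Suc n. \<Sum>j<Suc n. P i j * Q i j)
     = (\<Sum>i<Suc n. \<Sum>j<Suc n. P i j * Q' i j) + (\<Sum>i<Suc n. \<Sum>j<Suc n. cnj (Q n i) * Q n j * P i j) / of_real d"
    unfolding Q'_def herm[symmetric] sum_divide_distrib sum.distrib[symmetric]
    by (intro sum.cong refl) (simp add: algebra_simps)
  also have "(\<Sum>i<Suc n. \<Sum>j<Suc n. P i j * Q' i j) = (\<Sum>i<n. \<Sum>j<n. P i j * Q' i j)"
    unfolding split by (simp add: Q'n)
  finally have eq: "(\<Sum>i<Suc n. \<Sum>j<Suc n. P i j * Q i j)
     = (\<Sum>i<n. \<Sum>j<n. P i j * Q' i j) + (\<Sum>i<Suc n. \<Sum>j<Suc n. cnj (Q n i) * Q n j * P i j) / of_real d" .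
  have "0 \<le> Re (\<Sum>i<Suc n. \<Sum>j<Suc n. cnj (Q n i) * Q n j * P i j)"
    using Suc.prems(1) unfolding psd_def by blast
  then have "0 \<le> Re ((\<Sum>i<Suc n. \<Sum>j<Suc n. cnj (Q n i) * Q n j * P i j) / of_real d)"
    using d0 unfolding Re_divide_of_real by (rule divide_nonneg_pos)
  then show ?case unfolding eq plus_complex.sel using IH by linarith
qed

text \<open>Adding \<epsilon> times the identity makes Q strictly positive; then \<epsilon> tends to
  0.\<close>

lemma schur_product:
  assumes P: "psd n P" and Q: "psd n Q"
  shows "0 \<le> Re (\<Sum>i<n. \<Sum>j<n. P i j * Q i j)"
proof -
  define S where "S = Re (\<Sum>i<n. \<Sum>j<n. P i j * Q i j)"
  define D where "D = Re (\<Sum>i<n. P i i)"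
  have diag: "(\<Sum>i<n. \<Sum>j<n. f i j * (if i = j then x else 0)) = (\<Sum>i<n. f i i * x)"
    for f :: "nat \<Rightarrow> nat \<Rightarrow> complex" and x
  proof (rule sum.cong[OF refl])
    fix i assume i: "i \<in> {..<n}"
    have "(\<Sum>j<n. f i j * (if i = j then x else 0)) = (\<Sum>j<n. if j = i then f i j * x else 0)"
      by (rule sum.cong) auto
    also have "\<dots> = f i i * x" using i by (simp only: sum.delta finite_lessThan if_True)
    finally show "(\<Sum>j<n. f i j * (if i = j then x else 0)) = f i i * x" .
  qed
  have *: "0 \<le> S + \<epsilon> * D" if "\<epsilon> > 0" for \<epsilon>
  proof -
    define Q' where "Q' i j = Q i j + (if i = j then of_real \<epsilon> else 0)" for i j
    have "0 \<le> Re (\<Sum>i<n. \<Sum>j<n. P i j * Q' i j)"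
    proof (rule schur_product_aux[OF that P])
      show "Q' j i = cnj (Q' i j)" for i j
      proof -
        have "Q j i = cnj (Q i j)" using Q unfolding psd_def by blast
        then show ?thesis by (simp add: Q'_def)
      qed
      fix c
      have "(\<Sum>i<n. \<Sum>j<n. cnj (c i) * c j * Q' i j)
          = (\<Sum>i<n. \<Sum>j<n. cnj (c i) * c j * Q i j) + of_real (\<epsilon> * (\<Sum>i<n. (norm (c i))\<^sup>2))"
        unfolding Q'_def distrib_left sum.distrib diag
        by (simp add: sum_distrib_left cnj_mult_self mult_ac)
      moreover have "0 \<le> Re (\<Sum>i<n. \<Sum>j<n. cnj (c i) * c j * Q i j)" using Q unfolding psd_def by blast
      ultimately show "\<epsilon> * (\<Sum>i<n. (norm (c i))\<^sup>2) \<le> Re (\<Sum>i<n. \<Sum>j<n. cnj (c i) * c j * Q' i j)"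
        unfolding plus_complex.sel Re_complex_of_real by simp
    qed
    also have "(\<Sum>i<n. \<Sum>j<n. P i j * Q' i j) = (\<Sum>i<n. \<Sum>j<n. P i j * Q i j) + of_real \<epsilon> * (\<Sum>i<n. P i i)"
      unfolding Q'_def distrib_left sum.distrib diag by (simp add: sum_distrib_left mult_ac)
    finally show ?thesis by (simp add: S_def D_def)
  qed
  have "0 \<le> S"
  proof (rule ccontr)
    assume "\<not> 0 \<le> S"
    define m where "m = \<bar>D\<bar> + 1"
    have m: "m > 0" "D \<le> m" by (simp_all add: m_def)
    \<comment> \<open>With m a positive upper bound of D, this \<epsilon> makes S + \<epsilon> D at
      most S/2, which is negative.\<close>
    define e where "e = - S / (2 * m)"
    have e: "e > 0" "e * m = - S / 2" using m(1) \<open>\<not> 0 \<le> S\<close> by (simp_all add: e_def divide_neg_pos)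
    have "e * D \<le> e * m" using e(1) m(2) by (intro mult_left_mono) auto
    then show False using *[OF e(1)] e(2) \<open>\<not> 0 \<le> S\<close> by linarith
  qed
  then show ?thesis by (simp add: S_def)
qed

lemma psd_state: assumes "state \<phi>" shows "psd n (\<lambda>i j. \<phi> (star (a i) * a j))"
  unfolding psd_def
proof (intro conjI allI)
  show "\<phi> (star (a j) * a i) = cnj (\<phi> (star (a i) * a j))" for i j
    unfolding state_star[OF assms, symmetric] by (simp add: star_mult star_star)
  fix c :: "nat \<Rightarrow> complex"
  define y where "y = (\<Sum>i<n. scaleC (c i) (a i))"
  have "\<phi> (star y * y) = (\<Sum>i<n. \<Sum>j<n. cnj (c i) * c j * \<phi> (star (a i) * a j))"
    unfolding y_def star_sum sum_product
    by (simp add: state_sum[OF assms] star_scaleC scaleC_mult_left scaleC_mult_right scaleC_scaleC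
        state_scaleC[OF assms] mult_ac)
  then show "0 \<le> Re (\<Sum>i<n. \<Sum>j<n. cnj (c i) * c j * \<phi> (star (a i) * a j))"
    using state_nonneg[OF assms, of y] by simp
qed

section \<open>The minimal norm of a list of elementary tensors\<close>

text \<open>The inner product of x and y in the tensor product of the two GNS spaces, conjugate
  linear in x.\<close>

definition tform :: "('a::cstar_algebra \<Rightarrow> complex) \<Rightarrow> ('b::cstar_algebra \<Rightarrow> complex) \<Rightarrow> ('a \<times> 'b) list \<Rightarrow> ('a \<times> 'b) list \<Rightarrow> complex" where
  "tform \<phi> \<psi> x y = (\<Sum>(a, b)\<leftarrow>x. \<Sum>(c, d)\<leftarrow>y. \<phi> (star a * c) * \<psi> (star b * d))"

lemma product_state_append: "product_state \<phi> \<psi> (x @ y) = product_state \<phi> \<psi> x + product_state \<phi> \<psi> y"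
  by (simp add: product_state_def)

lemma alg_mult_Cons: "alg_mult ((a, b) # x) y = map (\<lambda>(c, d). (a * c, b * d)) y @ alg_mult x y"
  by (simp add: alg_mult_def case_prod_unfold o_def)

lemma product_state_star_mult: "product_state \<phi> \<psi> (alg_mult (alg_star x) y) = tform \<phi> \<psi> x y"
proof (induct x)
  case Nil
  then show ?case by (simp add: product_state_def alg_mult_def alg_star_def tform_def)
next
  case (Cons p x)
  then show ?case
    by (cases p) (simp add: alg_star_def alg_mult_Cons product_state_append tform_def,
        simp add: product_state_def case_prod_unfold o_def)
qed

text \<open>The value is the sum of all entries of the entrywise product of the two Gram matrices of
  the legs, so Schur's product theorem applies.\<close>

lemma tform_self_nonneg:
  assumes "state \<phi>" "state \<psi>" shows "0 \<le> Re (tform \<phi> \<psi> x x)"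
proof -
  have "tform \<phi> \<psi> x x = (\<Sum>i<length x. \<Sum>j<length x.
      \<phi> (star (fst (x ! i)) * fst (x ! j)) * \<psi> (star (snd (x ! i)) * snd (x ! j)))"
    by (simp add: tform_def sum_list_sum_nth case_prod_unfold atLeast0LessThan)
  then show ?thesis using schur_product[OF psd_state[OF assms(1)] psd_state[OF assms(2)]] by simp
qed

lemma tform_append:
  "tform \<phi> \<psi> (x @ y) z = tform \<phi> \<psi> x z + tform \<phi> \<psi> y z"
  "tform \<phi> \<psi> z (x @ y) = tform \<phi> \<psi> z x + tform \<phi> \<psi> z y"
  by (simp_all add: tform_def case_prod_unfold sum_list_addf)

text \<open>With s the root of the squared norm of a minus \<open>star a * a\<close>, the gap
  between the two sides is the form of y multiplied by s in the first leg.\<close>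

lemma tform_map_left:
  assumes "state \<phi>" "state \<psi>"
  shows "Re (tform \<phi> \<psi> (map (\<lambda>(c, d). (a * c, d)) y) (map (\<lambda>(c, d). (a * c, d)) y))
    \<le> (norm a)\<^sup>2 * Re (tform \<phi> \<psi> y y)"
proof -
  define r where "r = (norm a)\<^sup>2"
  have sx: "star (star a * a) = star a * a" by (simp add: star_mult star_star)
  have "positive (of_real r - star a * a)"
    unfolding r_def by (rule positive_diff_of_norm_le) (simp_all only: sx cstar_identity order_refl)
  then obtain s where s: "positive s" "s * s = of_real r - star a * a"
    using positive_sqrt by metis
  have ex: "star (s * c) * (s * c') = r *\<^sub>R (star c * c') - star (a * c) * (a * c')" for c c'
  proof -
    have "star (s * c) * (s * c') = star c * (s * s) * c'"
      by (simp add: star_mult positive_star[OF s(1)] mult.assoc)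
    then show ?thesis by (simp add: s(2) algebra_simps star_mult of_real_def)
  qed
  have "tform \<phi> \<psi> (map (\<lambda>(c, d). (s * c, d)) y) (map (\<lambda>(c, d). (s * c, d)) y)
    = of_real r * tform \<phi> \<psi> y y - tform \<phi> \<psi> (map (\<lambda>(c, d). (a * c, d)) y) (map (\<lambda>(c, d). (a * c, d)) y)"
    unfolding tform_def
    by (simp add: case_prod_unfold o_def ex state_diff[OF assms(1)] state_scaleR'[OF assms(1)] left_diff_distrib
        sum_list_subtractf sum_list_const_mult[symmetric] mult.assoc)
  then show ?thesis unfolding r_def[symmetric] using tform_self_nonneg[OF assms, of "map (\<lambda>(c, d). (s * c, d)) y"] by simp
qed

lemma tform_map_right:
  assumes "state \<phi>" "state \<psi>"
  shows "Re (tform \<phi> \<psi> (map (\<lambda>(c, d). (c, b * d)) y) (map (\<lambda>(c, d). (c, b * d)) y))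
    \<le> (norm b)\<^sup>2 * Re (tform \<phi> \<psi> y y)"
proof -
  have sw: "tform \<phi> \<psi> z z = tform \<psi> \<phi> (map prod.swap z) (map prod.swap z)" for z
    by (simp add: tform_def case_prod_unfold o_def mult.commute)
  show ?thesis unfolding sw
    using tform_map_left[OF assms(2,1), of b "map prod.swap y"] by (simp add: o_def case_prod_unfold prod.swap_def)
qed

text \<open>The parallelogram law together with positivity of the form at x - y; the minus sign is
  put on the first legs of y.\<close>

lemma tform_append_le:
  assumes "state \<phi>" "state \<psi>"
  shows "Re (tform \<phi> \<psi> (x @ y) (x @ y)) \<le> 2 * Re (tform \<phi> \<psi> x x) + 2 * Re (tform \<phi> \<psi> y y)"
proof -
  define y' where "y' = map (\<lambda>(c, d). (- c, d)) y"
  have m: "(\<Sum>x\<leftarrow>xs. - f x) = - (\<Sum>x\<leftarrow>xs. f x)" for xs :: "('a \<times> 'b) list" and f :: "_ \<Rightarrow> complex"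
    by (induct xs) auto
  have neg: "tform \<phi> \<psi> z y' = - tform \<phi> \<psi> z y" "tform \<phi> \<psi> y' z = - tform \<phi> \<psi> y z" for z
    by (simp_all add: tform_def y'_def case_prod_unfold o_def state_minus[OF assms(1)] m)
  have "0 \<le> Re (tform \<phi> \<psi> (x @ y') (x @ y'))" by (rule tform_self_nonneg[OF assms])
  then show ?thesis by (simp add: tform_append neg)
qed

text \<open>The supremum that defines \<open>min_norm\<close> is meaningful only for a bounded set;
  K bounds it uniformly in both states.\<close>

lemma tform_alg_mult_le:
  "\<exists>K. \<forall>\<phi> \<psi> y. state \<phi> \<and> state \<psi> \<longrightarrow> Re (tform \<phi> \<psi> (alg_mult x y) (alg_mult x y)) \<le> K * Re (tform \<phi> \<psi> y y)"
proof (induct x)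
  case Nil
  then show ?case by (auto simp: alg_mult_def tform_def intro!: exI[of _ 0])
next
  case (Cons p x)
  obtain a b where p: "p = (a, b)" by (cases p)
  obtain K where K: "state \<phi> \<Longrightarrow> state \<psi> \<Longrightarrow> Re (tform \<phi> \<psi> (alg_mult x y) (alg_mult x y)) \<le> K * Re (tform \<phi> \<psi> y y)" for \<phi> \<psi> y
    using Cons by blast
  have "Re (tform \<phi> \<psi> (alg_mult (p # x) y) (alg_mult (p # x) y)) \<le> (2 * ((norm a)\<^sup>2 * (norm b)\<^sup>2) + 2 * K) * Re (tform \<phi> \<psi> y y)"
    if st: "state \<phi>" "state \<psi>" for \<phi> \<psi> y
  proof -
    define z where "z = map (\<lambda>(c, d). (c, b * d)) y"
    have "map (\<lambda>(c, d). (a * c, b * d)) y = map (\<lambda>(c, d). (a * c, d)) z" by (simp add: z_def case_prod_unfold o_def)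
    then have "Re (tform \<phi> \<psi> (map (\<lambda>(c, d). (a * c, b * d)) y) (map (\<lambda>(c, d). (a * c, b * d)) y))
      \<le> (norm a)\<^sup>2 * Re (tform \<phi> \<psi> z z)" using tform_map_left[OF st, of a z] by simp
    also have "\<dots> \<le> (norm a)\<^sup>2 * ((norm b)\<^sup>2 * Re (tform \<phi> \<psi> y y))"
      unfolding z_def by (intro mult_left_mono tform_map_right[OF st]) simp
    finally show ?thesis
      using tform_append_le[OF st, of "map (\<lambda>(c, d). (a * c, b * d)) y" "alg_mult x y"] K[OF st, of y]
      by (simp add: p alg_mult_Cons algebra_simps)
  qed
  then show ?case by blast
qed

text \<open>The vector y = 1 \<otimes> 1 contributes the root of the form at x to the
  supremum.\<close>

lemma tform_le_min_norm:
  assumes st: "state \<phi>" "state \<psi>" shows "Re (tform \<phi> \<psi> x x) \<le> (min_norm x)\<^sup>2" "0 \<le> min_norm x"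
proof -
  define S where "S = {sqrt (Re (product_state \<phi> \<psi> (alg_mult (alg_star (alg_mult x y)) (alg_mult x y)))
      / Re (product_state \<phi> \<psi> (alg_mult (alg_star y) y))) | \<phi> \<psi> y.
     state \<phi> \<and> state \<psi> \<and> product_state \<phi> \<psi> (alg_mult (alg_star y) y) \<noteq> 0}"
  obtain K where K: "state \<phi> \<Longrightarrow> state \<psi> \<Longrightarrow> Re (tform \<phi> \<psi> (alg_mult x y) (alg_mult x y)) \<le> K * Re (tform \<phi> \<psi> y y)" for \<phi> \<psi> y
    using tform_alg_mult_le by blast
  have "bdd_above S"
  proof (rule bdd_aboveI)
    fix s assume "s \<in> S"
    then obtain \<phi> \<psi> y where s: "s = sqrt (Re (tform \<phi> \<psi> (alg_mult x y) (alg_mult x y)) / Re (tform \<phi> \<psi> y y))"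
      "state \<phi>" "state \<psi>" unfolding S_def product_state_star_mult by blast
    have "Re (tform \<phi> \<psi> (alg_mult x y) (alg_mult x y)) / Re (tform \<phi> \<psi> y y) \<le> \<bar>K\<bar>"
    proof (cases "Re (tform \<phi> \<psi> y y) = 0")
      case False
      then have pos: "Re (tform \<phi> \<psi> y y) > 0" using tform_self_nonneg[OF s(2,3), of y] by simp
      then have "K * Re (tform \<phi> \<psi> y y) \<le> \<bar>K\<bar> * Re (tform \<phi> \<psi> y y)" by (intro mult_right_mono) auto
      then show ?thesis unfolding pos_divide_le_eq[OF pos] using K[OF s(2,3), of y] by linarith
    qed simp
    then show "s \<le> sqrt \<bar>K\<bar>" unfolding s(1) by (rule real_sqrt_le_mono)
  qed
  have one: "tform \<phi> \<psi> [(1, 1)] [(1, 1)] = 1" by (simp add: tform_def state_one st)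
  have xm: "alg_mult x [(1, 1)] = x" by (induct x) (auto simp: alg_mult_Cons alg_mult_def)
  have "sqrt (Re (tform \<phi> \<psi> x x)) \<in> S"
    unfolding S_def product_state_star_mult using st one xm
    by (intro CollectI exI[of _ \<phi>] exI[of _ \<psi>] exI[of _ "[(1, 1)]"]) simp
  then have "sqrt (Re (tform \<phi> \<psi> x x)) \<le> Sup S" by (rule cSup_upper) fact
  then have "sqrt (Re (tform \<phi> \<psi> x x)) \<le> min_norm x" by (simp add: min_norm_def S_def)
  then have *: "sqrt (Re (tform \<phi> \<psi> x x)) \<le> min_norm x" by (simp add: min_norm_def S_def)
  moreover have "0 \<le> sqrt (Re (tform \<phi> \<psi> x x))" by (simp add: tform_self_nonneg[OF st])
  ultimately show "0 \<le> min_norm x" by linarith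
  from * have "(sqrt (Re (tform \<phi> \<psi> x x)))\<^sup>2 \<le> (min_norm x)\<^sup>2"
    by (intro power_mono) (simp_all add: tform_self_nonneg[OF st])
  then show "Re (tform \<phi> \<psi> x x) \<le> (min_norm x)\<^sup>2" by (simp add: tform_self_nonneg[OF st])
qed

lemma tform_self_real:
  assumes "state \<phi>" "state \<psi>" shows "Im (tform \<phi> \<psi> x x) = 0"
proof -
  define P where "P i j = \<phi> (star (fst (x ! i)) * fst (x ! j)) * \<psi> (star (snd (x ! i)) * snd (x ! j))" for i j
  have P: "tform \<phi> \<psi> x x = (\<Sum>i<length x. \<Sum>j<length x. P i j)"
    by (simp add: tform_def sum_list_sum_nth case_prod_unfold atLeast0LessThan P_def)
  have h: "P j i = cnj (P i j)" for i j
    unfolding P_def complex_cnj_mult state_star[OF assms(1), symmetric] state_star[OF assms(2), symmetric]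
    by (simp add: star_mult star_star)
  have "cnj (\<Sum>i<length x. \<Sum>j<length x. P i j) = (\<Sum>i<length x. \<Sum>j<length x. P j i)"
    by (simp add: h[symmetric])
  also have "\<dots> = (\<Sum>i<length x. \<Sum>j<length x. P i j)" by (rule sum.swap)
  finally show ?thesis unfolding P by (simp only: complex_eq_iff cnj.sel) linarith
qed

text \<open>With a the sliced element, a \<otimes> 1 is the orthogonal projection of x onto A
  \<otimes> 1 for the product state of \<phi> and \<psi>. So the form at x exceeds
  \<open>\<phi> (star a * a)\<close> by the form at x - a \<otimes> 1, and choosing \<phi> norming
  for a compares norm a with the minimal norm.\<close>

lemma slice_list_le:
  fixes x :: "('a::cstar_algebra \<times> 'b::cstar_algebra) list"
  assumes \<psi>: "state \<psi>"
  shows "norm (\<Sum>(a, b)\<leftarrow>x. scaleC (\<psi> b) a) \<le> min_norm x"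
proof -
  define a where "a = (\<Sum>(a, b)\<leftarrow>x. scaleC (\<psi> b) a)"
  obtain \<phi> where \<phi>: "state \<phi>" "Re (\<phi> (star a * a)) \<ge> (norm a)\<^sup>2" using norming_state .
  have r: "\<phi> (c * (\<Sum>(a, b)\<leftarrow>y. scaleC (\<psi> b) a)) = (\<Sum>(a, b)\<leftarrow>y. \<phi> (c * a) * \<psi> b)" for c and y :: "('a \<times> 'b) list"
    by (induct y) (auto simp: state_zero[OF \<phi>(1)] distrib_left state_add[OF \<phi>(1)] scaleC_mult_right state_scaleC[OF \<phi>(1)])
  have l: "\<phi> (star (\<Sum>(a, b)\<leftarrow>y. scaleC (\<psi> b) a) * c) = (\<Sum>(a, b)\<leftarrow>y. \<phi> (star a * c) * \<psi> (star b))" for c and y :: "('a \<times> 'b) list"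
    by (induct y) (auto simp: state_zero[OF \<phi>(1)] distrib_right state_add[OF \<phi>(1)] star_add star_scaleC
        scaleC_mult_left state_scaleC[OF \<phi>(1)] state_star[OF \<psi>])
  have "tform \<phi> \<psi> x [(a, 1)] = \<phi> (star a * a)" "tform \<phi> \<psi> [(a, 1)] x = \<phi> (star a * a)"
    "tform \<phi> \<psi> [(a, 1)] [(a, 1)] = \<phi> (star a * a)"
    using r[of "star a" x] l[of x a] unfolding a_def[symmetric] by (simp_all add: tform_def state_one[OF \<psi>])
  moreover have neg: "tform \<phi> \<psi> z [(- a, 1)] = - tform \<phi> \<psi> z [(a, 1)]" "tform \<phi> \<psi> [(- a, 1)] z = - tform \<phi> \<psi> [(a, 1)] z" for z
    by (induct z) (auto simp: tform_def state_minus[OF \<phi>(1)])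
  ultimately have "tform \<phi> \<psi> (x @ [(- a, 1)]) (x @ [(- a, 1)]) = tform \<phi> \<psi> x x - \<phi> (star a * a)"
    by (simp only: tform_append neg) simp
  then have "Re (\<phi> (star a * a)) \<le> Re (tform \<phi> \<psi> x x)"
    using tform_self_nonneg[OF \<phi>(1) \<psi>, of "x @ [(- a, 1)]"] by simp
  then have "(norm a)\<^sup>2 \<le> (min_norm x)\<^sup>2"
    using \<phi>(2) tform_le_min_norm(1)[OF \<phi>(1) \<psi>, of x] by linarith
  then show ?thesis unfolding a_def by (rule power2_le_imp_le) (rule tform_le_min_norm(2)[OF \<phi>(1) \<psi>])
qed

section \<open>Density arguments for bounded linear maps\<close>

lemma continuous_eq_on_dense:
  fixes f g :: "'a::topological_space \<Rightarrow> 'b::t2_space"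
  assumes "continuous_on UNIV f" "continuous_on UNIV g" "closure S = UNIV" "\<And>x. x \<in> S \<Longrightarrow> f x = g x"
  shows "f z = g z"
proof -
  have "closure S \<subseteq> {x. f x = g x}"
    by (rule closure_minimal) (use assms closed_Collect_eq in auto)
  then show ?thesis using assms(3) by auto
qed

lemma bounded_linear_eq_on_dense:
  assumes "bounded_linear f" "bounded_linear g" "closure (span S) = UNIV" "\<And>x. x \<in> S \<Longrightarrow> f x = g x"
  shows "f z = g z"
proof (rule continuous_eq_on_dense[OF _ _ assms(3)])
  show "continuous_on UNIV f" "continuous_on UNIV g"
    by (rule bounded_linear.continuous_on[OF assms(1) continuous_on_id] bounded_linear.continuous_on[OF assms(2) continuous_on_id])+
  show "f x = g x" if "x \<in> span S" for x
    using that assms linear_eq_on_span[of f g S] by (auto simp: bounded_linear.linear)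
qed

lemma bounded_linear_extension:
  fixes f :: "'a::real_normed_vector \<Rightarrow> 'b::banach"
  assumes X: "\<And>x y. x \<in> X \<Longrightarrow> y \<in> X \<Longrightarrow> x + y \<in> X" "closure X = UNIV" "\<And>c x. x \<in> X \<Longrightarrow> c *\<^sub>R x \<in> X"
    and f: "\<And>x y. x \<in> X \<Longrightarrow> y \<in> X \<Longrightarrow> f (x + y) = f x + f y" "\<And>c x. x \<in> X \<Longrightarrow> f (c *\<^sub>R x) = c *\<^sub>R f x"
      "\<And>x. x \<in> X \<Longrightarrow> norm (f x) \<le> norm x"
  shows "\<exists>g. bounded_linear g \<and> (\<forall>x\<in>X. g x = f x)"
proof -
  have sub: "x - y \<in> X" if "x \<in> X" "y \<in> X" for x y using X(1)[OF that(1) X(3)[OF that(2), of "-1"]] by simp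
  have d: "dist (f x) (f y) \<le> dist x y" if "x \<in> X" "y \<in> X" for x y
  proof -
    have "f x - f y = f (x - y)" using f(1)[OF sub[OF that] that(2)] by simp
    then show ?thesis using f(3)[OF sub[OF that]] by (simp add: dist_norm)
  qed
  have "uniformly_continuous_on X f" unfolding uniformly_continuous_on_def
    using d by (meson le_less_trans)
  then obtain g where g: "uniformly_continuous_on (closure X) g" "\<And>x. x \<in> X \<Longrightarrow> f x = g x"
    using uniformly_continuous_on_extension_on_closure by metis
  have cg: "continuous_on UNIV g" using uniformly_continuous_imp_continuous[OF g(1)] X(2) by simp
  have cg': "continuous_on UNIV (\<lambda>x. g (h x))" if "continuous_on UNIV h" for h :: "'a \<Rightarrow> 'a"
    using continuous_on_compose2[OF cg that] by simp
  have "g (x + y) = g x + g y" for x y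
  proof -
    \<comment> \<open>Additivity passes from X to its closure in one variable at a time.\<close>
    have c: "continuous_on UNIV (\<lambda>x. g (x + y))" "continuous_on UNIV (\<lambda>y. g (x + y))" for x y
      by (rule cg', intro continuous_intros)+
    have c': "continuous_on UNIV (\<lambda>x. g x + g y)" "continuous_on UNIV (\<lambda>y. g x + g y)" for x y
      by (intro continuous_on_add continuous_on_const cg)+
    have *: "g (x + y) = g x + g y" if y: "y \<in> X" for x y
      by (rule continuous_eq_on_dense[OF c(1) c'(1) X(2)]) (simp add: g(2)[symmetric] f(1) X(1) y)
    show ?thesis
      by (rule continuous_eq_on_dense[OF c(2) c'(2) X(2)]) (rule *)
  qed
  moreover have "g (c *\<^sub>R x) = c *\<^sub>R g x" for c x
    by (rule continuous_eq_on_dense[where f = "\<lambda>x. g (c *\<^sub>R x)" and g = "\<lambda>x. c *\<^sub>R g x", OF _ _ X(2)])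
      (simp_all add: g(2)[symmetric] f(2) X(3) continuous_on_scaleR cg cg' continuous_on_const continuous_on_id)
  moreover have "norm (g x) \<le> norm x * 1" for x
  proof -
    have "closure X \<subseteq> {x. norm (g x) \<le> norm x}"
      by (rule closure_minimal) (use f(3) g(2) in \<open>auto intro!: closed_Collect_le continuous_intros cg\<close>)
    then show ?thesis using X(2) by auto
  qed
  ultimately have "bounded_linear g" by (rule bounded_linear_intro)
  then show ?thesis using g(2) by auto
qed

section \<open>Slice maps on the minimal tensor product\<close>

locale min_tensor =
  fixes t :: "'a::cstar_algebra \<Rightarrow> 'b::cstar_algebra \<Rightarrow> 'c::cstar_algebra"
  assumes is_min_tensor: "is_min_tensor t"
begin

lemma t_add: "t (a + a') b = t a b + t a' b" "t a (b + b') = t a b + t a b'"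
  and t_scaleC: "t (scaleC c a) b = scaleC c (t a b)" "t a (scaleC c b) = scaleC c (t a b)"
  and t_mult: "t a b * t a' b' = t (a * a') (b * b')"
  and t_star: "star (t a b) = t (star a) (star b)"
  and t_norm: "norm (\<Sum>(a, b)\<leftarrow>x. t a b) = min_norm x"
  and t_dense: "closure (span {t a b | a b. True}) = UNIV"
  using is_min_tensor by (simp_all add: is_min_tensor_def)

lemma t_scaleR: "t (r *\<^sub>R a) b = r *\<^sub>R t a b" "t a (r *\<^sub>R b) = r *\<^sub>R t a b"
  by (simp_all add: scaleR_scaleC t_scaleC)

lemma t_zero [simp]: "t 0 b = 0" "t a 0 = 0"
  using t_scaleR(1)[where r = 0 and a = a and b = b] t_scaleR(2)[where r = 0 and a = a and b = b] by simp_all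

lemma t_sum: "t (\<Sum>i\<in>I. f i) b = (\<Sum>i\<in>I. t (f i) b)" "t a (\<Sum>i\<in>I. g i) = (\<Sum>i\<in>I. t a (g i))"
  by (induct I rule: infinite_finite_induct) (auto simp: t_add)

definition telem :: "('a \<times> 'b) list \<Rightarrow> 'c" where "telem x = (\<Sum>(a, b)\<leftarrow>x. t a b)"

lemma telem_simps: "telem [] = 0" "telem ((a, b) # x) = t a b + telem x" "telem (x @ y) = telem x + telem y"
  by (simp_all add: telem_def)

lemma telem_scaleR: "telem (map (\<lambda>(a, b). (r *\<^sub>R a, b)) x) = r *\<^sub>R telem x"
  by (induct x) (auto simp: telem_simps t_scaleR scaleR_add_right)

lemma range_telem_add: "x \<in> range telem \<Longrightarrow> y \<in> range telem \<Longrightarrow> x + y \<in> range telem"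
  by (auto simp: telem_simps(3)[symmetric])

lemma range_telem_scaleR: "x \<in> range telem \<Longrightarrow> c *\<^sub>R x \<in> range telem"
  by (auto simp: telem_scaleR[symmetric])

lemma closure_range_telem: "closure (range telem) = UNIV"
proof -
  have "span {t a b | a b. True} \<subseteq> range telem"
  proof
    fix z assume "z \<in> span {t a b | a b. True}"
    then show "z \<in> range telem"
    proof (induct rule: span_induct_alt)
      case base
      show ?case using telem_simps(1) by (metis rangeI)
    next
      case (step c x y)
      then have "x \<in> range telem" by (auto intro!: image_eqI[of _ _ "[(_, _)]"] simp: telem_simps)
      then show ?case using step by (intro range_telem_add range_telem_scaleR)
    qed
  qed
  then have "closure (span {t a b | a b. True}) \<subseteq> closure (range telem)" by (rule closure_mono)
  then show ?thesis unfolding t_dense by blast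
qed

text \<open>Multiplication by 1 \<otimes> 1 fixes the elementary tensors, hence by density
  everything, including the unit.\<close>

lemma t_one: "t 1 1 = 1"
proof -
  have "t 1 1 * 1 = 1 * (1::'c)"
    by (rule bounded_linear_eq_on_dense[OF _ _ t_dense, where f = "\<lambda>z. t 1 1 * z" and g = "\<lambda>z. 1 * z"])
      (auto intro: bounded_linear_mult_right simp: t_mult)
  then show ?thesis by simp
qed

lemma telem_star_mult: "star (telem x) * telem y = telem (alg_mult (alg_star x) y)"
proof -
  have s: "star (telem x) = telem (alg_star x)" for x
    by (induct x) (auto simp: telem_simps alg_star_def star_add t_star)
  have m: "t a b * telem y = telem (map (\<lambda>(c, d). (a * c, b * d)) y)" for a b y
    by (induct y) (auto simp: telem_simps distrib_left t_mult)
  have "telem x * telem y = telem (alg_mult x y)" for x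
    by (induct x) (auto simp: telem_simps alg_mult_Cons distrib_right m, simp add: alg_mult_def telem_simps)
  then show ?thesis by (simp add: s)
qed

text \<open>On sums of elementary tensors the map is forced, and \<open>slice_list_le\<close> makes
  it contractive. Contractivity gives both independence of the list chosen to represent an element
  and the extension to the completion.\<close>

lemma slice_exists:
  assumes \<psi>: "state \<psi>"
  shows "\<exists>R. bounded_linear R \<and> (\<forall>a b. R (t a b) = scaleC (\<psi> b) a)"
proof -
  define sl where "sl x = (\<Sum>(a, b)\<leftarrow>x. scaleC (\<psi> b) a)" for x :: "('a \<times> 'b) list"
  have sl: "norm (sl x) \<le> norm (telem x)" for x
    unfolding sl_def telem_def t_norm by (rule slice_list_le[OF \<psi>])
  have sl_app: "sl (x @ y) = sl x + sl y" for x y by (simp add: sl_def)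
  have sl_scale: "sl (map (\<lambda>(a, b). (r *\<^sub>R a, b)) x) = r *\<^sub>R sl x" for r x
    by (induct x) (auto simp: sl_def scaleR_scaleC scaleC_scaleC scaleC_add_right mult.commute)
  have wd: "sl x = sl y" if "telem x = telem y" for x y
  proof -
    have "norm (sl (x @ map (\<lambda>(a, b). ((-1) *\<^sub>R a, b)) y)) \<le> 0"
      using sl[of "x @ map (\<lambda>(a, b). ((-1) *\<^sub>R a, b)) y"] that unfolding telem_simps telem_scaleR by simp
    then show ?thesis unfolding sl_app sl_scale by simp
  qed
  define f where "f z = sl (SOME x. telem x = z)" for z
  have f: "f (telem x) = sl x" for x
    unfolding f_def by (rule wd) (rule someI[of "\<lambda>y. telem y = telem x"], simp)
  have "\<exists>g. bounded_linear g \<and> (\<forall>z\<in>range telem. g z = f z)"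
  proof (rule bounded_linear_extension[OF range_telem_add closure_range_telem range_telem_scaleR])
    fix x y assume "x \<in> range telem" "y \<in> range telem"
    then show "f (x + y) = f x + f y" by (auto simp: telem_simps(3)[symmetric] f sl_app)
  next
    fix c x assume "x \<in> range telem"
    then show "f (c *\<^sub>R x) = c *\<^sub>R f x" by (auto simp: telem_scaleR[symmetric] f sl_scale)
  next
    fix x assume "x \<in> range telem"
    then show "norm (f x) \<le> norm x" by (auto simp: f sl)
  qed
  then obtain g where g: "bounded_linear g" "\<And>z. z \<in> range telem \<Longrightarrow> g z = f z" by blast
  have "g (t a b) = scaleC (\<psi> b) a" for a b
  proof -
    have "t a b = telem [(a, b)]" by (simp add: telem_def)
    then show ?thesis using g(2)[of "telem [(a, b)]"] f[of "[(a, b)]"] by (simp add: sl_def)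
  qed
  then show ?thesis using g(1) by blast
qed

text \<open>The slice map id \<otimes> \<psi>; for a state \<psi> it is by density the only bounded
  linear map with these values.\<close>

definition slice :: "('b \<Rightarrow> complex) \<Rightarrow> 'c \<Rightarrow> 'a" where
  "slice \<psi> = (SOME R. bounded_linear R \<and> (\<forall>a b. R (t a b) = scaleC (\<psi> b) a))"

lemma bounded_linear_slice: "state \<psi> \<Longrightarrow> bounded_linear (slice \<psi>)"
  and slice_t: "state \<psi> \<Longrightarrow> slice \<psi> (t a b) = scaleC (\<psi> b) a"
  unfolding slice_def using someI_ex[OF slice_exists] by blast+

lemma tensor_eqI:
  assumes "bounded_linear f" "bounded_linear g" "\<And>a b. f (t a b) = g (t a b)"
  shows "f z = g z"
  by (rule bounded_linear_eq_on_dense[OF assms(1,2) t_dense]) (use assms(3) in auto)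

lemma slice_scaleC: "state \<psi> \<Longrightarrow> slice \<psi> (scaleC c z) = scaleC c (slice \<psi> z)"
  by (rule tensor_eqI)
    (auto intro!: bounded_linear_compose[OF bounded_linear_slice bounded_linear_scaleC]
      bounded_linear_compose[OF bounded_linear_scaleC bounded_linear_slice]
      simp: t_scaleC(1)[symmetric] slice_t scaleC_scaleC mult.commute)

lemma slice_mult_right: "state \<psi> \<Longrightarrow> slice \<psi> (z * t a 1) = slice \<psi> z * a"
  by (rule tensor_eqI)
    (auto intro!: bounded_linear_compose[OF bounded_linear_slice bounded_linear_mult_left]
      bounded_linear_compose[OF bounded_linear_mult_left bounded_linear_slice]
      simp: t_mult slice_t scaleC_mult_left)

lemma slice_mult_left: "state \<psi> \<Longrightarrow> slice \<psi> (t a 1 * z) = a * slice \<psi> z"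
  by (rule tensor_eqI)
    (auto intro!: bounded_linear_compose[OF bounded_linear_slice bounded_linear_mult_right]
      bounded_linear_compose[OF bounded_linear_mult_right bounded_linear_slice]
      simp: t_mult slice_t scaleC_mult_right)

lemma slice_one: "state \<psi> \<Longrightarrow> slice \<psi> 1 = 1"
  using slice_t[of \<psi> 1 1] by (simp add: t_one state_one)

lemma slice_telem: "state \<psi> \<Longrightarrow> state \<phi> \<Longrightarrow> \<phi> (slice \<psi> (telem x)) = product_state \<phi> \<psi> x"
proof (induct x)
  case Nil
  then show ?case by (simp add: telem_simps product_state_def linear_0 bounded_linear.linear[OF bounded_linear_slice] state_zero)
next
  case (Cons p x)
  then show ?case by (cases p) (simp add: telem_simps product_state_def state_add state_scaleC slice_t
      linear_add bounded_linear.linear[OF bounded_linear_slice])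
qed

text \<open>This functional is the product state \<phi> \<otimes> \<psi>. Positivity holds on the
  dense image of the lists by Schur's product theorem and persists in the limit.\<close>

lemma state_slice:
  assumes \<phi>: "state \<phi>" and \<psi>: "state \<psi>" shows "state (\<lambda>z. \<phi> (slice \<psi> z))"
proof -
  let ?f = "\<lambda>z. \<phi> (slice \<psi> z)"
  have bl: "bounded_linear ?f" by (rule bounded_linear_compose[OF bounded_linear_state[OF \<phi>] bounded_linear_slice[OF \<psi>]])
  have c: "continuous_on UNIV (\<lambda>z. ?f (star z * z))"
    by (intro bounded_linear.continuous_on[OF bl] continuous_on_mult bounded_linear.continuous_on[OF bounded_linear_star] continuous_on_id)
  have "closure (range telem) \<subseteq> {z. 0 \<le> Re (?f (star z * z)) \<and> Im (?f (star z * z)) = 0}"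
  proof (rule closure_minimal)
    show "closed {z. 0 \<le> Re (?f (star z * z)) \<and> Im (?f (star z * z)) = 0}"
      by (intro closed_Collect_conj closed_Collect_le closed_Collect_eq continuous_on_const continuous_on_Re continuous_on_Im c)
    show "range telem \<subseteq> {z. 0 \<le> Re (?f (star z * z)) \<and> Im (?f (star z * z)) = 0}"
      by (auto simp: telem_star_mult slice_telem[OF \<psi> \<phi>] product_state_star_mult tform_self_nonneg[OF \<phi> \<psi>] tform_self_real[OF \<phi> \<psi>])
  qed
  then have "0 \<le> Re (?f (star z * z)) \<and> Im (?f (star z * z)) = 0" for z using closure_range_telem by auto
  then show ?thesis unfolding state_def
    by (auto simp: linear_add[OF bounded_linear.linear[OF bl]] slice_scaleC[OF \<psi>] state_scaleC[OF \<phi>]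
        complex_is_Real_iff slice_one[OF \<psi>] state_one[OF \<phi>])
qed

end

context min_tensor
begin

text \<open>The map b \<mapsto> 1 \<otimes> b is a unital star homomorphism, hence contractive; then
  multiply by a \<otimes> 1.\<close>

lemma bounded_linear_t_right: "bounded_linear (t a)"
proof -
  have "unital_star_hom (t 1)"
    by (simp add: unital_star_hom_def t_add t_scaleC t_mult t_star t_one)
  then have "bounded_linear (\<lambda>b. t a 1 * t 1 b)"
    by (intro bounded_linear_const_mult bounded_linear_hom)
  then show ?thesis by (simp add: t_mult)
qed

lemma slice_star: assumes "state \<psi>" shows "slice \<psi> (star z) = star (slice \<psi> z)"
proof (rule tensor_eqI)
  note bl = bounded_linear_slice[OF assms]
  show "bounded_linear (\<lambda>z. slice \<psi> (star z))" "bounded_linear (\<lambda>z. star (slice \<psi> z))"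
    by (rule bounded_linear_compose[OF bl bounded_linear_star] bounded_linear_compose[OF bounded_linear_star bl])+
  show "slice \<psi> (star (t a b)) = star (slice \<psi> (t a b))" for a b
    by (simp add: t_star slice_t[OF assms] star_scaleC state_star[OF assms])
qed

lemma slice_convex:
  assumes "state \<phi>" "state \<psi>" "state \<theta>" "\<And>x. \<theta> x = of_real c * \<phi> x + of_real d * \<psi> x"
  shows "slice \<theta> z = c *\<^sub>R slice \<phi> z + d *\<^sub>R slice \<psi> z"
proof (rule tensor_eqI)
  show "bounded_linear (slice \<theta>)" "bounded_linear (\<lambda>z. c *\<^sub>R slice \<phi> z + d *\<^sub>R slice \<psi> z)"
    using assms by (auto intro!: bounded_linear_add bounded_linear_const_scaleR bounded_linear_slice)
  show "slice \<theta> (t a b) = c *\<^sub>R slice \<phi> (t a b) + d *\<^sub>R slice \<psi> (t a b)" for a b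
    by (simp add: slice_t assms scaleC_add_left scaleR_scaleC scaleC_scaleC)
qed

end

section \<open>Exchange of the tensor legs\<close>

definition min_norm_set :: "('a::cstar_algebra \<times> 'b::cstar_algebra) list \<Rightarrow> real set" where
  "min_norm_set x = {sqrt (Re (tform \<phi> \<psi> (alg_mult x y) (alg_mult x y)) / Re (tform \<phi> \<psi> y y)) | \<phi> \<psi> y.
     state \<phi> \<and> state \<psi> \<and> tform \<phi> \<psi> y y \<noteq> 0}"

lemma min_norm_set_swap_subset:
  fixes x :: "('a::cstar_algebra \<times> 'b::cstar_algebra) list"
  shows "min_norm_set (map prod.swap x) \<subseteq> min_norm_set x"
proof
  have tf: "tform \<psi> \<phi> (map prod.swap x) (map prod.swap y) = tform \<phi> \<psi> x y"
    for \<phi> :: "'b \<Rightarrow> complex" and \<psi> :: "'a \<Rightarrow> complex" and x y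
    by (simp add: tform_def case_prod_unfold o_def mult.commute)
  have am: "alg_mult x (map prod.swap y) = map prod.swap (alg_mult (map prod.swap x) y)"
    for x :: "('a \<times> 'b) list" and y
  proof (induct x)
    case (Cons p x)
    then show ?case by (cases p) (simp add: alg_mult_Cons case_prod_unfold o_def)
  qed (simp add: alg_mult_def)
  fix s assume "s \<in> min_norm_set (map prod.swap x)"
  then obtain \<phi> \<psi> y where y: "s = sqrt (Re (tform \<phi> \<psi> (alg_mult (map prod.swap x) y) (alg_mult (map prod.swap x) y)) / Re (tform \<phi> \<psi> y y))"
    "state \<phi>" "state \<psi>" "tform \<phi> \<psi> y y \<noteq> 0" unfolding min_norm_set_def by blast
  show "s \<in> min_norm_set x" unfolding min_norm_set_def
    using y by (intro CollectI exI[of _ \<psi>] exI[of _ \<phi>] exI[of _ "map prod.swap y"]) (simp add: am tf)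
qed

lemma min_norm_swap: "min_norm (map prod.swap x) = min_norm x"
proof -
  have mn: "min_norm x = Sup (min_norm_set x)" for x :: "('d::cstar_algebra \<times> 'e::cstar_algebra) list"
    by (simp add: min_norm_def min_norm_set_def product_state_star_mult)
  have mn': "min_norm x = Sup (min_norm_set x)" for x :: "('e::cstar_algebra \<times> 'd::cstar_algebra) list"
    by (simp add: min_norm_def min_norm_set_def product_state_star_mult)
  have "min_norm_set (map prod.swap x) = min_norm_set x"
    using min_norm_set_swap_subset[of x] min_norm_set_swap_subset[of "map prod.swap x"] by simp
  then show ?thesis by (simp add: mn mn')
qed

lemma is_min_tensor_flip:
  assumes "is_min_tensor t" shows "is_min_tensor (\<lambda>b a. t a b)"
proof -
  have n: "norm (\<Sum>(b, a)\<leftarrow>x. t a b) = min_norm x" for x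
  proof -
    have "(\<Sum>(b, a)\<leftarrow>x. t a b) = (\<Sum>(a, b)\<leftarrow>map prod.swap x. t a b)" by (induct x) auto
    moreover have "norm (\<Sum>(a, b)\<leftarrow>map prod.swap x. t a b) = min_norm (map prod.swap x)"
      using assms unfolding is_min_tensor_def by blast
    ultimately show ?thesis by (simp only: min_norm_swap)
  qed
  have "{t a b | b a. True} = {t a b | a b. True}" by blast
  then show ?thesis using assms n unfolding is_min_tensor_def by simp
qed

text \<open>The opposite quantum group: algebras and comultiplication stay, while elementary tensors
  are read backwards. Every statement about one leg thereby acquires its mirror image.\<close>

definition flip_group :: "('a, 'b, 'c) quantum_group \<Rightarrow> ('a, 'b, 'c) quantum_group" where
  "flip_group G = \<lparr>tensor = (\<lambda>a b. tensor G b a), tensor_l = (\<lambda>z a. tensor_r G a z),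
     tensor_r = (\<lambda>a z. tensor_l G z a), comult = comult G\<rparr>"

lemma flip_group_simps [simp]:
  "tensor (flip_group G) = (\<lambda>a b. tensor G b a)" "tensor_l (flip_group G) = (\<lambda>z a. tensor_r G a z)"
  "tensor_r (flip_group G) = (\<lambda>a z. tensor_l G z a)" "comult (flip_group G) = comult G"
  by (simp_all add: flip_group_def)

lemma compact_quantum_group_flip:
  assumes G: "compact_quantum_group G" shows "compact_quantum_group (flip_group G)"
proof -
  have "coassociative (flip_group G)"
    using G unfolding compact_quantum_group_def coassociative_def flip_group_simps by metis
  then show ?thesis using G unfolding compact_quantum_group_def flip_group_simps
    by (auto intro: is_min_tensor_flip)
qed

section \<open>Slices and convolution on a compact quantum group\<close>

locale cqg =
  fixes G :: "('a::cstar_algebra, 'b::cstar_algebra, 'c::cstar_algebra) quantum_group"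
  assumes cqg: "compact_quantum_group G"

sublocale cqg \<subseteq> T: min_tensor "tensor G"
  using cqg by unfold_locales (simp add: compact_quantum_group_def)

text \<open>With the legs exchanged, \<open>F.slice \<phi>\<close> is \<phi> \<otimes> id on the
  same algebra on which \<open>T.slice \<phi>\<close> is id \<otimes> \<phi>.\<close>

sublocale cqg \<subseteq> F: min_tensor "\<lambda>a b. tensor G b a"
  using cqg by unfold_locales (simp add: compact_quantum_group_def is_min_tensor_flip)

sublocale cqg \<subseteq> L: min_tensor "tensor_l G"
  using cqg by unfold_locales (simp add: compact_quantum_group_def)

sublocale cqg \<subseteq> R: min_tensor "tensor_r G"
  using cqg by unfold_locales (simp add: compact_quantum_group_def)

context cqg
begin

lemma hom_comult: "unital_star_hom (comult G)"
  and dense_left: "closure (span {tensor G a 1 * comult G b | a b. True}) = UNIV"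
  and dense_right: "closure (span {tensor G 1 a * comult G b | a b. True}) = UNIV"
  using cqg by (simp_all add: compact_quantum_group_def)

lemmas bounded_linear_comult = bounded_linear_hom[OF hom_comult]

lemma comult_mult: "comult G (x * y) = comult G x * comult G y"
  and comult_star: "comult G (star x) = star (comult G x)"
  and comult_one: "comult G 1 = 1"
  and comult_scaleC: "comult G (scaleC c x) = scaleC c (comult G x)"
  using hom_comult by (simp_all add: unital_star_hom_def)

text \<open>Fubini's theorem for the product state \<phi> \<otimes> \<psi>: the two iterated slices
  agree on elementary tensors.\<close>

lemma slice_swap: assumes "state \<phi>" "state \<psi>" shows "\<phi> (T.slice \<psi> z) = \<psi> (F.slice \<phi> z)"
proof (rule T.tensor_eqI)
  show "bounded_linear (\<lambda>z. \<phi> (T.slice \<psi> z))" "bounded_linear (\<lambda>z. \<psi> (F.slice \<phi> z))"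
    using assms by (auto intro!: bounded_linear_compose[OF bounded_linear_state] T.bounded_linear_slice F.bounded_linear_slice)
  show "\<phi> (T.slice \<psi> (tensor G a b)) = \<psi> (F.slice \<phi> (tensor G a b))" for a b
    by (simp add: T.slice_t F.slice_t assms state_scaleC)
qed

text \<open>\<open>conv h\<close> is \<open>(id \<otimes> h) \<circ> \<Phi>\<close>, and \<open>\<lambda>x. \<omega> (conv h x)\<close> is the convolution of \<open>\<omega>\<close> and \<open>h\<close>.\<close>

definition conv :: "('a \<Rightarrow> complex) \<Rightarrow> 'a \<Rightarrow> 'a" where
  "conv h x = T.slice h (comult G x)"

lemma state_conv: "state \<omega> \<Longrightarrow> state h \<Longrightarrow> state (\<lambda>x. \<omega> (conv h x))"
  unfolding conv_def by (rule state_comp_hom[OF T.state_slice hom_comult])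

lemma conv_star: "state h \<Longrightarrow> conv h (star x) = star (conv h x)"
  by (simp add: conv_def comult_star T.slice_star)

text \<open>Coassociativity in dual form. A is \<Phi> \<otimes> id and B is id \<otimes> \<Phi>;
  slicing the equation A (\<Phi> x) = B (\<Phi> x) by h in the third leg and then by \<omega> in the
  second gives the two sides.\<close>

lemma conv_conv:
  assumes w: "state \<omega>" and h: "state h"
  shows "conv \<omega> (conv h x) = conv (\<lambda>y. \<omega> (conv h y)) x"
proof -
  obtain A B where A: "unital_star_hom A" "\<And>a b. A (tensor G a b) = tensor_l G (comult G a) b"
    and B: "unital_star_hom B" "\<And>a b. B (tensor G a b) = tensor_r G a (comult G b)"
    and AB: "\<And>a. A (comult G a) = B (comult G a)"
    using cqg unfolding compact_quantum_group_def coassociative_def by blast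
  have assoc: "tensor_l G (tensor G a b) c = tensor_r G a (tensor G b c)" for a b c
    using cqg by (simp add: compact_quantum_group_def)
  have 1: "L.slice h (A z) = comult G (T.slice h z)" for z
  proof (rule T.tensor_eqI[where f = "\<lambda>z. L.slice h (A z)" and g = "\<lambda>z. comult G (T.slice h z)"])
    show "bounded_linear (\<lambda>z. L.slice h (A z))" "bounded_linear (\<lambda>z. comult G (T.slice h z))"
      by (rule bounded_linear_compose[OF L.bounded_linear_slice[OF h] bounded_linear_hom[OF A(1)]]
          bounded_linear_compose[OF bounded_linear_comult T.bounded_linear_slice[OF h]])+
    show "L.slice h (A (tensor G a b)) = comult G (T.slice h (tensor G a b))" for a b
      by (simp add: A(2) L.slice_t h T.slice_t comult_scaleC)
  qed
  have 2: "L.slice h (tensor_r G a z) = tensor G a (T.slice h z)" for a z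
  proof (rule T.tensor_eqI[where f = "\<lambda>z. L.slice h (tensor_r G a z)" and g = "\<lambda>z. tensor G a (T.slice h z)"])
    show "bounded_linear (\<lambda>z. L.slice h (tensor_r G a z))" "bounded_linear (\<lambda>z. tensor G a (T.slice h z))"
      by (rule bounded_linear_compose[OF L.bounded_linear_slice[OF h] R.bounded_linear_t_right]
          bounded_linear_compose[OF T.bounded_linear_t_right T.bounded_linear_slice[OF h]])+
    show "L.slice h (tensor_r G a (tensor G b c)) = tensor G a (T.slice h (tensor G b c))" for b c
      by (simp add: assoc[symmetric] L.slice_t h T.slice_t T.t_scaleC)
  qed
  have 3: "T.slice \<omega> (L.slice h (B z)) = T.slice (\<lambda>y. \<omega> (conv h y)) z" for z
  proof (rule T.tensor_eqI[where f = "\<lambda>z. T.slice \<omega> (L.slice h (B z))"])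
    show "bounded_linear (\<lambda>z. T.slice \<omega> (L.slice h (B z)))" "bounded_linear (T.slice (\<lambda>y. \<omega> (conv h y)))"
      by (rule bounded_linear_compose[OF T.bounded_linear_slice[OF w]
            bounded_linear_compose[OF L.bounded_linear_slice[OF h] bounded_linear_hom[OF B(1)]]]
          T.bounded_linear_slice[OF state_conv[OF w h]])+
    show "T.slice \<omega> (L.slice h (B (tensor G a b))) = T.slice (\<lambda>y. \<omega> (conv h y)) (tensor G a b)" for a b
      by (simp add: B(2) 2 T.slice_t w h state_conv conv_def[symmetric])
  qed
  have "conv \<omega> (conv h x) = T.slice \<omega> (L.slice h (A (comult G x)))"
    by (simp add: conv_def 1)
  also have "\<dots> = conv (\<lambda>y. \<omega> (conv h y)) x" by (simp add: AB 3) (simp add: conv_def)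
  finally show ?thesis .
qed

end

section \<open>The Haar state\<close>

lemma state_convex:
  assumes "state \<phi>" "state \<psi>" "c \<ge> 0" "d \<ge> 0" "c + d = 1"
  shows "state (\<lambda>x. of_real c * \<phi> x + of_real d * \<psi> x)"
proof -
  have "complex_of_real c + complex_of_real d = 1" by (metis assms(5) of_real_1 of_real_add)
  then show ?thesis
    using assms state_nonneg[OF assms(1)] state_nonneg[OF assms(2)] state_real[OF assms(1)] state_real[OF assms(2)]
    unfolding state_def by (simp add: algebra_simps complex_is_Real_iff)
qed

lemma closed_states: "closed {\<phi> :: 'a::cstar_algebra \<Rightarrow> complex. state \<phi>}"
proof -
  have c: "continuous_on UNIV (\<lambda>\<phi> :: 'a \<Rightarrow> complex. \<phi> x)" for x by (rule continuous_on_product_coordinates)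
  show ?thesis unfolding state_def complex_is_Real_iff
    by (intro closed_Collect_conj closed_Collect_all closed_Collect_eq closed_Collect_le
        continuous_on_add continuous_on_mult continuous_on_const continuous_on_Re continuous_on_Im c)
qed

text \<open>Banach-Alaoglu for pointwise convergence: by \<open>state_norm_le\<close> the states
  form a closed subset of a product of compact squares in the complex plane.\<close>

lemma compact_states: "compact {\<phi> :: 'a::cstar_algebra \<Rightarrow> complex. state \<phi>}"
proof -
  define B where "B x = (\<lambda>(a, b). complex_of_real a + \<i> * complex_of_real b) ` ({- norm x..norm x} \<times> {- norm x..norm x})" for x :: 'a
  have "compact (B x)" for x unfolding B_def case_prod_unfold
    by (intro compact_continuous_image compact_Times compact_Icc continuous_intros)
  then have "compactin (product_topology (\<lambda>x. euclidean) (UNIV :: 'a set)) (PiE UNIV B)"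
    unfolding compactin_PiE by (simp add: compactin_euclidean_iff)
  then have "compact (PiE UNIV B)"
    by (simp add: euclidean_product_topology compactin_euclidean_iff)
  then have "compact (PiE UNIV B \<inter> {\<phi>. state \<phi>})"
    by (rule compact_Int_closed[OF _ closed_states])
  moreover have "\<phi> x \<in> B x" if "state \<phi>" for \<phi> x
  proof -
    have "\<bar>Re (\<phi> x)\<bar> \<le> norm x" "\<bar>Im (\<phi> x)\<bar> \<le> norm x"
      using state_norm_le[OF that, of x] abs_Re_le_cmod[of "\<phi> x"] abs_Im_le_cmod[of "\<phi> x"] by linarith+
    then show ?thesis unfolding B_def
      by (intro image_eqI[of _ _ "(Re (\<phi> x), Im (\<phi> x))"]) (auto simp: complex_eq_iff)
  qed
  then have "PiE UNIV B \<inter> {\<phi>. state \<phi>} = {\<phi>. state \<phi>}" by (auto simp: PiE_def)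
  ultimately show ?thesis by simp
qed

context cqg
begin

text \<open>A cluster point of the Cesaro means of the convolution powers of \<omega>. Convolving
  the mean of the first n + 1 powers with \<omega> on either side moves it by the difference of two
  states divided by n + 1.\<close>

lemma fixed_state_exists:
  assumes w: "state \<omega>"
  obtains h where "state h" "\<And>x. \<omega> (conv h x) = h x" "\<And>x. h (conv \<omega> x) = h x"
proof -
  define p where "p k = (\<lambda>x. \<omega> ((conv \<omega> ^^ k) x))" for k
  have p0: "p 0 = \<omega>" by (simp add: p_def)
  have pS: "p (Suc k) x = p k (conv \<omega> x)" for k x by (simp add: p_def funpow_swap1)
  have sp: "state (p k)" for k
  proof (induct k)
    case 0
    then show ?case using w by (simp add: p0)
  next
    case (Suc k)
    then show ?case using state_conv[OF Suc w] by (simp add: pS[abs_def])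
  qed
  have pS': "\<omega> (conv (p k) x) = p (Suc k) x" for k x
  proof (induct k arbitrary: x)
    case 0
    then show ?case by (simp add: p0 pS)
  next
    case (Suc k)
    have "p (Suc k) = (\<lambda>x. p k (conv \<omega> x))" using pS by blast
    then have "conv (p (Suc k)) x = conv (p k) (conv \<omega> x)"
      using conv_conv[OF sp w, of k x] by (simp only:)
    then have "\<omega> (conv (p (Suc k)) x) = p (Suc k) (conv \<omega> x)" by (simp only: Suc)
    then show ?case by (simp only: pS[of "Suc k"])
  qed
  define m where "m n = (\<lambda>x. (\<Sum>k<Suc n. p k x) / of_nat (Suc n))" for n
  have "p k (star x * x) \<in> \<real> \<and> 0 \<le> Re (p k (star x * x))" for k x using sp[of k] by (simp add: state_def)
  then have sm: "state (m n)" for n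
    unfolding state_def m_def
    by (auto simp: state_add[OF sp] state_scaleC[OF sp] state_one[OF sp] sum.distrib add_divide_distrib sum_distrib_left[symmetric]
        intro!: Reals_divide sum_in_Reals sum_nonneg divide_nonneg_pos simp del: sum.lessThan_Suc of_nat_Suc)
  have bound: "cmod (p (Suc n) x - p 0 x) / real (Suc n) \<le> 2 * norm x * inverse (real (Suc n))" for n x
    using norm_triangle_ineq4[of "p (Suc n) x" "p 0 x"] state_norm_le[OF sp, of "Suc n" x] state_norm_le[OF sp, of 0 x]
    by (simp add: divide_inverse mult_right_mono del: of_nat_Suc)
  have tele: "(\<Sum>k<Suc n. p (Suc k) x) - (\<Sum>k<Suc n. p k x) = p (Suc n) x - p 0 x" for n x
    unfolding sum_subtractf[symmetric] by (rule sum_lessThan_telescope)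
  have nd: "cmod (a / of_nat (Suc n) - b / of_nat (Suc n)) = cmod (a - b) / real (Suc n)" for a b n
    by (simp add: diff_divide_distrib[symmetric] norm_divide del: of_nat_Suc)
  have 1: "cmod (m n (conv \<omega> x) - m n x) \<le> 2 * norm x * inverse (real (Suc n))" for n x
    using bound[of n x] by (simp only: m_def pS[symmetric] nd tele)
  have 2: "cmod (m n (F.slice \<omega> (comult G x)) - m n x) \<le> 2 * norm x * inverse (real (Suc n))" for n x
  proof -
    have "p k (F.slice \<omega> (comult G x)) = p (Suc k) x" for k
      using slice_swap[OF w sp, of k "comult G x"] pS'[of k x] by (simp add: conv_def)
    then show ?thesis using bound[of n x] by (simp only: m_def nd tele)
  qed
  \<comment> \<open>Functionals that are fixed up to the error achieved by the n-th mean. The sets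
    decrease with n, so the mean for a common upper bound N of finitely many indices lies in all of
    them.\<close>
  define C where "C n = {\<phi>. \<forall>x. cmod (\<phi> (conv \<omega> x) - \<phi> x) \<le> 2 * norm x * inverse (real (Suc n)) \<and>
    cmod (\<phi> (F.slice \<omega> (comult G x)) - \<phi> x) \<le> 2 * norm x * inverse (real (Suc n))}" for n
  have c: "continuous_on UNIV (\<lambda>\<phi> :: 'a \<Rightarrow> complex. \<phi> x)" for x by (rule continuous_on_product_coordinates)
  have "{\<phi>. state \<phi>} \<inter> \<Inter> (range C) \<noteq> {}"
  proof (rule compact_imp_fip[OF compact_states])
    show "closed S" if "S \<in> range C" for S
    proof -
      have "closed (C n)" for n unfolding C_def
        by (intro closed_Collect_all closed_Collect_conj closed_Collect_le continuous_on_norm continuous_on_diff continuous_on_const c)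
      then show ?thesis using that by auto
    qed
    fix S assume "finite S" "S \<subseteq> range C"
    then obtain J where J: "finite J" "S = C ` J" by (meson finite_subset_image subset_UNIV)
    define N where "N = (\<Sum>j\<in>J. j)"
    have "m N \<in> C j" if "j \<in> J" for j
    proof -
      have "j \<le> N" unfolding N_def using J(1) that by (rule member_le_sum[rotated 2]) auto
      then have "2 * norm x * inverse (real (Suc N)) \<le> 2 * norm x * inverse (real (Suc j))" for x :: 'a
        by (intro mult_left_mono le_imp_inverse_le) auto
      then show ?thesis unfolding C_def using 1[of N] 2[of N] order_trans by blast
    qed
    then show "{\<phi>. state \<phi>} \<inter> \<Inter> S \<noteq> {}" using sm[of N] J by blast
  qed
  then obtain h where h: "state h" "\<And>n. h \<in> C n" by blast
  have lim: "d \<le> 0" if "\<And>n. d \<le> 2 * norm (x::'a) * inverse (real (Suc n))" for d x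
  proof -
    have "(\<lambda>n. 2 * norm x * inverse (real (Suc n))) \<longlonglongrightarrow> 2 * norm x * 0"
      by (intro tendsto_mult_left LIMSEQ_inverse_real_of_nat)
    from LIMSEQ_le_const[OF this, of d] show ?thesis using that by auto
  qed
  have "cmod (h (conv \<omega> x) - h x) \<le> 0" "cmod (h (F.slice \<omega> (comult G x)) - h x) \<le> 0" for x
  proof -
    have "cmod (h (conv \<omega> x) - h x) \<le> 2 * norm x * inverse (real (Suc n))"
      "cmod (h (F.slice \<omega> (comult G x)) - h x) \<le> 2 * norm x * inverse (real (Suc n))" for n
      using h(2)[of n] unfolding C_def by blast+
    then show "cmod (h (conv \<omega> x) - h x) \<le> 0" "cmod (h (F.slice \<omega> (comult G x)) - h x) \<le> 0"
      using lim by blast+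
  qed
  then have "h (conv \<omega> x) = h x" "\<omega> (conv h x) = h x" for x
    using slice_swap[OF w h(1), of "comult G x"] by (simp_all add: conv_def)
  then show ?thesis using that h(1) by blast
qed

text \<open>For b = \<open>conv h x\<close>, the element z = \<Phi>(b) - b \<otimes> 1 is a null
  vector of h \<otimes> \<omega>, because convolution by \<omega> fixes both b and h. That state is
  a mixture of h \<otimes> \<rho> and h \<otimes> \<sigma> with c > 0, so z is a null vector of h
  \<otimes> \<rho> as well, and b and \<open>conv \<rho> b\<close> become equal under every
  functional h (a _).\<close>

lemma invariant_component:
  assumes w: "state \<omega>" and h: "state h" and wh: "\<And>x. \<omega> (conv h x) = h x" "\<And>x. h (conv \<omega> x) = h x"
    and \<rho>: "state \<rho>" "state \<sigma>" "c > 0" "d \<ge> 0" "c + d = 1" "\<And>x. \<omega> x = of_real c * \<rho> x + of_real d * \<sigma> x"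
  shows "\<rho> (conv h y) = h y"
proof -
  define \<Omega> where "\<Omega> \<psi> z = h (T.slice \<psi> z)" for \<psi> z
  have s\<Omega>: "state (\<Omega> \<psi>)" if "state \<psi>" for \<psi> unfolding \<Omega>_def[abs_def] by (rule T.state_slice[OF h that])
  have key: "h (a * conv \<rho> (conv h x)) = h (a * conv h x)" for a x
  proof -
    define b where "b = conv h x"
    have wb: "conv \<omega> b = b" unfolding b_def conv_conv[OF w h] wh(1) by simp
    define z where "z = comult G b - tensor G b 1"
    have "star z * z = comult G (star b * b) - comult G (star b) * tensor G b 1
        - tensor G (star b) 1 * comult G b + tensor G (star b * b) 1"
      by (simp add: z_def star_diff comult_mult comult_star T.t_star T.t_mult algebra_simps)
    then have "T.slice \<omega> (star z * z) = conv \<omega> (star b * b) - conv \<omega> (star b) * b - star b * conv \<omega> b + star b * b"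
      using linear_diff[OF bounded_linear.linear[OF T.bounded_linear_slice[OF w]]]
        linear_add[OF bounded_linear.linear[OF T.bounded_linear_slice[OF w]]]
      by (simp add: T.slice_mult_left T.slice_mult_right T.slice_t w state_one conv_def)
    then have "\<Omega> \<omega> (star z * z) = 0"
      by (simp add: \<Omega>_def conv_star[OF w] wb state_diff[OF h] wh(2))
    moreover have "\<Omega> \<omega> u = of_real c * \<Omega> \<rho> u + of_real d * \<Omega> \<sigma> u" for u
      unfolding \<Omega>_def T.slice_convex[OF \<rho>(1,2) w \<rho>(6)]
      by (simp add: state_add[OF h] state_scaleR'[OF h])
    ultimately have "c * Re (\<Omega> \<rho> (star z * z)) + d * Re (\<Omega> \<sigma> (star z * z)) = 0"
      by (simp add: complex_eq_iff)
    moreover have "0 \<le> d * Re (\<Omega> \<sigma> (star z * z))" using \<rho>(4) state_nonneg[OF s\<Omega>[OF \<rho>(2)]] by simp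
    moreover have "0 \<le> c * Re (\<Omega> \<rho> (star z * z))" using \<rho>(3) state_nonneg[OF s\<Omega>[OF \<rho>(1)]] by simp
    ultimately have "c * Re (\<Omega> \<rho> (star z * z)) = 0" by linarith
    then have "\<Omega> \<rho> (star z * z) = 0" using \<rho>(3) state_real[OF s\<Omega>[OF \<rho>(1)], of z] by (simp add: complex_eq_iff)
    then have "\<Omega> \<rho> (star (tensor G (star a) 1) * z) = 0" by (rule state_star_mult_zero(1)[OF s\<Omega>[OF \<rho>(1)]])
    then have "\<Omega> \<rho> (tensor G a 1 * comult G b) = \<Omega> \<rho> (tensor G a 1 * tensor G b 1)"
      by (simp add: T.t_star star_star z_def right_diff_distrib state_diff[OF s\<Omega>[OF \<rho>(1)]])
    then show ?thesis
      by (simp add: \<Omega>_def T.slice_mult_left T.slice_t \<rho>(1) state_one conv_def[symmetric] b_def[symmetric])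
  qed
  have s: "state (\<lambda>y. \<rho> (conv h y))" by (rule state_conv[OF \<rho>(1) h])
  \<comment> \<open>The states h \<otimes> (\<rho> * h) and h \<otimes> h agree on (A \<otimes>
    1)\<Phi>(A), which spans a dense subspace; evaluate both at 1 \<otimes> y.\<close>
  have "\<Omega> (\<lambda>y. \<rho> (conv h y)) (tensor G 1 y) = \<Omega> h (tensor G 1 y)"
  proof (rule bounded_linear_eq_on_dense[OF _ _ dense_left])
    show "bounded_linear (\<Omega> (\<lambda>y. \<rho> (conv h y)))" "bounded_linear (\<Omega> h)"
      by (rule bounded_linear_state[OF s\<Omega>] s h)+
    show "\<Omega> (\<lambda>y. \<rho> (conv h y)) u = \<Omega> h u" if u: "u \<in> {tensor G a 1 * comult G b | a b. True}" for u
    proof -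
      obtain a b where u: "u = tensor G a 1 * comult G b" using u by blast
      show ?thesis unfolding u
        using key[of a b] by (simp add: \<Omega>_def T.slice_mult_left s h conv_conv[OF \<rho>(1) h]) (simp add: conv_def)
    qed
  qed
  then show ?thesis by (simp add: \<Omega>_def T.slice_t s h state_scaleC[OF h] state_one[OF h])
qed

text \<open>A mixture of finitely many states with positive weights has a fixed state, which by
  \<open>invariant_component\<close> is invariant under each of them. Compactness of the state space
  passes from finite families to all states, and since states separate points, invariance under all
  \<rho> becomes an identity in A.\<close>

lemma invariant_state_exists:
  obtains h where "state h" "\<And>x. conv h x = scaleC (h x) 1"
proof -
  obtain \<omega>0 :: "'a \<Rightarrow> complex" where w0: "state \<omega>0" using norming_state .
  have comp: "\<exists>\<omega>. state \<omega> \<and> (\<forall>\<rho>\<in>S. \<exists>\<sigma> c d. state \<sigma> \<and> c > 0 \<and> d \<ge> 0 \<and> c + d = 1 \<and> (\<forall>x. \<omega> x = of_real c * \<rho> x + of_real d * \<sigma> x))"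
    if "finite S" "\<And>\<rho>. \<rho> \<in> S \<Longrightarrow> state \<rho>" for S :: "('a \<Rightarrow> complex) set"
    using that
  proof (induct S)
    case empty
    then show ?case using w0 by blast
  next
    case (insert \<rho> S)
    then obtain \<omega> where w: "state \<omega>" and wS: "\<And>\<rho>. \<rho> \<in> S \<Longrightarrow> \<exists>\<sigma> c d. state \<sigma> \<and> c > 0 \<and> d \<ge> 0 \<and> c + d = 1 \<and> (\<forall>x. \<omega> x = of_real c * \<rho> x + of_real d * \<sigma> x)"
      by blast
    have r: "state \<rho>" using insert by blast
    define \<omega>' where "\<omega>' = (\<lambda>x. of_real (1/2) * \<rho> x + of_real (1/2) * \<omega> x)"
    have w': "state \<omega>'" unfolding \<omega>'_def by (rule state_convex[OF r w]) auto
    have "\<exists>\<sigma> c d. state \<sigma> \<and> c > 0 \<and> d \<ge> 0 \<and> c + d = 1 \<and> (\<forall>x. \<omega>' x = of_real c * \<tau> x + of_real d * \<sigma> x)"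
      if t: "\<tau> \<in> insert \<rho> S" for \<tau>
    proof (cases "\<tau> = \<rho>")
      case True
      then show ?thesis using w by (intro exI[of _ \<omega>] exI[of _ "1/2"]) (simp add: \<omega>'_def)
    next
      case False
      then obtain \<sigma> c d where s: "state \<sigma>" "c > 0" "d \<ge> 0" "c + d = 1" "\<And>x. \<omega> x = of_real c * \<tau> x + of_real d * \<sigma> x"
        using wS[of \<tau>] t by blast
      \<comment> \<open>What remains of \<omega>' once c/2 of \<tau> is split off: it has weight (1
        + d)/2 and contains \<rho> and \<sigma> in the ratio 1 : d.\<close>
      define \<sigma>' where "\<sigma>' = (\<lambda>x. of_real (1 / (1 + d)) * \<rho> x + of_real (d / (1 + d)) * \<sigma> x)"
      have d1: "1 + d \<noteq> 0" using s(3) by simp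
      have "state \<sigma>'" unfolding \<sigma>'_def
        by (rule state_convex[OF r s(1)]) (use s(3) d1 in \<open>auto simp: add_divide_distrib[symmetric]\<close>)
      moreover have "\<omega>' x = of_real (c/2) * \<tau> x + of_real ((1 + d)/2) * \<sigma>' x" for x
      proof -
        have "e/2 * (1 / e) = 1/2" "e/2 * (d / e) = d/2" if "e \<noteq> 0" for e :: real using that by simp_all
        from this[OF d1] have "(1 + d)/2 * (1 / (1 + d)) = 1/2" "(1 + d)/2 * (d / (1 + d)) = d/2" .
        then have "of_real ((1 + d)/2) * \<sigma>' x = of_real (1/2) * \<rho> x + of_real (d/2) * \<sigma> x"
          unfolding \<sigma>'_def distrib_left mult.assoc[symmetric] of_real_mult[symmetric] by presburger
        then show ?thesis unfolding \<omega>'_def s(5) by (simp add: distrib_left)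
      qed
      moreover have "c/2 + (1 + d)/2 = 1" using s(4) by (simp add: field_simps)
      ultimately show ?thesis using s(2,3) by (intro exI[of _ \<sigma>'] exI[of _ "c/2"] exI[of _ "(1+d)/2"]) auto
    qed
    then show ?case using w' by blast
  qed
  \<comment> \<open>Invariance under \<rho>, rewritten as in \<open>slice_swap\<close> so that
    \<phi> is only evaluated at points independent of \<phi>; this makes the set closed for
    pointwise convergence.\<close>
  define C where "C \<rho> = {\<phi> :: 'a \<Rightarrow> complex. \<forall>x. \<phi> (F.slice \<rho> (comult G x)) = \<phi> x}" for \<rho> :: "'a \<Rightarrow> complex"
  have "{\<phi>. state \<phi>} \<inter> \<Inter> (C ` {\<rho>. state \<rho>}) \<noteq> {}"
  proof (rule compact_imp_fip[OF compact_states])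
    have c: "continuous_on UNIV (\<lambda>\<phi> :: 'a \<Rightarrow> complex. \<phi> x)" for x by (rule continuous_on_product_coordinates)
    have "closed (C \<rho>)" for \<rho> unfolding C_def by (intro closed_Collect_all closed_Collect_eq c)
    then show "closed S" if "S \<in> C ` {\<rho>. state \<rho>}" for S using that by auto
    fix S assume "finite S" "S \<subseteq> C ` {\<rho>. state \<rho>}"
    then obtain J where J: "finite J" "J \<subseteq> {\<rho>. state \<rho>}" "S = C ` J" by (meson finite_subset_image)
    then obtain \<omega> where w: "state \<omega>" and wJ: "\<And>\<rho>. \<rho> \<in> J \<Longrightarrow> \<exists>\<sigma> c d. state \<sigma> \<and> c > 0 \<and> d \<ge> 0 \<and> c + d = 1 \<and> (\<forall>x. \<omega> x = of_real c * \<rho> x + of_real d * \<sigma> x)"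
      using comp[of J] by blast
    obtain h where h: "state h" "\<And>x. \<omega> (conv h x) = h x" "\<And>x. h (conv \<omega> x) = h x"
      using fixed_state_exists[OF w] by metis
    have "h \<in> C \<rho>" if r: "\<rho> \<in> J" for \<rho>
    proof -
      obtain \<sigma> c d where s: "state \<sigma>" "c > 0" "d \<ge> 0" "c + d = 1" "\<And>x. \<omega> x = of_real c * \<rho> x + of_real d * \<sigma> x"
        using wJ[OF r] by blast
      have "state \<rho>" using r J by blast
      then have "\<rho> (conv h y) = h y" for y
        using invariant_component[OF w h(1) h(2) h(3) _ s] by blast
      then show ?thesis using slice_swap[OF \<open>state \<rho>\<close> h(1)] by (simp add: C_def conv_def)
    qed
    then show "{\<phi>. state \<phi>} \<inter> \<Inter> S \<noteq> {}" using h(1) J(3) by blast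
  qed
  then obtain h where h: "state h" "\<And>\<rho>. state \<rho> \<Longrightarrow> h \<in> C \<rho>" by blast
  have "conv h x = scaleC (h x) 1" for x
  proof (rule states_separate)
    fix \<rho> :: "'a \<Rightarrow> complex" assume r: "state \<rho>"
    show "\<rho> (conv h x) = \<rho> (scaleC (h x) 1)"
      using h(2)[OF r] slice_swap[OF r h(1), of "comult G x"]
      by (simp add: C_def conv_def state_scaleC[OF r] state_one[OF r])
  qed
  then show ?thesis using that h(1) by blast
qed

end

text \<open>The flipped group provides an invariant state for the other side. Slicing \<Phi>(x) by
  both states, in either order, gives the two values at x, so the states coincide.\<close>

theorem (in cqg) haar_state_exists:
  obtains h where "state h" "\<And>x. T.slice h (comult G x) = scaleC (h x) 1" "\<And>x. F.slice h (comult G x) = scaleC (h x) 1"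
proof -
  interpret flip: cqg "flip_group G" by unfold_locales (rule compact_quantum_group_flip[OF cqg])
  obtain h where h: "state h" "\<And>x. T.slice h (comult G x) = scaleC (h x) 1"
    using invariant_state_exists unfolding conv_def by metis
  obtain h' where h': "state h'" "\<And>x. F.slice h' (comult G x) = scaleC (h' x) 1"
    using flip.invariant_state_exists unfolding flip.conv_def flip_group_simps by metis
  have "h' x = h x" for x
    using slice_swap[OF h'(1) h(1), of "comult G x"]
    by (simp add: h(2) h'(2) state_scaleC h(1) h'(1) state_one)
  then have "h' = h" by blast
  then show ?thesis using that h h' by metis
qed

section \<open>Invariant forms of unitary corepresentations\<close>

locale unitary_corep = cqg G for G :: "('a::cstar_algebra, 'b::cstar_algebra, 'c::cstar_algebra) quantum_group" +
  fixes n :: nat and u :: "nat \<Rightarrow> nat \<Rightarrow> 'a"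
  assumes iso: "\<And>i j. i < n \<Longrightarrow> j < n \<Longrightarrow> (\<Sum>k<n. star (u k i) * u k j) = (if i = j then 1 else 0)"
    and coiso: "\<And>i j. i < n \<Longrightarrow> j < n \<Longrightarrow> (\<Sum>k<n. u i k * star (u j k)) = (if i = j then 1 else 0)"
    and comult_u: "\<And>i j. i < n \<Longrightarrow> j < n \<Longrightarrow> comult G (u i j) = (\<Sum>k<n. tensor G (u i k) (u k j))"
begin

text \<open>Entrywise form of 1 \<otimes> u = (u* \<otimes> 1)\<Phi>(u), which follows from
  \<Phi>(u) = (u \<otimes> 1)(1 \<otimes> u). It lets an entry in the right leg be absorbed into a
  value of \<Phi>.\<close>

lemma right_leg:
  assumes "i < n" "j < n"
  shows "tensor G 1 (u j i) = (\<Sum>k<n. tensor G (star (u k j)) 1 * comult G (u k i))"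
proof -
  have "(\<Sum>k<n. tensor G (star (u k j)) 1 * comult G (u k i)) = (\<Sum>k<n. \<Sum>m<n. tensor G (star (u k j) * u k m) (u m i))"
    by (rule sum.cong) (auto simp: comult_u assms sum_distrib_left T.t_mult)
  also have "\<dots> = (\<Sum>m<n. tensor G (\<Sum>k<n. star (u k j) * u k m) (u m i))"
    by (subst sum.swap) (simp add: T.t_sum)
  also have "\<dots> = (\<Sum>m<n. if m = j then tensor G 1 (u m i) else 0)"
    by (rule sum.cong) (auto simp: iso assms)
  also have "\<dots> = tensor G 1 (u j i)" using assms by simp
  finally show ?thesis by simp
qed

lemma left_leg:
  assumes "i < n" "j < n"
  shows "tensor G (u i j) 1 = (\<Sum>l<n. comult G (u i l) * tensor G 1 (star (u j l)))"
proof -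
  have "(\<Sum>l<n. comult G (u i l) * tensor G 1 (star (u j l))) = (\<Sum>l<n. \<Sum>m<n. tensor G (u i m) (u m l * star (u j l)))"
    by (rule sum.cong) (auto simp: comult_u assms sum_distrib_right T.t_mult)
  also have "\<dots> = (\<Sum>m<n. tensor G (u i m) (\<Sum>l<n. u m l * star (u j l)))"
    by (subst sum.swap) (simp add: T.t_sum)
  also have "\<dots> = (\<Sum>m<n. if m = j then tensor G (u i m) 1 else 0)"
    by (rule sum.cong) (auto simp: coiso assms)
  also have "\<dots> = tensor G (u i j) 1" using assms by simp
  finally show ?thesis by simp
qed

context
  fixes h
  assumes h: "state h"
    and right_inv: "\<And>x. T.slice h (comult G x) = scaleC (h x) 1"
    and left_inv: "\<And>x. F.slice h (comult G x) = scaleC (h x) 1"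
begin

lemmas h_lin = linear_sum[OF bounded_linear.linear[OF bounded_linear_state[OF h]]]
  linear_sum[OF bounded_linear.linear[OF T.bounded_linear_slice[OF h]]]
  linear_sum[OF bounded_linear.linear[OF F.bounded_linear_slice[OF h]]]

text \<open>Strong invariance of h, with \<open>star (u k j)\<close> in the role of the antipode of
  \<open>u j k\<close>: the entry is merged with x inside \<Phi>, where right invariance evaluates
  the slice.\<close>

lemma slice_right_leg:
  assumes "i < n" "j < n"
  shows "T.slice h (tensor G 1 (u j i) * comult G x) = (\<Sum>k<n. scaleC (h (u k i * x)) (star (u k j)))"
  unfolding right_leg[OF assms] sum_distrib_right mult.assoc comult_mult[symmetric] h_lin T.slice_mult_left[OF h] right_inv
  by (simp add: scaleC_mult_right)

lemma slice_left_leg: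
  assumes "i < n" "j < n"
  shows "F.slice h (comult G x * tensor G (u i j) 1) = (\<Sum>l<n. scaleC (h (x * u i l)) (star (u j l)))"
  unfolding left_leg[OF assms] sum_distrib_left mult.assoc[symmetric] comult_mult[symmetric] h_lin F.slice_mult_right[OF h] left_inv
  by (simp add: scaleC_mult_left)

lemma h_star_swap: "h (y * star x) = cnj (h (x * star y))"
  unfolding state_star[OF h, symmetric] by (simp add: star_mult star_star)

text \<open>
  Two density arguments turn vanishing of all \<open>h (y\<^sub>i x)\<close> into vanishing of all \<open>h (x y\<^sub>i)\<close>;
  this replaces the modular properties of the Haar state.
\<close>

lemma haar_kernel_trivial:
  assumes \<eta>: "\<And>i x. i < n \<Longrightarrow> h ((\<Sum>j<n. scaleC (\<eta> j) (u i j)) * x) = 0" and j0: "j0 < n"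
  shows "\<eta> j0 = 0"
proof -
  have \<eta>': "(\<Sum>j<n. \<eta> j * h (u i j * x)) = 0" if "i < n" for i x
    using \<eta>[OF that, of x] by (simp add: sum_distrib_right h_lin scaleC_mult_left state_scaleC[OF h])
  have A: "(\<Sum>j<n. \<eta> j * cnj (h (u j i * w))) = 0" if i: "i < n" for i w
  proof -
    \<comment> \<open>Bounded and real linear, \<Theta> vanishes on (A \<otimes> 1)\<Phi>(A) by the
      hypothesis and hence everywhere; the claim is its value at 1 \<otimes> w.\<close>
    define \<Theta> where "\<Theta> z = (\<Sum>j<n. \<eta> j * cnj (h (T.slice h (tensor G 1 (u j i) * z))))" for z
    have "bounded_linear \<Theta>" unfolding \<Theta>_def[abs_def]
      by (intro bounded_linear_sum bounded_linear_const_mult bounded_linear_compose[OF bounded_linear_cnj]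
          bounded_linear_compose[OF bounded_linear_state[OF h]] bounded_linear_compose[OF T.bounded_linear_slice[OF h]]
          bounded_linear_mult_right)
    moreover have "\<Theta> (tensor G y 1 * comult G x) = 0" for x y
    proof -
      have "T.slice h (tensor G 1 (u j i) * (tensor G y 1 * comult G x)) = (\<Sum>k<n. scaleC (h (u k i * x)) (y * star (u k j)))"
        if "j < n" for j
      proof -
        have "tensor G 1 (u j i) * (tensor G y 1 * comult G x) = tensor G y 1 * (tensor G 1 (u j i) * comult G x)"
          unfolding mult.assoc[symmetric] T.t_mult by simp
        then show ?thesis
          by (simp add: T.slice_mult_left[OF h] slice_right_leg[OF i that] sum_distrib_left scaleC_mult_right)
      qed
      then have "\<Theta> (tensor G y 1 * comult G x) = (\<Sum>j<n. \<eta> j * cnj (\<Sum>k<n. h (u k i * x) * h (y * star (u k j))))"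
        unfolding \<Theta>_def by (intro sum.cong refl) (simp add: h_lin state_scaleC[OF h])
      also have "\<dots> = (\<Sum>j<n. \<Sum>k<n. cnj (h (u k i * x)) * (\<eta> j * h (u k j * star y)))"
        by (simp add: h_star_swap[of y] sum_distrib_left mult_ac)
      also have "\<dots> = (\<Sum>k<n. cnj (h (u k i * x)) * (\<Sum>j<n. \<eta> j * h (u k j * star y)))"
        by (subst sum.swap) (simp add: sum_distrib_left)
      also have "\<dots> = 0" by (intro sum.neutral) (simp add: \<eta>')
      finally show ?thesis .
    qed
    ultimately have "\<Theta> z = 0" for z
      using bounded_linear_eq_on_dense[OF _ bounded_linear_zero dense_left, of \<Theta>] by blast
    from this[of "tensor G 1 w"] show ?thesis
      by (simp add: \<Theta>_def T.t_mult T.slice_t[OF h] state_scaleC[OF h] state_one[OF h])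
  qed
  have B: "(\<Sum>j<n. \<eta> j * h (w * u i j)) = 0" if i: "i < n" for i w
  proof -
    define \<Theta> where "\<Theta> z = (\<Sum>j<n. \<eta> j * h (F.slice h (z * tensor G (u i j) 1)))" for z
    have "bounded_linear \<Theta>" unfolding \<Theta>_def[abs_def]
      by (intro bounded_linear_sum bounded_linear_const_mult
          bounded_linear_compose[OF bounded_linear_state[OF h]] bounded_linear_compose[OF F.bounded_linear_slice[OF h]]
          bounded_linear_mult_left)
    moreover have "\<Theta> (tensor G 1 y * comult G x) = 0" for x y
    proof -
      have "F.slice h (tensor G 1 y * comult G x * tensor G (u i j) 1) = (\<Sum>l<n. scaleC (h (x * u i l)) (y * star (u j l)))"
        if "j < n" for j
        unfolding mult.assoc F.slice_mult_left[OF h] slice_left_leg[OF i that] by (simp add: sum_distrib_left scaleC_mult_right)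
      then have "\<Theta> (tensor G 1 y * comult G x) = (\<Sum>j<n. \<eta> j * (\<Sum>l<n. h (x * u i l) * h (y * star (u j l))))"
        unfolding \<Theta>_def by (intro sum.cong refl) (simp add: h_lin state_scaleC[OF h])
      also have "\<dots> = (\<Sum>j<n. \<Sum>l<n. h (x * u i l) * (\<eta> j * cnj (h (u j l * star y))))"
        by (simp add: h_star_swap[of y] sum_distrib_left mult_ac)
      also have "\<dots> = (\<Sum>l<n. h (x * u i l) * (\<Sum>j<n. \<eta> j * cnj (h (u j l * star y))))"
        by (subst sum.swap) (simp add: sum_distrib_left)
      also have "\<dots> = 0" by (intro sum.neutral) (simp add: A)
      finally show ?thesis .
    qed
    ultimately have "\<Theta> z = 0" for z
      using bounded_linear_eq_on_dense[OF _ bounded_linear_zero dense_right, of \<Theta>] by blast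
    from this[of "tensor G w 1"] show ?thesis
      by (simp add: \<Theta>_def T.t_mult F.slice_t[OF h] state_scaleC[OF h] state_one[OF h])
  qed
  \<comment> \<open>With \<open>star (y i)\<close> for w, the previous fact makes every y i a null
    vector of h. By the isometry relation the elements \<open>star (y i) * y i\<close> add up to a
    scalar, the sum of the squared moduli of \<eta>.\<close>
  define y where "y i = (\<Sum>j<n. scaleC (\<eta> j) (u i j))" for i
  have "h (star (y i) * y i) = 0" if "i < n" for i
    using B[OF that, of "star (y i)"]
    by (simp add: y_def[of i] sum_distrib_left h_lin scaleC_mult_right state_scaleC[OF h])
  then have "h (\<Sum>i<n. star (y i) * y i) = 0" by (simp add: h_lin)
  also have "(\<Sum>i<n. star (y i) * y i) = (\<Sum>i<n. \<Sum>j<n. \<Sum>k<n. scaleC (cnj (\<eta> j) * \<eta> k) (star (u i j) * u i k))"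
    by (simp add: y_def star_sum star_scaleC sum_product scaleC_mult_left scaleC_mult_right scaleC_scaleC mult.commute)
  also have "\<dots> = (\<Sum>j<n. \<Sum>k<n. scaleC (cnj (\<eta> j) * \<eta> k) (\<Sum>i<n. star (u i j) * u i k))"
    by (subst sum.swap, rule sum.cong[OF refl], subst sum.swap) (simp add: scaleC_sum_right)
  also have "\<dots> = (\<Sum>j<n. \<Sum>k<n. if k = j then scaleC (cnj (\<eta> j) * \<eta> j) 1 else 0)"
    by (intro sum.cong refl) (auto simp: iso)
  also have "\<dots> = scaleC (\<Sum>j<n. cnj (\<eta> j) * \<eta> j) 1" by (simp add: scaleC_sum_left)
  also have "(\<Sum>j<n. cnj (\<eta> j) * \<eta> j) = of_real (\<Sum>j<n. (cmod (\<eta> j))\<^sup>2)" by (simp add: cnj_mult_self)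
  finally have "(\<Sum>j<n. (cmod (\<eta> j))\<^sup>2) = 0" by (simp add: state_scaleC[OF h] state_one[OF h] del: of_real_sum)
  then show ?thesis using j0 by (subst (asm) sum_nonneg_eq_0_iff) auto
qed

text \<open>Entry (j, l) of the Haar average of b* b, where b is the entrywise conjugate of u:
  Weyl's unitarian trick applied to b.\<close>

definition haar_form :: "nat \<Rightarrow> nat \<Rightarrow> complex" where
  "haar_form j l = h (\<Sum>i<n. u i j * star (u i l))"

lemma haar_form_cnj: "cnj (haar_form j l) = haar_form l j"
  unfolding haar_form_def state_star[OF h, symmetric] by (simp add: star_sum star_mult star_star)

lemma haar_form_value:
  "(\<Sum>j<n. \<Sum>l<n. cnj (c j) * haar_form j l * c l)
    = (\<Sum>i<n. h ((\<Sum>j<n. scaleC (cnj (c j)) (u i j)) * star (\<Sum>j<n. scaleC (cnj (c j)) (u i j))))"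
proof -
  have "(\<Sum>i<n. h ((\<Sum>j<n. scaleC (cnj (c j)) (u i j)) * star (\<Sum>j<n. scaleC (cnj (c j)) (u i j))))
      = (\<Sum>i<n. \<Sum>j<n. \<Sum>l<n. cnj (c j) * c l * h (u i j * star (u i l)))"
    by (simp add: star_sum star_scaleC sum_product h_lin scaleC_mult_left scaleC_mult_right scaleC_scaleC state_scaleC[OF h] mult_ac)
  also have "\<dots> = (\<Sum>j<n. \<Sum>l<n. cnj (c j) * c l * (\<Sum>i<n. h (u i j * star (u i l))))"
    by (subst sum.swap, rule sum.cong[OF refl], subst sum.swap) (simp add: sum_distrib_left)
  finally show ?thesis by (simp add: haar_form_def h_lin mult_ac)
qed

lemma haar_form_nonneg: "0 \<le> Re (\<Sum>j<n. \<Sum>l<n. cnj (c j) * haar_form j l * c l)"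
  unfolding haar_form_value Re_sum using state_nonneg[OF h, of "star _"] by (intro sum_nonneg) (simp add: star_star)

text \<open>The value is a sum of terms \<open>h (y i * star (y i))\<close>, so if it vanishes,
  Cauchy-Schwarz gives \<open>h (y i * x) = 0\<close> for all x. As h need not be faithful, the
  conclusion has to come from \<open>haar_kernel_trivial\<close>.\<close>

lemma haar_form_definite:
  assumes "Re (\<Sum>j<n. \<Sum>l<n. cnj (c j) * haar_form j l * c l) = 0" "j < n" shows "c j = 0"
proof -
  define y where "y i = (\<Sum>j<n. scaleC (cnj (c j)) (u i j))" for i
  have p: "0 \<le> Re (h (y i * star (y i)))" "Im (h (y i * star (y i))) = 0" for i
    using state_nonneg[OF h, of "star (y i)"] state_real[OF h, of "star (y i)"] by (simp_all add: star_star)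
  have "(\<Sum>i<n. Re (h (y i * star (y i)))) = 0"
    using assms(1) unfolding haar_form_value Re_sum y_def[symmetric] .
  then have "\<forall>i\<in>{..<n}. Re (h (y i * star (y i))) = 0" using p by (subst (asm) sum_nonneg_eq_0_iff) auto
  then have "h (star (star (y i)) * star (y i)) = 0" if "i < n" for i
    using p that by (simp add: star_star complex_eq_iff)
  then have "h (y i * x) = 0" if "i < n" for i x
    using state_star_mult_zero(2)[OF h, of "star (y i)" x] that by (simp add: star_star)
  then have "cnj (c j) = 0"
    using haar_kernel_trivial[of "\<lambda>j. cnj (c j)" j] assms(2) by (simp add: y_def)
  then show ?thesis by simp
qed

text \<open>Slice \<Phi>(b* b) by h in the left leg, once by expanding \<Phi> and once by left
  invariance.\<close>

lemma haar_form_invariant: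
  assumes "j < n" "l < n"
  shows "(\<Sum>k<n. \<Sum>m<n. scaleC (haar_form k m) (u k j * star (u m l))) = scaleC (haar_form j l) 1"
proof -
  have "comult G (\<Sum>i<n. u i j * star (u i l))
      = (\<Sum>i<n. \<Sum>k<n. \<Sum>m<n. tensor G (u i k * star (u i m)) (u k j * star (u m l)))"
    unfolding unital_star_hom_sum[OF hom_comult] comult_mult comult_star
    by (intro sum.cong refl) (simp add: comult_u assms star_sum T.t_star sum_product T.t_mult)
  also have "\<dots> = (\<Sum>k<n. \<Sum>m<n. tensor G (\<Sum>i<n. u i k * star (u i m)) (u k j * star (u m l)))"
    by (subst sum.swap, rule sum.cong[OF refl], subst sum.swap) (simp add: T.t_sum)
  finally have "F.slice h (comult G (\<Sum>i<n. u i j * star (u i l)))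
      = (\<Sum>k<n. \<Sum>m<n. scaleC (haar_form k m) (u k j * star (u m l)))"
    by (simp add: h_lin F.slice_t[OF h] haar_form_def)
  then show ?thesis by (simp add: left_inv haar_form_def)
qed

end

theorem invariant_form_exists:
  obtains F where "\<And>j l. cnj (F j l) = F l j"
    "\<And>c. 0 \<le> Re (\<Sum>j<n. \<Sum>l<n. cnj (c j) * F j l * c l)"
    "\<And>c j. Re (\<Sum>j<n. \<Sum>l<n. cnj (c j) * F j l * c l) = 0 \<Longrightarrow> j < n \<Longrightarrow> c j = 0"
    "\<And>j l. j < n \<Longrightarrow> l < n \<Longrightarrow> (\<Sum>k<n. \<Sum>m<n. scaleC (F k m) (u k j * star (u m l))) = scaleC (F j l) 1"
proof -
  obtain h where h: "state h" "\<And>x. T.slice h (comult G x) = scaleC (h x) 1" "\<And>x. F.slice h (comult G x) = scaleC (h x) 1"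
    using haar_state_exists by blast
  show ?thesis
    by (rule that[of "haar_form h"]; rule haar_form_cnj[OF h] haar_form_nonneg[OF h] haar_form_definite[OF h] haar_form_invariant[OF h])
qed

end

section \<open>Hermitian matrices\<close>

lemma mat_mult_entry:
  assumes "A \<in> carrier_mat n m" "B \<in> carrier_mat m k" "i < n" "j < k"
  shows "(A * B) $$ (i, j) = (\<Sum>l<m. A $$ (i, l) * B $$ (l, j))"
  using assms by (auto simp: scalar_prod_def lessThan_atLeast0 intro!: sum.cong)

lemma mult_carrier_square [simp]:
  "A \<in> carrier_mat n n \<Longrightarrow> B \<in> carrier_mat n n \<Longrightarrow> (A :: 'a::semiring_0 mat) * B \<in> carrier_mat n n"
  by (rule mult_carrier_mat)

lemma mat_adjoint_dim [simp]: "dim_row (mat_adjoint A) = dim_col A" "dim_col (mat_adjoint A) = dim_row A"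
  by (simp_all add: mat_adjoint_def mat_of_rows_def)

lemma mat_adjoint_carrier [simp]: "A \<in> carrier_mat n m \<Longrightarrow> mat_adjoint A \<in> carrier_mat m n"
  unfolding carrier_mat_def by simp

lemma mat_adjoint_entry [simp]:
  "i < dim_col A \<Longrightarrow> j < dim_row A \<Longrightarrow> mat_adjoint (A :: complex mat) $$ (i, j) = cnj (A $$ (j, i))"
  by (simp add: mat_adjoint_def mat_of_rows_index)

lemma mat_adjoint_adjoint [simp]: "mat_adjoint (mat_adjoint A) = (A :: complex mat)"
  by (rule eq_matI) auto

lemma mat_adjoint_one [simp]: "mat_adjoint (1\<^sub>m n :: complex mat) = 1\<^sub>m n"
  by (rule eq_matI) auto

lemma mat_adjoint_mult:
  assumes "A \<in> carrier_mat n m" "B \<in> carrier_mat m k"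
  shows "mat_adjoint (A * B :: complex mat) = mat_adjoint B * mat_adjoint A"
proof (rule eq_matI)
  fix i j assume "i < dim_row (mat_adjoint B * mat_adjoint A)" "j < dim_col (mat_adjoint B * mat_adjoint A)"
  then have ij: "i < k" "j < n" using assms by auto
  have "mat_adjoint (A * B) $$ (i, j) = cnj ((A * B) $$ (j, i))" using ij assms by simp
  also have "\<dots> = (\<Sum>l<m. mat_adjoint B $$ (i, l) * mat_adjoint A $$ (l, j))"
    unfolding mat_mult_entry[OF assms ij(2,1)] using ij assms by (auto intro!: sum.cong simp: mult.commute)
  also have "\<dots> = (mat_adjoint B * mat_adjoint A) $$ (i, j)"
    by (rule mat_mult_entry[symmetric, where m = m and n = k and k = n]) (use assms ij in auto)
  finally show "mat_adjoint (A * B) $$ (i, j) = (mat_adjoint B * mat_adjoint A) $$ (i, j)" .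
qed (use assms in auto)

section \<open>Unitary matrices and the spectral theorem\<close>

definition unitary_mat :: "nat \<Rightarrow> complex mat \<Rightarrow> bool" where
  "unitary_mat n U \<longleftrightarrow> U \<in> carrier_mat n n \<and> mat_adjoint U * U = 1\<^sub>m n \<and> U * mat_adjoint U = 1\<^sub>m n"

lemma unitary_matI:
  assumes "U \<in> carrier_mat n n" "mat_adjoint U * U = 1\<^sub>m n" shows "unitary_mat n U"
  unfolding unitary_mat_def using assms mat_mult_left_right_inverse[of "mat_adjoint U" n U] by simp

lemma unitary_mat_mult:
  assumes "unitary_mat n U" "unitary_mat n V" shows "unitary_mat n (U * V)"
proof (rule unitary_matI)
  have c: "U \<in> carrier_mat n n" "V \<in> carrier_mat n n" using assms by (auto simp: unitary_mat_def)
  then show "U * V \<in> carrier_mat n n" by simp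
  have "mat_adjoint (U * V) * (U * V) = mat_adjoint V * (mat_adjoint U * U) * V"
    unfolding mat_adjoint_mult[OF c] using c by (simp add: assoc_mult_mat[of _ n n _ n _ n])
  also have "\<dots> = 1\<^sub>m n" using assms c by (simp add: unitary_mat_def)
  finally show "mat_adjoint (U * V) * (U * V) = 1\<^sub>m n" .
qed

text \<open>Complete v to a basis and apply Gram-Schmidt, which keeps v as its first vector. The
  result is orthogonal but not normalised, so each column is divided by its norm, and c is the
  inverse of the norm of v.\<close>

lemma unitary_mat_extend_vec:
  fixes v :: "complex vec"
  assumes v: "v \<in> carrier_vec n" and v0: "v \<noteq> 0\<^sub>v n"
  obtains W c where "unitary_mat n W" "\<And>i. i < n \<Longrightarrow> W $$ (i, 0) = c * v $ i"
proof -
  interpret cof_vec_space n "TYPE(complex)" .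
  define b where "b = basis_completion v"
  define ws where "ws = gram_schmidt n b"
  have n: "n > 0" using v v0 by (cases n) auto
  from basis_completion[OF v v0, folded b_def]
  have bb: "distinct b" "\<not> lin_dep (set b)" "set b \<subseteq> carrier_vec n" "hd b = v" "length b = n" by auto
  then obtain vs where bv: "b = v # vs" using n by (cases b) auto
  from gram_schmidt_result[OF bb(3,1,2) refl, folded ws_def] bb
  have ws: "set ws \<subseteq> carrier_vec n" "corthogonal ws" "length ws = n" by auto
  have hdws: "hd ws = v" unfolding ws_def bv by (rule gram_schmidt_hd[OF v])
  have wc: "ws ! j \<in> carrier_vec n" if "j < n" for j using ws that by auto
  have sp: "ws ! k \<bullet>c ws ! j = (\<Sum>i<n. ws ! k $ i * cnj (ws ! j $ i))" if "j < n" "k < n" for j k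
    using wc[OF that(1)] wc[OF that(2)] by (auto simp: scalar_prod_def lessThan_atLeast0 intro!: sum.cong)
  define s where "s j = (\<Sum>i<n. (cmod (ws ! j $ i))\<^sup>2)" for j
  have s: "ws ! j \<bullet>c ws ! j = of_real (s j)" if "j < n" for j
    unfolding sp[OF that that] s_def of_real_sum by (rule sum.cong) (auto simp: cnj_mult_self)
  have "s j \<noteq> 0" if "j < n" for j using s[OF that] corthogonalD[OF ws(2), of j j] that ws(3) by auto
  moreover have "s j \<ge> 0" for j unfolding s_def by (intro sum_nonneg) simp
  ultimately have s0: "s j > 0" if "j < n" for j using that by (simp add: less_le)
  define W where "W = mat n n (\<lambda>(i, j). (ws ! j $ i) / of_real (sqrt (s j)))"
  have Wc: "W \<in> carrier_mat n n" by (simp add: W_def)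
  have "mat_adjoint W * W = 1\<^sub>m n"
  proof (rule eq_matI)
    fix j k assume "j < dim_row (1\<^sub>m n)" "k < dim_col (1\<^sub>m n)"
    then have jk: "j < n" "k < n" by auto
    have "(mat_adjoint W * W) $$ (j, k) = (\<Sum>i<n. mat_adjoint W $$ (j, i) * W $$ (i, k))"
      using Wc jk by (intro mat_mult_entry) auto
    also have "\<dots> = (\<Sum>i<n. ws ! k $ i * cnj (ws ! j $ i)) / (of_real (sqrt (s j)) * of_real (sqrt (s k)))"
      using jk Wc by (auto simp: W_def sum_divide_distrib intro!: sum.cong)
    also have "\<dots> = (ws ! k \<bullet>c ws ! j) / (of_real (sqrt (s j)) * of_real (sqrt (s k)))" by (simp add: sp jk)
    also have "\<dots> = (if j = k then 1 else 0)"
    proof (cases "j = k")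
      case True
      have "complex_of_real (sqrt (s j)) * of_real (sqrt (s j)) = of_real (s j)"
        unfolding of_real_mult[symmetric] using s0[OF jk(1)] by simp
      then show ?thesis using s[OF jk(1)] s0[OF jk(1)] True by simp
    next
      case False
      then show ?thesis using corthogonalD[OF ws(2), of k j] jk ws(3) by auto
    qed
    finally show "(mat_adjoint W * W) $$ (j, k) = 1\<^sub>m n $$ (j, k)" using jk by simp
  qed (auto simp: W_def)
  then have "unitary_mat n W" using Wc by (rule unitary_matI[rotated])
  moreover have "W $$ (i, 0) = 1 / of_real (sqrt (s 0)) * v $ i" if "i < n" for i
  proof -
    have "ws ! 0 = v" using hdws ws(3) n by (metis hd_conv_nth length_greater_0_conv)
    then show ?thesis using that n by (simp add: W_def)
  qed
  ultimately show ?thesis using that by blast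
qed

definition diagm :: "nat \<Rightarrow> (nat \<Rightarrow> 'a::zero) \<Rightarrow> 'a mat" where
  "diagm n d = mat n n (\<lambda>(i, j). if i = j then d i else 0)"

lemma diagm_carrier [simp]: "diagm n d \<in> carrier_mat n n" by (simp add: diagm_def)

lemma mult_diagm_entry:
  fixes A :: "'a::semiring_1 mat"
  assumes "A \<in> carrier_mat m n" "i < m" "j < n" shows "(A * diagm n d) $$ (i, j) = A $$ (i, j) * d j"
proof -
  have "(A * diagm n d) $$ (i, j) = (\<Sum>l<n. A $$ (i, l) * diagm n d $$ (l, j))"
    by (rule mat_mult_entry[OF assms(1) diagm_carrier assms(2,3)])
  also have "\<dots> = (\<Sum>l<n. if l = j then A $$ (i, l) * d j else 0)"
    by (rule sum.cong) (use assms in \<open>auto simp: diagm_def\<close>)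
  finally show ?thesis using assms by simp
qed

lemma diagm_mult_entry:
  fixes A :: "'a::semiring_1 mat"
  assumes "A \<in> carrier_mat n m" "i < n" "j < m" shows "(diagm n d * A) $$ (i, j) = d i * A $$ (i, j)"
proof -
  have "(diagm n d * A) $$ (i, j) = (\<Sum>l<n. diagm n d $$ (i, l) * A $$ (l, j))"
    by (rule mat_mult_entry[OF diagm_carrier assms])
  also have "\<dots> = (\<Sum>l<n. if l = i then d i * A $$ (l, j) else 0)"
    by (rule sum.cong) (use assms in \<open>auto simp: diagm_def\<close>)
  finally show ?thesis using assms by simp
qed

abbreviation block_diag :: "'a::zero mat \<Rightarrow> 'a mat \<Rightarrow> 'a mat" where
  "block_diag A B \<equiv> four_block_mat A (0\<^sub>m (dim_row A) (dim_col B)) (0\<^sub>m (dim_row B) (dim_col A)) B"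

lemma block_diag_mult:
  fixes A :: "'a::semiring_0 mat"
  assumes c: "A \<in> carrier_mat a b" "A' \<in> carrier_mat b a'" "B \<in> carrier_mat c d" "B' \<in> carrier_mat d c'"
  shows "block_diag A B * block_diag A' B' = block_diag (A * A') (B * B')"
proof -
  have d: "dim_row A = a" "dim_col A = b" "dim_row A' = b" "dim_col A' = a'" "dim_row B = c" "dim_col B = d"
    "dim_row B' = d" "dim_col B' = c'" using c by auto
  have z: "0\<^sub>m a d * 0\<^sub>m d a' = (0\<^sub>m a a' :: 'a mat)" "0\<^sub>m c b * 0\<^sub>m b c' = (0\<^sub>m c c' :: 'a mat)"
    "A * 0\<^sub>m b c' = 0\<^sub>m a c'" "0\<^sub>m a d * B' = 0\<^sub>m a c'" "0\<^sub>m c b * A' = 0\<^sub>m c a'" "B * 0\<^sub>m d a' = 0\<^sub>m c a'"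
    using c by (auto intro!: left_mult_zero_mat right_mult_zero_mat)
  show ?thesis
    unfolding d index_mult_mat
    by (subst mult_four_block_mat[OF c(1) zero_carrier_mat zero_carrier_mat c(3) c(2) zero_carrier_mat zero_carrier_mat c(4)])
      (simp only: z, use c in \<open>auto intro!: cong_four_block_mat\<close>)
qed

text \<open>Deflation by an eigenvector: in an orthonormal basis that starts with it, the first
  column of A is a multiple of the first unit vector, and hermiticity clears the first row as well.
  The remaining block is Hermitian again.\<close>

theorem spectral_theorem:
  assumes "A \<in> carrier_mat n n" "mat_adjoint A = A"
  shows "\<exists>U d. unitary_mat n U \<and> A * U = U * diagm n d"
  using assms
proof (induct n arbitrary: A)
  case 0
  then have "unitary_mat 0 A \<and> A * A = A * diagm 0 (\<lambda>_. 0)"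
    by (auto simp: unitary_mat_def diagm_def intro!: eq_matI)
  then show ?case by blast
next
  case (Suc n)
  note A = Suc.prems(1)
  obtain e where "eigenvalue A e"
    using spectrum_non_empty[OF A zero_less_Suc] unfolding spectrum_def by blast
  then obtain v where v: "v \<in> carrier_vec (Suc n)" "v \<noteq> 0\<^sub>v (Suc n)" "A *\<^sub>v v = e \<cdot>\<^sub>v v"
    using A by (auto simp: eigenvalue_def eigenvector_def)
  obtain W c where W: "unitary_mat (Suc n) W" "\<And>i. i < Suc n \<Longrightarrow> W $$ (i, 0) = c * v $ i"
    using unitary_mat_extend_vec[OF v(1,2)] by blast
  have Wc: "W \<in> carrier_mat (Suc n) (Suc n)" using W by (simp add: unitary_mat_def)
  have AW: "(A * W) $$ (i, 0) = e * W $$ (i, 0)" if i: "i < Suc n" for i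
  proof -
    have "(A * W) $$ (i, 0) = (\<Sum>l<Suc n. A $$ (i, l) * W $$ (l, 0))" by (rule mat_mult_entry[OF A Wc i zero_less_Suc])
    also have "\<dots> = (\<Sum>l<Suc n. A $$ (i, l) * (c * v $ l))" by (intro sum.cong refl) (simp add: W(2))
    also have "\<dots> = c * (\<Sum>l<Suc n. A $$ (i, l) * v $ l)" by (simp only: sum_distrib_left mult.left_commute)
    also have "(\<Sum>l<Suc n. A $$ (i, l) * v $ l) = (A *\<^sub>v v) $ i"
      using A v(1) i by (auto simp: scalar_prod_def lessThan_atLeast0 intro!: sum.cong)
    finally show ?thesis using v i by (simp add: W(2))
  qed
  define B where "B = mat_adjoint W * (A * W)"
  have Bc: "B \<in> carrier_mat (Suc n) (Suc n)" using A Wc by (simp add: B_def)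
  have Ba: "mat_adjoint B = B"
    using A Wc Suc.prems(2) by (simp add: B_def mat_adjoint_mult[of _ "Suc n" "Suc n" _ "Suc n"] assoc_mult_mat[of _ "Suc n" "Suc n" _ "Suc n" _ "Suc n"])
  have B0: "B $$ (i, 0) = (if i = 0 then e else 0)" if i: "i < Suc n" for i
  proof -
    have "B $$ (i, 0) = (\<Sum>l<Suc n. mat_adjoint W $$ (i, l) * (A * W) $$ (l, 0))"
      unfolding B_def using i A Wc by (intro mat_mult_entry) auto
    also have "\<dots> = (\<Sum>l<Suc n. e * (mat_adjoint W $$ (i, l) * W $$ (l, 0)))"
      by (intro sum.cong refl) (simp add: AW)
    also have "\<dots> = e * (mat_adjoint W * W) $$ (i, 0)"
      unfolding sum_distrib_left[symmetric] using i Wc by (subst mat_mult_entry) auto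
    also have "\<dots> = (if i = 0 then e else 0)" using W(1) i by (simp add: unitary_mat_def)
    finally show ?thesis .
  qed
  have B0': "B $$ (0, j) = (if j = 0 then e else 0)" if j: "j < Suc n" for j
  proof -
    have "B $$ (0, j) = cnj (B $$ (j, 0))" using Ba mat_adjoint_entry[of 0 B j] Bc j by simp
    also have "\<dots> = (if j = 0 then B $$ (0, 0) else 0)"
      using B0[OF j] B0[of 0] Ba mat_adjoint_entry[of 0 B 0] Bc by auto
    finally show ?thesis using B0[of 0] by simp
  qed
  define C where "C = mat n n (\<lambda>(i, j). B $$ (Suc i, Suc j))"
  have Cc: "C \<in> carrier_mat n n" by (simp add: C_def)
  have "mat_adjoint C = C"
  proof (rule eq_matI)
    fix i j assume "i < dim_row C" "j < dim_col C"
    then show "mat_adjoint C $$ (i, j) = C $$ (i, j)"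
      using Ba mat_adjoint_entry[of "Suc i" B "Suc j"] Bc by (simp add: C_def)
  qed (auto simp: C_def)
  then obtain V d where V: "unitary_mat n V" "C * V = V * diagm n d" using Suc.hyps[OF Cc] by blast
  have Vc: "V \<in> carrier_mat n n" using V by (simp add: unitary_mat_def)
  define Q where "Q = block_diag (1\<^sub>m 1) V"
  have Qc: "Q \<in> carrier_mat (Suc n) (Suc n)" using Vc four_block_carrier_mat[of "1\<^sub>m 1" 1 1 V n n] by (simp add: Q_def)
  define E where "E = mat 1 1 (\<lambda>_. e)"
  have Ec: "E \<in> carrier_mat 1 1" by (simp add: E_def)
  have Beq: "B = block_diag E C"
    by (rule eq_matI) (use Bc B0 B0' in \<open>auto simp: C_def E_def\<close>)
  define d' where "d' = case_nat e d"
  have D: "diagm (Suc n) d' = block_diag E (diagm n d)"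
    by (rule eq_matI) (auto simp: diagm_def d'_def E_def split: nat.split)
  have "B * Q = block_diag (E * 1\<^sub>m 1) (C * V)"
    unfolding Beq Q_def by (rule block_diag_mult[OF Ec one_carrier_mat Cc Vc])
  also have "E * 1\<^sub>m 1 = 1\<^sub>m 1 * E" using Ec by simp
  also have "block_diag (1\<^sub>m 1 * E) (C * V) = Q * diagm (Suc n) d'"
    unfolding D Q_def V(2) by (rule block_diag_mult[OF one_carrier_mat Ec Vc diagm_carrier, symmetric])
  finally have BQ: "B * Q = Q * diagm (Suc n) d'" .
  have "mat_adjoint Q = block_diag (1\<^sub>m 1) (mat_adjoint V)"
    by (rule eq_matI) (use Vc in \<open>auto simp: Q_def\<close>)
  then have "mat_adjoint Q * Q = block_diag (1\<^sub>m 1 * 1\<^sub>m 1) (mat_adjoint V * V)"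
    unfolding Q_def using block_diag_mult[OF one_carrier_mat one_carrier_mat mat_adjoint_carrier[OF Vc] Vc, of 1] by simp
  also have "\<dots> = 1\<^sub>m (Suc n)" using V(1) by (simp add: unitary_mat_def)
  finally have Q: "unitary_mat (Suc n) Q" using Qc unitary_matI by blast
  have "A * W = (W * mat_adjoint W) * (A * W)" using W(1) A Wc by (simp add: unitary_mat_def)
  also have "\<dots> = W * B" unfolding B_def
    by (rule assoc_mult_mat[OF Wc mat_adjoint_carrier[OF Wc] mult_carrier_square[OF A Wc]])
  finally have AWB: "A * W = W * B" .
  have "A * (W * Q) = (A * W) * Q" by (rule assoc_mult_mat[OF A Wc Qc, symmetric])
  also have "\<dots> = W * (B * Q)" unfolding AWB by (rule assoc_mult_mat[OF Wc Bc Qc])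
  also have "\<dots> = (W * Q) * diagm (Suc n) d'"
    unfolding BQ using Wc Qc by (simp add: assoc_mult_mat[of _ "Suc n" "Suc n" _ "Suc n" _ "Suc n"])
  finally show ?case using unitary_mat_mult[OF W(1) Q] by blast
qed

lemma unitary_mat_permute_columns:
  assumes U: "unitary_mat n U" and p: "inj_on p {..<n}" "p ` {..<n} \<subseteq> {..<n}"
  shows "unitary_mat n (mat n n (\<lambda>(i, j). U $$ (i, p j)))"
proof (rule unitary_matI)
  let ?V = "mat n n (\<lambda>(i, j). U $$ (i, p j))"
  have Uc: "U \<in> carrier_mat n n" using U by (simp add: unitary_mat_def)
  have pn: "p j < n" if "j < n" for j using p that by auto
  show "mat_adjoint ?V * ?V = 1\<^sub>m n"
  proof (rule eq_matI)
    fix j k assume "j < dim_row (1\<^sub>m n)" "k < dim_col (1\<^sub>m n)"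
    then have jk: "j < n" "k < n" by auto
    have Vc: "?V \<in> carrier_mat n n" by simp
    have "(mat_adjoint ?V * ?V) $$ (j, k) = (\<Sum>i<n. mat_adjoint ?V $$ (j, i) * ?V $$ (i, k))"
      by (rule mat_mult_entry[OF mat_adjoint_carrier[OF Vc] Vc jk])
    also have "\<dots> = (\<Sum>i<n. mat_adjoint U $$ (p j, i) * U $$ (i, p k))"
      using jk pn Uc by (intro sum.cong refl) auto
    also have "\<dots> = (mat_adjoint U * U) $$ (p j, p k)"
      by (rule mat_mult_entry[OF mat_adjoint_carrier[OF Uc] Uc pn[OF jk(1)] pn[OF jk(2)], symmetric])
    also have "\<dots> = 1\<^sub>m n $$ (p j, p k)" using U by (simp add: unitary_mat_def)
    also have "\<dots> = 1\<^sub>m n $$ (j, k)"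
      using jk pn[OF jk(1)] pn[OF jk(2)] inj_onD[OF p(1), of j k] by auto
    finally show "(mat_adjoint ?V * ?V) $$ (j, k) = 1\<^sub>m n $$ (j, k)" .
  qed auto
qed simp

text \<open>The eigenvectors for the eigenvalue \<open>d 0\<close> are moved to the front and m
  counts them. If they were all, A would be scalar, so the spectrum falls into two nonempty disjoint
  parts.\<close>

lemma spectral_split:
  assumes A: "A \<in> carrier_mat n n" "mat_adjoint A = A" and ns: "\<And>c. A \<noteq> c \<cdot>\<^sub>m 1\<^sub>m n"
  obtains U d m where "unitary_mat n U" "A * U = U * diagm n d" "0 < m" "m < n"
    "\<And>i j. i < m \<Longrightarrow> m \<le> j \<Longrightarrow> j < n \<Longrightarrow> d i \<noteq> d j"
proof -
  obtain V d where V: "unitary_mat n V" "A * V = V * diagm n d" using spectral_theorem[OF A] by blast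
  have Vc: "V \<in> carrier_mat n n" using V by (simp add: unitary_mat_def)
  define xs where "xs = filter (\<lambda>i. d i = d 0) [0..<n]"
  define ys where "ys = filter (\<lambda>i. d i \<noteq> d 0) [0..<n]"
  define js where "js = xs @ ys"
  define m where "m = length xs"
  have len: "length js = n"
    using sum_length_filter_compl[of "\<lambda>i. d i = d 0" "[0..<n]"] by (simp add: js_def xs_def ys_def)
  have dist: "distinct js" by (auto simp: js_def xs_def ys_def)
  have set: "set js = {..<n}" by (auto simp: js_def xs_def ys_def)
  have xs: "d i = d 0" if "i \<in> set xs" for i using that by (simp add: xs_def)
  have ys: "d i \<noteq> d 0" if "i \<in> set ys" for i using that by (simp add: ys_def)
  have lo: "d (js ! j) = d 0" if "j < m" for j
    using that xs[OF nth_mem, of j] by (simp add: js_def m_def nth_append)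
  have hi: "d (js ! j) \<noteq> d 0" if "m \<le> j" "j < n" for j
    using that len ys[OF nth_mem, of "j - m"] by (simp add: js_def m_def nth_append)
  have inj: "inj_on ((!) js) {..<n}" using dist len by (simp add: inj_on_nth)
  have im: "(!) js ` {..<n} \<subseteq> {..<n}" using set len nth_mem[of _ js] by auto
  then have jn: "js ! j < n" if "j < n" for j using that by auto
  define U where "U = mat n n (\<lambda>(i, j). V $$ (i, js ! j))"
  have U: "unitary_mat n U" unfolding U_def by (rule unitary_mat_permute_columns[OF V(1) inj im])
  have Uc: "U \<in> carrier_mat n n" by (simp add: U_def)
  have n0: "n > 0"
  proof (rule ccontr)
    assume "\<not> n > 0"
    then have "A = 0 \<cdot>\<^sub>m 1\<^sub>m n" using A by (intro eq_matI) auto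
    then show False using ns by blast
  qed
  have "A * U = U * diagm n (\<lambda>j. d (js ! j))"
  proof (rule eq_matI)
    fix i j assume "i < dim_row (U * diagm n (\<lambda>j. d (js ! j)))" "j < dim_col (U * diagm n (\<lambda>j. d (js ! j)))"
    then have ij: "i < n" "j < n" using Uc by (auto simp: diagm_def)
    have "(A * U) $$ (i, j) = (\<Sum>l<n. A $$ (i, l) * V $$ (l, js ! j))"
      using A Uc ij by (subst mat_mult_entry) (auto simp: U_def)
    also have "\<dots> = (A * V) $$ (i, js ! j)" using A Vc ij jn by (subst mat_mult_entry) auto
    also have "\<dots> = V $$ (i, js ! j) * d (js ! j)" unfolding V(2) using Vc ij jn by (intro mult_diagm_entry) auto
    also have "\<dots> = (U * diagm n (\<lambda>j. d (js ! j))) $$ (i, j)"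
      using Uc ij by (subst mult_diagm_entry) (auto simp: U_def)
    finally show "(A * U) $$ (i, j) = (U * diagm n (\<lambda>j. d (js ! j))) $$ (i, j)" .
  qed (use A Uc in \<open>auto simp: diagm_def\<close>)
  moreover have "0 < m"
  proof -
    have "0 \<in> set xs" using n0 by (simp add: xs_def)
    then show ?thesis unfolding m_def by (rule length_pos_if_in_set)
  qed
  moreover have "m < n"
  proof (rule ccontr)
    assume "\<not> m < n"
    have all: "d i = d 0" if "i < n" for i
    proof -
      have "i \<in> set js" using set that by simp
      then obtain k where "k < n" "js ! k = i" using len by (auto simp: in_set_conv_nth)
      then show ?thesis using lo[of k] \<open>\<not> m < n\<close> by simp
    qed
    define D where "D = diagm n (\<lambda>_. d 0)"
    have Dc: "D \<in> carrier_mat n n" by (simp add: D_def)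
    have "A * V = D * V"
    proof (rule eq_matI)
      fix i j assume "i < dim_row (D * V)" "j < dim_col (D * V)"
      then have ij: "i < n" "j < n" using Vc Dc by auto
      show "(A * V) $$ (i, j) = (D * V) $$ (i, j)"
        unfolding V(2) D_def mult_diagm_entry[OF Vc ij] diagm_mult_entry[OF Vc ij]
        by (simp add: all[OF ij(2)])
    qed (use A Vc Dc in auto)
    then have "A * (V * mat_adjoint V) = D * (V * mat_adjoint V)"
      using assoc_mult_mat[OF A(1) Vc mat_adjoint_carrier[OF Vc]] assoc_mult_mat[OF Dc Vc mat_adjoint_carrier[OF Vc]] by simp
    then have "A = D" using V(1) A Dc by (simp add: unitary_mat_def)
    also have "D = d 0 \<cdot>\<^sub>m 1\<^sub>m n" by (rule eq_matI) (auto simp: D_def diagm_def)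
    finally have "A = d 0 \<cdot>\<^sub>m 1\<^sub>m n" .
    then show False using ns by blast
  qed
  moreover have "d (js ! i) \<noteq> d (js ! j)" if "i < m" "m \<le> j" "j < n" for i j
    using lo[OF that(1)] hi[OF that(2,3)] by simp
  ultimately show ?thesis using that U by blast
qed

text \<open>In an eigenbasis U the eigenvalues are the values of the form at the columns of U, hence
  positive; R is the diagonal matrix of their roots times the adjoint of U.\<close>

lemma positive_definite_factor:
  assumes F: "F \<in> carrier_mat n n" "mat_adjoint F = F"
    and pd: "\<And>c. 0 \<le> Re (\<Sum>j<n. \<Sum>l<n. cnj (c j) * F $$ (j, l) * c l)"
      "\<And>c j. Re (\<Sum>j<n. \<Sum>l<n. cnj (c j) * F $$ (j, l) * c l) = 0 \<Longrightarrow> j < n \<Longrightarrow> c j = 0"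
  obtains R S where "R \<in> carrier_mat n n" "S \<in> carrier_mat n n" "R * S = 1\<^sub>m n" "S * R = 1\<^sub>m n" "mat_adjoint R * R = F"
proof -
  obtain U d where U: "unitary_mat n U" "F * U = U * diagm n d" using spectral_theorem[OF F] by blast
  have Uc: "U \<in> carrier_mat n n" using U by (simp add: unitary_mat_def)
  have dv: "d i = (\<Sum>j<n. \<Sum>l<n. cnj (U $$ (j, i)) * F $$ (j, l) * U $$ (l, i))" if i: "i < n" for i
  proof -
    have FU: "(F * U) $$ (j, i) = (\<Sum>l<n. F $$ (j, l) * U $$ (l, i))" if "j < n" for j
      by (rule mat_mult_entry[OF F(1) Uc that i])
    have "(\<Sum>j<n. \<Sum>l<n. cnj (U $$ (j, i)) * F $$ (j, l) * U $$ (l, i)) = (\<Sum>j<n. mat_adjoint U $$ (i, j) * (F * U) $$ (j, i))"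
    proof (rule sum.cong[OF refl])
      fix j assume "j \<in> {..<n}"
      then have j: "j < n" by simp
      show "(\<Sum>l<n. cnj (U $$ (j, i)) * F $$ (j, l) * U $$ (l, i)) = mat_adjoint U $$ (i, j) * (F * U) $$ (j, i)"
        unfolding FU[OF j] sum_distrib_left using Uc i j by (simp add: mult.assoc)
    qed
    also have "\<dots> = (\<Sum>j<n. mat_adjoint U $$ (i, j) * U $$ (j, i) * d i)"
      unfolding U(2) by (intro sum.cong refl) (use mult_diagm_entry[OF Uc _ i] in simp)
    also have "\<dots> = (mat_adjoint U * U) $$ (i, i) * d i"
      unfolding sum_distrib_right[symmetric] mat_mult_entry[OF mat_adjoint_carrier[OF Uc] Uc i i] ..
    also have "\<dots> = d i" using U(1) i by (simp add: unitary_mat_def)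
    finally show ?thesis by simp
  qed
  have dpos: "Re (d i) > 0" if i: "i < n" for i
  proof -
    have "Re (d i) \<ge> 0" unfolding dv[OF i] by (rule pd(1))
    moreover have "Re (d i) \<noteq> 0"
    proof
      assume "Re (d i) = 0"
      then have "U $$ (j, i) = 0" if "j < n" for j
        using pd(2)[of "\<lambda>j. U $$ (j, i)" j] that by (simp add: dv[OF i])
      then have "(mat_adjoint U * U) $$ (i, i) = 0"
        unfolding mat_mult_entry[OF mat_adjoint_carrier[OF Uc] Uc i i] by simp
      then show False using U(1) i by (simp add: unitary_mat_def)
    qed
    ultimately show ?thesis by simp
  qed
  have dreal: "d i = of_real (Re (d i))" if i: "i < n" for i
  proof -
    have "cnj (d i) = (\<Sum>j<n. \<Sum>l<n. cnj (U $$ (l, i)) * F $$ (l, j) * U $$ (j, i))"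
      unfolding dv[OF i] cnj_sum using F
      by (intro sum.cong refl) (simp, metis carrier_matD lessThan_iff mat_adjoint_entry mult.assoc mult.commute)
    also have "\<dots> = d i" unfolding dv[OF i] by (rule sum.swap)
    finally show ?thesis by (simp add: complex_eq_iff)
  qed
  define r where "r i = complex_of_real (sqrt (Re (d i)))" for i
  have rr: "r i * r i = d i" "r i \<noteq> 0" "cnj (r i) = r i" if "i < n" for i
    using dpos[OF that] dreal[OF that] by (auto simp: r_def simp flip: of_real_mult)
  define R where "R = diagm n r * mat_adjoint U"
  define S where "S = U * diagm n (\<lambda>i. 1 / r i)"
  have Rc: "R \<in> carrier_mat n n" and Sc: "S \<in> carrier_mat n n" using Uc by (auto simp: R_def S_def)
  have "R * S = diagm n r * (mat_adjoint U * U) * diagm n (\<lambda>i. 1 / r i)"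
    unfolding R_def S_def using Uc by (simp add: assoc_mult_mat[of _ n n _ n _ n])
  also have "\<dots> = diagm n r * diagm n (\<lambda>i. 1 / r i)" using U(1) by (simp add: unitary_mat_def right_mult_one_mat[OF diagm_carrier])
  also have "\<dots> = 1\<^sub>m n"
  proof (rule eq_matI)
    fix i j assume "i < dim_row (1\<^sub>m n)" "j < dim_col (1\<^sub>m n)"
    then have ij: "i < n" "j < n" by auto
    show "(diagm n r * diagm n (\<lambda>i. 1 / r i)) $$ (i, j) = 1\<^sub>m n $$ (i, j)"
      using ij rr(2) by (simp add: mult_diagm_entry[of _ n n]) (simp add: diagm_def)
  qed (auto simp: diagm_def)
  finally have RS: "R * S = 1\<^sub>m n" .
  have ad: "mat_adjoint (diagm n r) = diagm n r"
    by (rule eq_matI) (auto simp: diagm_def rr(3))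
  have "diagm n r * diagm n r = diagm n d"
  proof (rule eq_matI)
    fix i j assume "i < dim_row (diagm n d)" "j < dim_col (diagm n d)"
    then have ij: "i < n" "j < n" by (auto simp: diagm_def)
    show "(diagm n r * diagm n r) $$ (i, j) = diagm n d $$ (i, j)"
      using ij rr(1) by (simp add: mult_diagm_entry[of _ n n]) (simp add: diagm_def)
  qed (auto simp: diagm_def)
  then have dd: "diagm n r * (diagm n r * mat_adjoint U) = diagm n d * mat_adjoint U"
    using assoc_mult_mat[OF diagm_carrier diagm_carrier mat_adjoint_carrier[OF Uc], of r r] by simp
  have "mat_adjoint R = U * diagm n r"
    unfolding R_def mat_adjoint_mult[OF diagm_carrier mat_adjoint_carrier[OF Uc]] ad by simp
  then have "mat_adjoint R * R = U * (diagm n r * (diagm n r * mat_adjoint U))"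
    unfolding R_def using assoc_mult_mat[OF Uc diagm_carrier, of "diagm n r * mat_adjoint U" n r] Uc by simp
  also have "\<dots> = U * diagm n d * mat_adjoint U"
    unfolding dd by (rule assoc_mult_mat[OF Uc diagm_carrier mat_adjoint_carrier[OF Uc], symmetric])
  also have "\<dots> = F * (U * mat_adjoint U)"
    unfolding U(2)[symmetric] by (rule assoc_mult_mat[OF F(1) Uc mat_adjoint_carrier[OF Uc]])
  also have "\<dots> = F" using U(1) F by (simp add: unitary_mat_def)
  finally show ?thesis using that[OF Rc Sc RS mat_mult_left_right_inverse[OF Rc Sc RS]] by blast
qed

section \<open>Representations and intertwiners\<close>

lemma scalar_mat_dim [simp]: "dim_row (scalar_mat T) = dim_row T" "dim_col (scalar_mat T) = dim_col T"
  by (simp_all add: scalar_mat_def)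

lemma scalar_mat_carrier [simp]: "scalar_mat T \<in> carrier_mat n m \<longleftrightarrow> T \<in> carrier_mat n m"
  unfolding carrier_mat_def mem_Collect_eq scalar_mat_dim ..

lemma scalar_mat_entry [simp]: "i < dim_row T \<Longrightarrow> j < dim_col T \<Longrightarrow> scalar_mat T $$ (i, j) = scaleC (T $$ (i, j)) 1"
  by (simp add: scalar_mat_def)

lemma scalar_mat_mult:
  assumes "A \<in> carrier_mat n m" "B \<in> carrier_mat m k"
  shows "(scalar_mat (A * B) :: 'a::cstar_algebra mat) = scalar_mat A * scalar_mat B"
proof (rule eq_matI)
  fix i j assume "i < dim_row (scalar_mat A * scalar_mat B :: 'a mat)" "j < dim_col (scalar_mat A * scalar_mat B :: 'a mat)"
  then have ij: "i < n" "j < k" using assms by auto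
  have "(scalar_mat A * scalar_mat B :: 'a mat) $$ (i, j) = (\<Sum>l<m. scalar_mat A $$ (i, l) * scalar_mat B $$ (l, j))"
    by (rule mat_mult_entry) (use assms ij in auto)
  also have "\<dots> = (\<Sum>l<m. scaleC (A $$ (i, l) * B $$ (l, j)) 1)"
    using assms ij by (intro sum.cong refl) (auto simp: scaleC_mult_left scaleC_scaleC)
  also have "\<dots> = scaleC ((A * B) $$ (i, j)) 1"
    unfolding mat_mult_entry[OF assms ij] by (simp add: scaleC_sum_left)
  finally show "(scalar_mat (A * B) :: 'a mat) $$ (i, j) = (scalar_mat A * scalar_mat B) $$ (i, j)" using assms ij by simp
qed (use assms in auto)

lemma scalar_mat_one [simp]: "scalar_mat (1\<^sub>m n) = 1\<^sub>m n"
  by (rule eq_matI) auto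

lemma scalar_mult_entry:
  fixes u :: "'a::cstar_algebra mat"
  assumes "T \<in> carrier_mat n m" "u \<in> carrier_mat m k" "i < n" "j < k"
  shows "(scalar_mat T * u) $$ (i, j) = (\<Sum>l<m. scaleC (T $$ (i, l)) (u $$ (l, j)))"
proof -
  have "(scalar_mat T * u) $$ (i, j) = (\<Sum>l<m. scalar_mat T $$ (i, l) * u $$ (l, j))"
    by (rule mat_mult_entry) (use assms in auto)
  also have "\<dots> = (\<Sum>l<m. scaleC (T $$ (i, l)) (u $$ (l, j)))"
    using assms by (intro sum.cong refl) (simp add: scaleC_mult_left)
  finally show ?thesis .
qed

lemma mult_scalar_entry:
  fixes u :: "'a::cstar_algebra mat"
  assumes "u \<in> carrier_mat n m" "T \<in> carrier_mat m k" "i < n" "j < k"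
  shows "(u * scalar_mat T) $$ (i, j) = (\<Sum>l<m. scaleC (T $$ (l, j)) (u $$ (i, l)))"
proof -
  have "(u * scalar_mat T) $$ (i, j) = (\<Sum>l<m. u $$ (i, l) * scalar_mat T $$ (l, j))"
    by (rule mat_mult_entry) (use assms in auto)
  also have "\<dots> = (\<Sum>l<m. scaleC (T $$ (l, j)) (u $$ (i, l)))"
    using assms by (intro sum.cong refl) (simp add: scaleC_mult_right)
  finally show ?thesis .
qed

lemma star_transpose_carrier [simp]: "star_transpose u \<in> carrier_mat n m \<longleftrightarrow> u \<in> carrier_mat m n"
  unfolding carrier_mat_def star_transpose_def by auto

lemma star_transpose_entry: "u \<in> carrier_mat m n \<Longrightarrow> i < n \<Longrightarrow> j < m \<Longrightarrow> star_transpose u $$ (i, j) = star (u $$ (j, i))"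
  by (auto simp: star_transpose_def)

lemma star_transpose_star_transpose [simp]: "star_transpose (star_transpose u) = u"
  by (rule eq_matI) (auto simp: star_transpose_def star_star)

lemma star_transpose_scalar [simp]: "star_transpose (scalar_mat T) = scalar_mat (mat_adjoint T)"
  by (rule eq_matI) (auto simp: star_transpose_def star_scaleC)

lemma star_transpose_mult:
  assumes "u \<in> carrier_mat n m" "v \<in> carrier_mat m k"
  shows "star_transpose (u * v) = star_transpose v * star_transpose u"
proof (rule eq_matI)
  fix i j assume "i < dim_row (star_transpose v * star_transpose u)" "j < dim_col (star_transpose v * star_transpose u)"
  then have ij: "i < k" "j < n" using assms by (auto simp: star_transpose_def)
  have "star_transpose (u * v) $$ (i, j) = star ((u * v) $$ (j, i))"
    using ij assms by (intro star_transpose_entry[where m = n and n = k]) auto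
  also have "\<dots> = (\<Sum>l<m. star (v $$ (l, i)) * star (u $$ (j, l)))"
    unfolding mat_mult_entry[OF assms ij(2,1)] by (simp add: star_sum star_mult)
  also have "\<dots> = (\<Sum>l<m. star_transpose v $$ (i, l) * star_transpose u $$ (l, j))"
    using assms ij by (intro sum.cong refl) (simp add: star_transpose_entry)
  also have "\<dots> = (star_transpose v * star_transpose u) $$ (i, j)"
    by (rule mat_mult_entry[symmetric]) (use assms ij in auto)
  finally show "star_transpose (u * v) $$ (i, j) = (star_transpose v * star_transpose u) $$ (i, j)" .
qed (use assms in \<open>auto simp: star_transpose_def\<close>)

definition unitary_over :: "nat \<Rightarrow> 'a::cstar_algebra mat \<Rightarrow> bool" where
  "unitary_over n u \<longleftrightarrow> u \<in> carrier_mat n n \<and> star_transpose u * u = 1\<^sub>m n \<and> u * star_transpose u = 1\<^sub>m n"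

lemma unitary_over_carrier: "unitary_over n u \<Longrightarrow> u \<in> carrier_mat n n"
  by (simp add: unitary_over_def)

lemma unitary_over_scalar: "unitary_mat n U \<Longrightarrow> unitary_over n (scalar_mat U)"
  unfolding unitary_over_def unitary_mat_def
  by (metis mat_adjoint_carrier scalar_mat_carrier scalar_mat_mult scalar_mat_one star_transpose_scalar)

lemma unitary_over_star_transpose: "unitary_over n u \<Longrightarrow> unitary_over n (star_transpose u)"
  by (simp add: unitary_over_def)

lemma unitary_over_mult:
  assumes "unitary_over n u" "unitary_over n v" shows "unitary_over n (u * v)"
proof -
  have c: "u \<in> carrier_mat n n" "v \<in> carrier_mat n n" using assms by (auto simp: unitary_over_def)
  have "star_transpose (u * v) * (u * v) = star_transpose v * (star_transpose u * u) * v"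
    unfolding star_transpose_mult[OF c] using c by (simp add: assoc_mult_mat[of _ n n _ n _ n])
  moreover have "(u * v) * star_transpose (u * v) = u * (v * star_transpose v) * star_transpose u"
    unfolding star_transpose_mult[OF c] using c by (simp add: assoc_mult_mat[of _ n n _ n _ n])
  ultimately show ?thesis using assms c unfolding unitary_over_def by simp
qed

lemma MorD: "T \<in> Mor u v \<Longrightarrow> T \<in> carrier_mat (dim_row v) (dim_row u)" "T \<in> Mor u v \<Longrightarrow> scalar_mat T * u = v * scalar_mat T"
  by (simp_all add: Mor_def)

lemma Mor_iff: "u \<in> carrier_mat n n \<Longrightarrow> v \<in> carrier_mat m m \<Longrightarrow> T \<in> Mor u v \<longleftrightarrow> T \<in> carrier_mat m n \<and> scalar_mat T * u = v * scalar_mat T"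
  by (auto simp: Mor_def)

lemma Mor_mult:
  fixes u v w :: "'a::cstar_algebra mat"
  assumes c: "u \<in> carrier_mat n n" "v \<in> carrier_mat m m" "w \<in> carrier_mat k k"
    and T: "T \<in> Mor u v" and R: "R \<in> Mor v w"
  shows "R * T \<in> Mor u w"
proof -
  have TR: "T \<in> carrier_mat m n" "R \<in> carrier_mat k m" using T R Mor_iff[OF c(1,2)] Mor_iff[OF c(2,3)] by auto
  let ?T = "scalar_mat T :: 'a mat" and ?R = "scalar_mat R :: 'a mat"
  have TR': "?T \<in> carrier_mat m n" "?R \<in> carrier_mat k m" using TR by auto
  have "scalar_mat (R * T) * u = ?R * (?T * u)"
    unfolding scalar_mat_mult[OF TR(2,1)] by (rule assoc_mult_mat[OF TR'(2,1) c(1)])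
  also have "\<dots> = (?R * v) * ?T"
    unfolding MorD(2)[OF T] by (rule assoc_mult_mat[OF TR'(2) c(2) TR'(1), symmetric])
  also have "\<dots> = w * (?R * ?T)"
    unfolding MorD(2)[OF R] by (rule assoc_mult_mat[OF c(3) TR'(2,1)])
  also have "\<dots> = w * scalar_mat (R * T)" unfolding scalar_mat_mult[OF TR(2,1)] ..
  finally show ?thesis using Mor_iff[OF c(1,3)] TR by auto
qed

text \<open>The star of the intertwining relation involves the adjoints of u and v; multiplying by u
  on the left and by v on the right removes them by unitarity.\<close>

lemma Mor_adjoint:
  fixes u v :: "'a::cstar_algebra mat"
  assumes u: "unitary_over n u" and v: "unitary_over m v" and T: "T \<in> Mor u v"
  shows "mat_adjoint T \<in> Mor v u"
proof -
  note c = unitary_over_carrier[OF u] unitary_over_carrier[OF v]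
  have Tc: "T \<in> carrier_mat m n" using T Mor_iff[OF c] by auto
  let ?S = "scalar_mat (mat_adjoint T) :: 'a mat"
  have Sc: "?S \<in> carrier_mat n m" using Tc by simp
  have "star_transpose (scalar_mat T * u) = star_transpose (v * scalar_mat T)" by (simp only: MorD(2)[OF T])
  then have e: "star_transpose u * ?S = ?S * star_transpose v"
    using star_transpose_mult[of "scalar_mat T" m n u n] star_transpose_mult[of v m m "scalar_mat T" n] c Tc by simp
  have "?S * v = (u * star_transpose u) * (?S * v)"
    using u left_mult_one_mat[OF mult_carrier_mat[OF Sc c(2)]] by (simp add: unitary_over_def)
  also have "\<dots> = u * (star_transpose u * (?S * v))"
    by (rule assoc_mult_mat[OF c(1) _ mult_carrier_mat[OF Sc c(2)]]) (use c in simp)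
  also have "star_transpose u * (?S * v) = (star_transpose u * ?S) * v"
    by (rule assoc_mult_mat[symmetric, OF _ Sc c(2)]) (use c in simp)
  also have "\<dots> = ?S * (star_transpose v * v)"
    unfolding e by (rule assoc_mult_mat[OF Sc _ c(2)]) (use c in simp)
  also have "\<dots> = ?S" using v right_mult_one_mat[OF Sc] by (simp add: unitary_over_def)
  finally show ?thesis using Mor_iff[OF c(2,1)] Tc by auto
qed

lemma Mor_inverse:
  fixes u v :: "'a::cstar_algebra mat"
  assumes c: "u \<in> carrier_mat n n" "v \<in> carrier_mat m m" and T: "T \<in> Mor u v"
    and R: "R \<in> carrier_mat n m" "R * T = 1\<^sub>m n" "T * R = 1\<^sub>m m"
  shows "R \<in> Mor v u"
proof -
  have Tc: "T \<in> carrier_mat m n" using T Mor_iff[OF c] by auto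
  let ?T = "scalar_mat T :: 'a mat" and ?R = "scalar_mat R :: 'a mat"
  have Tc': "?T \<in> carrier_mat m n" and Rc': "?R \<in> carrier_mat n m" using Tc R by auto
  have RT: "?R * ?T = 1\<^sub>m n" "?T * ?R = 1\<^sub>m m"
    using scalar_mat_mult[OF R(1) Tc, where 'a = 'a] scalar_mat_mult[OF Tc R(1), where 'a = 'a] R by simp_all
  have "?R * v = ?R * (v * (?T * ?R))" using c RT by simp
  also have "v * (?T * ?R) = (?T * u) * ?R"
    unfolding MorD(2)[OF T] by (rule assoc_mult_mat[OF c(2) Tc' Rc', symmetric])
  also have "?R * ((?T * u) * ?R) = (?R * (?T * u)) * ?R"
    by (rule assoc_mult_mat[symmetric, OF Rc' mult_carrier_mat[OF Tc' c(1)] Rc'])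
  also have "?R * (?T * u) = u" using assoc_mult_mat[OF Rc' Tc' c(1)] RT c by simp
  finally show ?thesis using Mor_iff[OF c(2,1)] R by auto
qed

lemma Mor_one: "u \<in> carrier_mat n n \<Longrightarrow> 1\<^sub>m n \<in> Mor u u"
  by (simp add: Mor_iff)

lemma Mor_linear:
  fixes u v :: "'a::cstar_algebra mat"
  assumes c: "u \<in> carrier_mat n n" "v \<in> carrier_mat m m" and T: "T \<in> Mor u v" and R: "R \<in> Mor u v"
  shows "a \<cdot>\<^sub>m T + b \<cdot>\<^sub>m R \<in> Mor u v"
proof -
  have tc: "T \<in> carrier_mat m n" "R \<in> carrier_mat m n" using T R Mor_iff[OF c] by auto
  then have lc: "a \<cdot>\<^sub>m T + b \<cdot>\<^sub>m R \<in> carrier_mat m n" by simp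
  have l: "(scalar_mat (a \<cdot>\<^sub>m T + b \<cdot>\<^sub>m R) * u) $$ (i, j) = scaleC a ((scalar_mat T * u) $$ (i, j)) + scaleC b ((scalar_mat R * u) $$ (i, j))"
    if "i < m" "j < n" for i j
    unfolding scalar_mult_entry[OF lc c(1) that] scalar_mult_entry[OF tc(1) c(1) that] scalar_mult_entry[OF tc(2) c(1) that]
      scaleC_sum_right sum.distrib[symmetric]
    by (rule sum.cong) (use tc that in \<open>auto simp: scaleC_add_left scaleC_scaleC\<close>)
  have r: "(v * scalar_mat (a \<cdot>\<^sub>m T + b \<cdot>\<^sub>m R)) $$ (i, j) = scaleC a ((v * scalar_mat T) $$ (i, j)) + scaleC b ((v * scalar_mat R) $$ (i, j))"
    if "i < m" "j < n" for i j
    unfolding mult_scalar_entry[OF c(2) lc that] mult_scalar_entry[OF c(2) tc(1) that] mult_scalar_entry[OF c(2) tc(2) that]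
      scaleC_sum_right sum.distrib[symmetric]
    by (rule sum.cong) (use tc that in \<open>auto simp: scaleC_add_left scaleC_scaleC\<close>)
  have "scalar_mat (a \<cdot>\<^sub>m T + b \<cdot>\<^sub>m R) * u = v * scalar_mat (a \<cdot>\<^sub>m T + b \<cdot>\<^sub>m R)"
  proof (rule eq_matI)
    fix i j assume "i < dim_row (v * scalar_mat (a \<cdot>\<^sub>m T + b \<cdot>\<^sub>m R))" "j < dim_col (v * scalar_mat (a \<cdot>\<^sub>m T + b \<cdot>\<^sub>m R))"
    then have "i < m" "j < n" using c lc by auto
    then show "(scalar_mat (a \<cdot>\<^sub>m T + b \<cdot>\<^sub>m R) * u) $$ (i, j) = (v * scalar_mat (a \<cdot>\<^sub>m T + b \<cdot>\<^sub>m R)) $$ (i, j)"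
      by (simp only: l r MorD(2)[OF T] MorD(2)[OF R])
  qed (use c lc in auto)
  then show ?thesis using Mor_iff[OF c] lc by auto
qed

lemma Mor_smult: "u \<in> carrier_mat n n \<Longrightarrow> v \<in> carrier_mat m m \<Longrightarrow> T \<in> Mor u v \<Longrightarrow> a \<cdot>\<^sub>m T \<in> Mor u v"
proof -
  assume c: "u \<in> carrier_mat n n" "v \<in> carrier_mat m m" and T: "T \<in> Mor u v"
  have "a \<cdot>\<^sub>m T + 0 \<cdot>\<^sub>m T = a \<cdot>\<^sub>m T" by (rule eq_matI) auto
  then show ?thesis using Mor_linear[OF c T T, of a 0] by simp
qed

lemma rep_equivI:
  assumes "u \<in> carrier_mat n n" "v \<in> carrier_mat n n" "T \<in> Mor u v" "R \<in> carrier_mat n n" "R * T = 1\<^sub>m n" "T * R = 1\<^sub>m n"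
  shows "rep_equiv u v"
  unfolding rep_equiv_def invertible_mat_def inverts_mat_def
  using assms by (intro bexI[of _ T] conjI exI[of _ R]) (auto simp: Mor_iff)

lemma rep_equivE:
  assumes c: "u \<in> carrier_mat n n" "v \<in> carrier_mat m m" and e: "rep_equiv u v"
  obtains T R where "m = n" "T \<in> Mor u v" "R \<in> Mor v u" "T \<in> carrier_mat n n" "R \<in> carrier_mat n n" "R * T = 1\<^sub>m n" "T * R = 1\<^sub>m n"
proof -
  obtain T R where T: "T \<in> Mor u v" "square_mat T" "T * R = 1\<^sub>m (dim_row T)" "R * T = 1\<^sub>m (dim_row R)"
    using e unfolding rep_equiv_def invertible_mat_def inverts_mat_def by blast
  have Tc: "T \<in> carrier_mat m n" using T(1) Mor_iff[OF c] by auto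
  then have mn: "m = n" using T(2) by auto
  have "dim_col R = n" using arg_cong[OF T(3), of dim_col] Tc mn by simp
  moreover have "dim_row R = n" using arg_cong[OF T(4), of dim_col] Tc by simp
  ultimately have Rc: "R \<in> carrier_mat n n" by auto
  have RT: "R * T = 1\<^sub>m n" "T * R = 1\<^sub>m n" using T(3,4) Rc Tc mn by auto
  have "R \<in> Mor v u" using Mor_inverse[OF c T(1), of R] Rc RT mn by simp
  then show ?thesis using that mn T(1) Tc Rc RT by blast
qed

lemma rep_equiv_refl: "u \<in> carrier_mat n n \<Longrightarrow> rep_equiv u u"
  by (rule rep_equivI[of u n u "1\<^sub>m n" "1\<^sub>m n"]) (auto simp: Mor_one)

lemma rep_equiv_sym:
  assumes "u \<in> carrier_mat n n" "v \<in> carrier_mat m m" "rep_equiv u v" shows "rep_equiv v u"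
proof -
  obtain T R where "m = n" "T \<in> Mor u v" "R \<in> Mor v u" "T \<in> carrier_mat n n" "R \<in> carrier_mat n n" "R * T = 1\<^sub>m n" "T * R = 1\<^sub>m n"
    using rep_equivE[OF assms] by metis
  then show ?thesis using rep_equivI[of v n u R T] assms by simp
qed

lemma four_mult:
  fixes A :: "'a::semiring_0 mat"
  assumes "A \<in> carrier_mat n n" "B \<in> carrier_mat n n" "C \<in> carrier_mat n n" "D \<in> carrier_mat n n"
  shows "(A * B) * (C * D) = A * ((B * C) * D)"
  using assms by (simp add: assoc_mult_mat[of _ n n _ n _ n])

lemma rep_equiv_trans:
  assumes c: "u \<in> carrier_mat n n" "v \<in> carrier_mat m m" "w \<in> carrier_mat k k" and e: "rep_equiv u v" "rep_equiv v w"
  shows "rep_equiv u w"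
proof -
  obtain T R where T: "m = n" "T \<in> Mor u v" "R \<in> Mor v u" "T \<in> carrier_mat n n" "R \<in> carrier_mat n n" "R * T = 1\<^sub>m n" "T * R = 1\<^sub>m n"
    using rep_equivE[OF c(1,2) e(1)] by metis
  obtain T' R' where T': "k = m" "T' \<in> Mor v w" "R' \<in> Mor w v" "T' \<in> carrier_mat m m" "R' \<in> carrier_mat m m" "R' * T' = 1\<^sub>m m" "T' * R' = 1\<^sub>m m"
    using rep_equivE[OF c(2,3) e(2)] by metis
  have c': "T' \<in> carrier_mat n n" "R' \<in> carrier_mat n n" "R' * T' = 1\<^sub>m n" "T' * R' = 1\<^sub>m n" using T' T(1) by auto
  have 1: "(R * R') * (T' * T) = 1\<^sub>m n"
    unfolding four_mult[OF T(5) c'(2,1) T(4)] c'(3) using T by simp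
  have 2: "(T' * T) * (R * R') = 1\<^sub>m n"
    unfolding four_mult[OF c'(1) T(4,5) c'(2)] T(7) using c' by simp
  show ?thesis
    by (rule rep_equivI[of u n w "T' * T" "R * R'", OF _ _ Mor_mult[OF c T(2) T'(2)] _ 1 2]) (use c T T' in auto)
qed

section \<open>Block diagonal sums and their injections\<close>

definition inj_left :: "nat \<Rightarrow> nat \<Rightarrow> complex mat" where
  "inj_left m k = mat (m + k) m (\<lambda>(i, j). if i = j then 1 else 0)"

definition inj_right :: "nat \<Rightarrow> nat \<Rightarrow> complex mat" where
  "inj_right m k = mat (m + k) k (\<lambda>(i, j). if i = m + j then 1 else 0)"

lemma inj_carrier [simp]: "inj_left m k \<in> carrier_mat (m + k) m" "inj_right m k \<in> carrier_mat (m + k) k"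
  by (simp_all add: inj_left_def inj_right_def)

lemma block_diag_carrier: "v \<in> carrier_mat m m \<Longrightarrow> w \<in> carrier_mat k k \<Longrightarrow> block_diag v w \<in> carrier_mat (m + k) (m + k)"
  by (rule four_block_carrier_mat)

lemma inj_left_Mor:
  fixes v w :: "'a::cstar_algebra mat"
  assumes c: "v \<in> carrier_mat m m" "w \<in> carrier_mat k k"
  shows "inj_left m k \<in> Mor v (block_diag v w)" "mat_adjoint (inj_left m k) \<in> Mor (block_diag v w) v"
proof -
  note b = block_diag_carrier[OF c]
  have ac: "mat_adjoint (inj_left m k) \<in> carrier_mat m (m + k)" by simp
  have s: "(\<Sum>l<m. scaleC (inj_left m k $$ (i, l)) (v $$ (l, j))) = (if i < m then v $$ (i, j) else 0)" if "i < m + k" for i j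
  proof -
    have "(\<Sum>l<m. scaleC (inj_left m k $$ (i, l)) (v $$ (l, j))) = (\<Sum>l<m. if l = i then v $$ (l, j) else 0)"
      using that by (intro sum.cong refl) (auto simp: inj_left_def)
    then show ?thesis by simp
  qed
  have s': "(\<Sum>l<m+k. scaleC (inj_left m k $$ (l, j)) (x l)) = x j" if "j < m" for j and x :: "nat \<Rightarrow> 'a"
  proof -
    have "(\<Sum>l<m+k. scaleC (inj_left m k $$ (l, j)) (x l)) = (\<Sum>l<m+k. if l = j then x l else 0)"
      using that by (intro sum.cong refl) (auto simp: inj_left_def)
    then show ?thesis using that by simp
  qed
  have "scalar_mat (inj_left m k) * v = block_diag v w * scalar_mat (inj_left m k)"
  proof (rule eq_matI)
    fix i j assume "i < dim_row (block_diag v w * scalar_mat (inj_left m k))" "j < dim_col (block_diag v w * scalar_mat (inj_left m k))"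
    then have ij: "i < m + k" "j < m" using c by (auto simp: inj_left_def)
    show "(scalar_mat (inj_left m k) * v) $$ (i, j) = (block_diag v w * scalar_mat (inj_left m k)) $$ (i, j)"
      unfolding scalar_mult_entry[OF inj_carrier(1) c(1) ij] mult_scalar_entry[OF b inj_carrier(1) ij] s[OF ij(1)] s'[OF ij(2)]
      using ij c by auto
  qed (use c in \<open>auto simp: inj_left_def\<close>)
  then show "inj_left m k \<in> Mor v (block_diag v w)" unfolding Mor_iff[OF c(1) b] by simp
  have a: "mat_adjoint (inj_left m k) $$ (i, l) = inj_left m k $$ (l, i)" if "i < m" "l < m + k" for i l
    using that by (simp add: inj_left_def)
  have "scalar_mat (mat_adjoint (inj_left m k)) * block_diag v w = v * scalar_mat (mat_adjoint (inj_left m k))"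
  proof (rule eq_matI)
    fix i j assume "i < dim_row (v * scalar_mat (mat_adjoint (inj_left m k)))" "j < dim_col (v * scalar_mat (mat_adjoint (inj_left m k)))"
    then have ij: "i < m" "j < m + k" using c by (auto simp: inj_left_def)
    have "(\<Sum>l<m+k. scaleC (mat_adjoint (inj_left m k) $$ (i, l)) (block_diag v w $$ (l, j)))
        = (\<Sum>l<m+k. scaleC (inj_left m k $$ (l, i)) (block_diag v w $$ (l, j)))"
      by (rule sum.cong) (use ij in \<open>auto simp: a\<close>)
    also have "\<dots> = block_diag v w $$ (i, j)" by (rule s'[OF ij(1)])
    finally have "(\<Sum>l<m+k. scaleC (mat_adjoint (inj_left m k) $$ (i, l)) (block_diag v w $$ (l, j))) = block_diag v w $$ (i, j)" .
    moreover have "(\<Sum>l<m. scaleC (mat_adjoint (inj_left m k) $$ (l, j)) (v $$ (i, l))) = (\<Sum>l<m. if l = j then v $$ (i, l) else 0)"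
      using ij by (intro sum.cong refl) (auto simp: inj_left_def)
    ultimately show "(scalar_mat (mat_adjoint (inj_left m k)) * block_diag v w) $$ (i, j) = (v * scalar_mat (mat_adjoint (inj_left m k))) $$ (i, j)"
      unfolding scalar_mult_entry[OF ac b ij] mult_scalar_entry[OF c(1) ac ij] using ij c by auto
  qed (use c in \<open>auto simp: inj_left_def\<close>)
  then show "mat_adjoint (inj_left m k) \<in> Mor (block_diag v w) v" unfolding Mor_iff[OF b c(1)] by simp
qed

lemma inj_right_Mor:
  fixes v w :: "'a::cstar_algebra mat"
  assumes c: "v \<in> carrier_mat m m" "w \<in> carrier_mat k k"
  shows "inj_right m k \<in> Mor w (block_diag v w)" "mat_adjoint (inj_right m k) \<in> Mor (block_diag v w) w"
proof -
  note b = block_diag_carrier[OF c]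
  have ac: "mat_adjoint (inj_right m k) \<in> carrier_mat k (m + k)" by simp
  have s: "(\<Sum>l<k. scaleC (inj_right m k $$ (i, l)) (w $$ (l, j))) = (if i < m then 0 else w $$ (i - m, j))" if "i < m + k" for i j
  proof -
    have "(\<Sum>l<k. scaleC (inj_right m k $$ (i, l)) (w $$ (l, j))) = (\<Sum>l<k. if l = i - m then (if i < m then 0 else w $$ (l, j)) else 0)"
      using that by (intro sum.cong refl) (auto simp: inj_right_def)
    then show ?thesis using that by auto
  qed
  have s': "(\<Sum>l<m+k. scaleC (inj_right m k $$ (l, j)) (x l)) = x (m + j)" if "j < k" for j and x :: "nat \<Rightarrow> 'a"
  proof -
    have "(\<Sum>l<m+k. scaleC (inj_right m k $$ (l, j)) (x l)) = (\<Sum>l<m+k. if l = m + j then x l else 0)"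
      using that by (intro sum.cong refl) (auto simp: inj_right_def)
    then show ?thesis using that by simp
  qed
  have "scalar_mat (inj_right m k) * w = block_diag v w * scalar_mat (inj_right m k)"
  proof (rule eq_matI)
    fix i j assume "i < dim_row (block_diag v w * scalar_mat (inj_right m k))" "j < dim_col (block_diag v w * scalar_mat (inj_right m k))"
    then have ij: "i < m + k" "j < k" using c by (auto simp: inj_right_def)
    show "(scalar_mat (inj_right m k) * w) $$ (i, j) = (block_diag v w * scalar_mat (inj_right m k)) $$ (i, j)"
      unfolding scalar_mult_entry[OF inj_carrier(2) c(2) ij] mult_scalar_entry[OF b inj_carrier(2) ij] s[OF ij(1)] s'[OF ij(2)]
      using ij c by auto
  qed (use c in \<open>auto simp: inj_right_def\<close>)
  then show "inj_right m k \<in> Mor w (block_diag v w)" unfolding Mor_iff[OF c(2) b] by simp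
  have a: "mat_adjoint (inj_right m k) $$ (i, l) = inj_right m k $$ (l, i)" if "i < k" "l < m + k" for i l
    using that by (simp add: inj_right_def)
  have "scalar_mat (mat_adjoint (inj_right m k)) * block_diag v w = w * scalar_mat (mat_adjoint (inj_right m k))"
  proof (rule eq_matI)
    fix i j assume "i < dim_row (w * scalar_mat (mat_adjoint (inj_right m k)))" "j < dim_col (w * scalar_mat (mat_adjoint (inj_right m k)))"
    then have ij: "i < k" "j < m + k" using c by (auto simp: inj_right_def)
    have "(\<Sum>l<m+k. scaleC (mat_adjoint (inj_right m k) $$ (i, l)) (block_diag v w $$ (l, j)))
        = (\<Sum>l<m+k. scaleC (inj_right m k $$ (l, i)) (block_diag v w $$ (l, j)))"
      by (rule sum.cong) (use ij in \<open>auto simp: a\<close>)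
    also have "\<dots> = block_diag v w $$ (m + i, j)" by (rule s'[OF ij(1)])
    finally have "(\<Sum>l<m+k. scaleC (mat_adjoint (inj_right m k) $$ (i, l)) (block_diag v w $$ (l, j))) = block_diag v w $$ (m + i, j)" .
    moreover have "(\<Sum>l<k. scaleC (mat_adjoint (inj_right m k) $$ (l, j)) (w $$ (i, l))) = (\<Sum>l<k. if l = j - m then (if j < m then 0 else w $$ (i, l)) else 0)"
      using ij by (intro sum.cong refl) (auto simp: inj_right_def)
    ultimately show "(scalar_mat (mat_adjoint (inj_right m k)) * block_diag v w) $$ (i, j) = (w * scalar_mat (mat_adjoint (inj_right m k))) $$ (i, j)"
      unfolding scalar_mult_entry[OF ac b ij] mult_scalar_entry[OF c(2) ac ij] using ij c by auto
  qed (use c in \<open>auto simp: inj_right_def\<close>)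
  then show "mat_adjoint (inj_right m k) \<in> Mor (block_diag v w) w" unfolding Mor_iff[OF b c(2)] by simp
qed

lemma inj_isometry:
  "mat_adjoint (inj_left m k) * inj_left m k = 1\<^sub>m m" "mat_adjoint (inj_right m k) * inj_right m k = 1\<^sub>m k"
proof -
  have "(\<Sum>l<m+k. cnj (inj_left m k $$ (l, i)) * inj_left m k $$ (l, j)) = (\<Sum>l<m+k. if l = i then if i = j then 1 else 0 else 0)"
    if "i < m" "j < m" for i j
    using that by (intro sum.cong refl) (auto simp: inj_left_def)
  then show "mat_adjoint (inj_left m k) * inj_left m k = 1\<^sub>m m"
    by (intro eq_matI) (auto simp: mat_mult_entry[OF mat_adjoint_carrier[OF inj_carrier(1)] inj_carrier(1)] simp del: index_mult_mat(1), auto simp: inj_left_def)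
  have "(\<Sum>l<m+k. cnj (inj_right m k $$ (l, i)) * inj_right m k $$ (l, j)) = (\<Sum>l<m+k. if l = m + i then if i = j then 1 else 0 else 0)"
    if "i < k" "j < k" for i j
    using that by (intro sum.cong refl) (auto simp: inj_right_def)
  then show "mat_adjoint (inj_right m k) * inj_right m k = 1\<^sub>m k"
    by (intro eq_matI) (auto simp: mat_mult_entry[OF mat_adjoint_carrier[OF inj_carrier(2)] inj_carrier(2)] simp del: index_mult_mat(1), auto simp: inj_right_def)
qed

lemma unital_star_hom_zero: "unital_star_hom f \<Longrightarrow> f 0 = 0"
  using unital_star_hom_scaleR[of f 0 0] by simp

lemma map_mat_hom_mult:
  assumes f: "unital_star_hom f" and c: "u \<in> carrier_mat n m" "v \<in> carrier_mat m k"
  shows "map_mat f (u * v) = map_mat f u * map_mat f v"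
proof (rule eq_matI)
  fix i j assume "i < dim_row (map_mat f u * map_mat f v)" "j < dim_col (map_mat f u * map_mat f v)"
  then have ij: "i < n" "j < k" using c by auto
  have "map_mat f (u * v) $$ (i, j) = f ((u * v) $$ (i, j))" using ij c by simp
  also have "\<dots> = (\<Sum>l<m. f (u $$ (i, l)) * f (v $$ (l, j)))"
    unfolding mat_mult_entry[OF c ij] unital_star_hom_sum[OF f] using f by (simp add: unital_star_hom_def)
  also have "\<dots> = (\<Sum>l<m. map_mat f u $$ (i, l) * map_mat f v $$ (l, j))"
    using c ij by (intro sum.cong refl) simp
  also have "\<dots> = (map_mat f u * map_mat f v) $$ (i, j)"
    by (rule mat_mult_entry[symmetric]) (use c ij in auto)
  finally show "map_mat f (u * v) $$ (i, j) = (map_mat f u * map_mat f v) $$ (i, j)" .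
qed (use c in auto)

lemma map_mat_hom_scalar: "unital_star_hom f \<Longrightarrow> map_mat f (scalar_mat T) = scalar_mat T"
  by (rule eq_matI) (auto simp: unital_star_hom_def)

lemma map_mat_block_diag:
  assumes "unital_star_hom f" shows "map_mat f (block_diag v w) = block_diag (map_mat f v) (map_mat f w)"
  by (rule eq_matI) (auto simp: unital_star_hom_zero[OF assms])

lemma block_diag_eqD:
  assumes "block_diag v w = block_diag v' w'" "v \<in> carrier_mat m m" "v' \<in> carrier_mat m m" "w \<in> carrier_mat k k" "w' \<in> carrier_mat k k"
  shows "v = v'" "w = w'"
proof -
  have e: "block_diag v w $$ (i, j) = block_diag v' w' $$ (i, j)" for i j using assms(1) by simp
  show "v = v'"
  proof (rule eq_matI)
    fix i j assume "i < dim_row v'" "j < dim_col v'"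
    then show "v $$ (i, j) = v' $$ (i, j)" using e[of i j] assms by auto
  qed (use assms in auto)
  show "w = w'"
  proof (rule eq_matI)
    fix i j assume "i < dim_row w'" "j < dim_col w'"
    then show "w $$ (i, j) = w' $$ (i, j)" using e[of "m + i" "m + j"] assms by auto
  qed (use assms in auto)
qed

lemma star_transpose_block_diag: "star_transpose (block_diag v w) = block_diag (star_transpose v) (star_transpose w)"
  by (rule eq_matI) (auto simp: star_transpose_def)

lemma block_diag_one: "block_diag (1\<^sub>m m) (1\<^sub>m k) = 1\<^sub>m (m + k)"
  by (simp add: four_block_one_mat)

lemma unitary_over_block_diag:
  assumes c: "v \<in> carrier_mat m m" "w \<in> carrier_mat k k" and u: "unitary_over (m + k) (block_diag v w)"
  shows "unitary_over m v" "unitary_over k w"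
proof -
  have c': "star_transpose v \<in> carrier_mat m m" "star_transpose w \<in> carrier_mat k k" using c by auto
  have 1: "block_diag (star_transpose v * v) (star_transpose w * w) = block_diag (1\<^sub>m m) (1\<^sub>m k)"
    using u unfolding unitary_over_def star_transpose_block_diag block_diag_mult[OF c'(1) c(1) c'(2) c(2)] block_diag_one by simp
  have 2: "block_diag (v * star_transpose v) (w * star_transpose w) = block_diag (1\<^sub>m m) (1\<^sub>m k)"
    using u unfolding unitary_over_def star_transpose_block_diag block_diag_mult[OF c(1) c'(1) c(2) c'(2)] block_diag_one by simp
  show "unitary_over m v" "unitary_over k w"
    using block_diag_eqD[OF 1, of m k] block_diag_eqD[OF 2, of m k] c c' by (auto simp: unitary_over_def)
qed

lemma isometry_nonzero: "mat_adjoint T * T = 1\<^sub>m m \<Longrightarrow> 0 < m \<Longrightarrow> T \<noteq> (0\<^sub>m n m :: complex mat)"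
proof
  assume a: "mat_adjoint T * T = 1\<^sub>m m" "0 < m" "T = 0\<^sub>m n m"
  have "mat_adjoint T * T = 0\<^sub>m m m" unfolding a(3) by (rule right_mult_zero_mat) (rule mat_adjoint_carrier, simp)
  then have "1\<^sub>m m = (0\<^sub>m m m :: complex mat)" using a(1) by simp
  from arg_cong[OF this, of "\<lambda>M. M $$ (0, 0)"] show False using a(2) by simp
qed

text \<open>Both traces are the squared Hilbert-Schmidt norm of T. Their equality is what compares
  dimensions in the arguments below.\<close>

lemma sum_norm_entries:
  fixes T :: "complex mat"
  assumes T: "T \<in> carrier_mat n m"
  shows "(\<Sum>j<m. (mat_adjoint T * T) $$ (j, j)) = of_real (\<Sum>j<m. \<Sum>i<n. (cmod (T $$ (i, j)))\<^sup>2)"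
    "(\<Sum>i<n. (T * mat_adjoint T) $$ (i, i)) = of_real (\<Sum>j<m. \<Sum>i<n. (cmod (T $$ (i, j)))\<^sup>2)"
proof -
  note a = mat_adjoint_carrier[OF T]
  have "(mat_adjoint T * T) $$ (j, j) = of_real (\<Sum>i<n. (cmod (T $$ (i, j)))\<^sup>2)" if "j < m" for j
    unfolding mat_mult_entry[OF a T that that] of_real_sum
    by (rule sum.cong) (use T that in \<open>auto simp: cnj_mult_self\<close>)
  then show "(\<Sum>j<m. (mat_adjoint T * T) $$ (j, j)) = of_real (\<Sum>j<m. \<Sum>i<n. (cmod (T $$ (i, j)))\<^sup>2)"
    by simp
  have "(T * mat_adjoint T) $$ (i, i) = of_real (\<Sum>j<m. (cmod (T $$ (i, j)))\<^sup>2)" if "i < n" for i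
    unfolding mat_mult_entry[OF T a that that] of_real_sum
    by (rule sum.cong) (use T that in \<open>auto simp: cnj_mult_self\<close>)
  then have "(\<Sum>i<n. (T * mat_adjoint T) $$ (i, i)) = of_real (\<Sum>i<n. \<Sum>j<m. (cmod (T $$ (i, j)))\<^sup>2)" by simp
  also have "(\<Sum>i<n. \<Sum>j<m. (cmod (T $$ (i, j)))\<^sup>2) = (\<Sum>j<m. \<Sum>i<n. (cmod (T $$ (i, j)))\<^sup>2)" by (rule sum.swap)
  finally show "(\<Sum>i<n. (T * mat_adjoint T) $$ (i, i)) = of_real (\<Sum>j<m. \<Sum>i<n. (cmod (T $$ (i, j)))\<^sup>2)" .
qed

text \<open>Taking traces, m c is the sum of the squared moduli of the entries of T, which is
  positive.\<close>

lemma scalar_gram_eq: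
  fixes T :: "complex mat"
  assumes T: "T \<in> carrier_mat n m" "T \<noteq> 0\<^sub>m n m" and g: "mat_adjoint T * T = c \<cdot>\<^sub>m 1\<^sub>m m"
  obtains r where "c = of_real r" "r > 0"
proof -
  have m0: "m > 0"
  proof (rule ccontr)
    assume "\<not> m > 0"
    then have "T = 0\<^sub>m n m" using T(1) by (intro eq_matI) auto
    then show False using T(2) by blast
  qed
  define s where "s = (\<Sum>j<m. \<Sum>i<n. (cmod (T $$ (i, j)))\<^sup>2)"
  have "s \<noteq> 0"
  proof
    assume "s = 0"
    have "T $$ (i, j) = 0" if ij: "i < n" "j < m" for i j
    proof -
      have "(\<Sum>i<n. (cmod (T $$ (i, j)))\<^sup>2) = 0" if "j < m" for j
        using \<open>s = 0\<close> that sum_nonneg_eq_0_iff[of "{..<m}" "\<lambda>j. \<Sum>i<n. (cmod (T $$ (i, j)))\<^sup>2"]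
        unfolding s_def by (simp add: sum_nonneg)
      then show ?thesis
        using ij sum_nonneg_eq_0_iff[of "{..<n}" "\<lambda>i. (cmod (T $$ (i, j)))\<^sup>2"] by simp
    qed
    then have "T = 0\<^sub>m n m" using T(1) by (intro eq_matI) auto
    then show False using T(2) by blast
  qed
  moreover have "s \<ge> 0" unfolding s_def by (intro sum_nonneg) simp
  ultimately have "s > 0" by simp
  have "(\<Sum>j<m. (mat_adjoint T * T) $$ (j, j)) = of_nat m * c" unfolding g by simp
  then have "of_nat m * c = of_real s" using sum_norm_entries(1)[OF T(1)] by (simp add: s_def)
  then have "c = of_real (s / real m)" using m0 by (simp add: field_simps)
  moreover have "s / real m > 0" using \<open>s > 0\<close> m0 by simp
  ultimately show ?thesis using that by blast
qed

lemma smult_one_mult: "T \<in> carrier_mat n m \<Longrightarrow> (c \<cdot>\<^sub>m 1\<^sub>m n) * T = c \<cdot>\<^sub>m (T :: complex mat)"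
  "T \<in> carrier_mat n m \<Longrightarrow> T * (c \<cdot>\<^sub>m 1\<^sub>m m) = c \<cdot>\<^sub>m (T :: complex mat)"
  using mult_smult_assoc_mat[of "1\<^sub>m n" n n T m c] mult_smult_distrib[of T n m "1\<^sub>m m" m c] by auto

lemma smult_mat_cancel: "a \<cdot>\<^sub>m T = b \<cdot>\<^sub>m T \<Longrightarrow> T \<in> carrier_mat n m \<Longrightarrow> T \<noteq> 0\<^sub>m n m \<Longrightarrow> a = (b :: complex)"
proof (rule ccontr)
  assume a: "a \<cdot>\<^sub>m T = b \<cdot>\<^sub>m T" "T \<in> carrier_mat n m" "T \<noteq> 0\<^sub>m n m" "a \<noteq> b"
  have "T $$ (i, j) = 0" if "i < n" "j < m" for i j
    using arg_cong[OF a(1), of "\<lambda>M. M $$ (i, j)"] a(2,4) that by simp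
  then have "T = 0\<^sub>m n m" using a(2) by (intro eq_matI) auto
  then show False using a(3) by blast
qed

section \<open>Schur's lemma and complete reducibility\<close>

context cqg
begin

lemma hom_legs: "unital_star_hom (\<lambda>a. tensor G a 1)" "unital_star_hom (tensor G 1)"
  by (simp_all add: unital_star_hom_def T.t_add T.t_scaleC T.t_mult T.t_star T.t_one)

text \<open>The corepresentation identity \<Phi>(u) = (u \<otimes> 1)(1 \<otimes> u) as one matrix
  equation over the tensor product, so that base change and block sums become matrix algebra instead
  of index sums.\<close>

definition comult_mat :: "'a mat \<Rightarrow> bool" where
  "comult_mat u \<longleftrightarrow> map_mat (comult G) u = map_mat (\<lambda>a. tensor G a 1) u * map_mat (tensor G 1) u"

lemma comult_mat_iff:
  assumes c: "u \<in> carrier_mat n n"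
  shows "comult_mat u \<longleftrightarrow> (\<forall>i<n. \<forall>j<n. comult G (u $$ (i, j)) = (\<Sum>k<n. tensor G (u $$ (i, k)) (u $$ (k, j))))"
proof -
  have e: "(map_mat (\<lambda>a. tensor G a 1) u * map_mat (tensor G 1) u) $$ (i, j) = (\<Sum>k<n. tensor G (u $$ (i, k)) (u $$ (k, j)))"
    if "i < n" "j < n" for i j
  proof -
    have "(map_mat (\<lambda>a. tensor G a 1) u * map_mat (tensor G 1) u) $$ (i, j)
        = (\<Sum>k<n. map_mat (\<lambda>a. tensor G a 1) u $$ (i, k) * map_mat (tensor G 1) u $$ (k, j))"
      by (rule mat_mult_entry) (use c that in auto)
    also have "\<dots> = (\<Sum>k<n. tensor G (u $$ (i, k)) (u $$ (k, j)))"
      using c that by (intro sum.cong refl) (simp add: T.t_mult)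
    finally show ?thesis .
  qed
  show ?thesis
  proof
    assume "comult_mat u"
    then have *: "map_mat (comult G) u $$ (i, j) = (map_mat (\<lambda>a. tensor G a 1) u * map_mat (tensor G 1) u) $$ (i, j)" for i j
      by (simp only: comult_mat_def)
    show "\<forall>i<n. \<forall>j<n. comult G (u $$ (i, j)) = (\<Sum>k<n. tensor G (u $$ (i, k)) (u $$ (k, j)))"
    proof (intro allI impI)
      fix i j assume ij: "i < n" "j < n"
      have "comult G (u $$ (i, j)) = map_mat (comult G) u $$ (i, j)" using ij c by simp
      then show "comult G (u $$ (i, j)) = (\<Sum>k<n. tensor G (u $$ (i, k)) (u $$ (k, j)))"
        by (simp only: * e[OF ij])
    qed
  next
    assume *: "\<forall>i<n. \<forall>j<n. comult G (u $$ (i, j)) = (\<Sum>k<n. tensor G (u $$ (i, k)) (u $$ (k, j)))"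
    show "comult_mat u" unfolding comult_mat_def
    proof (rule eq_matI)
      fix i j assume "i < dim_row (map_mat (\<lambda>a. tensor G a 1) u * map_mat (tensor G 1) u)"
        "j < dim_col (map_mat (\<lambda>a. tensor G a 1) u * map_mat (tensor G 1) u)"
      then have ij: "i < n" "j < n" using c by auto
      have "map_mat (comult G) u $$ (i, j) = comult G (u $$ (i, j))" using ij c by simp
      then show "map_mat (comult G) u $$ (i, j) = (map_mat (\<lambda>a. tensor G a 1) u * map_mat (tensor G 1) u) $$ (i, j)"
        using * ij by (simp only: e[OF ij])
    qed (use c in auto)
  qed
qed

lemma is_rep_iff: "is_rep G u \<longleftrightarrow> 0 < dim_row u \<and> unitary_over (dim_row u) u \<and> comult_mat u"
proof -
  have "(u \<in> carrier_mat n n \<and> star_transpose u * u = 1\<^sub>m n \<and> u * star_transpose u = 1\<^sub>m n \<and>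
        (\<forall>i<n. \<forall>j<n. comult G (u $$ (i, j)) = (\<Sum>k<n. tensor G (u $$ (i, k)) (u $$ (k, j)))))
    \<longleftrightarrow> unitary_over n u \<and> comult_mat u" for n
    by (cases "u \<in> carrier_mat n n") (simp_all only: unitary_over_def comult_mat_iff simp_thms conj_assoc)
  then have "is_rep G u \<longleftrightarrow> (\<exists>n>0. unitary_over n u \<and> comult_mat u)" unfolding is_rep_def by blast
  also have "\<dots> \<longleftrightarrow> 0 < dim_row u \<and> unitary_over (dim_row u) u \<and> comult_mat u"
    by (auto dest: unitary_over_carrier)
  finally show ?thesis .
qed

lemma is_rep_carrier: "is_rep G u \<Longrightarrow> u \<in> carrier_mat (dim_row u) (dim_row u)"
  by (simp add: is_rep_iff unitary_over_def)

lemma comult_mat_conj: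
  assumes c: "u \<in> carrier_mat n n" "A \<in> carrier_mat n n" "B \<in> carrier_mat n n" "A * B = 1\<^sub>m n" and u: "comult_mat u"
  shows "comult_mat (scalar_mat B * u * scalar_mat A)"
proof -
  have e: "map_mat f (scalar_mat B * u * scalar_mat A) = scalar_mat B * map_mat f u * scalar_mat A" if "unital_star_hom f" for f :: "'a \<Rightarrow> 'b"
    using map_mat_hom_mult[OF that, of "scalar_mat B * u" n n "scalar_mat A" n] map_mat_hom_mult[OF that, of "scalar_mat B" n n u n] c
    by (simp add: map_mat_hom_scalar[OF that])
  define x :: "'b mat" where "x = map_mat (\<lambda>a. tensor G a 1) u"
  define y :: "'b mat" where "y = map_mat (tensor G 1) u"
  define A' :: "'b mat" where "A' = scalar_mat A"
  define B' :: "'b mat" where "B' = scalar_mat B"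
  have c': "x \<in> carrier_mat n n" "y \<in> carrier_mat n n" "A' \<in> carrier_mat n n" "B' \<in> carrier_mat n n"
    using c by (auto simp: x_def y_def A'_def B'_def)
  have AB: "A' * B' = 1\<^sub>m n" using scalar_mat_mult[OF c(2,3), where 'a = 'b] c(4) by (simp add: A'_def B'_def)
  have "(B' * x * A') * (B' * y * A') = (B' * x) * ((A' * B') * (y * A'))"
    using c' by (simp add: assoc_mult_mat[of _ n n _ n _ n])
  also have "\<dots> = B' * (x * y) * A'"
    unfolding AB using c' by (simp add: assoc_mult_mat[of _ n n _ n _ n])
  finally show ?thesis
    using u unfolding comult_mat_def e[OF hom_comult] e[OF hom_legs(1)] e[OF hom_legs(2)]
    by (simp add: x_def y_def A'_def B'_def)
qed

lemma is_rep_block_diag: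
  assumes c: "v \<in> carrier_mat m m" "w \<in> carrier_mat k k" "0 < m" "0 < k" and u: "is_rep G (block_diag v w)"
  shows "is_rep G v" "is_rep G w"
proof -
  have un: "unitary_over m v" "unitary_over k w"
  proof -
    have "dim_row (block_diag v w) = m + k" using c by simp
    then have "unitary_over (m + k) (block_diag v w)" using u is_rep_iff[of "block_diag v w"] by metis
    then show "unitary_over m v" "unitary_over k w" by (rule unitary_over_block_diag[OF c(1,2)])+
  qed
  have cc: "map_mat (\<lambda>a. tensor G a 1) v \<in> carrier_mat m m" "map_mat (tensor G 1) v \<in> carrier_mat m m"
    "map_mat (\<lambda>a. tensor G a 1) w \<in> carrier_mat k k" "map_mat (tensor G 1) w \<in> carrier_mat k k" using c by auto
  have "block_diag (map_mat (comult G) v) (map_mat (comult G) w)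
     = block_diag (map_mat (\<lambda>a. tensor G a 1) v * map_mat (tensor G 1) v) (map_mat (\<lambda>a. tensor G a 1) w * map_mat (tensor G 1) w)"
    using u unfolding is_rep_iff comult_mat_def map_mat_block_diag[OF hom_comult] map_mat_block_diag[OF hom_legs(1)]
      map_mat_block_diag[OF hom_legs(2)] block_diag_mult[OF cc] by simp
  from block_diag_eqD[OF this, of m k] c have "comult_mat v" "comult_mat w" by (auto simp: comult_mat_def)
  then show "is_rep G v" "is_rep G w" using un c by (auto simp: is_rep_iff)
qed

text \<open>\<open>v\<close> and \<open>w\<close> live on complementary sums of eigenspaces of \<open>A\<close>.\<close>

lemma rep_split:
  assumes u: "is_rep G u" "u \<in> carrier_mat n n" and A: "A \<in> Mor u u" "mat_adjoint A = A" and ns: "\<And>c. A \<noteq> c \<cdot>\<^sub>m 1\<^sub>m n"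
  obtains v w m k where "is_rep G v" "is_rep G w" "v \<in> carrier_mat m m" "w \<in> carrier_mat k k" "n = m + k" "0 < m" "0 < k"
    "rep_equiv u (block_diag v w)" "subrep v u"
proof -
  have Ac: "A \<in> carrier_mat n n" using A(1) Mor_iff[OF u(2) u(2)] by simp
  obtain U d m where U: "unitary_mat n U" "A * U = U * diagm n d" "0 < m" "m < n"
    "\<And>i j. i < m \<Longrightarrow> m \<le> j \<Longrightarrow> j < n \<Longrightarrow> d i \<noteq> d j" using spectral_split[OF Ac A(2) ns] by blast
  have Uc: "U \<in> carrier_mat n n" and UU: "mat_adjoint U * U = 1\<^sub>m n" "U * mat_adjoint U = 1\<^sub>m n" using U(1) by (auto simp: unitary_mat_def)
  note Ua = mat_adjoint_carrier[OF Uc]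
  define S :: "'a mat" where "S = scalar_mat U"
  define S' :: "'a mat" where "S' = scalar_mat (mat_adjoint U)"
  have Sc: "S \<in> carrier_mat n n" "S' \<in> carrier_mat n n" using Uc Ua by (auto simp: S_def S'_def)
  have SS: "S' * S = 1\<^sub>m n" "S * S' = 1\<^sub>m n"
    using scalar_mat_mult[OF Ua Uc, where 'a = 'a] scalar_mat_mult[OF Uc Ua, where 'a = 'a] UU by (simp_all add: S_def S'_def)
  define x where "x = S' * u * S"
  have xc: "x \<in> carrier_mat n n" using Sc u by (simp add: x_def)
  have n0: "0 < n" using U by simp
  have rx: "is_rep G x"
  proof -
    have "unitary_over n S'" using unitary_over_star_transpose[OF unitary_over_scalar[OF U(1)]] by (simp add: S'_def)
    then have "unitary_over n x" unfolding x_def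
      using u unitary_over_scalar[OF U(1), where 'a = 'a] by (intro unitary_over_mult) (auto simp: is_rep_iff S_def)
    moreover have "comult_mat x" unfolding x_def S_def S'_def
      by (rule comult_mat_conj[OF u(2) Uc Ua UU(2)]) (use u in \<open>simp add: is_rep_iff\<close>)
    ultimately show ?thesis using n0 xc by (auto simp: is_rep_iff)
  qed
  have uS: "u * S \<in> carrier_mat n n" using u Sc by simp
  have Sx: "S * x = u * S"
    unfolding x_def assoc_mult_mat[OF Sc(2) u(2) Sc(1)] assoc_mult_mat[OF Sc(1,2) uS, symmetric] SS(2)
    by (rule left_mult_one_mat[OF uS])
  then have Um: "U \<in> Mor x u" unfolding Mor_iff[OF xc u(2)] using Uc by (simp add: S_def)
  then have Um': "mat_adjoint U \<in> Mor u x"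
    using Mor_adjoint[of n x n u U] u rx xc by (auto simp: is_rep_iff)
  have "mat_adjoint U * (A * U) = diagm n d"
    unfolding U(2) using assoc_mult_mat[OF Ua Uc diagm_carrier, of d] UU left_mult_one_mat[OF diagm_carrier, of n d] by simp
  then have D: "diagm n d \<in> Mor x x"
    using Mor_mult[OF xc u(2) xc Mor_mult[OF xc u(2) u(2) Um A(1)] Um'] by simp
  \<comment> \<open>x commutes with the diagonal matrix of d; comparing entries kills x between
    indices with different eigenvalues.\<close>
  have z: "scaleC (d i) (x $$ (i, j)) = scaleC (d j) (x $$ (i, j))" if "i < n" "j < n" for i j
  proof -
    have sd: "scalar_mat (diagm n d) = diagm n (\<lambda>i. scaleC (d i) (1::'a))"
      by (rule eq_matI) (auto simp: diagm_def)
    have "(diagm n (\<lambda>i. scaleC (d i) 1) * x) $$ (i, j) = (x * diagm n (\<lambda>i. scaleC (d i) 1)) $$ (i, j)"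
      using MorD(2)[OF D] unfolding sd by simp
    then show ?thesis
      unfolding diagm_mult_entry[OF xc that] mult_diagm_entry[OF xc that] by (simp add: scaleC_mult_left scaleC_mult_right)
  qed
  have x0: "x $$ (i, j) = 0" if "i < n" "j < n" "d i \<noteq> d j" for i j
  proof -
    have "scaleC (inverse (d i - d j)) (scaleC (d i - d j) (x $$ (i, j))) = 0"
      unfolding scaleC_diff_left z[OF that(1,2)] by simp
    then show ?thesis using that(3) by (simp add: scaleC_scaleC)
  qed
  define k where "k = n - m"
  have nk: "n = m + k" "0 < k" using U(4) by (simp_all add: k_def)
  define v where "v = mat m m (\<lambda>(i, j). x $$ (i, j))"
  define w where "w = mat k k (\<lambda>(i, j). x $$ (m + i, m + j))"
  have vw: "v \<in> carrier_mat m m" "w \<in> carrier_mat k k" by (simp_all add: v_def w_def)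
  have xb: "x = block_diag v w"
  proof (rule eq_matI)
    fix i j assume "i < dim_row (block_diag v w)" "j < dim_col (block_diag v w)"
    then have ij: "i < n" "j < n" using vw nk by auto
    show "x $$ (i, j) = block_diag v w $$ (i, j)"
      using ij nk x0[OF ij] U(5)[of i j] U(5)[of j i] by (auto simp: v_def w_def)
  qed (use xc vw nk in auto)
  have r: "is_rep G v" "is_rep G w" using is_rep_block_diag[OF vw U(3) nk(2)] rx xb by auto
  have "rep_equiv u x" by (rule rep_equivI[OF u(2) xc Um' Uc UU(2,1)])
  moreover have "subrep v u"
  proof -
    define J where "J = inj_left m k"
    have Jc: "J \<in> carrier_mat n m" by (simp add: J_def nk(1))
    have "U * J \<in> Mor v u"
      by (rule Mor_mult[OF vw(1) xc u(2) _ Um]) (use inj_left_Mor(1)[OF vw] in \<open>simp add: J_def xb\<close>)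
    moreover have "mat_adjoint (U * J) * (U * J) = mat_adjoint J * (mat_adjoint U * (U * J))"
      unfolding mat_adjoint_mult[OF Uc Jc] by (rule assoc_mult_mat[OF mat_adjoint_carrier[OF Jc] Ua mult_carrier_mat[OF Uc Jc]])
    moreover have "mat_adjoint U * (U * J) = J" using assoc_mult_mat[OF Ua Uc Jc] UU Jc by simp
    ultimately show ?thesis unfolding subrep_def using inj_isometry(1)[of m k] vw by (intro bexI[of _ "U * J"]) (auto simp: J_def)
  qed
  ultimately show ?thesis using that[OF r vw nk(1) U(3) nk(2)] xb by simp
qed

lemma irreducible_rep_carrier: "irreducible_rep G u \<Longrightarrow> u \<in> carrier_mat (dim_row u) (dim_row u)"
  by (simp add: irreducible_rep_def is_rep_carrier)

text \<open>Otherwise \<open>rep_split\<close> would produce a subrepresentation of smaller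
  dimension.\<close>

lemma irreducible_hermitian_scalar:
  assumes u: "irreducible_rep G u" "u \<in> carrier_mat n n" and A: "A \<in> Mor u u" "mat_adjoint A = A"
  shows "\<exists>c. A = c \<cdot>\<^sub>m 1\<^sub>m n"
proof (rule ccontr)
  assume "\<not> ?thesis"
  then have ns: "A \<noteq> c \<cdot>\<^sub>m 1\<^sub>m n" for c by blast
  have rep: "is_rep G u" using u(1) by (simp add: irreducible_rep_def)
  obtain v w m k where v: "is_rep G v" "is_rep G w" "v \<in> carrier_mat m m" "w \<in> carrier_mat k k" "n = m + k" "0 < m" "0 < k"
    "rep_equiv u (block_diag v w)" "subrep v u" by (rule rep_split[OF rep u(2) A ns])
  have "dim_row v = dim_row u" using u(1) v(1,9) by (simp add: irreducible_rep_def)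
  then show False using u(2) v(3,5,7) by auto
qed

text \<open>The adjoint of A intertwines as well because u is unitary, so A is a combination of two
  Hermitian intertwiners, and each of these is scalar.\<close>

lemma irreducible_endo_scalar:
  assumes u: "irreducible_rep G u" "u \<in> carrier_mat n n" and A: "A \<in> Mor u u"
  shows "\<exists>c. A = c \<cdot>\<^sub>m 1\<^sub>m n"
proof -
  have un: "unitary_over n u" using u by (auto simp: irreducible_rep_def is_rep_iff)
  have Ac: "A \<in> carrier_mat n n" using A Mor_iff[OF u(2) u(2)] by simp
  note A' = Mor_adjoint[OF un un A]
  define X where "X = (1/2) \<cdot>\<^sub>m A + (1/2) \<cdot>\<^sub>m mat_adjoint A"
  define Y where "Y = (\<i>/2) \<cdot>\<^sub>m A + (-\<i>/2) \<cdot>\<^sub>m mat_adjoint A"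
  have M: "X \<in> Mor u u" "Y \<in> Mor u u" unfolding X_def Y_def by (rule Mor_linear[OF u(2) u(2) A A'])+
  have "mat_adjoint X = X" "mat_adjoint Y = Y"
    by (rule eq_matI; use Ac in \<open>auto simp: X_def Y_def algebra_simps\<close>)+
  then obtain c d where cd: "X = c \<cdot>\<^sub>m 1\<^sub>m n" "Y = d \<cdot>\<^sub>m 1\<^sub>m n"
    using irreducible_hermitian_scalar[OF u] M by metis
  have "A = X + (-\<i>) \<cdot>\<^sub>m Y" by (rule eq_matI) (use Ac in \<open>auto simp: X_def Y_def algebra_simps\<close>)
  also have "\<dots> = (c - \<i> * d) \<cdot>\<^sub>m 1\<^sub>m n" unfolding cd by (rule eq_matI) auto
  finally show ?thesis by blast
qed

lemma irreducible_gram_scalar: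
  assumes w: "irreducible_rep G w" "w \<in> carrier_mat n n" and v: "unitary_over m v" and T: "T \<in> Mor w v" "T \<noteq> 0\<^sub>m m n"
  obtains r where "r > 0" "mat_adjoint T * T = of_real r \<cdot>\<^sub>m 1\<^sub>m n"
proof -
  have un: "unitary_over n w" using w by (auto simp: irreducible_rep_def is_rep_iff)
  note vc = unitary_over_carrier[OF v]
  have Tc: "T \<in> carrier_mat m n" using T(1) Mor_iff[OF w(2) vc] by simp
  have "mat_adjoint T * T \<in> Mor w w" by (rule Mor_mult[OF w(2) vc w(2) T(1) Mor_adjoint[OF un v T(1)]])
  then obtain c where "mat_adjoint T * T = c \<cdot>\<^sub>m 1\<^sub>m n" using irreducible_endo_scalar[OF w] by blast
  then show ?thesis using scalar_gram_eq[OF Tc T(2)] that by metis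
qed

text \<open>T* T = r and T T* = c are scalars. Computing T T* T in both ways gives c = r, and
  equality of the traces, n r = m c, gives n = m; so T is invertible with inverse T* / r.\<close>

theorem schur:
  assumes w: "irreducible_rep G w" "w \<in> carrier_mat n n" and v: "irreducible_rep G v" "v \<in> carrier_mat m m"
    and T: "T \<in> Mor w v" "T \<noteq> 0\<^sub>m m n"
  shows "rep_equiv w v"
proof -
  have un: "unitary_over n w" "unitary_over m v" using w v by (auto simp: irreducible_rep_def is_rep_iff)
  have Tc: "T \<in> carrier_mat m n" using T(1) Mor_iff[OF w(2) v(2)] by simp
  note Ta = mat_adjoint_carrier[OF Tc]
  obtain r where r: "r > 0" "mat_adjoint T * T = of_real r \<cdot>\<^sub>m 1\<^sub>m n"
    using irreducible_gram_scalar[OF w un(2) T] by blast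
  have "T * mat_adjoint T \<in> Mor v v"
    by (rule Mor_mult[OF v(2) w(2) v(2) Mor_adjoint[OF un T(1)] T(1)])
  then obtain c where c: "T * mat_adjoint T = c \<cdot>\<^sub>m 1\<^sub>m m" using irreducible_endo_scalar[OF v] by blast
  have "c \<cdot>\<^sub>m T = (T * mat_adjoint T) * T" unfolding c using smult_one_mult(1)[OF Tc] by simp
  also have "\<dots> = T * (mat_adjoint T * T)" by (rule assoc_mult_mat[OF Tc Ta Tc])
  also have "\<dots> = of_real r \<cdot>\<^sub>m T" unfolding r(2) using smult_one_mult(2)[OF Tc] by simp
  finally have cr: "c = of_real r" using smult_mat_cancel[OF _ Tc T(2)] by blast
  have "of_nat n * complex_of_real r = of_nat m * c"
    using sum_norm_entries[OF Tc] unfolding c r(2) by simp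
  then have nm: "n = m" using r(1) cr by simp
  define R where "R = complex_of_real (1/r) \<cdot>\<^sub>m mat_adjoint T"
  have "R * T = complex_of_real (1/r) \<cdot>\<^sub>m (of_real r \<cdot>\<^sub>m 1\<^sub>m n)"
    unfolding R_def r(2)[symmetric] by (rule mult_smult_assoc_mat[OF Ta Tc])
  also have "\<dots> = 1\<^sub>m n" by (rule eq_matI) (use r(1) in auto)
  finally have 1: "R * T = 1\<^sub>m n" .
  have "T * R = complex_of_real (1/r) \<cdot>\<^sub>m (c \<cdot>\<^sub>m 1\<^sub>m m)"
    unfolding R_def c[symmetric] by (rule mult_smult_distrib[OF Tc Ta])
  also have "\<dots> = 1\<^sub>m m" by (rule eq_matI) (use r(1) cr in auto)
  finally have 2: "T * R = 1\<^sub>m m" .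
  show ?thesis
    by (rule rep_equivI[of w n v T R]) (use w v T 1 2 nm Ta in \<open>auto simp: R_def\<close>)
qed

text \<open>\<open>mat_adjoint T * T\<close> is a positive scalar r, so dividing T by the root of r
  gives an isometry.\<close>

lemma subrep_of_nonzero_Mor:
  assumes w: "irreducible_rep G w" "w \<in> carrier_mat n n" and v: "unitary_over m v" and T: "T \<in> Mor w v" "T \<noteq> 0\<^sub>m m n"
  shows "subrep w v"
proof -
  note vc = unitary_over_carrier[OF v]
  have Tc: "T \<in> carrier_mat m n" using T(1) Mor_iff[OF w(2) vc] by simp
  note Ta = mat_adjoint_carrier[OF Tc]
  obtain r where r: "r > 0" "mat_adjoint T * T = of_real r \<cdot>\<^sub>m 1\<^sub>m n"
    using irreducible_gram_scalar[OF w v T] by blast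
  define s where "s = complex_of_real (1 / sqrt r)"
  have ss: "s * (s * complex_of_real r) = 1"
    using r(1) unfolding s_def of_real_mult[symmetric] by (simp add: real_div_sqrt divide_divide_eq_left[symmetric])
  define R where "R = s \<cdot>\<^sub>m T"
  have Rc: "R \<in> carrier_mat m n" using Tc by (simp add: R_def)
  have "mat_adjoint R = s \<cdot>\<^sub>m mat_adjoint T" by (rule eq_matI) (use Tc in \<open>auto simp: R_def s_def\<close>)
  then have "mat_adjoint R * R = s \<cdot>\<^sub>m (s \<cdot>\<^sub>m (mat_adjoint T * T))"
    unfolding R_def using mult_smult_assoc_mat[OF Ta, of "s \<cdot>\<^sub>m T" n s] mult_smult_distrib[OF Ta Tc, of s] Tc by simp
  also have "\<dots> = 1\<^sub>m n" unfolding r(2) by (rule eq_matI) (use ss in auto)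
  finally have "mat_adjoint R * R = 1\<^sub>m n" .
  moreover have "R \<in> Mor w v" unfolding R_def by (rule Mor_smult[OF w(2) vc T(1)])
  ultimately show ?thesis unfolding subrep_def using w(2) by auto
qed

lemma subrep_irreducible_equiv:
  assumes w: "irreducible_rep G w" and v: "irreducible_rep G v" and s: "subrep w v"
  shows "rep_equiv w v"
proof -
  note c = irreducible_rep_carrier[OF w] irreducible_rep_carrier[OF v]
  obtain T where T: "T \<in> Mor w v" "mat_adjoint T * T = 1\<^sub>m (dim_row w)" using s by (auto simp: subrep_def)
  have Tc: "T \<in> carrier_mat (dim_row v) (dim_row w)" using T(1) Mor_iff[OF c] by simp
  have "0 < dim_row w" using w by (simp add: irreducible_rep_def is_rep_iff)
  then show ?thesis using schur[OF w c(1) v c(2) T(1)] isometry_nonzero[OF T(2)] by blast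
qed

lemma rep_equiv_block_diag:
  assumes c: "v \<in> carrier_mat m m" "w \<in> carrier_mat k k" "v' \<in> carrier_mat m' m'" "w' \<in> carrier_mat k' k'"
    and e: "rep_equiv v v'" "rep_equiv w w'"
  shows "rep_equiv (block_diag v w) (block_diag v' w' :: 'a mat)"
proof -
  obtain T R where T: "m' = m" "T \<in> Mor v v'" "R \<in> Mor v' v" "T \<in> carrier_mat m m" "R \<in> carrier_mat m m" "R * T = 1\<^sub>m m" "T * R = 1\<^sub>m m"
    using rep_equivE[OF c(1,3) e(1)] by metis
  obtain T' R' where T': "k' = k" "T' \<in> Mor w w'" "R' \<in> Mor w' w" "T' \<in> carrier_mat k k" "R' \<in> carrier_mat k k" "R' * T' = 1\<^sub>m k" "T' * R' = 1\<^sub>m k"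
    using rep_equivE[OF c(2,4) e(2)] by metis
  have c': "v' \<in> carrier_mat m m" "w' \<in> carrier_mat k k" using c T T' by auto
  have sb: "(scalar_mat (block_diag T T') :: 'a mat) = block_diag (scalar_mat T :: 'a mat) (scalar_mat T' :: 'a mat)"
    by (rule eq_matI) auto
  have st: "scalar_mat T \<in> carrier_mat m m" "scalar_mat T' \<in> carrier_mat k k" using T T' by auto
  have "scalar_mat (block_diag T T') * block_diag v w = block_diag (scalar_mat T * v) (scalar_mat T' * w)"
    unfolding sb by (rule block_diag_mult[OF st(1) c(1) st(2) c(2)])
  also have "\<dots> = block_diag (v' * scalar_mat T) (w' * scalar_mat T')"
    by (simp only: MorD(2)[OF T(2)] MorD(2)[OF T'(2)])
  also have "\<dots> = block_diag v' w' * scalar_mat (block_diag T T')"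
    unfolding sb by (rule block_diag_mult[OF c'(1) st(1) c'(2) st(2), symmetric])
  finally have "scalar_mat (block_diag T T') * block_diag v w = block_diag v' w' * scalar_mat (block_diag T T')" .
  then have M: "block_diag T T' \<in> Mor (block_diag v w) (block_diag v' w')"
    unfolding Mor_iff[OF block_diag_carrier[OF c(1,2)] block_diag_carrier[OF c']]
    using block_diag_carrier[OF T(4) T'(4)] by simp
  show ?thesis
    by (rule rep_equivI[OF block_diag_carrier[OF c(1,2)] block_diag_carrier[OF c'] M block_diag_carrier[OF T(5) T'(5)]])
      (simp_all only: block_diag_mult[OF T(5,4) T'(5,4)] block_diag_mult[OF T(4,5) T'(4,5)] T(6,7) T'(6,7) block_diag_one)
qed

lemma diag_block_mat_Cons': "diag_block_mat (v # ws) = block_diag v (diag_block_mat ws)"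
  by (simp add: Let_def)

lemma diag_block_mat_append': "diag_block_mat (ws @ ws') = block_diag (diag_block_mat ws) (diag_block_mat ws')"
  by (simp add: diag_block_mat_append Let_def)

lemma diag_block_mat_square_carrier:
  "(\<And>w. w \<in> set ws \<Longrightarrow> w \<in> carrier_mat (dim_row w) (dim_row w)) \<Longrightarrow>
    diag_block_mat ws \<in> carrier_mat (sum_list (map dim_row ws)) (sum_list (map dim_row ws))"
proof (induct ws)
  case Nil
  show ?case by simp
next
  case (Cons w ws)
  have w: "w \<in> carrier_mat (dim_row w) (dim_row w)" by (rule Cons.prems) simp
  have "diag_block_mat ws \<in> carrier_mat (sum_list (map dim_row ws)) (sum_list (map dim_row ws))"
    by (rule Cons.hyps) (rule Cons.prems, simp)
  from block_diag_carrier[OF w this] show ?case unfolding diag_block_mat_Cons' list.map sum_list.Cons .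
qed

text \<open>A proper subrepresentation, embedded by an isometry T, gives the Hermitian intertwiner T
  T*, which is not scalar; \<open>rep_split\<close> then cuts u into two representations of smaller
  dimension.\<close>

theorem complete_reducibility:
  assumes "is_rep G u"
  shows "\<exists>ws. (\<forall>w\<in>set ws. irreducible_rep G w) \<and> rep_equiv u (diag_block_mat ws)"
  using assms
proof (induct "dim_row u" arbitrary: u rule: less_induct)
  case less
  define n where "n = dim_row u"
  have uc: "u \<in> carrier_mat n n" unfolding n_def by (rule is_rep_carrier[OF less.prems])
  show ?case
  proof (cases "irreducible_rep G u")
    case True
    then show ?thesis using rep_equiv_refl[OF uc] by (intro exI[of _ "[u]"]) (simp del: diag_block_mat.simps)
  next
    case False
    then obtain v where v: "is_rep G v" "subrep v u" "dim_row v \<noteq> n"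
      using less.prems by (auto simp: irreducible_rep_def n_def)
    define m where "m = dim_row v"
    have vc: "v \<in> carrier_mat m m" unfolding m_def by (rule is_rep_carrier[OF v(1)])
    obtain T where T: "T \<in> Mor v u" "mat_adjoint T * T = 1\<^sub>m m" using v(2) by (auto simp: subrep_def m_def)
    have un: "unitary_over m v" "unitary_over n u" and m0: "0 < m" using v(1) less.prems by (auto simp: is_rep_iff m_def n_def)
    have Tc: "T \<in> carrier_mat n m" using T(1) Mor_iff[OF vc uc] by simp
    note Ta = mat_adjoint_carrier[OF Tc]
    define A where "A = T * mat_adjoint T"
    have AM: "A \<in> Mor u u" unfolding A_def by (rule Mor_mult[OF uc vc uc Mor_adjoint[OF un T(1)] T(1)])
    have Aa: "mat_adjoint A = A" unfolding A_def mat_adjoint_mult[OF Tc Ta] by simp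
    \<comment> \<open>If T T* = c, multiplying by T gives c = 1, and then the traces of T* T and T
      T* force m = n.\<close>
    have ns: "A \<noteq> c \<cdot>\<^sub>m 1\<^sub>m n" for c
    proof
      assume A: "A = c \<cdot>\<^sub>m 1\<^sub>m n"
      have "c \<cdot>\<^sub>m T = A * T" unfolding A using smult_one_mult(1)[OF Tc] by simp
      also have "\<dots> = T * (mat_adjoint T * T)" unfolding A_def by (rule assoc_mult_mat[OF Tc Ta Tc])
      also have "\<dots> = 1 \<cdot>\<^sub>m T" unfolding T(2) using Tc by (intro eq_matI) auto
      finally have "c = 1" using smult_mat_cancel[OF _ Tc isometry_nonzero[OF T(2) m0]] by blast
      then have "of_nat m = (of_nat n :: complex)"
        using sum_norm_entries[OF Tc] A unfolding T(2) A_def by simp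
      then show False using v(3) by (simp add: m_def)
    qed
    obtain x y k l where xy: "is_rep G x" "is_rep G y" "x \<in> carrier_mat k k" "y \<in> carrier_mat l l" "n = k + l" "0 < k" "0 < l"
      "rep_equiv u (block_diag x y)" by (rule rep_split[OF less.prems uc AM Aa ns])
    obtain xs where xs: "\<forall>w\<in>set xs. irreducible_rep G w" "rep_equiv x (diag_block_mat xs)"
      using less.hyps[of x] xy by (auto simp: n_def)
    obtain ys where ys: "\<forall>w\<in>set ys. irreducible_rep G w" "rep_equiv y (diag_block_mat ys)"
      using less.hyps[of y] xy by (auto simp: n_def)
    have dc: "diag_block_mat xs \<in> carrier_mat (sum_list (map dim_row xs)) (sum_list (map dim_row xs))"
      "diag_block_mat ys \<in> carrier_mat (sum_list (map dim_row ys)) (sum_list (map dim_row ys))"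
      by (rule diag_block_mat_square_carrier, use xs(1) ys(1) irreducible_rep_carrier in blast)+
    have "rep_equiv (block_diag x y) (block_diag (diag_block_mat xs) (diag_block_mat ys))"
      by (rule rep_equiv_block_diag[OF xy(3,4) dc xs(2) ys(2)])
    then have "rep_equiv u (diag_block_mat (xs @ ys))"
      unfolding diag_block_mat_append'
      by (rule rep_equiv_trans[OF uc block_diag_carrier[OF xy(3,4)] block_diag_carrier[OF dc] xy(8)])
    then show ?thesis using xs ys by (intro exI[of _ "xs @ ys"]) auto
  qed
qed

text \<open>The adjoints of the block injections are intertwiners, so they cut T into component
  intertwiners, and T vanishes if all of these do. Nonvanishing is stated with the dimensions of T
  itself because the size of the sum changes along the induction.\<close>

lemma nonzero_component:
  assumes "\<And>w. w \<in> set ws \<Longrightarrow> w \<in> carrier_mat (dim_row w) (dim_row w)" and w: "w \<in> carrier_mat n n"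
    and T: "T \<in> Mor w (diag_block_mat ws)" "T \<noteq> 0\<^sub>m (dim_row T) (dim_col T)"
  shows "\<exists>x\<in>set ws. \<exists>R\<in>Mor w x. R \<noteq> 0\<^sub>m (dim_row x) n"
  using assms(1) T
proof (induct ws arbitrary: T)
  case Nil
  then have "T \<in> carrier_mat 0 n"
    using Mor_iff[OF w zero_carrier_mat[of 0 0], of T] unfolding diag_block_mat.simps by blast
  then have "T = 0\<^sub>m (dim_row T) (dim_col T)" by (intro eq_matI) auto
  then show ?case using Nil by blast
next
  case (Cons x ws)
  define m where "m = dim_row x"
  define k where "k = sum_list (map dim_row ws)"
  have xc: "x \<in> carrier_mat m m" unfolding m_def by (rule Cons.prems(1)) simp
  have dc: "diag_block_mat ws \<in> carrier_mat k k" unfolding k_def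
    by (rule diag_block_mat_square_carrier, rule Cons.prems(1), simp)
  note bc = block_diag_carrier[OF xc dc]
  have TM: "T \<in> Mor w (block_diag x (diag_block_mat ws))" using Cons.prems(2) by (simp only: diag_block_mat_Cons')
  have Tc: "T \<in> carrier_mat (m + k) n" using TM Mor_iff[OF w bc] by blast
  define A where "A = mat_adjoint (inj_left m k) * T"
  define B where "B = mat_adjoint (inj_right m k) * T"
  have AM: "A \<in> Mor w x" unfolding A_def by (rule Mor_mult[OF w bc xc TM inj_left_Mor(2)[OF xc dc]])
  have BM: "B \<in> Mor w (diag_block_mat ws)" unfolding B_def by (rule Mor_mult[OF w bc dc TM inj_right_Mor(2)[OF xc dc]])
  have Ae: "A $$ (i, j) = T $$ (i, j)" if "i < m" "j < n" for i j
  proof -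
    have "A $$ (i, j) = (\<Sum>l<m+k. mat_adjoint (inj_left m k) $$ (i, l) * T $$ (l, j))"
      unfolding A_def by (rule mat_mult_entry[OF mat_adjoint_carrier[OF inj_carrier(1)] Tc that])
    also have "\<dots> = (\<Sum>l<m+k. if l = i then T $$ (l, j) else 0)"
      by (rule sum.cong) (use that in \<open>auto simp: inj_left_def\<close>)
    finally show ?thesis using that by simp
  qed
  have Be: "B $$ (i, j) = T $$ (m + i, j)" if "i < k" "j < n" for i j
  proof -
    have "B $$ (i, j) = (\<Sum>l<m+k. mat_adjoint (inj_right m k) $$ (i, l) * T $$ (l, j))"
      unfolding B_def by (rule mat_mult_entry[OF mat_adjoint_carrier[OF inj_carrier(2)] Tc that])
    also have "\<dots> = (\<Sum>l<m+k. if l = m + i then T $$ (l, j) else 0)"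
      by (rule sum.cong) (use that in \<open>auto simp: inj_right_def\<close>)
    finally show ?thesis using that by simp
  qed
  have Bc: "B \<in> carrier_mat k n" using BM Mor_iff[OF w dc] by blast
  show ?case
  proof (cases "A = 0\<^sub>m m n")
    case False
    then show ?thesis using AM by (auto simp: m_def)
  next
    case True
    have "B \<noteq> 0\<^sub>m (dim_row B) (dim_col B)"
    proof
      assume B0: "B = 0\<^sub>m (dim_row B) (dim_col B)"
      have "T $$ (i, j) = 0" if "i < m + k" "j < n" for i j
      proof (cases "i < m")
        case True
        then show ?thesis using Ae[of i j] \<open>A = 0\<^sub>m m n\<close> that by simp
      next
        case False
        then have "T $$ (i, j) = B $$ (i - m, j)" using Be[of "i - m" j] that by simp
        also have "\<dots> = 0" using B0 Bc that False by (metis add_diff_inverse_nat carrier_matD index_zero_mat(1) nat_add_left_cancel_less)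
        finally show ?thesis .
      qed
      then have "T = 0\<^sub>m (dim_row T) (dim_col T)" using Tc by (intro eq_matI) auto
      then show False using Cons.prems(3) by blast
    qed
    then show ?thesis using Cons.hyps[OF _ BM] Cons.prems(1) by auto
  qed
qed

lemma component_embeds:
  assumes "\<And>w. w \<in> set ws \<Longrightarrow> w \<in> carrier_mat (dim_row w) (dim_row w)" "x \<in> set ws"
  shows "\<exists>T\<in>Mor x (diag_block_mat ws). mat_adjoint T * T = 1\<^sub>m (dim_row x)"
  using assms
proof (induct ws)
  case Nil
  from Nil(2) show ?case by simp
next
  case (Cons y ws)
  define m where "m = dim_row y"
  define k where "k = sum_list (map dim_row ws)"
  have yc: "y \<in> carrier_mat m m" unfolding m_def by (rule Cons.prems(1)) simp
  have xc: "x \<in> carrier_mat (dim_row x) (dim_row x)" using Cons.prems by blast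
  have dc: "diag_block_mat ws \<in> carrier_mat k k" unfolding k_def
    by (rule diag_block_mat_square_carrier, rule Cons.prems(1), simp)
  note bc = block_diag_carrier[OF yc dc]
  show ?case
  proof (cases "x = y")
    case True
    then show ?thesis using inj_left_Mor(1)[OF yc dc] inj_isometry(1)[of m k]
      unfolding diag_block_mat_Cons' by (auto simp: m_def)
  next
    case False
    then obtain T where T: "T \<in> Mor x (diag_block_mat ws)" "mat_adjoint T * T = 1\<^sub>m (dim_row x)"
      using Cons by auto
    have Tc: "T \<in> carrier_mat k (dim_row x)" using T(1) Mor_iff[OF xc dc] by blast
    define J where "J = inj_right m k"
    have Jc: "J \<in> carrier_mat (m + k) k" by (simp add: J_def)
    have "J * T \<in> Mor x (block_diag y (diag_block_mat ws))"
      unfolding J_def by (rule Mor_mult[OF xc dc bc T(1) inj_right_Mor(1)[OF yc dc]])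
    moreover have "mat_adjoint (J * T) * (J * T) = mat_adjoint T * (mat_adjoint J * (J * T))"
      unfolding mat_adjoint_mult[OF Jc Tc]
      by (rule assoc_mult_mat[OF mat_adjoint_carrier[OF Tc] mat_adjoint_carrier[OF Jc] mult_carrier_mat[OF Jc Tc]])
    moreover have "mat_adjoint J * (J * T) = T"
      using assoc_mult_mat[OF mat_adjoint_carrier[OF Jc] Jc Tc] inj_isometry(2)[of m k] Tc by (simp add: J_def)
    ultimately show ?thesis using T(2) unfolding diag_block_mat_Cons' by auto
  qed
qed

end

section \<open>Tensor products and conjugates\<close>

lemma sum_div_mod:
  fixes f :: "nat \<Rightarrow> nat \<Rightarrow> 'a::comm_monoid_add"
  assumes "0 < m" shows "(\<Sum>r<n * m. f (r div m) (r mod m)) = (\<Sum>i<n. \<Sum>j<m. f i j)"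
proof -
  have "(\<Sum>i<n. \<Sum>j<m. f i j) = (\<Sum>(i, j)\<in>{..<n} \<times> {..<m}. f i j)" by (rule sum.cartesian_product)
  also have "\<dots> = (\<Sum>r<n * m. f (r div m) (r mod m))"
  proof (rule sum.reindex_bij_witness[of _ "\<lambda>r. (r div m, r mod m)" "\<lambda>(i, j). i * m + j"])
    fix p assume "p \<in> {..<n} \<times> {..<m}"
    then obtain i j where p: "p = (i, j)" "i < n" "j < m" by auto
    have "i * m + j < Suc i * m" using p by simp
    also have "\<dots> \<le> n * m" using p by (intro mult_right_mono) auto
    finally show "(case p of (i, j) \<Rightarrow> i * m + j) \<in> {..<n * m}" using p by simp
    show "((case p of (i, j) \<Rightarrow> i * m + j) div m, (case p of (i, j) \<Rightarrow> i * m + j) mod m) = p" using p by simp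
    show "f ((case p of (i, j) \<Rightarrow> i * m + j) div m) ((case p of (i, j) \<Rightarrow> i * m + j) mod m) = (case p of (i, j) \<Rightarrow> f i j)"
      using p by simp
  next
    fix r assume "r \<in> {..<n * m}"
    then show "(r div m, r mod m) \<in> {..<n} \<times> {..<m}" using assms by (simp add: less_mult_imp_div_less)
    show "(case (r div m, r mod m) of (i, j) \<Rightarrow> i * m + j) = r" by simp
  qed
  finally show ?thesis by simp
qed

lemma unitary_over_sums:
  assumes u: "unitary_over n u" and ij: "i < n" "j < n"
  shows "(\<Sum>k<n. star (u $$ (k, i)) * u $$ (k, j)) = (if i = j then 1 else 0)"
    "(\<Sum>k<n. u $$ (i, k) * star (u $$ (j, k))) = (if i = j then 1 else 0)"
proof -
  have c: "u \<in> carrier_mat n n" "star_transpose u \<in> carrier_mat n n" using u by (auto simp: unitary_over_def)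
  have "(star_transpose u * u) $$ (i, j) = (\<Sum>k<n. star (u $$ (k, i)) * u $$ (k, j))"
    unfolding mat_mult_entry[OF c(2,1) ij] by (rule sum.cong) (use ij star_transpose_entry[OF c(1)] in auto)
  then show "(\<Sum>k<n. star (u $$ (k, i)) * u $$ (k, j)) = (if i = j then 1 else 0)"
    using u ij by (simp add: unitary_over_def)
  have "(u * star_transpose u) $$ (i, j) = (\<Sum>k<n. u $$ (i, k) * star (u $$ (j, k)))"
    unfolding mat_mult_entry[OF c ij] by (rule sum.cong) (use ij star_transpose_entry[OF c(1)] in auto)
  then show "(\<Sum>k<n. u $$ (i, k) * star (u $$ (j, k))) = (if i = j then 1 else 0)"
    using u ij by (simp add: unitary_over_def)
qed

lemma unitary_overI:
  assumes c: "u \<in> carrier_mat n n"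
    and 1: "\<And>i j. i < n \<Longrightarrow> j < n \<Longrightarrow> (\<Sum>k<n. star (u $$ (k, i)) * u $$ (k, j)) = (if i = j then 1 else 0)"
    and 2: "\<And>i j. i < n \<Longrightarrow> j < n \<Longrightarrow> (\<Sum>k<n. u $$ (i, k) * star (u $$ (j, k))) = (if i = j then 1 else 0)"
  shows "unitary_over n u"
proof -
  have c': "star_transpose u \<in> carrier_mat n n" using c by simp
  have "star_transpose u * u = 1\<^sub>m n"
  proof (rule eq_matI)
    fix i j assume "i < dim_row (1\<^sub>m n)" "j < dim_col (1\<^sub>m n)"
    then have ij: "i < n" "j < n" by auto
    have "(star_transpose u * u) $$ (i, j) = (\<Sum>k<n. star (u $$ (k, i)) * u $$ (k, j))"
      unfolding mat_mult_entry[OF c' c ij] by (rule sum.cong) (use ij star_transpose_entry[OF c] in auto)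
    then show "(star_transpose u * u) $$ (i, j) = 1\<^sub>m n $$ (i, j)" using 1[OF ij] ij by (simp del: index_mult_mat(1))
  qed (use c c' in auto)
  moreover have "u * star_transpose u = 1\<^sub>m n"
  proof (rule eq_matI)
    fix i j assume "i < dim_row (1\<^sub>m n)" "j < dim_col (1\<^sub>m n)"
    then have ij: "i < n" "j < n" by auto
    have "(u * star_transpose u) $$ (i, j) = (\<Sum>k<n. u $$ (i, k) * star (u $$ (j, k)))"
      unfolding mat_mult_entry[OF c c' ij] by (rule sum.cong) (use ij star_transpose_entry[OF c] in auto)
    then show "(u * star_transpose u) $$ (i, j) = 1\<^sub>m n $$ (i, j)" using 2[OF ij] ij by (simp del: index_mult_mat(1))
  qed (use c c' in auto)
  ultimately show ?thesis using c by (simp add: unitary_over_def)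
qed

lemma tensor_rep_carrier:
  "u \<in> carrier_mat n n \<Longrightarrow> v \<in> carrier_mat m m \<Longrightarrow> tensor_rep u v \<in> carrier_mat (n * m) (n * m)"
  by (auto simp: tensor_rep_def Let_def)

lemma tensor_rep_entry:
  "u \<in> carrier_mat n n \<Longrightarrow> v \<in> carrier_mat m m \<Longrightarrow> r < n * m \<Longrightarrow> s < n * m \<Longrightarrow>
    tensor_rep u v $$ (r, s) = u $$ (r div m, s div m) * v $$ (r mod m, s mod m)"
  by (auto simp: tensor_rep_def Let_def)

lemma div_mod_less: "r < n * m \<Longrightarrow> r div m < n \<and> r mod m < (m::nat)"
  by (metis less_mult_imp_div_less mod_less_divisor mult_0_right not_gr_zero not_less_zero)

lemma unitary_over_tensor_rep:
  fixes u v :: "'a::cstar_algebra mat"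
  assumes u: "unitary_over n u" and v: "unitary_over m v" and m: "0 < m"
  shows "unitary_over (n * m) (tensor_rep u v)"
proof (rule unitary_overI)
  note c = unitary_over_carrier[OF u] unitary_over_carrier[OF v]
  show "tensor_rep u v \<in> carrier_mat (n * m) (n * m)" by (rule tensor_rep_carrier[OF c])
  fix r s assume rs: "r < n * m" "s < n * m"
  note d = div_mod_less[OF rs(1)] div_mod_less[OF rs(2)]
  have eq: "(r div m = s div m \<and> r mod m = s mod m) \<longleftrightarrow> r = s" by (metis div_mult_mod_eq)
  \<comment> \<open>Entries do not commute, so the order of summation matters: here the two entries
    of u stand inside, and their index is summed first. In the second relation the entries of v
    stand inside.\<close>
  have "(\<Sum>q<n*m. star (tensor_rep u v $$ (q, r)) * tensor_rep u v $$ (q, s))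
     = (\<Sum>q<n*m. (\<lambda>i k. star (v $$ (k, r mod m)) * (star (u $$ (i, r div m)) * u $$ (i, s div m)) * v $$ (k, s mod m)) (q div m) (q mod m))"
    by (rule sum.cong) (use rs in \<open>auto simp: tensor_rep_entry[OF c] star_mult mult.assoc\<close>)
  also have "\<dots> = (\<Sum>i<n. \<Sum>k<m. star (v $$ (k, r mod m)) * (star (u $$ (i, r div m)) * u $$ (i, s div m)) * v $$ (k, s mod m))"
    by (rule sum_div_mod[OF m])
  also have "\<dots> = (\<Sum>k<m. star (v $$ (k, r mod m)) * (\<Sum>i<n. star (u $$ (i, r div m)) * u $$ (i, s div m)) * v $$ (k, s mod m))"
    by (subst sum.swap) (simp add: sum_distrib_left sum_distrib_right)
  also have "\<dots> = (if r div m = s div m then (\<Sum>k<m. star (v $$ (k, r mod m)) * v $$ (k, s mod m)) else 0)"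
    using d by (simp add: unitary_over_sums(1)[OF u])
  also have "\<dots> = (if r = s then 1 else 0)"
    unfolding eq[symmetric] using unitary_over_sums(1)[OF v conjunct2 conjunct2, OF d] by auto
  finally show "(\<Sum>q<n*m. star (tensor_rep u v $$ (q, r)) * tensor_rep u v $$ (q, s)) = (if r = s then 1 else 0)" .
  have "(\<Sum>q<n*m. tensor_rep u v $$ (r, q) * star (tensor_rep u v $$ (s, q)))
     = (\<Sum>q<n*m. (\<lambda>i k. u $$ (r div m, i) * (v $$ (r mod m, k) * star (v $$ (s mod m, k))) * star (u $$ (s div m, i))) (q div m) (q mod m))"
    by (rule sum.cong) (use rs in \<open>auto simp: tensor_rep_entry[OF c] star_mult mult.assoc\<close>)
  also have "\<dots> = (\<Sum>i<n. \<Sum>k<m. u $$ (r div m, i) * (v $$ (r mod m, k) * star (v $$ (s mod m, k))) * star (u $$ (s div m, i)))"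
    by (rule sum_div_mod[OF m])
  also have "\<dots> = (\<Sum>i<n. u $$ (r div m, i) * (\<Sum>k<m. v $$ (r mod m, k) * star (v $$ (s mod m, k))) * star (u $$ (s div m, i)))"
    by (simp add: sum_distrib_left sum_distrib_right)
  also have "\<dots> = (if r mod m = s mod m then (\<Sum>i<n. u $$ (r div m, i) * star (u $$ (s div m, i))) else 0)"
    using d by (simp add: unitary_over_sums(2)[OF v])
  also have "\<dots> = (if r = s then 1 else 0)"
    unfolding eq[symmetric] using unitary_over_sums(2)[OF u conjunct1 conjunct1, OF d] by auto
  finally show "(\<Sum>q<n*m. tensor_rep u v $$ (r, q) * star (tensor_rep u v $$ (s, q))) = (if r = s then 1 else 0)" .
qed

lemma conj_rep_carrier [simp]: "conj_rep u \<in> carrier_mat n m \<longleftrightarrow> u \<in> carrier_mat n m"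
  unfolding carrier_mat_def conj_rep_def by simp

lemma conj_rep_entry: "u \<in> carrier_mat n m \<Longrightarrow> i < n \<Longrightarrow> j < m \<Longrightarrow> conj_rep u $$ (i, j) = star (u $$ (i, j))"
  by (auto simp: conj_rep_def)

lemma conj_rep_conj_rep [simp]: "conj_rep (conj_rep u) = u"
  by (rule eq_matI) (auto simp: conj_rep_def star_star)

lemma Mor_conj:
  fixes u v :: "'a::cstar_algebra mat"
  assumes c: "u \<in> carrier_mat n n" "v \<in> carrier_mat m m" and T: "T \<in> Mor u v"
  shows "map_mat cnj T \<in> Mor (conj_rep u) (conj_rep v)"
proof -
  have Tc: "T \<in> carrier_mat m n" using T Mor_iff[OF c] by blast
  then have Tc': "map_mat cnj T \<in> carrier_mat m n" by simp
  have c': "conj_rep u \<in> carrier_mat n n" "conj_rep v \<in> carrier_mat m m" using c by auto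
  have "scalar_mat (map_mat cnj T) * conj_rep u = conj_rep v * scalar_mat (map_mat cnj T)"
  proof (rule eq_matI)
    fix i j assume "i < dim_row (conj_rep v * scalar_mat (map_mat cnj T))" "j < dim_col (conj_rep v * scalar_mat (map_mat cnj T))"
    then have ij: "i < m" "j < n" using c' Tc by auto
    have "(scalar_mat (map_mat cnj T) * conj_rep u) $$ (i, j) = star ((scalar_mat T * u) $$ (i, j))"
      unfolding scalar_mult_entry[OF Tc' c'(1) ij] scalar_mult_entry[OF Tc c(1) ij] star_sum
      by (rule sum.cong) (use Tc ij conj_rep_entry[OF c(1)] in \<open>auto simp: star_scaleC\<close>)
    also have "\<dots> = star ((v * scalar_mat T) $$ (i, j))" by (simp only: MorD(2)[OF T])
    also have "\<dots> = (conj_rep v * scalar_mat (map_mat cnj T)) $$ (i, j)"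
      unfolding mult_scalar_entry[OF c'(2) Tc' ij] mult_scalar_entry[OF c(2) Tc ij] star_sum
      by (rule sum.cong) (use Tc ij conj_rep_entry[OF c(2)] in \<open>auto simp: star_scaleC\<close>)
    finally show "(scalar_mat (map_mat cnj T) * conj_rep u) $$ (i, j) = (conj_rep v * scalar_mat (map_mat cnj T)) $$ (i, j)" .
  qed (use c' Tc in auto)
  then show ?thesis using Mor_iff[OF c'] Tc' by blast
qed

lemma rep_equiv_conj:
  assumes c: "u \<in> carrier_mat n n" "v \<in> carrier_mat m m" and e: "rep_equiv u v"
  shows "rep_equiv (conj_rep u) (conj_rep v)"
proof -
  obtain T R where T: "m = n" "T \<in> Mor u v" "T \<in> carrier_mat n n" "R \<in> carrier_mat n n" "R * T = 1\<^sub>m n" "T * R = 1\<^sub>m n"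
    using rep_equivE[OF c e] by metis
  have m: "map_mat cnj A * map_mat cnj B = map_mat cnj (A * B)" if "A \<in> carrier_mat n n" "B \<in> carrier_mat n n" for A B
  proof (rule eq_matI)
    fix i j assume "i < dim_row (map_mat cnj (A * B))" "j < dim_col (map_mat cnj (A * B))"
    then have ij: "i < n" "j < n" using that by auto
    have "(map_mat cnj A * map_mat cnj B) $$ (i, j) = (\<Sum>l<n. map_mat cnj A $$ (i, l) * map_mat cnj B $$ (l, j))"
      by (rule mat_mult_entry) (use that ij in auto)
    also have "\<dots> = cnj ((A * B) $$ (i, j))" unfolding mat_mult_entry[OF that ij] cnj_sum
      by (rule sum.cong) (use that ij in auto)
    also have "\<dots> = map_mat cnj (A * B) $$ (i, j)" using that ij by simp
    finally show "(map_mat cnj A * map_mat cnj B) $$ (i, j) = map_mat cnj (A * B) $$ (i, j)" .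
  qed (use that in auto)
  have one: "map_mat cnj (1\<^sub>m n) = 1\<^sub>m n" by (rule eq_matI) auto
  show ?thesis
    by (rule rep_equivI[of _ n _ "map_mat cnj T" "map_mat cnj R"])
      (use c T Mor_conj[OF c T(2)] in \<open>simp_all only: m one conj_rep_carrier map_carrier_mat\<close>)
qed

text \<open>Computing T T* T in both ways gives c = 1, and then the traces of T* T and T T* are m
  and n.\<close>

lemma isometry_scalar_range:
  fixes T :: "complex mat"
  assumes Tc: "T \<in> carrier_mat n m" and T: "mat_adjoint T * T = 1\<^sub>m m" "T * mat_adjoint T = c \<cdot>\<^sub>m 1\<^sub>m n" and m0: "0 < m"
  shows "n = m"
proof -
  have "c \<cdot>\<^sub>m T = (T * mat_adjoint T) * T" unfolding T(2) using smult_one_mult(1)[OF Tc] by simp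
  also have "\<dots> = T * (mat_adjoint T * T)" by (rule assoc_mult_mat[OF Tc mat_adjoint_carrier[OF Tc] Tc])
  also have "\<dots> = 1 \<cdot>\<^sub>m T" unfolding T(1) using Tc by (intro eq_matI) auto
  finally have "c = 1" using smult_mat_cancel[OF _ Tc isometry_nonzero[OF T(1) m0]] by blast
  then have "of_nat m = (of_nat n :: complex)"
    using sum_norm_entries[OF Tc] unfolding T by simp
  then show ?thesis by simp
qed

context cqg
begin

lemma is_rep_tensor_rep:
  assumes u: "is_rep G u" and v: "is_rep G v" shows "is_rep G (tensor_rep u v)"
proof -
  define n where "n = dim_row u"
  define m where "m = dim_row v"
  have un: "unitary_over n u" "unitary_over m v" "0 < n" "0 < m" "comult_mat u" "comult_mat v"
    using u v by (simp_all add: is_rep_iff n_def m_def)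
  note c = unitary_over_carrier[OF un(1)] unitary_over_carrier[OF un(2)]
  note tc = tensor_rep_carrier[OF c]
  have cu: "comult G (u $$ (i, j)) = (\<Sum>k<n. tensor G (u $$ (i, k)) (u $$ (k, j)))" if "i < n" "j < n" for i j
    using un(5) that comult_mat_iff[OF c(1)] by blast
  have cv: "comult G (v $$ (i, j)) = (\<Sum>k<m. tensor G (v $$ (i, k)) (v $$ (k, j)))" if "i < m" "j < m" for i j
    using un(6) that comult_mat_iff[OF c(2)] by blast
  have "comult_mat (tensor_rep u v)" unfolding comult_mat_iff[OF tc]
  proof (intro allI impI)
    fix r s assume rs: "r < n * m" "s < n * m"
    note d = div_mod_less[OF rs(1)] div_mod_less[OF rs(2)]
    have "(\<Sum>q<n*m. tensor G (tensor_rep u v $$ (r, q)) (tensor_rep u v $$ (q, s)))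
      = (\<Sum>q<n*m. (\<lambda>i k. tensor G (u $$ (r div m, i)) (u $$ (i, s div m)) * tensor G (v $$ (r mod m, k)) (v $$ (k, s mod m))) (q div m) (q mod m))"
      by (rule sum.cong) (use rs in \<open>auto simp: tensor_rep_entry[OF c] T.t_mult\<close>)
    also have "\<dots> = (\<Sum>i<n. \<Sum>k<m. tensor G (u $$ (r div m, i)) (u $$ (i, s div m)) * tensor G (v $$ (r mod m, k)) (v $$ (k, s mod m)))"
      by (rule sum_div_mod[OF un(4)])
    also have "\<dots> = comult G (u $$ (r div m, s div m)) * comult G (v $$ (r mod m, s mod m))"
      using d by (simp add: cu cv sum_product)
    also have "\<dots> = comult G (tensor_rep u v $$ (r, s))"
      unfolding tensor_rep_entry[OF c rs] comult_mult ..
    finally show "comult G (tensor_rep u v $$ (r, s)) = (\<Sum>q<n*m. tensor G (tensor_rep u v $$ (r, q)) (tensor_rep u v $$ (q, s)))" ..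
  qed
  moreover have "dim_row (tensor_rep u v) = n * m" using tc by blast
  ultimately show ?thesis
    unfolding is_rep_iff using unitary_over_tensor_rep[OF un(1,2,4)] un(3,4) by simp
qed

text \<open>Converse of Schur's lemma: the range projection of a subrepresentation is an
  intertwiner, hence scalar, and \<open>isometry_scalar_range\<close> compares dimensions.\<close>

lemma irreducibleI:
  assumes u: "is_rep G u" "u \<in> carrier_mat n n" and s: "\<And>A. A \<in> Mor u u \<Longrightarrow> \<exists>c. A = c \<cdot>\<^sub>m 1\<^sub>m n"
  shows "irreducible_rep G u"
  unfolding irreducible_rep_def
proof (intro conjI allI impI)
  fix w assume w: "is_rep G w \<and> subrep w u"
  define m where "m = dim_row w"
  have un: "unitary_over m w" "0 < m" using w by (auto simp: is_rep_iff m_def)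
  have uu: "unitary_over n u" using u by (auto simp: is_rep_iff)
  note wc = unitary_over_carrier[OF un(1)]
  obtain T where T: "T \<in> Mor w u" "mat_adjoint T * T = 1\<^sub>m m" using w by (auto simp: subrep_def m_def)
  have Tc: "T \<in> carrier_mat n m" using T(1) Mor_iff[OF wc u(2)] by blast
  have "T * mat_adjoint T \<in> Mor u u"
    by (rule Mor_mult[OF u(2) wc u(2) Mor_adjoint[OF un(1) uu T(1)] T(1)])
  then obtain c where "T * mat_adjoint T = c \<cdot>\<^sub>m 1\<^sub>m n" using s by blast
  then have "n = m" using isometry_scalar_range[OF Tc T(2)] un(2) by blast
  then show "dim_row w = dim_row u" using u(2) by (auto simp: m_def)
qed (rule u(1))

text \<open>The form of \<open>invariant_form_exists\<close>, factored as
  \<open>mat_adjoint R * R\<close>: R is the change of basis that turns it into the standard inner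
  product.\<close>

lemma rep_invariant_form:
  assumes u: "is_rep G u" "u \<in> carrier_mat n n"
  obtains R S where "R \<in> carrier_mat n n" "S \<in> carrier_mat n n" "R * S = 1\<^sub>m n" "S * R = 1\<^sub>m n"
    "star_transpose (conj_rep u) * scalar_mat (mat_adjoint R * R) * conj_rep u = scalar_mat (mat_adjoint R * R)"
proof -
  have un: "unitary_over n u" "comult_mat u" using u by (auto simp: is_rep_iff)
  interpret U: unitary_corep G n "\<lambda>i j. u $$ (i, j)"
    by unfold_locales (use un comult_mat_iff[OF u(2)] unitary_over_sums[OF un(1)] in auto)
  obtain F where F: "\<forall>j l. cnj (F j l) = F l j"
    "\<forall>c. 0 \<le> Re (\<Sum>j<n. \<Sum>l<n. cnj (c j) * F j l * c l)"
    "\<forall>c j. Re (\<Sum>j<n. \<Sum>l<n. cnj (c j) * F j l * c l) = 0 \<longrightarrow> j < n \<longrightarrow> c j = 0"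
    "\<forall>j l. j < n \<longrightarrow> l < n \<longrightarrow> (\<Sum>k<n. \<Sum>m<n. scaleC (F k m) (u $$ (k, j) * star (u $$ (m, l)))) = scaleC (F j l) 1"
    using U.invariant_form_exists by blast
  define M where "M = mat n n (\<lambda>(i, j). F i j)"
  have Mc: "M \<in> carrier_mat n n" by (simp add: M_def)
  have Ma: "mat_adjoint M = M" by (rule eq_matI) (auto simp: M_def F(1)[rule_format])
  have Ms: "(\<Sum>j<n. \<Sum>l<n. cnj (c j) * M $$ (j, l) * c l) = (\<Sum>j<n. \<Sum>l<n. cnj (c j) * F j l * c l)" for c
    by (intro sum.cong refl) (simp add: M_def)
  obtain R S where RS: "R \<in> carrier_mat n n" "S \<in> carrier_mat n n" "R * S = 1\<^sub>m n" "S * R = 1\<^sub>m n" "mat_adjoint R * R = M"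
  proof (rule positive_definite_factor[OF Mc Ma])
    show "0 \<le> Re (\<Sum>j<n. \<Sum>l<n. cnj (c j) * M $$ (j, l) * c l)" for c unfolding Ms by (rule F(2)[rule_format])
    show "c j = 0" if "Re (\<Sum>j<n. \<Sum>l<n. cnj (c j) * M $$ (j, l) * c l) = 0" "j < n" for c j
      using F(3) that unfolding Ms by blast
  qed blast
  define b where "b = conj_rep u"
  have bc: "b \<in> carrier_mat n n" "star_transpose b \<in> carrier_mat n n" using u(2) by (simp_all add: b_def)
  have be: "b $$ (i, j) = star (u $$ (i, j))" "star_transpose b $$ (i, j) = u $$ (j, i)" if "i < n" "j < n" for i j
    using conj_rep_entry[OF u(2) that] conj_rep_entry[OF u(2) that(2,1)] star_transpose_entry[OF bc(1) that]
    by (simp_all add: b_def star_star)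
  have SMc: "scalar_mat M \<in> carrier_mat n n" using Mc by simp
  have "star_transpose b * scalar_mat M * b = scalar_mat M"
  proof (rule eq_matI)
    fix j l assume "j < dim_row (scalar_mat M)" "l < dim_col (scalar_mat M)"
    then have jl: "j < n" "l < n" using Mc by auto
    have "(star_transpose b * scalar_mat M * b) $$ (j, l) = (\<Sum>m<n. (star_transpose b * scalar_mat M) $$ (j, m) * b $$ (m, l))"
      by (rule mat_mult_entry[OF mult_carrier_square[OF bc(2) SMc] bc(1) jl])
    also have "\<dots> = (\<Sum>m<n. \<Sum>k<n. scaleC (F k m) (u $$ (k, j) * star (u $$ (m, l))))"
    proof (rule sum.cong[OF refl])
      fix m assume "m \<in> {..<n}"
      then have m: "m < n" by simp
      show "(star_transpose b * scalar_mat M) $$ (j, m) * b $$ (m, l) = (\<Sum>k<n. scaleC (F k m) (u $$ (k, j) * star (u $$ (m, l))))"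
        unfolding mult_scalar_entry[OF bc(2) Mc jl(1) m] sum_distrib_right
        by (rule sum.cong) (use m jl be in \<open>auto simp: M_def scaleC_mult_left\<close>)
    qed
    also have "\<dots> = scaleC (F j l) 1" by (subst sum.swap) (rule F(4)[rule_format, OF jl])
    also have "\<dots> = scalar_mat M $$ (j, l)" using jl by (simp add: M_def)
    finally show "(star_transpose b * scalar_mat M * b) $$ (j, l) = scalar_mat M $$ (j, l)" .
  qed (use bc Mc in auto)
  then show ?thesis using that[OF RS(1-4)] unfolding RS(5) b_def by blast
qed

end

section \<open>Conjugates of irreducible representations\<close>

text \<open>Transposition reverses the chain of indices in \<Phi>(u), and exchanging the tensor legs
  restores it.\<close>

lemma is_rep_flip:
  assumes G: "cqg G" and u: "is_rep G u" shows "is_rep (flip_group G) (star_transpose u)"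
proof -
  interpret cqg G by (rule G)
  interpret flip: cqg "flip_group G" by unfold_locales (rule compact_quantum_group_flip[OF cqg])
  define n where "n = dim_row u"
  have un: "unitary_over n u" "comult_mat u" "0 < n" using u by (auto simp: is_rep_iff n_def)
  note c = unitary_over_carrier[OF un(1)]
  have c': "star_transpose u \<in> carrier_mat n n" using c by simp
  have "flip.comult_mat (star_transpose u)" unfolding flip.comult_mat_iff[OF c'] flip_group_simps
  proof (intro allI impI)
    fix i j assume ij: "i < n" "j < n"
    have "comult G (u $$ (j, i)) = (\<Sum>k<n. tensor G (u $$ (j, k)) (u $$ (k, i)))"
      using un(2) ij comult_mat_iff[OF c] by blast
    then have "comult G (star_transpose u $$ (i, j)) = (\<Sum>k<n. tensor G (star (u $$ (j, k))) (star (u $$ (k, i))))"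
      unfolding star_transpose_entry[OF c ij] by (simp add: comult_star star_sum T.t_star)
    also have "\<dots> = (\<Sum>k<n. tensor G (star_transpose u $$ (k, j)) (star_transpose u $$ (i, k)))"
      by (rule sum.cong) (use ij star_transpose_entry[OF c] in auto)
    finally show "comult G (star_transpose u $$ (i, j)) = (\<Sum>k<n. tensor G (star_transpose u $$ (k, j)) (star_transpose u $$ (i, k)))" .
  qed
  moreover have "dim_row (star_transpose u) = n" using c' by blast
  ultimately show ?thesis unfolding flip.is_rep_iff using unitary_over_star_transpose[OF un(1)] un(3) by simp
qed

context cqg
begin

text \<open>
  \<open>b = conj_rep u\<close> satisfies \<open>b* F b = F\<close> and, by the flipped quantum group, \<open>b E b* = E\<close> with
  \<open>F\<close> and \<open>E\<close> positive definite; so \<open>b\<close> is invertible and unitary for the inner product of \<open>F\<close>.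
\<close>

lemma conj_rep_unitarizable:
  assumes u: "is_rep G u" "u \<in> carrier_mat n n"
  obtains v where "is_rep G v" "v \<in> carrier_mat n n" "rep_equiv (conj_rep u) v"
proof -
  define b where "b = conj_rep u"
  define b' where "b' = star_transpose b"
  have bc: "b \<in> carrier_mat n n" "b' \<in> carrier_mat n n" using u(2) by (simp_all add: b_def b'_def)
  have n0: "0 < n" using u by (auto simp: is_rep_iff)
  interpret flip: cqg "flip_group G" by unfold_locales (rule compact_quantum_group_flip[OF cqg])
  obtain R S where R: "R \<in> carrier_mat n n" "S \<in> carrier_mat n n" "R * S = 1\<^sub>m n" "S * R = 1\<^sub>m n"
    "b' * scalar_mat (mat_adjoint R * R) * b = scalar_mat (mat_adjoint R * R)"
    using rep_invariant_form[OF u] unfolding b_def b'_def by metis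
  have uc': "star_transpose u \<in> carrier_mat n n" using u(2) by simp
  have "conj_rep (star_transpose u) = b'" "star_transpose (conj_rep (star_transpose u)) = b"
    by (rule eq_matI; use u(2) in \<open>auto simp: b_def b'_def conj_rep_def star_transpose_def star_star\<close>)+
  then obtain Q P where Q: "Q \<in> carrier_mat n n" "P \<in> carrier_mat n n" "Q * P = 1\<^sub>m n" "P * Q = 1\<^sub>m n"
    "b * scalar_mat (mat_adjoint Q * Q) * b' = scalar_mat (mat_adjoint Q * Q)"
    using flip.rep_invariant_form[OF is_rep_flip[OF cqg_axioms u(1)] uc'] by metis
  define E where "E = mat_adjoint Q * Q"
  define K where "K = P * mat_adjoint P"
  have Ec: "E \<in> carrier_mat n n" "K \<in> carrier_mat n n" using Q by (simp_all add: E_def K_def)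
  have PQ: "mat_adjoint Q * mat_adjoint P = 1\<^sub>m n"
    using mat_adjoint_mult[OF Q(2,1)] Q(4) by simp
  have "E * K = mat_adjoint Q * ((Q * P) * mat_adjoint P)"
    unfolding E_def K_def by (rule four_mult) (use Q in auto)
  then have EK: "E * K = 1\<^sub>m n" unfolding Q(3) using PQ Q by simp
  \<comment> \<open>A right inverse of b: from b E b* = E and K = \<open>E\<close> inverse follows b
    (E b* K) = 1.\<close>
  define x where "x = scalar_mat E * b' * scalar_mat K"
  have sE: "scalar_mat E \<in> carrier_mat n n" "scalar_mat K \<in> carrier_mat n n" using Ec by auto
  have xc: "x \<in> carrier_mat n n" using sE bc by (simp add: x_def)
  have bx: "b * x = 1\<^sub>m n"
  proof -
    have "b * x = (b * scalar_mat E * b') * scalar_mat K"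
      unfolding x_def using sE bc by (simp add: assoc_mult_mat[of _ n n _ n _ n])
    also have "\<dots> = scalar_mat E * scalar_mat K" using Q(5) by (simp add: E_def)
    also have "\<dots> = 1\<^sub>m n" unfolding scalar_mat_mult[OF Ec, symmetric] EK by simp
    finally show ?thesis .
  qed
  define r where "r = (scalar_mat R :: 'a mat)"
  define s where "s = (scalar_mat S :: 'a mat)"
  have rs: "r \<in> carrier_mat n n" "s \<in> carrier_mat n n" "r * s = 1\<^sub>m n" "s * r = 1\<^sub>m n"
    using R scalar_mat_mult[OF R(1,2), where 'a = 'a] scalar_mat_mult[OF R(2,1), where 'a = 'a] by (simp_all add: r_def s_def)
  \<comment> \<open>The matrix b in a basis that is orthonormal for the form
    \<open>mat_adjoint R * R\<close>, which makes it an isometry.\<close>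
  define v where "v = r * b * s"
  have vc: "v \<in> carrier_mat n n" using rs bc by (simp add: v_def)
  have sc: "star_transpose s \<in> carrier_mat n n" "star_transpose r \<in> carrier_mat n n" using rs by simp_all
  have rr: "scalar_mat (mat_adjoint R * R) = star_transpose r * r"
    using scalar_mat_mult[OF mat_adjoint_carrier[OF R(1)] R(1), where 'a = 'a] by (simp add: r_def)
  have "star_transpose v = star_transpose s * (b' * star_transpose r)"
    unfolding v_def b'_def using star_transpose_mult[OF mult_carrier_square[OF rs(1) bc(1)] rs(2)] star_transpose_mult[OF rs(1) bc(1)] by simp
  then have "star_transpose v * v = star_transpose s * (b' * (star_transpose r * r) * b) * s"
    unfolding v_def using rs sc bc by (simp add: assoc_mult_mat[of _ n n _ n _ n])
  also have "\<dots> = star_transpose s * (star_transpose r * r) * s" using R(5) unfolding rr by simp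
  also have "\<dots> = (star_transpose s * star_transpose r) * (r * s)"
    using rs sc by (simp add: assoc_mult_mat[of _ n n _ n _ n])
  also have "star_transpose s * star_transpose r = star_transpose (r * s)" using star_transpose_mult[OF rs(1,2)] by simp
  also have "star_transpose (r * s) * (r * s) = 1\<^sub>m n"
    unfolding rs(3) using star_transpose_scalar[of "1\<^sub>m n", where 'a = 'a] by simp
  finally have vv: "star_transpose v * v = 1\<^sub>m n" .
  define y where "y = r * x * s"
  have yc: "y \<in> carrier_mat n n" using rs xc by (simp add: y_def)
  have "v * y = (r * b) * ((s * r) * (x * s))"
    unfolding v_def y_def using rs(1,2) bc xc by (simp add: assoc_mult_mat[of _ n n _ n _ n])
  also have "\<dots> = r * (b * x) * s" unfolding rs(4) using rs(1,2) bc xc by (simp add: assoc_mult_mat[of _ n n _ n _ n])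
  also have "\<dots> = 1\<^sub>m n" unfolding bx using rs by simp
  finally have vy: "v * y = 1\<^sub>m n" .
  have vc': "star_transpose v \<in> carrier_mat n n" using vc by simp
  \<comment> \<open>The left inverse of v equals its right inverse y, so v is unitary and not just
    an isometry.\<close>
  have "star_transpose v = y"
    using assoc_mult_mat[OF vc' vc yc] unfolding vv vy using vc' yc by simp
  then have uv: "unitary_over n v" using vc vv vy by (simp add: unitary_over_def)
  have "comult_mat b" unfolding comult_mat_iff[OF bc(1)]
  proof (intro allI impI)
    fix i j assume ij: "i < n" "j < n"
    have "comult G (u $$ (i, j)) = (\<Sum>k<n. tensor G (u $$ (i, k)) (u $$ (k, j)))"
      using u ij comult_mat_iff[OF u(2)] by (auto simp: is_rep_iff)
    then have "comult G (b $$ (i, j)) = (\<Sum>k<n. tensor G (star (u $$ (i, k))) (star (u $$ (k, j))))"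
      unfolding b_def conj_rep_entry[OF u(2) ij] by (simp add: comult_star star_sum T.t_star)
    also have "\<dots> = (\<Sum>k<n. tensor G (b $$ (i, k)) (b $$ (k, j)))"
      unfolding b_def by (rule sum.cong) (use ij conj_rep_entry[OF u(2)] in auto)
    finally show "comult G (b $$ (i, j)) = (\<Sum>k<n. tensor G (b $$ (i, k)) (b $$ (k, j)))" .
  qed
  then have "comult_mat v" unfolding v_def r_def s_def by (rule comult_mat_conj[OF bc(1) R(2,1,4)])
  then have rv: "is_rep G v" unfolding is_rep_iff carrier_matD(1)[OF vc] using uv n0 by blast
  have "v * r = r * (b * (s * r))" unfolding v_def using rs(1,2) bc by (simp add: assoc_mult_mat[of _ n n _ n _ n])
  then have "r * b = v * r" unfolding rs(4) using bc by simp
  then have "R \<in> Mor b v" unfolding Mor_iff[OF bc(1) vc] using R(1) by (simp add: r_def)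
  then have "rep_equiv b v" by (rule rep_equivI[OF bc(1) vc _ R(2) R(4) R(3)])
  then show ?thesis unfolding b_def by (rule that[OF rv vc])
qed

text \<open>An endomorphism of v, transported along the equivalence to \<open>conj_rep u\<close> and
  then conjugated entrywise, becomes an endomorphism of u and is therefore scalar.\<close>

theorem conj_irreducible:
  assumes u: "irreducible_rep G u"
  obtains v where "irreducible_rep G v" "rep_equiv (conj_rep u) v"
proof -
  define n where "n = dim_row u"
  have uc: "u \<in> carrier_mat n n" unfolding n_def by (rule irreducible_rep_carrier[OF u])
  have bc: "conj_rep u \<in> carrier_mat n n" using uc by simp
  obtain v where v: "is_rep G v" "v \<in> carrier_mat n n" "rep_equiv (conj_rep u) v"
    using conj_rep_unitarizable[OF _ uc] u unfolding irreducible_rep_def by blast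
  obtain T R where T: "T \<in> Mor (conj_rep u) v" "R \<in> Mor v (conj_rep u)" "T \<in> carrier_mat n n" "R \<in> carrier_mat n n"
    "R * T = 1\<^sub>m n" "T * R = 1\<^sub>m n" by (rule rep_equivE[OF bc v(2,3)]) blast
  have "irreducible_rep G v"
  proof (rule irreducibleI[OF v(1,2)])
    fix A assume A: "A \<in> Mor v v"
    have Ac: "A \<in> carrier_mat n n" using A Mor_iff[OF v(2) v(2)] by blast
    define B where "B = R * (A * T)"
    have Bc: "B \<in> carrier_mat n n" using T Ac by (simp add: B_def)
    have "B \<in> Mor (conj_rep u) (conj_rep u)" unfolding B_def
      by (rule Mor_mult[OF bc v(2) bc Mor_mult[OF bc v(2) v(2) T(1) A] T(2)])
    from Mor_conj[OF bc bc this] have "map_mat cnj B \<in> Mor u u" by simp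
    then obtain c where c: "map_mat cnj B = c \<cdot>\<^sub>m 1\<^sub>m n" using irreducible_endo_scalar[OF u uc] by blast
    have B: "B = cnj c \<cdot>\<^sub>m 1\<^sub>m n"
    proof (rule eq_matI)
      fix i j assume "i < dim_row (cnj c \<cdot>\<^sub>m 1\<^sub>m n)" "j < dim_col (cnj c \<cdot>\<^sub>m 1\<^sub>m n)"
      then have ij: "i < n" "j < n" by auto
      have "cnj (B $$ (i, j)) = map_mat cnj B $$ (i, j)" using ij Bc by simp
      also have "\<dots> = (c \<cdot>\<^sub>m 1\<^sub>m n) $$ (i, j)" by (simp only: c)
      finally have "B $$ (i, j) = cnj ((c \<cdot>\<^sub>m 1\<^sub>m n) $$ (i, j))" by (metis complex_cnj_cnj)
      then show "B $$ (i, j) = (cnj c \<cdot>\<^sub>m 1\<^sub>m n) $$ (i, j)" using ij by simp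
    qed (use Bc in auto)
    have "T * B = (T * R) * (A * T)" unfolding B_def
      by (rule assoc_mult_mat[OF T(3,4) mult_carrier_square[OF Ac T(3)], symmetric])
    then have "A * T = T * B" unfolding T(6) left_mult_one_mat[OF mult_carrier_square[OF Ac T(3)]] by (rule sym)
    also have "\<dots> = cnj c \<cdot>\<^sub>m T" unfolding B by (rule smult_one_mult(2)[OF T(3)])
    finally have AT: "A * T = cnj c \<cdot>\<^sub>m T" .
    have "A = A * (T * R)" unfolding T(6) right_mult_one_mat[OF Ac] ..
    also have "\<dots> = (A * T) * R" by (rule assoc_mult_mat[OF Ac T(3,4), symmetric])
    also have "\<dots> = cnj c \<cdot>\<^sub>m (T * R)" unfolding AT by (rule mult_smult_assoc_mat[OF T(3,4)])
    finally show "\<exists>c. A = c \<cdot>\<^sub>m 1\<^sub>m n" unfolding T(6) by blast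
  qed
  then show ?thesis using that v(3) by blast
qed

lemma irreducible_one: "irreducible_rep G (1\<^sub>m 1)"
proof (rule irreducibleI[of _ 1])
  have "comult_mat (1\<^sub>m 1)"
    unfolding comult_mat_iff[OF one_carrier_mat] by (auto simp: comult_one T.t_one)
  moreover have "star_transpose (1\<^sub>m 1 :: 'a mat) = 1\<^sub>m 1" by (rule eq_matI) (auto simp: star_transpose_def)
  ultimately show "is_rep G (1\<^sub>m 1)" by (simp add: is_rep_iff unitary_over_def)
  show "\<exists>c. A = c \<cdot>\<^sub>m 1\<^sub>m 1" if "A \<in> Mor (1\<^sub>m 1) (1\<^sub>m 1 :: 'a mat)" for A
  proof -
    have "A \<in> carrier_mat 1 1" using MorD(1)[OF that] by (simp only: index_one_mat(2,3))
    then have "A = A $$ (0, 0) \<cdot>\<^sub>m 1\<^sub>m 1" by (intro eq_matI) auto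
    then show ?thesis by blast
  qed
qed simp

end

section \<open>The trivial representation and invariant vectors\<close>

lemma tensor_rep_one:
  fixes u :: "'a::cstar_algebra mat"
  assumes "u \<in> carrier_mat n n" shows "tensor_rep u (1\<^sub>m 1) = u" "tensor_rep (1\<^sub>m 1) u = u"
  by (rule eq_matI; use assms in \<open>auto simp: tensor_rep_def Let_def\<close>)+

text \<open>A 1 by 1 intertwiner is an invertible scalar and cancels, so equivalence becomes
  equality and the trivial class is a singleton.\<close>

lemma rep_equiv_one_imp:
  fixes v :: "'a::cstar_algebra mat"
  assumes v: "v \<in> carrier_mat n n" and e: "rep_equiv (1\<^sub>m 1) v" shows "v = 1\<^sub>m 1"
proof -
  obtain T R where T: "n = 1" "T \<in> Mor (1\<^sub>m 1) v" "T \<in> carrier_mat 1 1" "R \<in> carrier_mat 1 1" "T * R = 1\<^sub>m 1"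
    by (rule rep_equivE[OF one_carrier_mat v e]) blast
  have v1: "v \<in> carrier_mat 1 1" using v T(1) by simp
  let ?T = "scalar_mat T :: 'a mat" and ?R = "scalar_mat R :: 'a mat"
  have c: "?T \<in> carrier_mat 1 1" "?R \<in> carrier_mat 1 1" using T by auto
  have TR: "?T * ?R = 1\<^sub>m 1" using scalar_mat_mult[OF T(3,4), where 'a = 'a] T(5) by simp
  have "?T = v * ?T" using MorD(2)[OF T(2)] right_mult_one_mat[OF c(1)] by simp
  then have "?T * ?R = v * (?T * ?R)" using assoc_mult_mat[OF v1 c] by simp
  then show ?thesis unfolding TR using v1 by simp
qed

text \<open>Invariant vectors of \<open>u \<otimes> w\<close>, read as matrices, are intertwiners from \<open>conj_rep u\<close> to \<open>w\<close>.\<close>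

lemma invariant_vector_iff:
  fixes u w :: "'a::cstar_algebra mat"
  assumes u: "unitary_over n u" and w: "w \<in> carrier_mat m m" and m: "0 < m"
  shows "(\<exists>X\<in>Mor (1\<^sub>m 1) (tensor_rep u w). X \<noteq> 0\<^sub>m (n * m) 1) \<longleftrightarrow> (\<exists>Y\<in>Mor (conj_rep u) w. Y \<noteq> 0\<^sub>m m n)"
proof -
  note uc = unitary_over_carrier[OF u]
  have bc: "conj_rep u \<in> carrier_mat n n" using uc by simp
  note tc = tensor_rep_carrier[OF uc w]
  \<comment> \<open>f holds the coordinates of X as a matrix, with the pair (i, k) encoded as i m +
    k.\<close>
  have XM: "X \<in> Mor (1\<^sub>m 1) (tensor_rep u w) \<longleftrightarrow>
      (\<forall>r<n * m. (\<Sum>i<n. \<Sum>k<m. scaleC (f i k) (u $$ (r div m, i) * w $$ (r mod m, k))) = scaleC (f (r div m) (r mod m)) 1)"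
    if X: "X \<in> carrier_mat (n * m) 1" "\<And>r. r < n * m \<Longrightarrow> X $$ (r, 0) = f (r div m) (r mod m)" for X f
  proof -
    have l: "(tensor_rep u w * scalar_mat X) $$ (r, 0) = (\<Sum>i<n. \<Sum>k<m. scaleC (f i k) (u $$ (r div m, i) * w $$ (r mod m, k)))"
      if "r < n * m" for r
    proof -
      have "(tensor_rep u w * scalar_mat X) $$ (r, 0) = (\<Sum>q<n * m. scaleC (X $$ (q, 0)) (tensor_rep u w $$ (r, q)))"
        by (rule mult_scalar_entry[OF tc X(1) that]) simp
      also have "\<dots> = (\<Sum>q<n * m. (\<lambda>i k. scaleC (f i k) (u $$ (r div m, i) * w $$ (r mod m, k))) (q div m) (q mod m))"
        by (rule sum.cong) (use that X in \<open>auto simp: tensor_rep_entry[OF uc w]\<close>)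
      finally show ?thesis unfolding sum_div_mod[OF m, of "\<lambda>i k. scaleC (f i k) (u $$ (r div m, i) * w $$ (r mod m, k))"] .
    qed
    have sX: "scalar_mat X \<in> carrier_mat (n * m) 1" "scalar_mat X * 1\<^sub>m 1 = (scalar_mat X :: 'a mat)"
      using X(1) right_mult_one_mat[of "scalar_mat X :: 'a mat" "n * m" 1] by simp_all
    have pX: "tensor_rep u w * scalar_mat X \<in> carrier_mat (n * m) 1" by (rule mult_carrier_mat[OF tc sX(1)])
    have "X \<in> Mor (1\<^sub>m 1) (tensor_rep u w) \<longleftrightarrow> tensor_rep u w * scalar_mat X = (scalar_mat X :: 'a mat)"
      using Mor_iff[OF one_carrier_mat tc, of X] X(1) sX(2) by auto
    also have "\<dots> \<longleftrightarrow> (\<forall>r<n * m. (tensor_rep u w * scalar_mat X) $$ (r, 0) = scalar_mat X $$ (r, 0))"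
    proof
      assume "\<forall>r<n * m. (tensor_rep u w * scalar_mat X) $$ (r, 0) = (scalar_mat X :: 'a mat) $$ (r, 0)"
      then show "tensor_rep u w * scalar_mat X = scalar_mat X"
        by (intro eq_matI) (use sX(1) pX X(1) tc in \<open>auto simp del: index_mult_mat(1)\<close>)
    qed simp
    also have "\<dots> \<longleftrightarrow> (\<forall>r<n * m. (\<Sum>i<n. \<Sum>k<m. scaleC (f i k) (u $$ (r div m, i) * w $$ (r mod m, k))) = scaleC (f (r div m) (r mod m)) 1)"
      using X by (simp add: l del: index_mult_mat(1))
    finally show ?thesis .
  qed
  have YM: "Y \<in> Mor (conj_rep u) w \<longleftrightarrow> (\<forall>k<m. \<forall>j<n. (\<Sum>i<n. scaleC (Y $$ (k, i)) (star (u $$ (i, j)))) = (\<Sum>l<m. scaleC (Y $$ (l, j)) (w $$ (k, l))))"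
    if Y: "Y \<in> carrier_mat m n" for Y
  proof -
    have sY: "scalar_mat Y \<in> carrier_mat m n" using Y by simp
    have c1: "scalar_mat Y * conj_rep u \<in> carrier_mat m n" "w * scalar_mat Y \<in> carrier_mat m n"
      using mult_carrier_mat[OF sY bc] mult_carrier_mat[OF w sY] by auto
    have l: "(scalar_mat Y * conj_rep u) $$ (k, j) = (\<Sum>i<n. scaleC (Y $$ (k, i)) (star (u $$ (i, j))))" if "k < m" "j < n" for k j
      unfolding scalar_mult_entry[OF Y bc that] by (rule sum.cong) (use that conj_rep_entry[OF uc] in auto)
    have "Y \<in> Mor (conj_rep u) w \<longleftrightarrow> scalar_mat Y * conj_rep u = w * scalar_mat Y"
      using Mor_iff[OF bc w, of Y] Y by blast
    also have "\<dots> \<longleftrightarrow> (\<forall>k<m. \<forall>j<n. (scalar_mat Y * conj_rep u) $$ (k, j) = (w * scalar_mat Y) $$ (k, j))"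
    proof
      assume "\<forall>k<m. \<forall>j<n. (scalar_mat Y * conj_rep u) $$ (k, j) = (w * scalar_mat Y) $$ (k, j)"
      then show "scalar_mat Y * conj_rep u = w * scalar_mat Y"
        by (intro eq_matI) (use c1 in \<open>auto simp del: index_mult_mat\<close>)
    qed simp
    also have "\<dots> \<longleftrightarrow> (\<forall>k<m. \<forall>j<n. (\<Sum>i<n. scaleC (Y $$ (k, i)) (star (u $$ (i, j)))) = (\<Sum>l<m. scaleC (Y $$ (l, j)) (w $$ (k, l))))"
      by (simp add: l mult_scalar_entry[OF w Y] del: index_mult_mat(1))
    finally show ?thesis .
  qed
  have s1: "(\<Sum>i<n. star (u $$ (i, j)) * (\<Sum>j'<n. u $$ (i, j') * g j')) = g j" if "j < n" for j and g :: "nat \<Rightarrow> 'a"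
  proof -
    have "(\<Sum>i<n. star (u $$ (i, j)) * (\<Sum>j'<n. u $$ (i, j') * g j')) = (\<Sum>j'<n. (\<Sum>i<n. star (u $$ (i, j)) * u $$ (i, j')) * g j')"
      unfolding sum_distrib_left sum_distrib_right by (subst sum.swap) (simp add: mult.assoc)
    also have "\<dots> = (\<Sum>j'<n. if j' = j then g j' else 0)"
      by (rule sum.cong) (use that unitary_over_sums(1)[OF u that] in auto)
    finally show ?thesis using that by simp
  qed
  have s2: "(\<Sum>j<n. u $$ (i, j) * (\<Sum>i'<n. star (u $$ (i', j)) * g i')) = g i" if "i < n" for i and g :: "nat \<Rightarrow> 'a"
  proof -
    have "(\<Sum>j<n. u $$ (i, j) * (\<Sum>i'<n. star (u $$ (i', j)) * g i')) = (\<Sum>i'<n. (\<Sum>j<n. u $$ (i, j) * star (u $$ (i', j))) * g i')"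
      unfolding sum_distrib_left sum_distrib_right by (subst sum.swap) (simp add: mult.assoc)
    also have "\<dots> = (\<Sum>i'<n. if i' = i then g i' else 0)"
      by (rule sum.cong) (use that unitary_over_sums(2)[OF u that] in auto)
    finally show ?thesis using that by simp
  qed
  \<comment> \<open>On the left, u applied to g gives f, where g is w applied to f. By unitarity of
    u this is equivalent to the adjoint of u applied to f giving g, which is the relation for an
    intertwiner from \<open>conj_rep u\<close> to w.\<close>
  have eqv: "(\<forall>r<n * m. (\<Sum>i<n. \<Sum>k<m. scaleC (f i k) (u $$ (r div m, i) * w $$ (r mod m, k))) = scaleC (f (r div m) (r mod m)) 1)
      \<longleftrightarrow> (\<forall>k<m. \<forall>j<n. (\<Sum>i<n. scaleC (f i k) (star (u $$ (i, j)))) = (\<Sum>l<m. scaleC (f j l) (w $$ (k, l))))" for f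
  proof -
    define g where "g k j = (\<Sum>l<m. scaleC (f j l) (w $$ (k, l)))" for k j
    have gl: "(\<Sum>i<n. \<Sum>l<m. scaleC (f i l) (u $$ (i0, i) * w $$ (k, l))) = (\<Sum>i<n. u $$ (i0, i) * g k i)" for i0 k
      by (simp add: g_def sum_distrib_left scaleC_mult_right)
    have fl: "(\<Sum>i<n. scaleC (f i k) (star (u $$ (i, j)))) = (\<Sum>i<n. star (u $$ (i, j)) * scaleC (f i k) 1)" for k j
      by (simp add: scaleC_mult_right)
    have "(\<forall>r<n * m. (\<Sum>i<n. u $$ (r div m, i) * g (r mod m) i) = scaleC (f (r div m) (r mod m)) 1)
       \<longleftrightarrow> (\<forall>i0<n. \<forall>k<m. (\<Sum>i<n. u $$ (i0, i) * g k i) = scaleC (f i0 k) 1)" (is "?L \<longleftrightarrow> ?M")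
    proof
      assume L: ?L
      show ?M
      proof (intro allI impI)
        fix i0 k assume ik: "i0 < n" "k < m"
        have "i0 * m + k < Suc i0 * m" using ik by simp
        also have "\<dots> \<le> n * m" using ik by (intro mult_right_mono) auto
        finally have "i0 * m + k < n * m" .
        moreover have "(i0 * m + k) div m = i0" "(i0 * m + k) mod m = k" using ik by auto
        ultimately show "(\<Sum>i<n. u $$ (i0, i) * g k i) = scaleC (f i0 k) 1" using L by metis
      qed
    qed (use div_mod_less in blast)
    also have "\<dots> \<longleftrightarrow> (\<forall>k<m. \<forall>j<n. (\<Sum>i<n. star (u $$ (i, j)) * scaleC (f i k) 1) = g k j)"
    proof
      assume M: "\<forall>i0<n. \<forall>k<m. (\<Sum>i<n. u $$ (i0, i) * g k i) = scaleC (f i0 k) 1"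
      show "\<forall>k<m. \<forall>j<n. (\<Sum>i<n. star (u $$ (i, j)) * scaleC (f i k) 1) = g k j"
      proof (intro allI impI)
        fix k j assume kj: "k < m" "j < n"
        have "(\<Sum>i<n. star (u $$ (i, j)) * scaleC (f i k) 1) = (\<Sum>i<n. star (u $$ (i, j)) * (\<Sum>j'<n. u $$ (i, j') * g k j'))"
          by (rule sum.cong) (use M kj in auto)
        then show "(\<Sum>i<n. star (u $$ (i, j)) * scaleC (f i k) 1) = g k j" using s1[OF kj(2)] by simp
      qed
    next
      assume M: "\<forall>k<m. \<forall>j<n. (\<Sum>i<n. star (u $$ (i, j)) * scaleC (f i k) 1) = g k j"
      show "\<forall>i0<n. \<forall>k<m. (\<Sum>i<n. u $$ (i0, i) * g k i) = scaleC (f i0 k) 1"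
      proof (intro allI impI)
        fix i0 k assume ik: "i0 < n" "k < m"
        have "(\<Sum>i<n. u $$ (i0, i) * g k i) = (\<Sum>j<n. u $$ (i0, j) * (\<Sum>i'<n. star (u $$ (i', j)) * scaleC (f i' k) 1))"
          by (rule sum.cong) (use M ik in auto)
        then show "(\<Sum>i<n. u $$ (i0, i) * g k i) = scaleC (f i0 k) 1" using s2[OF ik(1)] by simp
      qed
    qed
    finally show ?thesis unfolding gl fl g_def[symmetric] .
  qed
  show ?thesis
  proof
    assume "\<exists>X\<in>Mor (1\<^sub>m 1) (tensor_rep u w). X \<noteq> 0\<^sub>m (n * m) 1"
    then obtain X where X: "X \<in> Mor (1\<^sub>m 1) (tensor_rep u w)" "X \<noteq> 0\<^sub>m (n * m) 1" by blast
    have Xc: "X \<in> carrier_mat (n * m) 1" using X(1) Mor_iff[OF one_carrier_mat tc] by blast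
    define f where "f i k = X $$ (i * m + k, 0)" for i k
    have Xf: "X $$ (r, 0) = f (r div m) (r mod m)" for r by (simp add: f_def)
    define Y where "Y = mat m n (\<lambda>(k, i). f i k)"
    have Yc: "Y \<in> carrier_mat m n" by (simp add: Y_def)
    have Ye: "Y $$ (k, i) = f i k" if "k < m" "i < n" for k i using that by (simp add: Y_def)
    have "Y \<in> Mor (conj_rep u) w"
      using X(1) unfolding XM[OF Xc Xf] eqv YM[OF Yc] by (simp add: Ye)
    moreover have "Y \<noteq> 0\<^sub>m m n"
    proof
      assume Y0: "Y = 0\<^sub>m m n"
      have "X $$ (r, 0) = 0" if "r < n * m" for r
        using Ye[of "r mod m" "r div m"] div_mod_less[OF that] Xf[of r] unfolding Y0 by simp
      then have "X = 0\<^sub>m (n * m) 1" using Xc by (intro eq_matI) auto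
      then show False using X(2) by blast
    qed
    ultimately show "\<exists>Y\<in>Mor (conj_rep u) w. Y \<noteq> 0\<^sub>m m n" by blast
  next
    assume "\<exists>Y\<in>Mor (conj_rep u) w. Y \<noteq> 0\<^sub>m m n"
    then obtain Y where Y: "Y \<in> Mor (conj_rep u) w" "Y \<noteq> 0\<^sub>m m n" by blast
    have Yc: "Y \<in> carrier_mat m n" using Y(1) Mor_iff[OF bc w] by blast
    define f where "f i k = Y $$ (k, i)" for i k
    define X where "X = mat (n * m) 1 (\<lambda>(r, _). f (r div m) (r mod m))"
    have Xc: "X \<in> carrier_mat (n * m) 1" by (simp add: X_def)
    have Xf: "X $$ (r, 0) = f (r div m) (r mod m)" if "r < n * m" for r using that by (simp add: X_def)
    have "(\<forall>r<n * m. (\<Sum>i<n. \<Sum>k<m. scaleC (f i k) (u $$ (r div m, i) * w $$ (r mod m, k))) = scaleC (f (r div m) (r mod m)) 1)"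
      using Y(1) unfolding eqv YM[OF Yc] by (simp only: f_def)
    then have "X \<in> Mor (1\<^sub>m 1) (tensor_rep u w)" by (subst XM[OF Xc]) (rule Xf)
    moreover have "X \<noteq> 0\<^sub>m (n * m) 1"
    proof
      assume X0: "X = 0\<^sub>m (n * m) 1"
      have "Y $$ (k, i) = 0" if ki: "k < m" "i < n" for k i
      proof -
        have "i * m + k < Suc i * m" using ki by simp
        also have "\<dots> \<le> n * m" using ki by (intro mult_right_mono) auto
        finally have r: "i * m + k < n * m" .
        have "X $$ (i * m + k, 0) = Y $$ (k, i)" using Xf[OF r] ki by (simp add: f_def)
        then show ?thesis using r unfolding X0 by simp
      qed
      then have "Y = 0\<^sub>m m n" using Yc by (intro eq_matI) auto
      then show False using Y(2) by blast
    qed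
    ultimately show "\<exists>X\<in>Mor (1\<^sub>m 1) (tensor_rep u w). X \<noteq> 0\<^sub>m (n * m) 1" by blast
  qed
qed

section \<open>The dual\<close>

lemma left_invertible_mult_nonzero:
  fixes R S T :: "complex mat"
  assumes c: "R \<in> carrier_mat n k" "S \<in> carrier_mat k n" "T \<in> carrier_mat n m" and RS: "R * S = 1\<^sub>m n" and T: "T \<noteq> 0\<^sub>m n m"
  shows "S * T \<noteq> 0\<^sub>m k m"
proof
  assume 0: "S * T = 0\<^sub>m k m"
  have "T = R * S * T" unfolding RS left_mult_one_mat[OF c(3)] ..
  also have "\<dots> = R * (S * T)" by (rule assoc_mult_mat[OF c])
  also have "\<dots> = 0\<^sub>m n m" unfolding 0 by (rule right_mult_zero_mat[OF c(1)])
  finally show False using T by blast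
qed

lemma right_invertible_mult_nonzero:
  fixes R S T :: "complex mat"
  assumes c: "T \<in> carrier_mat m n" "R \<in> carrier_mat n k" "S \<in> carrier_mat k n" and RS: "R * S = 1\<^sub>m n" and T: "T \<noteq> 0\<^sub>m m n"
  shows "T * R \<noteq> 0\<^sub>m m k"
proof
  assume 0: "T * R = 0\<^sub>m m k"
  have "T = T * (R * S)" unfolding RS right_mult_one_mat[OF c(1)] ..
  also have "\<dots> = T * R * S" by (rule assoc_mult_mat[OF c, symmetric])
  also have "\<dots> = 0\<^sub>m m n" unfolding 0 by (rule left_mult_zero_mat[OF c(3)])
  finally show False using T by blast
qed

context cqg
begin

definition rep_class :: "'a mat \<Rightarrow> 'a mat set" where
  "rep_class u = {v. irreducible_rep G v \<and> rep_equiv u v}"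

lemma rep_equiv_irr_refl: "irreducible_rep G u \<Longrightarrow> rep_equiv u u"
  by (rule rep_equiv_refl[OF irreducible_rep_carrier])

lemma rep_equiv_irr_sym: "irreducible_rep G u \<Longrightarrow> irreducible_rep G v \<Longrightarrow> rep_equiv u v \<Longrightarrow> rep_equiv v u"
  by (rule rep_equiv_sym[OF irreducible_rep_carrier irreducible_rep_carrier])

lemma rep_equiv_irr_trans:
  "irreducible_rep G u \<Longrightarrow> irreducible_rep G v \<Longrightarrow> irreducible_rep G w \<Longrightarrow> rep_equiv u v \<Longrightarrow> rep_equiv v w \<Longrightarrow> rep_equiv u w"
  by (rule rep_equiv_trans[OF irreducible_rep_carrier irreducible_rep_carrier irreducible_rep_carrier])

lemma rep_class_eq: "irreducible_rep G u \<Longrightarrow> irreducible_rep G v \<Longrightarrow> rep_equiv u v \<Longrightarrow> rep_class u = rep_class v"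
  unfolding rep_class_def using rep_equiv_irr_sym rep_equiv_irr_trans by blast

lemma dual_eq: "dual G = rep_class ` {u. irreducible_rep G u}"
  unfolding dual_def quotient_def rep_class_def by auto

lemma rep_class_dual: "irreducible_rep G u \<Longrightarrow> rep_class u \<in> dual G"
  by (simp add: dual_eq)

lemma rep_class_self: "irreducible_rep G u \<Longrightarrow> u \<in> rep_class u"
  by (simp add: rep_class_def rep_equiv_irr_refl)

lemma dual_memberD:
  assumes "a \<in> dual G" "u \<in> a" shows "irreducible_rep G u" "a = rep_class u"
proof -
  obtain x where x: "irreducible_rep G x" "a = rep_class x" using assms(1) by (auto simp: dual_eq)
  then have u: "irreducible_rep G u" "rep_equiv x u" using assms(2) by (auto simp: rep_class_def)
  show "irreducible_rep G u" "a = rep_class u" using u x(2) rep_class_eq[OF x(1) u] by auto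
qed

lemma dual_nonempty: "a \<in> dual G \<Longrightarrow> \<exists>u. u \<in> a"
  using rep_class_self by (auto simp: dual_eq)

lemma trivial_class_eq: "trivial_class G = rep_class (1\<^sub>m 1)"
  by (simp add: trivial_class_def rep_class_def)

lemma trivial_class_dual: "trivial_class G \<in> dual G"
  unfolding trivial_class_eq by (rule rep_class_dual[OF irreducible_one])

lemma one_in_trivial_class: "1\<^sub>m 1 \<in> trivial_class G"
  unfolding trivial_class_eq by (rule rep_class_self[OF irreducible_one])

lemma trivial_class_unique: "v \<in> trivial_class G \<Longrightarrow> v = 1\<^sub>m 1"
  unfolding trivial_class_def using rep_equiv_one_imp irreducible_rep_carrier by blast

lemma conj_class_eq:
  assumes a: "a \<in> dual G" "u \<in> a" and v: "irreducible_rep G v" "rep_equiv (conj_rep u) v"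
  shows "conj_class G a = rep_class v"
proof -
  note u = dual_memberD[OF a]
  note uc = irreducible_rep_carrier[OF u(1)] and vc = irreducible_rep_carrier[OF v(1)]
  have bc: "conj_rep u \<in> carrier_mat (dim_row u) (dim_row u)" by (rule iffD2[OF conj_rep_carrier uc])
  have eqv: "rep_equiv (conj_rep x) w \<longleftrightarrow> rep_equiv v w" if x: "x \<in> a" and w: "irreducible_rep G w" for x w
  proof -
    have xi: "irreducible_rep G x" by (rule dual_memberD(1)[OF a(1) x])
    note xc = irreducible_rep_carrier[OF xi] and wc = irreducible_rep_carrier[OF w]
    have xbc: "conj_rep x \<in> carrier_mat (dim_row x) (dim_row x)" by (rule iffD2[OF conj_rep_carrier xc])
    have "rep_equiv u x" using x u(2) by (auto simp: rep_class_def)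
    then have e: "rep_equiv (conj_rep u) (conj_rep x)" by (rule rep_equiv_conj[OF uc xc])
    have "rep_equiv (conj_rep x) v"
      by (rule rep_equiv_trans[OF xbc bc vc rep_equiv_sym[OF bc xbc e] v(2)])
    then show ?thesis
      using rep_equiv_trans[OF xbc vc wc] rep_equiv_trans[OF vc xbc wc] rep_equiv_sym[OF xbc vc] by blast
  qed
  then show ?thesis unfolding conj_class_def rep_class_def using a(2) by blast
qed

lemma conj_class_dual: "a \<in> dual G \<Longrightarrow> conj_class G a \<in> dual G"
  by (metis conj_class_eq conj_irreducible dual_memberD(1) dual_nonempty rep_class_dual)

lemma tensor_irreducible:
  assumes "a \<in> dual G" "b \<in> dual G" "u \<in> a" "v \<in> b"
  shows "is_rep G (tensor_rep u v)"
  using is_rep_tensor_rep dual_memberD(1) assms by (simp add: irreducible_rep_def)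

text \<open>An isometric intertwiner from w to the tensor product has a nonzero component in some
  summand of a decomposition, and Schur's lemma identifies that summand with w. Conversely, the
  injection of a summand gives a nonzero intertwiner, which can be normalised to an
  isometry.\<close>

lemma fusion_iff_decomposition:
  assumes ab: "a \<in> dual G" "b \<in> dual G"
  shows "c \<in> fusion G a b \<longleftrightarrow> (\<exists>cs\<in>lists (dual G). tensor_decomposition G a b cs \<and> c \<in> set cs)"
proof
  assume "c \<in> fusion G a b"
  then obtain u v w where c: "c \<in> dual G" "u \<in> a" "v \<in> b" "w \<in> c" "subrep w (tensor_rep u v)"
    by (auto simp: fusion_def)
  define t where "t = tensor_rep u v"
  have rep: "is_rep G t" unfolding t_def by (rule tensor_irreducible[OF ab c(2,3)])
  note tc = is_rep_carrier[OF rep]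
  note w = dual_memberD[OF c(1,4)]
  note wc = irreducible_rep_carrier[OF w(1)]
  obtain ws where ws: "\<forall>x\<in>set ws. irreducible_rep G x" "rep_equiv t (diag_block_mat ws)"
    using complete_reducibility[OF rep] by blast
  have wsc: "x \<in> carrier_mat (dim_row x) (dim_row x)" if "x \<in> set ws" for x
    using ws(1) that irreducible_rep_carrier by blast
  note dc = diag_block_mat_square_carrier[OF wsc]
  obtain S R where S: "sum_list (map dim_row ws) = dim_row t" "S \<in> Mor t (diag_block_mat ws)"
    "S \<in> carrier_mat (dim_row t) (dim_row t)" "R \<in> carrier_mat (dim_row t) (dim_row t)" "R * S = 1\<^sub>m (dim_row t)"
    using rep_equivE[OF tc dc ws(2)] by metis
  obtain T where T: "T \<in> Mor w t" "mat_adjoint T * T = 1\<^sub>m (dim_row w)" using c(5) by (auto simp: subrep_def t_def)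
  have Tc: "T \<in> carrier_mat (dim_row t) (dim_row w)" using T(1) Mor_iff[OF wc tc] by blast
  have "0 < dim_row w" using w(1) by (simp add: irreducible_rep_def is_rep_iff)
  then have "T \<noteq> 0\<^sub>m (dim_row t) (dim_row w)" using isometry_nonzero[OF T(2)] by blast
  then have "S * T \<noteq> 0\<^sub>m (dim_row t) (dim_row w)" by (rule left_invertible_mult_nonzero[OF S(4,3) Tc S(5)])
  moreover have "dim_row (S * T) = dim_row t" "dim_col (S * T) = dim_row w" using S Tc by auto
  ultimately have nz: "S * T \<noteq> 0\<^sub>m (dim_row (S * T)) (dim_col (S * T))" by (simp only: not_False_eq_True)
  have "S * T \<in> Mor w (diag_block_mat ws)" by (rule Mor_mult[OF wc tc dc T(1) S(2)])
  then obtain x Q where x: "x \<in> set ws" "Q \<in> Mor w x" "Q \<noteq> 0\<^sub>m (dim_row x) (dim_row w)"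
    using nonzero_component[OF wsc wc _ nz] by blast
  have xi: "irreducible_rep G x" using ws(1) x(1) by blast
  have "rep_equiv w x" by (rule schur[OF w(1) wc xi irreducible_rep_carrier[OF xi] x(2,3)])
  then have "c = rep_class x" using w(2) rep_class_eq[OF w(1) xi] by simp
  then have "c \<in> set (map rep_class ws)" using x(1) by auto
  moreover have "set (map rep_class ws) \<subseteq> dual G" using ws(1) rep_class_dual by auto
  moreover have "list_all2 (\<in>) ws (map rep_class ws)"
    unfolding list_all2_map2 by (rule list.rel_refl_strong) (use ws(1) rep_class_self in blast)
  ultimately show "\<exists>cs\<in>lists (dual G). tensor_decomposition G a b cs \<and> c \<in> set cs"
    using c(2,3) ws(2) unfolding tensor_decomposition_def lists_eq_set t_def
    by (intro bexI[of _ "map rep_class ws"] conjI) auto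
next
  assume "\<exists>cs\<in>lists (dual G). tensor_decomposition G a b cs \<and> c \<in> set cs"
  then obtain cs u v ws where cs: "set cs \<subseteq> dual G" "c \<in> set cs" "u \<in> a" "v \<in> b" "list_all2 (\<in>) ws cs"
    "rep_equiv (tensor_rep u v) (diag_block_mat ws)" unfolding tensor_decomposition_def by blast
  define t where "t = tensor_rep u v"
  have rep: "is_rep G t" unfolding t_def by (rule tensor_irreducible[OF ab cs(3,4)])
  note tc = is_rep_carrier[OF rep]
  have un: "unitary_over (dim_row t) t" using rep by (simp add: is_rep_iff)
  have wsi: "irreducible_rep G x" if "x \<in> set ws" for x
  proof -
    obtain i where i: "i < length ws" "ws ! i = x" using \<open>x \<in> set ws\<close> unfolding in_set_conv_nth by blast
    have "x \<in> cs ! i" using list_all2_nthD[OF cs(5) i(1)] unfolding i(2) .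
    moreover have "cs ! i \<in> dual G" using nth_mem[of i cs] i(1) cs(1) unfolding list_all2_lengthD[OF cs(5)] by blast
    ultimately show ?thesis by (rule dual_memberD(1)[rotated])
  qed
  obtain i where i: "i < length cs" "cs ! i = c" using cs(2) unfolding in_set_conv_nth by blast
  obtain w where w: "w \<in> set ws" "w \<in> c"
    using list_all2_nthD2[OF cs(5) i(1)] i(1) nth_mem[of i ws] unfolding i(2) list_all2_lengthD[OF cs(5), symmetric] by blast
  note dc = diag_block_mat_square_carrier[OF irreducible_rep_carrier[OF wsi]]
  note wi = wsi[OF w(1)] and wc = irreducible_rep_carrier[OF wsi[OF w(1)]]
  obtain S R where S: "sum_list (map dim_row ws) = dim_row t" "R \<in> Mor (diag_block_mat ws) t"
    "S \<in> carrier_mat (dim_row t) (dim_row t)" "R \<in> carrier_mat (dim_row t) (dim_row t)" "S * R = 1\<^sub>m (dim_row t)"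
    using rep_equivE[OF tc dc cs(6)[folded t_def]] by metis
  obtain T where T: "T \<in> Mor w (diag_block_mat ws)" "mat_adjoint T * T = 1\<^sub>m (dim_row w)"
    using component_embeds[OF irreducible_rep_carrier[OF wsi] w(1)] by blast
  have Tc: "T \<in> carrier_mat (dim_row t) (dim_row w)" using T(1) Mor_iff[OF wc dc] S(1) by simp
  have "0 < dim_row w" using wi by (simp add: irreducible_rep_def is_rep_iff)
  then have "T \<noteq> 0\<^sub>m (dim_row t) (dim_row w)" using isometry_nonzero[OF T(2)] by blast
  then have nz: "R * T \<noteq> 0\<^sub>m (dim_row t) (dim_row w)" by (rule left_invertible_mult_nonzero[OF S(3,4) Tc S(5)])
  have "R * T \<in> Mor w t" by (rule Mor_mult[OF wc dc tc T(1) S(2)])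
  then have "subrep w t" using nz by (rule subrep_of_nonzero_Mor[OF wi wc un])
  then show "c \<in> fusion G a b" unfolding fusion_def t_def using cs w by blast
qed

lemma subrep_refl: "u \<in> carrier_mat n n \<Longrightarrow> subrep u u"
  unfolding subrep_def using Mor_one[of u n] by (intro bexI[of _ "1\<^sub>m n"]) auto

text \<open>Tensoring with the 1 by 1 unit matrix leaves u literally unchanged, and an irreducible
  subrepresentation of an irreducible u is equivalent to u.\<close>

lemma fusion_trivial:
  assumes a: "a \<in> dual G"
  shows "fusion G a (trivial_class G) = {a}" "fusion G (trivial_class G) a = {a}"
proof -
  have *: "{c \<in> dual G. \<exists>u\<in>a. \<exists>w\<in>c. subrep w u} = {a}"
  proof (intro equalityI subsetI)
    fix c assume "c \<in> {c \<in> dual G. \<exists>u\<in>a. \<exists>w\<in>c. subrep w u}"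
    then obtain u w where c: "c \<in> dual G" "u \<in> a" "w \<in> c" "subrep w u" by blast
    note u = dual_memberD[OF a c(2)] and w = dual_memberD[OF c(1,3)]
    show "c \<in> {a}" using rep_class_eq[OF w(1) u(1) subrep_irreducible_equiv[OF w(1) u(1) c(4)]] u(2) w(2) by simp
  next
    fix c assume "c \<in> {a}"
    moreover obtain u where u: "u \<in> a" using dual_nonempty[OF a] by blast
    moreover have "subrep u u" by (rule subrep_refl[OF irreducible_rep_carrier[OF dual_memberD(1)[OF a u]]])
    ultimately show "c \<in> {c \<in> dual G. \<exists>u\<in>a. \<exists>w\<in>c. subrep w u}" using a by blast
  qed
  have t: "tensor_rep u v = u" "tensor_rep v u = u" if "u \<in> a" "v \<in> trivial_class G" for u v
    using tensor_rep_one[OF irreducible_rep_carrier[OF dual_memberD(1)[OF a that(1)]]] trivial_class_unique[OF that(2)] by simp_all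
  have "fusion G a (trivial_class G) = {c \<in> dual G. \<exists>u\<in>a. \<exists>w\<in>c. subrep w u}"
    "fusion G (trivial_class G) a = {c \<in> dual G. \<exists>u\<in>a. \<exists>w\<in>c. subrep w u}"
    unfolding fusion_def using t one_in_trivial_class by (fastforce)+
  then show "fusion G a (trivial_class G) = {a}" "fusion G (trivial_class G) a = {a}" unfolding * by simp_all
qed

text \<open>Frobenius reciprocity: nonzero invariant vectors of u \<otimes> v amount to nonzero
  intertwiners from \<open>conj_rep u\<close> to v. As \<open>conj_rep u\<close> is equivalent to an
  irreducible representation, Schur's lemma decides.\<close>

lemma trivial_in_fusion_iff:
  assumes ab: "a \<in> dual G" "b \<in> dual G"
  shows "trivial_class G \<in> fusion G a b \<longleftrightarrow> b = conj_class G a"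
proof
  assume "trivial_class G \<in> fusion G a b"
  then obtain u v w where uv: "u \<in> a" "v \<in> b" "w \<in> trivial_class G" "subrep w (tensor_rep u v)"
    by (auto simp: fusion_def)
  note u = dual_memberD[OF ab(1) uv(1)] and v = dual_memberD[OF ab(2) uv(2)]
  note uc = irreducible_rep_carrier[OF u(1)] and vc = irreducible_rep_carrier[OF v(1)]
  have un: "unitary_over (dim_row u) u" "0 < dim_row v" using u v by (simp_all add: irreducible_rep_def is_rep_iff)
  have bc: "conj_rep u \<in> carrier_mat (dim_row u) (dim_row u)" by (rule iffD2[OF conj_rep_carrier uc])
  obtain X where X: "X \<in> Mor (1\<^sub>m 1) (tensor_rep u v)" "mat_adjoint X * X = 1\<^sub>m 1"
    using uv(4) unfolding trivial_class_unique[OF uv(3)] subrep_def index_one_mat by blast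
  have "X \<noteq> 0\<^sub>m (dim_row u * dim_row v) 1" using isometry_nonzero[OF X(2)] by simp
  then obtain Y where Y: "Y \<in> Mor (conj_rep u) v" "Y \<noteq> 0\<^sub>m (dim_row v) (dim_row u)"
    using X(1) invariant_vector_iff[OF un(1) vc un(2)] by blast
  have Yc: "Y \<in> carrier_mat (dim_row v) (dim_row u)" using Y(1) Mor_iff[OF bc vc] by blast
  obtain x where x: "irreducible_rep G x" "rep_equiv (conj_rep u) x" by (rule conj_irreducible[OF u(1)])
  note xc = irreducible_rep_carrier[OF x(1)]
  obtain S R where S: "dim_row x = dim_row u" "R \<in> Mor x (conj_rep u)" "S \<in> carrier_mat (dim_row u) (dim_row u)"
    "R \<in> carrier_mat (dim_row u) (dim_row u)" "R * S = 1\<^sub>m (dim_row u)"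
    using rep_equivE[OF bc xc x(2)] by metis
  have "Y * R \<in> Mor x v" by (rule Mor_mult[OF xc bc vc S(2) Y(1)])
  moreover have "Y * R \<noteq> 0\<^sub>m (dim_row v) (dim_row x)" unfolding S(1)
    by (rule right_invertible_mult_nonzero[OF Yc S(4,3,5) Y(2)])
  ultimately have "rep_equiv x v" by (rule schur[OF x(1) xc v(1) vc])
  then show "b = conj_class G a" unfolding conj_class_eq[OF ab(1) uv(1) x] v(2) using rep_class_eq[OF x(1) v(1)] by simp
next
  assume b: "b = conj_class G a"
  obtain v where v: "v \<in> b" using dual_nonempty[OF ab(2)] by blast
  then obtain u where u: "u \<in> a" "rep_equiv (conj_rep u) v" unfolding b conj_class_def by blast
  note ui = dual_memberD[OF ab(1) u(1)] and vi = dual_memberD[OF ab(2) v]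
  note uc = irreducible_rep_carrier[OF ui(1)] and vc = irreducible_rep_carrier[OF vi(1)]
  have un: "unitary_over (dim_row u) u" "0 < dim_row u" "0 < dim_row v" using ui vi by (simp_all add: irreducible_rep_def is_rep_iff)
  have bc: "conj_rep u \<in> carrier_mat (dim_row u) (dim_row u)" by (rule iffD2[OF conj_rep_carrier uc])
  have rep: "is_rep G (tensor_rep u v)" by (rule tensor_irreducible[OF ab u(1) v])
  have tc: "dim_row (tensor_rep u v) = dim_row u * dim_row v" using tensor_rep_carrier[OF uc vc] by auto
  have tun: "unitary_over (dim_row u * dim_row v) (tensor_rep u v)" using rep unfolding is_rep_iff tc by blast
  obtain T R where T: "dim_row v = dim_row u" "T \<in> Mor (conj_rep u) v" "T \<in> carrier_mat (dim_row u) (dim_row u)"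
    "R \<in> carrier_mat (dim_row u) (dim_row u)" "R * T = 1\<^sub>m (dim_row u)"
    using rep_equivE[OF bc vc u(2)] by metis
  have "T \<noteq> 0\<^sub>m (dim_row v) (dim_row u)"
  proof
    assume "T = 0\<^sub>m (dim_row v) (dim_row u)"
    then have "R * T = 0\<^sub>m (dim_row u) (dim_row u)" unfolding T(1) using right_mult_zero_mat[OF T(4)] by simp
    then have "1\<^sub>m (dim_row u) = (0\<^sub>m (dim_row u) (dim_row u) :: complex mat)" unfolding T(5) .
    from arg_cong[OF this, of "\<lambda>M. M $$ (0, 0)"] show False using un(2) by simp
  qed
  then obtain X where X: "X \<in> Mor (1\<^sub>m 1) (tensor_rep u v)" "X \<noteq> 0\<^sub>m (dim_row u * dim_row v) 1"
    using T(2) invariant_vector_iff[OF un(1) vc un(3)] by blast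
  have "subrep (1\<^sub>m 1) (tensor_rep u v)"
    by (rule subrep_of_nonzero_Mor[OF irreducible_one one_carrier_mat tun X])
  then show "trivial_class G \<in> fusion G a b"
    unfolding fusion_def using trivial_class_dual u(1) v one_in_trivial_class by blast
qed

end

section \<open>Transport of the center along a fusion isomorphism\<close>

text \<open>The structure on the duals from which cosets and central subobjects are built. The
  inverse of p satisfies the same assumptions, so an inclusion proved for p also holds in the other
  direction.\<close>

locale fusion_iso =
  fixes G1 :: "('a1::cstar_algebra, 'b1::cstar_algebra, 'c1::cstar_algebra) quantum_group"
    and G2 :: "('a2::cstar_algebra, 'b2::cstar_algebra, 'c2::cstar_algebra) quantum_group"
    and p :: "'a1 mat set \<Rightarrow> 'a2 mat set"
  assumes bij: "bij_betw p (dual G1) (dual G2)"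
    and p_fusion: "a \<in> dual G1 \<Longrightarrow> b \<in> dual G1 \<Longrightarrow> fusion G2 (p a) (p b) = p ` fusion G1 a b"
    and p_trivial: "p (trivial_class G1) = trivial_class G2"
    and p_conj: "a \<in> dual G1 \<Longrightarrow> p (conj_class G1 a) = conj_class G2 (p a)"
    and conj_dual: "a \<in> dual G1 \<Longrightarrow> conj_class G1 a \<in> dual G1"
    and trivial_dual: "trivial_class G1 \<in> dual G1"
begin

lemma p_image: "p ` dual G1 = dual G2"
  using bij by (rule bij_betw_imp_surj_on)

lemma p_dual: "a \<in> dual G1 \<Longrightarrow> p a \<in> dual G2"
  using p_image by blast

lemma p_inj: "inj_on p (dual G1)"
  using bij by (rule bij_betw_imp_inj_on)

lemma p_mem_image_iff: "S \<subseteq> dual G1 \<Longrightarrow> x \<in> dual G1 \<Longrightarrow> p x \<in> p ` S \<longleftrightarrow> x \<in> S"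
  using inj_on_image_mem_iff[OF p_inj] by blast

lemma fusion_dual: "fusion G1 a b \<subseteq> dual G1"
  by (auto simp: fusion_def)

lemma subobject_image: "subobject G1 S \<Longrightarrow> subobject G2 (p ` S)"
  unfolding subobject_def
proof (intro conjI)
  assume S: "S \<subseteq> dual G1 \<and> trivial_class G1 \<in> S \<and> (\<forall>a\<in>S. \<forall>b\<in>S. fusion G1 a b \<subseteq> S) \<and> (\<forall>a\<in>S. conj_class G1 a \<in> S)"
  show "p ` S \<subseteq> dual G2" using S p_dual by blast
  show "trivial_class G2 \<in> p ` S" using imageI[of "trivial_class G1" S p] S unfolding p_trivial by blast
  show "\<forall>a\<in>p ` S. \<forall>b\<in>p ` S. fusion G2 a b \<subseteq> p ` S"
  proof (intro ballI)
    fix a' b' assume "a' \<in> p ` S" "b' \<in> p ` S"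
    then obtain a b where ab: "a \<in> S" "b \<in> S" "a' = p a" "b' = p b" by blast
    moreover from this have "a \<in> dual G1" "b \<in> dual G1" using S by blast+
    ultimately have "fusion G2 a' b' = p ` fusion G1 a b" using p_fusion by simp
    moreover have "fusion G1 a b \<subseteq> S" using S ab by blast
    ultimately show "fusion G2 a' b' \<subseteq> p ` S" by blast
  qed
  show "\<forall>a\<in>p ` S. conj_class G2 a \<in> p ` S"
  proof
    fix a' assume "a' \<in> p ` S"
    then obtain a where a: "a \<in> S" "a' = p a" by blast
    then have "a \<in> dual G1" using S by blast
    then have "conj_class G2 a' = p (conj_class G1 a)" using p_conj a(2) by simp
    then show "conj_class G2 a' \<in> p ` S" using S a by blast
  qed
qed

text \<open>
  Only the traces of \<open>S\<close> and \<open>S'\<close> on the duals matter for the cosets, which covers the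
  junk value \<open>UNIV\<close> of the intersection of an empty family of central subobjects.
\<close>

lemma coset_group_iso:
  assumes S: "p ` (S \<inter> dual G1) = S' \<inter> dual G2"
  shows "image p \<in> iso (coset_group G1 S) (coset_group G2 S')"
proof -
  have rel: "(p a, p b) \<in> coset_rel G2 S' \<longleftrightarrow> (a, b) \<in> coset_rel G1 S" if ab: "a \<in> dual G1" "b \<in> dual G1" for a b
  proof -
    have e: "fusion G2 (p a) (conj_class G2 (p b)) = p ` fusion G1 a (conj_class G1 b)"
      using p_fusion[OF ab(1) conj_dual[OF ab(2)]] p_conj[OF ab(2)] by simp
    have sx: "p x \<in> S' \<longleftrightarrow> x \<in> S" if x: "x \<in> dual G1" for x
    proof -
      have "p x \<in> S' \<longleftrightarrow> p x \<in> p ` (S \<inter> dual G1)" unfolding S using p_dual[OF x] by blast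
      also have "\<dots> \<longleftrightarrow> x \<in> S" using p_mem_image_iff[of "S \<inter> dual G1", OF _ x] x by blast
      finally show ?thesis .
    qed
    have "p x \<in> S' \<longleftrightarrow> x \<in> S" if "x \<in> fusion G1 a (conj_class G1 b)" for x
      by (rule sx[OF subsetD[OF fusion_dual that]])
    then have "fusion G2 (p a) (conj_class G2 (p b)) \<inter> S' \<noteq> {} \<longleftrightarrow> fusion G1 a (conj_class G1 b) \<inter> S \<noteq> {}"
      unfolding e by blast
    then show ?thesis using ab p_dual by (simp add: coset_rel_def)
  qed
  have coset: "coset_rel G2 S' `` {p a} = p ` (coset_rel G1 S `` {a})" if a: "a \<in> dual G1" for a
  proof (intro equalityI subsetI)
    fix y assume y: "y \<in> coset_rel G2 S' `` {p a}"
    then have "y \<in> dual G2" by (simp add: coset_rel_def)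
    then obtain b where "b \<in> dual G1" "y = p b" using p_image by blast
    then show "y \<in> p ` (coset_rel G1 S `` {a})" using y rel[OF a] by blast
  next
    fix y assume "y \<in> p ` (coset_rel G1 S `` {a})"
    then obtain b where "(a, b) \<in> coset_rel G1 S" "y = p b" by blast
    moreover from this have "b \<in> dual G1" by (simp add: coset_rel_def)
    ultimately show "y \<in> coset_rel G2 S' `` {p a}" using rel[OF a] by simp
  qed
  have img: "image p ` (dual G1 // coset_rel G1 S) = dual G2 // coset_rel G2 S'"
  proof -
    have q: "A // r = (\<lambda>x. r `` {x}) ` A" for A :: "'x set" and r
      unfolding quotient_def by (rule UNION_singleton_eq_range)
    have "image p ` (dual G1 // coset_rel G1 S) = (\<lambda>a. coset_rel G2 S' `` {p a}) ` dual G1"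
      unfolding q image_image by (rule image_cong[OF refl]) (rule coset[symmetric])
    also have "\<dots> = (\<lambda>b. coset_rel G2 S' `` {b}) ` p ` dual G1" unfolding image_image ..
    finally show ?thesis unfolding q p_image .
  qed
  have sub: "X \<subseteq> dual G1" if "X \<in> dual G1 // coset_rel G1 S" for X
    using that by (auto simp: quotient_def coset_rel_def)
  have "inj_on (image p) (dual G1 // coset_rel G1 S)"
    by (rule inj_onI) (rule iffD1[OF inj_on_image_eq_iff[OF p_inj sub sub]])
  moreover have "fusion_set G2 (p ` X) (p ` Y) = p ` fusion_set G1 X Y"
    if XY: "X \<in> dual G1 // coset_rel G1 S" "Y \<in> dual G1 // coset_rel G1 S" for X Y
  proof -
    have "fusion G2 (p a) (p b) = p ` fusion G1 a b" if ab: "a \<in> X" "b \<in> Y" for a b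
      by (rule p_fusion[OF subsetD[OF sub[OF XY(1)] ab(1)] subsetD[OF sub[OF XY(2)] ab(2)]])
    then show ?thesis unfolding fusion_set_def by (simp add: image_UN)
  qed
  ultimately show ?thesis unfolding iso_def hom_def coset_group_def bij_betw_def using img by auto
qed

lemma central_subobject_image:
  assumes "central_subobject G1 S" shows "central_subobject G2 (p ` S)"
proof -
  have S: "subobject G1 S" "group (coset_group G1 S)" using assms by (simp_all add: central_subobject_def)
  then have "S \<subseteq> dual G1" by (simp add: subobject_def)
  then have "p ` (S \<inter> dual G1) = p ` S \<inter> dual G2" using p_dual by blast
  from group.iso_imp_img_group[OF S(2) coset_group_iso[OF this]] have "group (coset_group G2 (p ` S))"
    by (simp add: coset_group_def)
  then show ?thesis using subobject_image[OF S(1)] by (simp add: central_subobject_def)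
qed

lemma inverse: "fusion_iso G2 G1 (inv_into (dual G1) p)"
proof
  define q where "q = inv_into (dual G1) p"
  have pq: "p (q y) = y" "q y \<in> dual G1" if "y \<in> dual G2" for y
    using f_inv_into_f[of y p "dual G1"] inv_into_into[of y p "dual G1"] that unfolding p_image q_def by blast+
  have qp: "q (p x) = x" if "x \<in> dual G1" for x unfolding q_def by (rule inv_into_f_f[OF p_inj that])
  show "bij_betw q (dual G2) (dual G1)" unfolding q_def by (rule bij_betw_inv_into[OF bij])
  show "fusion G1 (q a) (q b) = q ` fusion G2 a b" if ab: "a \<in> dual G2" "b \<in> dual G2" for a b
  proof -
    have "fusion G2 a b = p ` fusion G1 (q a) (q b)" using p_fusion[of "q a" "q b"] pq ab by simp
    moreover have "q ` p ` fusion G1 (q a) (q b) = fusion G1 (q a) (q b)"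
      using qp fusion_dual[of "q a" "q b"] by (force simp: image_image)
    ultimately show ?thesis by simp
  qed
  show "q (trivial_class G2) = trivial_class G1" using qp[OF trivial_dual] p_trivial by simp
  show "q (conj_class G2 a) = conj_class G1 (q a)" if "a \<in> dual G2" for a
    using qp[OF conj_dual] p_conj pq that by metis
  show "conj_class G2 a \<in> dual G2" if "a \<in> dual G2" for a
    using p_dual[OF conj_dual] p_conj pq that by metis
  show "trivial_class G2 \<in> dual G2" using p_dual[OF trivial_dual] p_trivial by simp
qed

text \<open>Central subobjects are pushed forward along p for one inclusion and along its inverse
  for the other; hence p matches the two intersections inside the duals.\<close>

theorem center_iso: "center G1 \<cong> center G2"
proof -
  interpret inv: fusion_iso G2 G1 "inv_into (dual G1) p" by (rule inverse)
  have mem: "p x \<in> center_subobject G2 \<longleftrightarrow> x \<in> center_subobject G1" if x: "x \<in> dual G1" for x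
  proof
    assume px: "p x \<in> center_subobject G2"
    have "x \<in> S" if S: "central_subobject G1 S" for S
    proof -
      have "p x \<in> p ` S" using px central_subobject_image[OF S] unfolding center_subobject_def by blast
      moreover have "S \<subseteq> dual G1" using S by (simp add: central_subobject_def subobject_def)
      ultimately show "x \<in> S" using p_mem_image_iff x by blast
    qed
    then show "x \<in> center_subobject G1" unfolding center_subobject_def by blast
  next
    assume x1: "x \<in> center_subobject G1"
    have "p x \<in> S" if S: "central_subobject G2 S" for S
    proof -
      have "x \<in> inv_into (dual G1) p ` S"
        using x1 inv.central_subobject_image[OF S] unfolding center_subobject_def by blast
      then obtain y where y: "y \<in> S" "x = inv_into (dual G1) p y" by blast
      have "S \<subseteq> dual G2" using S by (simp add: central_subobject_def subobject_def)
      then have "y \<in> p ` dual G1" using y(1) p_image by blast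
      then have "p x = y" unfolding y(2) by (rule f_inv_into_f)
      then show "p x \<in> S" using y(1) by simp
    qed
    then show "p x \<in> center_subobject G2" unfolding center_subobject_def by blast
  qed
  have "p ` (center_subobject G1 \<inter> dual G1) = center_subobject G2 \<inter> dual G2"
  proof (intro equalityI subsetI)
    fix y assume "y \<in> p ` (center_subobject G1 \<inter> dual G1)"
    then obtain x where "x \<in> center_subobject G1" "x \<in> dual G1" "y = p x" by blast
    then show "y \<in> center_subobject G2 \<inter> dual G2" using mem p_dual by simp
  next
    fix y assume y: "y \<in> center_subobject G2 \<inter> dual G2"
    then obtain x where "x \<in> dual G1" "y = p x" using p_image by blast
    then show "y \<in> p ` (center_subobject G1 \<inter> dual G1)" using mem y by blast
  qed
  from coset_group_iso[OF this] show ?thesis unfolding center_def is_iso_def by blast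
qed

end

section \<open>Fusion rules determine the trivial class and conjugation\<close>

theorem identical_fusion_rules_fusion_iso:
  assumes G1: "cqg G1" and G2: "cqg G2" and f: "identical_fusion_rules G1 G2"
  shows "\<exists>p. fusion_iso G1 G2 p"
proof -
  interpret G1: cqg G1 by (rule G1)
  interpret G2: cqg G2 by (rule G2)
  obtain p where p: "bij_betw p (dual G1) (dual G2)"
    and dec: "\<forall>a\<in>dual G1. \<forall>b\<in>dual G1. \<forall>cs\<in>lists (dual G1).
      tensor_decomposition G1 a b cs \<longleftrightarrow> tensor_decomposition G2 (p a) (p b) (map p cs)"
    using f unfolding identical_fusion_rules_def by blast
  have p_image: "p ` dual G1 = dual G2" using p by (rule bij_betw_imp_surj_on)
  have fus: "fusion G2 (p a) (p b) = p ` fusion G1 a b" if ab: "a \<in> dual G1" "b \<in> dual G1" for a b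
  proof -
    have ab2: "p a \<in> dual G2" "p b \<in> dual G2" using ab p_image by auto
    have "c \<in> fusion G2 (p a) (p b) \<longleftrightarrow> (\<exists>cs\<in>lists (dual G1). tensor_decomposition G1 a b cs \<and> c \<in> p ` set cs)" for c
    proof -
      \<comment> \<open>As p is onto, every list over the second dual is the image of a list over
        the first.\<close>
      have "c \<in> fusion G2 (p a) (p b) \<longleftrightarrow> (\<exists>cs\<in>map p ` lists (dual G1). tensor_decomposition G2 (p a) (p b) cs \<and> c \<in> set cs)"
        unfolding G2.fusion_iff_decomposition[OF ab2] lists_image[symmetric] p_image ..
      then show ?thesis using dec ab by simp
    qed
    moreover have "(\<exists>x. x \<in> fusion G1 a b \<and> c = p x) \<longleftrightarrow> (\<exists>cs\<in>lists (dual G1). tensor_decomposition G1 a b cs \<and> c \<in> p ` set cs)" for c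
      unfolding G1.fusion_iff_decomposition[OF ab] image_iff by blast
    ultimately have "c \<in> fusion G2 (p a) (p b) \<longleftrightarrow> (\<exists>x. x \<in> fusion G1 a b \<and> c = p x)" for c
      by (simp only:)
    then show ?thesis unfolding set_eq_iff image_iff Bex_def by blast
  qed
  \<comment> \<open>Let e be the class that p sends to the trivial class. The fusion of p e with the
    image of the trivial class is that image by the unit law in the second dual, and p e by the unit
    law in the first.\<close>
  have triv: "p (trivial_class G1) = trivial_class G2"
  proof -
    obtain e where e: "e \<in> dual G1" "p e = trivial_class G2" using G2.trivial_class_dual unfolding p_image[symmetric] by (rule imageE) simp
    have "p (trivial_class G1) \<in> dual G2" using G1.trivial_class_dual p_image by blast
    from G2.fusion_trivial(2)[OF this] have "{p (trivial_class G1)} = fusion G2 (p e) (p (trivial_class G1))" unfolding e(2) ..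
    also have "\<dots> = {p e}" unfolding fus[OF e(1) G1.trivial_class_dual] G1.fusion_trivial(1)[OF e(1)] by simp
    finally show ?thesis using e(2) by simp
  qed
  have conj: "p (conj_class G1 a) = conj_class G2 (p a)" if a: "a \<in> dual G1" for a
  proof -
    note ca = G1.conj_class_dual[OF a]
    have "trivial_class G1 \<in> fusion G1 a (conj_class G1 a)" using G1.trivial_in_fusion_iff[OF a ca] by blast
    then have "trivial_class G2 \<in> fusion G2 (p a) (p (conj_class G1 a))"
      unfolding fus[OF a ca] triv[symmetric] by (rule imageI)
    moreover have "p a \<in> dual G2" "p (conj_class G1 a) \<in> dual G2" using a ca p_image by auto
    ultimately show ?thesis using G2.trivial_in_fusion_iff by blast
  qed
  show ?thesis
    by (rule exI[of _ p], rule fusion_iso.intro; fact p fus triv conj G1.conj_class_dual G1.trivial_class_dual)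
qed

theorem theorem7p1:
  fixes G1 :: "('a1::cstar_algebra, 'b1::cstar_algebra, 'c1::cstar_algebra) quantum_group"
    and G2 :: "('a2::cstar_algebra, 'b2::cstar_algebra, 'c2::cstar_algebra) quantum_group"
  assumes "compact_quantum_group G1"
    and "compact_quantum_group G2"
    and "identical_fusion_rules G1 G2"
  shows "center G1 \<cong> center G2"
proof -
  obtain p where "fusion_iso G1 G2 p"
    using identical_fusion_rules_fusion_iso[OF cqg.intro[OF assms(1)] cqg.intro[OF assms(2)] assms(3)] ..
  then show ?thesis by (rule fusion_iso.center_iso)
qed

end
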